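(* (1) If $K\subset\mathbb R^2$ is a smooth closed curve, then $E(K)=E(f(K))$ for every M\"obius transformation $f$ leaving $K$ closed (that is, such that $f(K)$ is again a closed curve in $\mathbb R^2$). (2) If $\Omega\subset\mathbb R^2$ is bounded by a (smooth) closed curve, then $E(\Omega)=E(f(\Omega))$ for every M\"obius transformation $f$ such that $\Omega$ and $f(\Omega)$ are both compact or both unbounded.
   Context: M\"obius transformations (orientation preserving or not) act on $\mathbb R^2\cup\{\infty\}$. $d^2w,d^2z$ denote the area element of $\mathbb R^2$; $L(K)$ is the length of $K$. For a smooth compact curve $K\subset\mathbb R^2$ bounding the compact region $\Omega$, with $\Omega^c=\mathbb R^2\setminus\Omega$, the renormalized energy of $K$ is $E(K)=\lim_{\varepsilon\to0}\Big(\frac{2L(K)}{\varepsilon}-\int_{(\Omega\times\Omega^c)\setminus\Delta_\varepsilon}\frac{d^2w\,d^2z}{|z-w|^4}\Big)$, where $\Delta_\varepsilon=\{(w,z): |z-w|\le\varepsilon\}$. For a planar domain $\Omega$ (compact or not) with compact smooth boundary $K=\partial\Omega$, and $w$ in the interior of $\Omega$, put $V(w,\Omega)=\lim_{\varepsilon\to0}\Big(\int_{\Omega\setminus B_\varepsilon(w)}\frac{d^2z}{|z-w|^4}-\frac{\pi}{\varepsilon^2}\Big)$. The renormalized M\"obius energy of $\Omega$ is $E(\Omega)=\lim_{\delta\to0}\Big(\int_{\Omega_\delta}V(w,\Omega)\,d^2w+\frac{\pi}{4\delta}L(K)\Big)$, where $\Omega_\delta=\{w\in\Omega: d(w,K)\ge\delta\}$.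 *)

theory Defs
  imports "HOL-Analysis.Analysis"
begin

text \<open>
  The plane is identified with \<^typ>\<open>complex\<close>, the extended plane with \<^typ>\<open>complex option\<close>,
  where \<^term>\<open>None\<close> is the point at infinity.
\<close>

definition smooth :: "(real \<Rightarrow> complex) \<Rightarrow> bool" where
  "smooth \<gamma> \<longleftrightarrow>
     (\<forall>n t. (((\<lambda>g s. vector_derivative g (at s)) ^^ n) \<gamma>) differentiable (at t))"

definition parametrizes :: "(real \<Rightarrow> complex) \<Rightarrow> complex set \<Rightarrow> bool" where
  "parametrizes \<gamma> K \<longleftrightarrow>
     smooth \<gamma> \<and> (\<forall>t. \<gamma> (t + 1) = \<gamma> t) \<and> (\<forall>t. vector_derivative \<gamma> (at t) \<noteq> 0) \<and>
     inj_on \<gamma> {0..<1} \<and> \<gamma> ` {0..<1} = K"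

definition smooth_closed_curve :: "complex set \<Rightarrow> bool" where
  "smooth_closed_curve K \<longleftrightarrow> (\<exists>\<gamma>. parametrizes \<gamma> K)"

text \<open>The length does not depend on the parametrization, so any one may be chosen.\<close>

definition curve_length :: "complex set \<Rightarrow> real" where
  "curve_length K =
     (let \<gamma> = (SOME \<gamma>. parametrizes \<gamma> K)
      in integral {0..1} (\<lambda>t. norm (vector_derivative \<gamma> (at t))))"


subsection \<open>Moebius transformations\<close>

definition ext_moebius ::
    "complex \<Rightarrow> complex \<Rightarrow> complex \<Rightarrow> complex \<Rightarrow> complex option \<Rightarrow> complex option" where
  "ext_moebius a b c d x =
     (case x of
        None \<Rightarrow> if c = 0 then None else Some (a / c)
      | Some z \<Rightarrow> if c * z + d = 0 then None else Some (moebius a b c d z))"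

definition moebius_transformation :: "(complex option \<Rightarrow> complex option) \<Rightarrow> bool" where
  "moebius_transformation f \<longleftrightarrow>
     (\<exists>a b c d. a * d - b * c \<noteq> 0 \<and>
        (f = ext_moebius a b c d \<or> f = ext_moebius a b c d \<circ> map_option cnj))"

text \<open>
  An unbounded region is understood to contain the point at infinity, so that its image also
  contains the image of that point. For bounded sets \<open>moebius_image\<close> is the ordinary image, with
  the point at infinity omitted.
\<close>

definition extended :: "complex set \<Rightarrow> complex option set" where
  "extended A = Some ` A \<union> (if bounded A then {} else {None})"

definition moebius_image ::
    "(complex option \<Rightarrow> complex option) \<Rightarrow> complex set \<Rightarrow> complex set" where
  "moebius_image f A = {z. Some z \<in> f ` extended A}"


subsection \<open>The renormalized energy of a curve\<close>

definition bounded_region :: "complex set \<Rightarrow> complex set" where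
  "bounded_region K = K \<union> inside K"

definition curve_energy_approx :: "complex set \<Rightarrow> real \<Rightarrow> real" where
  "curve_energy_approx K \<epsilon> =
     2 * curve_length K / \<epsilon> -
     (LINT (w, z) : (bounded_region K \<times> (- bounded_region K)) - {(w, z). norm (z - w) \<le> \<epsilon>} | lborel.
        1 / norm (z - w) ^ 4)"

definition curve_energy :: "complex set \<Rightarrow> real" where
  "curve_energy K = Lim (at_right 0) (curve_energy_approx K)"

definition has_curve_energy :: "complex set \<Rightarrow> bool" where
  "has_curve_energy K \<longleftrightarrow> (curve_energy_approx K \<longlongrightarrow> curve_energy K) (at_right 0)"


subsection \<open>The renormalized energy of a planar domain\<close>

text \<open>Domains contain their boundary; regularity excludes sets such as \<open>K\<close> itself.\<close>

definition region_bounded_by :: "complex set \<Rightarrow> complex set \<Rightarrow> bool" where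
  "region_bounded_by \<Omega> K \<longleftrightarrow> closure (interior \<Omega>) = \<Omega> \<and> frontier \<Omega> = K"

definition potential :: "complex \<Rightarrow> complex set \<Rightarrow> real" where
  "potential w \<Omega> =
     Lim (at_right 0)
       (\<lambda>\<epsilon>. (LINT z : \<Omega> - ball w \<epsilon> | lborel. 1 / norm (z - w) ^ 4) - pi / \<epsilon>\<^sup>2)"

definition domain_energy_approx :: "complex set \<Rightarrow> real \<Rightarrow> real" where
  "domain_energy_approx \<Omega> \<delta> =
     (LINT w : {w \<in> \<Omega>. infdist w (frontier \<Omega>) \<ge> \<delta>} | lborel. potential w \<Omega>) +
     pi / (4 * \<delta>) * curve_length (frontier \<Omega>)"

definition domain_energy :: "complex set \<Rightarrow> real" where
  "domain_energy \<Omega> = Lim (at_right 0) (domain_energy_approx \<Omega>)"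

definition has_domain_energy :: "complex set \<Rightarrow> bool" where
  "has_domain_energy \<Omega> \<longleftrightarrow> (domain_energy_approx \<Omega> \<longlongrightarrow> domain_energy \<Omega>) (at_right 0)"

end

theory Submission
  imports Defs "HOL-Complex_Analysis.Complex_Analysis"
begin

text \<open>
  For a radial kernel, Fubini's theorem and the Cauchy integral turn the integral of \<open>1 / |z - w|^4\<close>
  over \<open>A \<times> - B\<close>, cut off at a distance \<open>\<epsilon>\<close>, into a double contour integral over the boundaries of \<open>A\<close>
  and \<open>B\<close>, in which the regions enter only through winding numbers. For \<open>A = B\<close> an integration by parts
  along the curve removes the divergence \<open>2 L / \<epsilon>\<close> and leaves the energy as an absolutely convergent
  integral of \<open>- Im (x' / (x - y)) Im (y' / (x - y)) / 2\<close> over pairs of points \<open>x\<close>, \<open>y\<close> of the curve. A Moebius map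
  changes both factors by logarithmic derivatives of its denominator but not the product
  \<open>x' y' / (x - y)^2\<close>; the remaining terms cancel by the Plemelj formula and the argument principle.

  The potential of a domain is minus the integral of the kernel over its complement. Hence the energy of
  a domain is governed by the same double integral between the curve and its parallel curve at distance
  \<open>\<delta>\<close>. As \<open>\<delta>\<close> tends to \<open>0\<close>, a boundary layer adds to the energy of the curve a constant multiple of
  its total turning, which a Moebius map preserves if its pole does not lie inside the curve.
\<close>

subsection \<open>Radial integrals in the plane\<close>

text \<open>Why the cancellation holds even with the pole inside the curve: let o be the
  orientation, equal to 1 or -1, and n the winding number about the pole, which is 0 or o. The
  Plemelj term contributes 4 pi^2 o n and the product of the two logarithmic derivatives 4 pi^2 n^2,
  and these agree. The total turning, however, changes by -4 pi n, so the domain statement has to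
  place the pole, and this is what compactness or unboundedness of both regions achieves. Regions
  are never parametrized: an indicator function is replaced by the Cauchy integral of the boundary
  loop, so that topology enters only through winding numbers, and the radial kernel makes every
  remaining plane integral a mean over circles. The turning correction has coefficient (pi - B) / 4,
  with opposite signs for the inner and the outer region. Here pi comes from the change of length of
  the parallel curve and B, the mass of a universal profile, from the boundary layer. Both B and the
  turning number stay symbolic: only their behaviour under the maps matters.\<close>

lemma nn_integral_complex_rotate:
  fixes f :: "complex \<Rightarrow> ennreal" and c :: complex
  assumes [measurable]: "f \<in> borel_measurable borel" and c: "norm c = 1"
  shows "(\<integral>\<^sup>+z. f (c * z) \<partial>lborel) = (\<integral>\<^sup>+z. f z \<partial>lborel)"
proof -
  have c0: "c \<noteq> 0" using c by auto
  have tr: "(\<integral>\<^sup>+z. h (a + z) \<partial>lborel) = (\<integral>\<^sup>+z. h z \<partial>lborel)"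
    if [measurable]: "h \<in> borel_measurable borel" for h :: "complex \<Rightarrow> ennreal" and a
    by (subst (2) lborel_distr_plus[of a, symmetric]) (simp add: nn_integral_distr)
  have neg: "(\<integral>\<^sup>+z. h (- z) \<partial>lborel) = (\<integral>\<^sup>+z. h z \<partial>lborel)"
    if [measurable]: "h \<in> borel_measurable borel" for h :: "complex \<Rightarrow> ennreal"
    by (subst (2) lborel_affine[of "-1" 0]) (simp_all add: nn_integral_density nn_integral_distr)
  \<comment> \<open>The argument for uniqueness of Haar measure: the disc is rotation invariant and
    has known mass. A double integral of \<open>f\<close> against \<open>g\<close>, evaluated in
    both orders with translations and a reflection only, yields the rotated and the unrotated
    integral of \<open>f\<close>, each times that mass.\<close>
  define g :: "complex \<Rightarrow> ennreal" where "g = indicator (ball 0 1)"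
  have [measurable]: "g \<in> borel_measurable borel" by (simp add: g_def borel_measurable_indicator)
  have gc: "g (c * z) = g z" for z using c by (simp add: g_def indicator_def norm_mult)
  have gint: "(\<integral>\<^sup>+z. g z \<partial>lborel) = ennreal pi"
    by (simp add: g_def emeasure_ball unit_ball_vol_2)
  have "(\<integral>\<^sup>+x. f (c * x) \<partial>lborel) * (\<integral>\<^sup>+y. g y \<partial>lborel)
     = (\<integral>\<^sup>+x. (\<integral>\<^sup>+y. f (c * x) * g (c * x + y) \<partial>lborel) \<partial>lborel)"
    by (simp add: nn_integral_cmult nn_integral_multc tr[of g])
  also have "\<dots> = (\<integral>\<^sup>+y. (\<integral>\<^sup>+x. f (c * x) * g (c * x + y) \<partial>lborel) \<partial>lborel)"
    by (rule lborel_pair.Fubini') measurable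
  also have "\<dots> = (\<integral>\<^sup>+y. (\<integral>\<^sup>+x. f (c * x - y) * g (c * x) \<partial>lborel) \<partial>lborel)"
  proof (rule nn_integral_cong)
    fix y
    show "(\<integral>\<^sup>+x. f (c * x) * g (c * x + y) \<partial>lborel) = (\<integral>\<^sup>+x. f (c * x - y) * g (c * x) \<partial>lborel)"
      using tr[of "\<lambda>x. f (c * x) * g (c * x + y)" "- y / c"] c0
      by (simp add: algebra_simps)
  qed
  also have "\<dots> = (\<integral>\<^sup>+x. (\<integral>\<^sup>+y. f (c * x - y) * g (c * x) \<partial>lborel) \<partial>lborel)"
    by (rule lborel_pair.Fubini'[symmetric]) measurable
  also have "\<dots> = (\<integral>\<^sup>+x. (\<integral>\<^sup>+y. f y \<partial>lborel) * g x \<partial>lborel)"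
  proof (rule nn_integral_cong)
    fix x
    have "(\<integral>\<^sup>+y. f (c * x - y) \<partial>lborel) = (\<integral>\<^sup>+y. f y \<partial>lborel)"
      using neg[of "\<lambda>y. f (c * x + y)"] tr[of f "c * x"] by simp
    then show "(\<integral>\<^sup>+y. f (c * x - y) * g (c * x) \<partial>lborel) = (\<integral>\<^sup>+y. f y \<partial>lborel) * g x"
      by (simp add: nn_integral_multc gc)
  qed
  also have "\<dots> = (\<integral>\<^sup>+y. f y \<partial>lborel) * ennreal pi"
    by (simp add: nn_integral_cmult gint)
  finally show ?thesis
    unfolding gint by (simp add: ennreal_mult_cancel_left mult.commute[of _ "ennreal pi"])
qed

lemma distr_complex_rotate:
  fixes c :: complex
  assumes c: "norm c = 1"
  shows "distr lborel borel (\<lambda>z. c * z) = lborel"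
proof (rule measure_eqI)
  fix A assume "A \<in> sets (distr lborel borel (\<lambda>z. c * z))"
  then have [measurable]: "A \<in> sets borel" by simp
  have "emeasure (distr lborel borel (\<lambda>z. c * z)) A = (\<integral>\<^sup>+z. indicator A z \<partial>distr lborel borel (\<lambda>z. c * z))"
    by simp
  also have "\<dots> = (\<integral>\<^sup>+z. indicator A (c * z) \<partial>lborel)"
    by (subst nn_integral_distr) auto
  also have "\<dots> = emeasure lborel A"
    using nn_integral_complex_rotate[of "indicator A" c] c by simp
  finally show "emeasure (distr lborel borel (\<lambda>z. c * z)) A = emeasure lborel A" .
qed simp

text \<open>The sign is flipped because the uniqueness criterion for measures tests the rays
  \<open>{x<..}\<close> and wants them of finite measure. With \<open>- (norm z)\<^sup>2\<close>
  their preimages are discs, whose area is linear in the squared radius; this is polar integration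
  without an angle.\<close>

lemma distr_neg_norm_square_complex:
  "distr lborel borel (\<lambda>z::complex. - (norm z)\<^sup>2) = density lborel (\<lambda>v. ennreal pi * indicator {..0} v)"
proof (rule measure_eqI_lessThan)
  have em: "emeasure (distr lborel borel (\<lambda>z::complex. - (norm z)\<^sup>2)) {x<..} = ennreal (pi * max 0 (-x))" for x :: real
  proof -
    have "(\<lambda>z::complex. - (norm z)\<^sup>2) -` {x<..} = ball 0 (sqrt (-x))"
      by (auto simp: real_less_rsqrt dest: real_less_lsqrt) (metis norm_ge_zero real_sqrt_less_iff real_sqrt_unique minus_less_iff real_sqrt_abs abs_norm_cancel sqrt_le_D linorder_not_less minus_le_iff)
    moreover have "(sqrt (-x))\<^sup>2 = max 0 (-x)" if "x \<le> 0" using that by simp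
    ultimately show ?thesis
      by (cases "x \<le> 0") (simp_all add: emeasure_distr emeasure_ball unit_ball_vol_2 ball_empty ennreal_mult mult.commute)
  qed
  show "emeasure (distr lborel borel (\<lambda>z::complex. - (norm z)\<^sup>2)) {x<..} < \<infinity>" for x
    by (simp add: em)
  show "emeasure (distr lborel borel (\<lambda>z::complex. - (norm z)\<^sup>2)) {x<..} =
        emeasure (density lborel (\<lambda>v. ennreal pi * indicator {..0} v)) {x<..}" for x :: real
  proof -
    have "emeasure (density lborel (\<lambda>v. ennreal pi * indicator {..0} v)) {x<..}
      = (\<integral>\<^sup>+v. ennreal pi * indicator {x<..0} v \<partial>lborel)"
      by (subst emeasure_density) (auto intro!: nn_integral_cong simp: indicator_def)
    also have "\<dots> = ennreal pi * emeasure lborel {x<..0}"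
      by (simp add: nn_integral_cmult)
    finally show ?thesis by (cases "x \<le> 0") (auto simp: em simp flip: ennreal_mult'')
  qed
qed simp_all

lemma nn_integral_radial_complex:
  assumes [measurable]: "f \<in> borel_measurable borel"
  shows "(\<integral>\<^sup>+z. f ((norm (z::complex))\<^sup>2) \<partial>lborel) = (\<integral>\<^sup>+v. ennreal pi * f v * indicator {0..} v \<partial>lborel)"
proof -
  have "(\<integral>\<^sup>+z. f ((norm (z::complex))\<^sup>2) \<partial>lborel)
      = (\<integral>\<^sup>+v. f (- v) \<partial>distr lborel borel (\<lambda>z::complex. - (norm z)\<^sup>2))"
    by (simp add: nn_integral_distr)
  also have "\<dots> = (\<integral>\<^sup>+v. ennreal pi * f (-v) * indicator {..0} v \<partial>lborel)"
    unfolding distr_neg_norm_square_complex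
    by (simp add: nn_integral_density mult_ac)
  also have "\<dots> = (\<integral>\<^sup>+v. ennreal pi * f v * indicator {0..} v \<partial>lborel)"
    by (subst lborel_distr_uminus[symmetric]) (auto simp: nn_integral_distr indicator_def intro!: nn_integral_cong)
  finally show ?thesis .
qed

text \<open>With w running over the circle of radius \<open>norm z\<close>, d\<theta> is dw / (2 pi
  i w). Partial fractions split the integrand into two Cauchy kernels with poles 0 and \<xi>, where
  \<xi> is \<zeta> turned by the argument of \<open>z\<close>. The circle always winds around 0, and
  around \<xi> exactly if \<open>norm \<zeta> < norm z\<close>; in that case the two contributions
  cancel.\<close>

lemma has_integral_circle_mean:
  fixes \<zeta> z :: complex
  assumes "norm z \<noteq> norm \<zeta>" "\<zeta> \<noteq> 0"
  shows "((\<lambda>\<theta>. 1 / (\<zeta> - cis (2 * pi * \<theta>) * z)) has_integral (if norm z < norm \<zeta> then 1 / \<zeta> else 0)) {0..1}"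
proof (cases "z = 0")
  case True
  then show ?thesis using assms has_integral_const_real[of "1/\<zeta>" 0 1] by simp
next
  case False
  define r where "r = norm z"
  have r: "r > 0" using False by (simp add: r_def)
  define u where "u = z / of_real r"
  have zu: "z = u * of_real r" and u: "norm u = 1" "u \<noteq> 0" using r False by (auto simp: u_def r_def norm_divide)
  define \<xi> where "\<xi> = \<zeta> / u"
  have x: "\<xi> \<noteq> 0" "norm \<xi> \<noteq> r" "norm \<xi> = norm \<zeta>" using assms u by (auto simp: \<xi>_def norm_divide r_def)
  have wn: "winding_number (circlepath 0 r) a = (if norm a < r then 1 else 0)" if "norm a \<noteq> r" for a
  proof (cases "norm a < r")
    case True
    then show ?thesis using winding_number_circlepath[of a 0 r] by simp
  next
    case False
    then have "a \<notin> cball 0 r" using that by auto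
    then show ?thesis using False r
      winding_number_zero_outside[of "circlepath 0 r" "cball 0 r" a] by auto
  qed
  have pim: "a \<notin> path_image (circlepath 0 r)" if "norm a \<noteq> r" for a using that r by auto
  have hc: "((\<lambda>w. 1 / (w - a)) has_contour_integral 2 * pi * \<i> * (if norm a < r then 1 else 0)) (circlepath 0 r)"
    if "norm a \<noteq> r" for a
    using has_contour_integral_winding_number[OF _ pim[OF that]] wn[OF that] by simp
  have "((\<lambda>w. (1 / \<zeta>) / (2 * pi * \<i>) * (1 / (w - 0) - 1 / (w - \<xi>))) has_contour_integral
     (1 / \<zeta>) / (2 * pi * \<i>) * (2 * pi * \<i> * (if norm (0::complex) < r then 1 else 0) - 2 * pi * \<i> * (if norm \<xi> < r then 1 else 0))) (circlepath 0 r)"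
    by (intro has_contour_integral_lmul has_contour_integral_diff hc) (use r x in auto)
  also have "(1 / \<zeta>) / (2 * pi * \<i>) * (2 * pi * \<i> * (if norm (0::complex) < r then 1 else 0) - 2 * pi * \<i> * (if norm \<xi> < r then 1 else 0))
     = (if norm z < norm \<zeta> then 1 / \<zeta> else 0)"
    using r x by (auto simp: r_def)
  finally have *: "((\<lambda>\<theta>. (1 / \<zeta>) / (2 * pi * \<i>) * (1 / (circlepath 0 r \<theta> - 0) - 1 / (circlepath 0 r \<theta> - \<xi>)) *
     vector_derivative (circlepath 0 r) (at \<theta> within {0..1})) has_integral (if norm z < norm \<zeta> then 1 / \<zeta> else 0)) {0..1}"
    unfolding has_contour_integral_def .
  show ?thesis
  proof (rule has_integral_eq[OF _ *])
    fix \<theta> :: real assume \<theta>: "\<theta> \<in> {0..1}"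
    define w where "w = circlepath 0 r \<theta>"
    have w: "w = of_real r * cis (2 * pi * \<theta>)" by (simp add: w_def circlepath cis_conv_exp mult_ac)
    have w0: "w \<noteq> 0" "w \<noteq> \<xi>" using r x by (auto simp: w norm_mult)
    have vd: "vector_derivative (circlepath 0 r) (at \<theta> within {0..1}) = 2 * pi * \<i> * w"
      using \<theta> by (simp add: vector_derivative_circlepath01 w cis_conv_exp mult_ac)
    have "\<zeta> - cis (2 * pi * \<theta>) * z = u * (\<xi> - w)" using u by (simp add: zu w \<xi>_def algebra_simps)
    moreover have "(1 / \<zeta>) / (2 * pi * \<i>) * (1 / w - 1 / (w - \<xi>)) * (2 * pi * \<i> * w) = 1 / (u * (\<xi> - w))"
    proof -
      have "1 / w - 1 / (w - \<xi>) = \<xi> / (w * (\<xi> - w))"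
        using w0 x(1) by (simp add: divide_simps) (simp add: algebra_simps)
      moreover have "\<zeta> = u * \<xi>" using u by (simp add: \<xi>_def)
      ultimately show ?thesis using w0 x(1) u(2) by simp
    qed
    ultimately show "(1 / \<zeta>) / (2 * pi * \<i>) * (1 / (circlepath 0 r \<theta> - 0) - 1 / (circlepath 0 r \<theta> - \<xi>)) *
        vector_derivative (circlepath 0 r) (at \<theta> within {0..1}) = 1 / (\<zeta> - cis (2 * pi * \<theta>) * z)"
      by (simp add: vd w_def[symmetric])
  qed
qed

text \<open>All rotates of \<open>F\<close> have the same integral, so Fubini on angle times plane
  allows \<open>F\<close> to be replaced by its means over circles. The mean is given as a gauge
  integral for almost every point, which is the form in which winding numbers deliver it.\<close>

lemma integral_angular_mean:
  fixes F :: "complex \<Rightarrow> complex"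
  assumes F: "integrable lborel F" and Gm[measurable]: "G \<in> borel_measurable borel"
    and G: "AE z in lborel. ((\<lambda>\<theta>. F (cis (2 * pi * \<theta>) * z)) has_integral G z) {0..1}"
  shows "integrable lborel G" and "integral\<^sup>L lborel G = integral\<^sup>L lborel F"
proof -
  have Fm[measurable]: "F \<in> borel_measurable borel" using borel_measurable_integrable[OF F] by simp
  have [measurable]: "(\<lambda>\<theta>. cis (2 * pi * \<theta>)) \<in> borel_measurable borel"
    by (intro borel_measurable_continuous_onI continuous_intros)
  define H where "H = (\<lambda>\<theta> z. indicator {0..1::real} \<theta> *\<^sub>R F (cis (2 * pi * \<theta>) * z))"
  have [measurable]: "case_prod H \<in> borel_measurable (lborel \<Otimes>\<^sub>M lborel)"
    unfolding H_def by measurable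
  have rot: "integrable lborel (\<lambda>z. F (cis a * z))" "(\<integral>z. F (cis a * z) \<partial>lborel) = integral\<^sup>L lborel F"
    "(\<integral>z. norm (F (cis a * z)) \<partial>lborel) = (\<integral>z. norm (F z) \<partial>lborel)" for a
  proof -
    have d: "distr lborel borel (\<lambda>z. cis a * z) = lborel" by (rule distr_complex_rotate) simp
    show "integrable lborel (\<lambda>z. F (cis a * z))"
      using F by (subst (asm) d[symmetric]) (simp add: integrable_distr_eq)
    show "(\<integral>z. F (cis a * z) \<partial>lborel) = integral\<^sup>L lborel F"
      by (subst (2) d[symmetric]) (simp add: integral_distr)
    show "(\<integral>z. norm (F (cis a * z)) \<partial>lborel) = (\<integral>z. norm (F z) \<partial>lborel)"
      by (subst (2) d[symmetric]) (simp add: integral_distr)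
  qed
  have int: "integrable (lborel \<Otimes>\<^sub>M lborel) (case_prod H)"
  proof (rule lborel_pair.Fubini_integrable)
    show "integrable lborel (\<lambda>\<theta>. \<integral>z. norm (case (\<theta>, z) of (\<theta>, z) \<Rightarrow> H \<theta> z) \<partial>lborel)"
      by (simp add: H_def rot)
    show "AE \<theta> in lborel. integrable lborel (\<lambda>z. case (\<theta>, z) of (\<theta>, z) \<Rightarrow> H \<theta> z)"
      by (simp add: H_def rot)
  qed simp
  have inner: "AE z in lborel. (\<integral>\<theta>. H \<theta> z \<partial>lborel) = G z"
    using lborel_pair.AE_integrable_snd[OF int] G
  proof eventually_elim
    case (elim z)
    then have "set_integrable lborel {0..1} (\<lambda>\<theta>. F (cis (2 * pi * \<theta>) * z))"
      by (simp add: set_integrable_def H_def)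
    from set_borel_integral_eq_integral(2)[OF this] elim(2) show ?case
      by (simp add: H_def set_lebesgue_integral_def integral_unique)
  qed
  have meas: "(\<lambda>z. \<integral>\<theta>. H \<theta> z \<partial>lborel) \<in> borel_measurable lborel"
    by measurable
  have I: "integrable lborel (\<lambda>z. \<integral>\<theta>. H \<theta> z \<partial>lborel)"
    using lborel_pair.integrable_snd[OF int] .
  show "integrable lborel G"
    by (rule integrable_cong_AE_imp[OF I]) (use inner in auto)
  have "integral\<^sup>L lborel G = (\<integral>z. (\<integral>\<theta>. H \<theta> z \<partial>lborel) \<partial>lborel)"
    by (rule integral_cong_AE) (use inner meas in auto)
  also have "\<dots> = (\<integral>\<theta>. (\<integral>z. H \<theta> z \<partial>lborel) \<partial>lborel)"
    using lborel_pair.Fubini_integral[OF int] .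
  also have "\<dots> = integral\<^sup>L lborel F"
    by (simp add: H_def rot)
  finally show "integral\<^sup>L lborel G = integral\<^sup>L lborel F" .
qed

lemma AE_norm_neq: "AE z::complex in lborel. norm z \<noteq> r"
proof -
  have "sphere (0::complex) r \<in> null_sets lborel"
    using negligible_sphere[of "0::complex" r] by (auto simp: null_sets_completion_iff negligible_iff_null_sets)
  then show ?thesis by (rule AE_I') auto
qed

text \<open>Newton's shell theorem for the Cauchy kernel: by the circle mean, mass closer to 0 than
  \<zeta> acts as if concentrated at 0, and mass farther out does not act at all.\<close>

lemma integral_radial_Cauchy_kernel:
  fixes k :: "real \<Rightarrow> real" and \<zeta> :: complex
  assumes [measurable]: "k \<in> borel_measurable borel" and \<zeta>: "\<zeta> \<noteq> 0"
    and int: "integrable lborel (\<lambda>z. of_real (k (norm z)) / (\<zeta> - z))"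
  shows "(\<integral>z. of_real (k (norm z)) / (\<zeta> - z) \<partial>lborel)
       = of_real (\<integral>z. (if norm (z::complex) < norm \<zeta> then k (norm z) else 0) \<partial>lborel) / \<zeta>"
proof -
  define G where "G = (\<lambda>z::complex. of_real (if norm z < norm \<zeta> then k (norm z) else 0) / \<zeta>)"
  have "(\<integral>z. of_real (k (norm z)) / (\<zeta> - z) \<partial>lborel) = integral\<^sup>L lborel G"
  proof (rule integral_angular_mean(2)[OF int, symmetric])
    show "G \<in> borel_measurable borel" unfolding G_def by measurable
    show "AE z in lborel. ((\<lambda>\<theta>. complex_of_real (k (norm (cis (2 * pi * \<theta>) * z))) / (\<zeta> - cis (2 * pi * \<theta>) * z))
        has_integral G z) {0..1}"
      using AE_norm_neq[of "norm \<zeta>"]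
    proof eventually_elim
      case (elim z)
      show ?case
        using has_integral_mult_right[OF has_integral_circle_mean[OF elim \<zeta>], of "of_real (k (norm z))"]
        by (cases "norm z < norm \<zeta>") (simp_all add: G_def norm_mult)
    qed
  qed
  also have "\<dots> = of_real (\<integral>z. (if norm (z::complex) < norm \<zeta> then k (norm z) else 0) \<partial>lborel) / \<zeta>"
    unfolding G_def by simp
  finally show ?thesis .
qed

text \<open>After expanding by \<open>cnj v\<close> the kernel is k / |v|^2 times
  \<open>cnj v / (cnj v - cnj d) = 1 - cnj d * cnj (1 / (d - v))\<close>. By the conjugated circle
  mean this factor averages to 0 for |v| < |d| and to 1 for |v| > |d|.\<close>

lemma integral_radial_Cauchy_kernel2:
  fixes k :: "real \<Rightarrow> real" and d :: complex
  assumes [measurable]: "k \<in> borel_measurable borel" and d: "d \<noteq> 0"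
    and int: "integrable lborel (\<lambda>v. of_real (k (norm v)) / (v * (cnj v - cnj d)))"
  shows "(\<integral>v. of_real (k (norm v)) / (v * (cnj v - cnj d)) \<partial>lborel)
       = of_real (\<integral>v. (if norm (v::complex) > norm d then k (norm v) / (norm v)\<^sup>2 else 0) \<partial>lborel)"
proof -
  define G where "G = (\<lambda>v::complex. complex_of_real (if norm v > norm d then k (norm v) / (norm v)\<^sup>2 else 0))"
  have "(\<integral>v. of_real (k (norm v)) / (v * (cnj v - cnj d)) \<partial>lborel) = integral\<^sup>L lborel G"
  proof (rule integral_angular_mean(2)[OF int, symmetric])
    show "G \<in> borel_measurable borel" unfolding G_def by measurable
    show "AE v in lborel. ((\<lambda>\<theta>. complex_of_real (k (norm (cis (2 * pi * \<theta>) * v))) /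
        (cis (2 * pi * \<theta>) * v * (cnj (cis (2 * pi * \<theta>) * v) - cnj d))) has_integral G v) {0..1}"
      using AE_norm_neq[of "norm d"] AE_norm_neq[of 0]
    proof eventually_elim
      case (elim v)
      have m: "((\<lambda>\<theta>. of_real (k (norm v) / (norm v)\<^sup>2) * (1 - cnj d * cnj (1 / (d - cis (2 * pi * \<theta>) * v))))
          has_integral of_real (k (norm v) / (norm v)\<^sup>2) * (1 - cnj d * cnj (if norm v < norm d then 1 / d else 0))) {0..1}"
        using has_integral_const_real[of "1::complex" 0 1]
          has_integral_cnj[THEN iffD2, OF has_integral_circle_mean[OF elim(1) d], unfolded o_def]
        by (intro has_integral_mult_right has_integral_diff) simp_all
      have e1: "of_real (k (norm v) / (norm v)\<^sup>2) * (1 - cnj d * cnj (if norm v < norm d then 1 / d else 0)) = G v"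
        using d elim by (auto simp: G_def)
      have e2: "of_real (k (norm v) / (norm v)\<^sup>2) * (1 - cnj d * cnj (1 / (d - e * v))) =
         of_real (k (norm (e * v))) / (e * v * (cnj (e * v) - cnj d))" if e: "norm e = 1" for e
      proof -
        define w where "w = e * v"
        have nw: "norm w = norm v" "w \<noteq> 0" "w \<noteq> d" using e elim by (auto simp: w_def norm_mult)
        have "of_real ((norm v)\<^sup>2) = w * cnj w" by (simp add: nw(1)[symmetric] complex_norm_square[symmetric])
        then have k: "complex_of_real (k (norm v) / (norm v)\<^sup>2) = of_real (k (norm v)) / (w * cnj w)"
          by (metis of_real_divide)
        have k2: "1 - cnj d * cnj (1 / (d - w)) = cnj w / (cnj w - cnj d)"
          using nw by (simp add: divide_simps) (simp add: algebra_simps)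
        show ?thesis unfolding w_def[symmetric] nw(1) k k2 using nw(2) by simp
      qed
      show ?case using m unfolding e1 by (rule has_integral_eq[rotated]) (rule e2, simp)
    qed
  qed
  also have "\<dots> = of_real (\<integral>v. (if norm (v::complex) > norm d then k (norm v) / (norm v)\<^sup>2 else 0) \<partial>lborel)"
    unfolding G_def by simp
  finally show ?thesis .
qed

lemma has_bochner_integral_radial:
  fixes f :: "real \<Rightarrow> real"
  assumes [measurable]: "f \<in> borel_measurable borel" "S \<in> sets borel"
    and nn: "\<And>v. v \<in> S \<Longrightarrow> 0 \<le> v \<and> 0 \<le> f v" and I: "(f has_integral I) S"
  shows "has_bochner_integral lborel (\<lambda>z::complex. if (norm z)\<^sup>2 \<in> S then f ((norm z)\<^sup>2) else 0) (pi * I)"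
proof -
  have I0: "I \<ge> 0" using has_integral_nonneg[OF I] nn by auto
  have "(\<integral>\<^sup>+z. ennreal (if (norm z)\<^sup>2 \<in> S then f ((norm (z::complex))\<^sup>2) else 0) \<partial>lborel)
      = (\<integral>\<^sup>+v. ennreal pi * ennreal (if v \<in> S then f v else 0) * indicator {0..} v \<partial>lborel)"
    by (rule nn_integral_radial_complex[of "\<lambda>v. ennreal (if v \<in> S then f v else 0)"]) measurable
  also have "\<dots> = (\<integral>\<^sup>+v. ennreal pi * ennreal (if v \<in> S then f v else 0) \<partial>lborel)"
    using nn by (intro nn_integral_cong) (auto simp: indicator_def)
  also have "\<dots> = ennreal pi * (\<integral>\<^sup>+v. ennreal (if v \<in> S then f v else 0) \<partial>lborel)"
    by (rule nn_integral_cmult) measurable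
  also have "(\<integral>\<^sup>+v. ennreal (if v \<in> S then f v else 0) \<partial>lborel) = ennreal I"
    by (rule nn_integral_has_integral_lborel) (use nn I in \<open>auto simp: has_integral_restrict_UNIV\<close>)
  finally show ?thesis using I0 nn
    by (intro has_bochner_integral_nn_integral) (auto simp: ennreal_mult)
qed

lemma has_bochner_integral_norm_powr_outside:
  assumes "a > 2" "\<rho> > 0"
  shows "has_bochner_integral lborel (\<lambda>z::complex. if norm z \<ge> \<rho> then norm z powr (- a) else 0) (2 * pi * \<rho> powr (2 - a) / (a - 2))"
proof -
  have sq: "norm z powr (-a) = (norm z)\<^sup>2 powr (- a / 2)" for z :: complex
    by (simp add: power2_eq_square powr_mult flip: powr_add)
  have "((\<lambda>v. v powr (- a / 2)) has_integral - ((\<rho>\<^sup>2) powr (- a / 2 + 1)) / (- a / 2 + 1)) {\<rho>\<^sup>2..}"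
    by (rule has_integral_powr_to_inf) (use assms in auto)
  from has_bochner_integral_radial[OF _ _ _ this]
  have 1: "has_bochner_integral lborel (\<lambda>z::complex. if (norm z)\<^sup>2 \<in> {\<rho>\<^sup>2..} then (norm z)\<^sup>2 powr (- a / 2) else 0)
      (pi * (- ((\<rho>\<^sup>2) powr (- a / 2 + 1)) / (- a / 2 + 1)))"
    using assms by (auto intro: order_trans[OF zero_le_power2])
  have 2: "(\<rho>\<^sup>2) powr (- a / 2 + 1) = \<rho> powr (2 - a)"
  proof -
    have "\<rho>\<^sup>2 = \<rho> powr 2" using assms by simp
    then show ?thesis by (simp add: powr_powr algebra_simps)
  qed
  have 3: "pi * (- ((\<rho>\<^sup>2) powr (- a / 2 + 1)) / (- a / 2 + 1)) = 2 * pi * \<rho> powr (2 - a) / (a - 2)"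
    unfolding 2 using assms by (simp add: field_simps)
  have 4: "(norm z)\<^sup>2 \<in> {\<rho>\<^sup>2..} \<longleftrightarrow> norm z \<ge> \<rho>" for z :: complex using assms by (simp add: power2_le_iff_abs_le power_mono_iff)
  show ?thesis using 1 unfolding 3 4 sq .
qed

lemma has_bochner_integral_norm_powr_inside:
  assumes "0 \<le> a" "a < 2"
  shows "has_bochner_integral lborel (\<lambda>z::complex. if norm z \<le> 1 then norm z powr (- a) else 0) (2 * pi / (2 - a))"
proof -
  have sq: "norm z powr (-a) = (norm z)\<^sup>2 powr (- a / 2)" for z :: complex
    by (simp add: power2_eq_square powr_mult flip: powr_add)
  have "((\<lambda>v. v powr (- a / 2)) has_integral (1 powr (- a / 2 + 1)) / (- a / 2 + 1)) {0..1}"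
    by (rule has_integral_powr_from_0) (use assms in auto)
  from has_bochner_integral_radial[OF _ _ _ this]
  have 1: "has_bochner_integral lborel (\<lambda>z::complex. if (norm z)\<^sup>2 \<in> {0..1} then (norm z)\<^sup>2 powr (- a / 2) else 0)
      (pi * ((1 powr (- a / 2 + 1)) / (- a / 2 + 1)))"
    by auto
  have 3: "pi * ((1 powr (- a / 2 + 1)) / (- a / 2 + 1)) = 2 * pi / (2 - a)"
    using assms by (simp add: field_simps)
  have 4: "(norm z)\<^sup>2 \<in> {0..1} \<longleftrightarrow> norm z \<le> 1" for z :: complex by (simp add: abs_square_le_1)
  show ?thesis using 1 unfolding 3 4 sq .
qed

section \<open>The truncated kernel and its radial integrals\<close>

definition trunc_kernel :: "real \<Rightarrow> real \<Rightarrow> real" where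
  "trunc_kernel \<epsilon> r = (if r > \<epsilon> then 1 / r ^ 4 else 0)"

text \<open>The mass of the truncated kernel outside the disc of radius \<open>r\<close> about its
  centre: what remains of it once one of the two points has been integrated out.\<close>

definition kernel_tail :: "real \<Rightarrow> real \<Rightarrow> real" where
  "kernel_tail \<epsilon> r = pi / (max \<epsilon> r)\<^sup>2"

text \<open>The integral of \<open>kernel_tail\<close> over |v|^2 outside the disc of radius
  \<open>r\<close>: what remains once both points have been integrated out to the boundary. Cutting
  off 1 / r^4 at \<epsilon> leaves only a logarithmic singularity here.\<close>

definition log_kernel :: "real \<Rightarrow> real \<Rightarrow> real" where
  "log_kernel \<epsilon> r = (if r > \<epsilon> then pi\<^sup>2 / r\<^sup>2 else pi\<^sup>2 / \<epsilon>\<^sup>2 * (1 + ln (\<epsilon>\<^sup>2 / r\<^sup>2)))"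

lemma measurable_kernels [measurable]:
  "trunc_kernel \<epsilon> \<in> borel_measurable borel" "kernel_tail \<epsilon> \<in> borel_measurable borel" "log_kernel \<epsilon> \<in> borel_measurable borel"
  unfolding trunc_kernel_def kernel_tail_def log_kernel_def by measurable

lemma has_bochner_integral_inverse_fourth:
  assumes "\<rho> > 0"
  shows "has_bochner_integral lborel (\<lambda>z::complex. if norm z \<ge> \<rho> then 1 / norm z ^ 4 else 0) (pi / \<rho>\<^sup>2)"
proof -
  have 1: "norm z powr (-4) = 1 / norm z ^ 4" if "norm z \<ge> \<rho>" for z :: complex
  proof -
    have "norm z > 0" using that assms by linarith
    then show ?thesis using powr_minus[of "norm z" 4] by (simp only: powr_numeral inverse_eq_divide)
  qed
  have "\<rho> powr (-2) = 1 / \<rho>\<^sup>2"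
    using powr_minus[of \<rho> 2] assms by (simp only: powr_numeral inverse_eq_divide)
  moreover have "2 - 4 = (-2::real)" "4 - 2 = (2::real)" by simp_all
  ultimately have "2 * pi * \<rho> powr (2 - 4) / (4 - 2) = pi / \<rho>\<^sup>2" by (simp only:) simp
  moreover have "(\<lambda>z::complex. if norm z \<ge> \<rho> then norm z powr (-4) else 0) = (\<lambda>z. if norm z \<ge> \<rho> then 1 / norm z ^ 4 else 0)"
  proof
    fix z :: complex
    show "(if norm z \<ge> \<rho> then norm z powr (-4) else 0) = (if norm z \<ge> \<rho> then 1 / norm z ^ 4 else 0)"
      using 1[of z] by (cases "norm z \<ge> \<rho>") (simp_all only: if_True if_False)
  qed
  ultimately show ?thesis
    using has_bochner_integral_norm_powr_outside[of 4 \<rho>] assms by (simp only:)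
qed

lemma has_bochner_integral_trunc_kernel_outside:
  assumes "\<epsilon> > 0"
  shows "has_bochner_integral lborel (\<lambda>z::complex. if norm z \<ge> R then trunc_kernel \<epsilon> (norm z) else 0) (kernel_tail \<epsilon> R)"
proof -
  have "has_bochner_integral lborel (\<lambda>z::complex. if norm z \<ge> max \<epsilon> R then 1 / norm z ^ 4 else 0) (pi / (max \<epsilon> R)\<^sup>2)"
    by (rule has_bochner_integral_inverse_fourth) (use assms in auto)
  then show ?thesis unfolding kernel_tail_def
  proof (rule has_bochner_integralI_AE)
    show "AE z::complex in lborel. (if norm z \<ge> max \<epsilon> R then 1 / norm z ^ 4 else 0) = (if norm z \<ge> R then trunc_kernel \<epsilon> (norm z) else 0)"
      using AE_norm_neq[of \<epsilon>] by eventually_elim (auto simp: trunc_kernel_def)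
  qed measurable
qed

lemma has_bochner_integral_trunc_kernel:
  assumes "\<epsilon> > 0"
  shows "has_bochner_integral lborel (\<lambda>z::complex. trunc_kernel \<epsilon> (norm z)) (pi / \<epsilon>\<^sup>2)"
  using has_bochner_integral_trunc_kernel_outside[OF assms, of 0] assms by (simp add: kernel_tail_def)

lemma has_bochner_integral_trunc_kernel_inside:
  assumes "\<epsilon> > 0"
  shows "has_bochner_integral lborel (\<lambda>z::complex. if norm z < R then trunc_kernel \<epsilon> (norm z) else 0) (pi / \<epsilon>\<^sup>2 - kernel_tail \<epsilon> R)"
  using has_bochner_integral_diff[OF has_bochner_integral_trunc_kernel[OF assms] has_bochner_integral_trunc_kernel_outside[OF assms, of R]]
  by (rule has_bochner_integral_cong[THEN iffD1, rotated -1]) auto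

lemma has_bochner_integral_log_kernel:
  assumes "\<epsilon> > 0" "r > 0"
  shows "has_bochner_integral lborel (\<lambda>z::complex. if norm z > r then kernel_tail \<epsilon> (norm z) / (norm z)\<^sup>2 else 0) (log_kernel \<epsilon> r)"
proof -
  \<comment> \<open>Outside radius \<open>m\<close> the integrand is pi / |v|^4. In the annulus
    between \<open>r\<close> and \<open>m\<close>, which is void of mass if r \<ge> \<epsilon>, the
    tail is the constant pi / \<epsilon>^2 and 1 / |v|^2 integrates to the logarithm.\<close>
  define m where "m = max \<epsilon> r"
  have m: "m > 0" "m \<ge> \<epsilon>" "m \<ge> r" using assms by (auto simp: m_def)
  have 1: "has_bochner_integral lborel (\<lambda>z::complex. pi * (if norm z \<ge> m then 1 / norm z ^ 4 else 0)) (pi * (pi / m\<^sup>2))"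
    by (rule has_bochner_integral_mult_right) (use has_bochner_integral_inverse_fourth[OF m(1)] in auto)
  have pos: "x > 0" if "r\<^sup>2 \<le> x" for x
    using that assms by (meson less_le_trans zero_less_power)
  have "((\<lambda>v. 1 / v) has_integral ln (m\<^sup>2) - ln (r\<^sup>2)) {r\<^sup>2..m\<^sup>2}"
    using m assms by (intro fundamental_theorem_of_calculus)
      (auto intro!: derivative_eq_intros simp: has_real_derivative_iff_has_vector_derivative[symmetric] power_mono dest: pos)
  from has_bochner_integral_radial[OF _ _ _ this]
  have "has_bochner_integral lborel (\<lambda>z::complex. if (norm z)\<^sup>2 \<in> {r\<^sup>2..m\<^sup>2} then 1 / (norm z)\<^sup>2 else 0) (pi * (ln (m\<^sup>2) - ln (r\<^sup>2)))"
    by (auto intro: order_trans[OF zero_le_power2])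
  then have 2: "has_bochner_integral lborel (\<lambda>z::complex. pi / \<epsilon>\<^sup>2 * (if (norm z)\<^sup>2 \<in> {r\<^sup>2..m\<^sup>2} then 1 / (norm z)\<^sup>2 else 0)) (pi / \<epsilon>\<^sup>2 * (pi * (ln (m\<^sup>2) - ln (r\<^sup>2))))"
    by (intro has_bochner_integral_mult_right) auto
  have val: "pi * (pi / m\<^sup>2) + pi / \<epsilon>\<^sup>2 * (pi * (ln (m\<^sup>2) - ln (r\<^sup>2))) = log_kernel \<epsilon> r"
  proof (cases "r > \<epsilon>")
    case True
    then show ?thesis by (simp add: log_kernel_def m_def power2_eq_square)
  next
    case False
    then have "m = \<epsilon>" by (simp add: m_def)
    moreover have "ln (\<epsilon>\<^sup>2 / r\<^sup>2) = ln (\<epsilon>\<^sup>2) - ln (r\<^sup>2)" using assms by (simp add: ln_div)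
    ultimately show ?thesis using False by (simp add: log_kernel_def power2_eq_square distrib_left)
  qed
  show ?thesis unfolding val[symmetric]
  proof (rule has_bochner_integralI_AE[OF has_bochner_integral_add[OF 1 2]])
    show "AE z::complex in lborel. pi * (if norm z \<ge> m then 1 / norm z ^ 4 else 0) + pi / \<epsilon>\<^sup>2 * (if (norm z)\<^sup>2 \<in> {r\<^sup>2..m\<^sup>2} then 1 / (norm z)\<^sup>2 else 0)
        = (if norm z > r then kernel_tail \<epsilon> (norm z) / (norm z)\<^sup>2 else 0)"
      using AE_norm_neq[of r] AE_norm_neq[of \<epsilon>]
    proof eventually_elim
      case (elim z)
      have iff: "(norm z)\<^sup>2 \<in> {r\<^sup>2..m\<^sup>2} \<longleftrightarrow> r \<le> norm z \<and> norm z \<le> m"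
        using assms m by (simp add: power_mono_iff)
      consider "norm z < r" | "norm z > r" "norm z < \<epsilon>" | "norm z > r" "norm z > \<epsilon>"
        using elim by linarith
      then show ?case
      proof cases
        case 1
        then show ?thesis unfolding iff using m by simp
      next
        case 2
        then show ?thesis unfolding iff using assms by (simp add: kernel_tail_def m_def)
      next
        case 3
        then have "max \<epsilon> (norm z) = norm z" "m \<le> norm z" by (auto simp: m_def)
        moreover have "\<not> norm z \<le> m" using 3 by (simp add: m_def)
        ultimately show ?thesis unfolding iff using 3 by (simp add: kernel_tail_def power2_eq_square power4_eq_xxxx)
      qed
    qed
  qed measurable
qed

subsection \<open>Double integrals over regions enclosed by loops\<close>

lemma measurable_cnj [measurable]: "cnj \<in> borel_measurable borel"
  by (intro borel_measurable_continuous_onI continuous_intros)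

lemma nn_integral_eq_has_bochner_integral:
  fixes f :: "'a \<Rightarrow> real"
  assumes "has_bochner_integral M f r" "\<And>x. 0 \<le> f x"
  shows "(\<integral>\<^sup>+x. ennreal (f x) \<partial>M) = ennreal r"
  using assms by (auto simp: has_bochner_integral_iff nn_integral_eq_integral)

lemma integral_complex_shift:
  fixes f :: "complex \<Rightarrow> 'b::{banach, second_countable_topology}"
  assumes [measurable]: "f \<in> borel_measurable borel"
  shows "(\<integral>z. f (z + a) \<partial>lborel) = (\<integral>z. f z \<partial>lborel)"
  by (subst (2) lborel_distr_plus[of a, symmetric]) (simp add: integral_distr add.commute)

lemma integral_complex_reflect:
  fixes f :: "complex \<Rightarrow> 'b::{banach, second_countable_topology}"
  assumes [measurable]: "f \<in> borel_measurable borel"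
  shows "(\<integral>z. f (a - z) \<partial>lborel) = (\<integral>z. f z \<partial>lborel)"
proof -
  have "(\<integral>z. f (a - z) \<partial>lborel) = (\<integral>z. f (a + z) \<partial>lborel)"
    using distr_complex_rotate[of "-1"]
    by (subst (2) distr_complex_rotate[of "-1", symmetric]) (simp_all add: integral_distr)
  then show ?thesis using integral_complex_shift[of f a] by (simp add: add.commute)
qed

lemma nn_integral_complex_shift:
  fixes f :: "complex \<Rightarrow> ennreal"
  assumes [measurable]: "f \<in> borel_measurable borel"
  shows "(\<integral>\<^sup>+z. f (z + a) \<partial>lborel) = (\<integral>\<^sup>+z. f z \<partial>lborel)"
  by (subst (2) lborel_distr_plus[of a, symmetric]) (simp add: nn_integral_distr add.commute)

lemma nn_integral_complex_reflect:
  fixes f :: "complex \<Rightarrow> ennreal"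
  assumes [measurable]: "f \<in> borel_measurable borel"
  shows "(\<integral>\<^sup>+z. f (a - z) \<partial>lborel) = (\<integral>\<^sup>+z. f z \<partial>lborel)"
proof -
  have "(\<integral>\<^sup>+z. f (a - z) \<partial>lborel) = (\<integral>\<^sup>+z. f (a + z) \<partial>lborel)"
    using nn_integral_complex_rotate[of "\<lambda>z. f (a + z)" "-1"] by simp
  then show ?thesis using nn_integral_complex_shift[of f a] by (simp add: add.commute)
qed

abbreviation unit_interval :: "real measure" where
  "unit_interval \<equiv> restrict_space lborel {0..1}"

interpretation unit_interval: finite_measure unit_interval
  by (rule finite_measureI) (simp add: emeasure_restrict_space space_restrict_space)

interpretation unit_plane: pair_sigma_finite unit_interval "lborel :: complex measure"
  by unfold_locales

lemma space_unit_interval [simp]: "space unit_interval = {0..1}"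
  by (simp add: space_restrict_space)

lemma measurable_unit_interval:
  assumes "f \<in> borel_measurable borel"
  shows "f \<in> borel_measurable unit_interval"
  using assms by (intro measurable_restrict_space1) simp

lemma integral_unit_interval:
  fixes f :: "real \<Rightarrow> complex"
  assumes "integrable unit_interval f"
  shows "(f has_integral integral\<^sup>L unit_interval f) {0..1}"
proof -
  have "set_integrable lborel {0..1} f"
    using assms by (simp add: integrable_restrict_space set_integrable_def)
  then have "(f has_integral (LINT x:{0..1}|lborel. f x)) {0..1}"
    using set_borel_integral_eq_integral[of "{0..1}" f] by (simp add: has_integral_integrable_integral)
  then show ?thesis
    by (simp add: integral_restrict_space set_lebesgue_integral_def)
qed

lemma integrable_unit_plane:
  fixes H :: "real \<Rightarrow> complex \<Rightarrow> complex"
  assumes [measurable]: "case_prod H \<in> borel_measurable (unit_interval \<Otimes>\<^sub>M lborel)" "f \<in> borel_measurable unit_interval"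
    and b: "AE s in unit_interval. (\<integral>\<^sup>+z. ennreal (norm (H s z)) \<partial>lborel) \<le> f s"
    and fin: "(\<integral>\<^sup>+s. f s \<partial>unit_interval) < \<infinity>"
  shows "integrable (unit_interval \<Otimes>\<^sub>M lborel) (case_prod H)"
proof (rule integrableI_bounded)
  have "(\<integral>\<^sup>+p. ennreal (norm (case_prod H p)) \<partial>(unit_interval \<Otimes>\<^sub>M lborel))
     = (\<integral>\<^sup>+s. (\<integral>\<^sup>+z. ennreal (norm (H s z)) \<partial>lborel) \<partial>unit_interval)"
    by (subst lborel.nn_integral_fst[symmetric]) auto
  also have "\<dots> \<le> (\<integral>\<^sup>+s. f s \<partial>unit_interval)"
    using b by (intro nn_integral_mono_AE)
  finally show "(\<integral>\<^sup>+p. ennreal (norm (case_prod H p)) \<partial>(unit_interval \<Otimes>\<^sub>M lborel)) < \<infinity>"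
    using fin by (rule le_less_trans)
qed simp

text \<open>An integrable majorant of 1 / |z| near 0 with room to spare: the exponent 3/2 is the one
  that \<open>inverse_product_bound\<close> leaves over when two simple poles are separated.\<close>

definition near_kernel :: "complex \<Rightarrow> real" where
  "near_kernel z = (if norm z \<le> 1 then norm z powr (- (3/2)) else 0)"

lemma measurable_near_kernel [measurable]: "near_kernel \<in> borel_measurable borel"
  unfolding near_kernel_def by measurable

lemma near_kernel_nonneg: "0 \<le> near_kernel z"
  by (simp add: near_kernel_def)

lemma nn_integral_near_kernel: "(\<integral>\<^sup>+z. ennreal (near_kernel (a - z)) \<partial>lborel) = ennreal (4 * pi)"
proof -
  have "has_bochner_integral lborel near_kernel (4 * pi)"
    using has_bochner_integral_norm_powr_inside[of "3/2"] unfolding near_kernel_def[abs_def] by simp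
  then have "(\<integral>\<^sup>+z. ennreal (near_kernel z) \<partial>lborel) = ennreal (4 * pi)"
    by (rule nn_integral_eq_has_bochner_integral) (rule near_kernel_nonneg)
  then show ?thesis using nn_integral_complex_reflect[of "\<lambda>z. ennreal (near_kernel z)" a] by simp
qed

lemma inverse_le_near_kernel: "1 / norm z \<le> near_kernel z + 1"
proof (cases "norm z \<le> 1 \<and> z \<noteq> 0")
  case True
  then have "norm z powr (-1) \<le> norm z powr (- (3/2))"
    by (intro powr_mono') auto
  moreover have "norm z powr (-1) = 1 / norm z" using True by (simp add: powr_minus_divide)
  ultimately show ?thesis using True by (simp add: near_kernel_def)
next
  case False
  then have "1 / norm z \<le> 1" by (cases "z = 0") auto
  then show ?thesis using near_kernel_nonneg[of z] by linarith
qed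

text \<open>Near \<zeta> the bound \<open>B\<close> meets the near kernel, of mass 4 pi; elsewhere
  the Cauchy kernel is at most 1 and the mass \<open>K\<close> suffices. The bound is uniform in
  \<zeta>, as Fubini along a loop requires.\<close>

lemma nn_integral_Cauchy_bound:
  fixes k :: "complex \<Rightarrow> real"
  assumes [measurable]: "k \<in> borel_measurable borel" and k: "\<And>z. 0 \<le> k z" "\<And>z. k z \<le> B"
    and K: "(\<integral>\<^sup>+z. ennreal (k z) \<partial>lborel) \<le> ennreal K" and "0 \<le> K"
  shows "(\<integral>\<^sup>+z. ennreal (k z / norm (\<zeta> - z)) \<partial>lborel) \<le> ennreal (B * (4 * pi) + K)"
proof -
  have B: "B \<ge> 0" using k[of 0] by linarith
  have "(\<integral>\<^sup>+z. ennreal (k z / norm (\<zeta> - z)) \<partial>lborel) \<le> (\<integral>\<^sup>+z. ennreal B * ennreal (near_kernel (\<zeta> - z)) + ennreal (k z) \<partial>lborel)"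
  proof (rule nn_integral_mono)
    fix z
    have "k z / norm (\<zeta> - z) \<le> k z * near_kernel (\<zeta> - z) + k z"
      using mult_left_mono[OF inverse_le_near_kernel[of "\<zeta> - z"] k(1)[of z]] by (simp add: algebra_simps)
    also have "\<dots> \<le> B * near_kernel (\<zeta> - z) + k z"
      using k(2)[of z] by (intro add_mono mult_right_mono) (auto simp: near_kernel_def)
    finally have "ennreal (k z / norm (\<zeta> - z)) \<le> ennreal (B * near_kernel (\<zeta> - z) + k z)" by (rule ennreal_leI)
    also have "\<dots> = ennreal B * ennreal (near_kernel (\<zeta> - z)) + ennreal (k z)"
      using B k by (simp add: ennreal_mult near_kernel_def)
    finally show "ennreal (k z / norm (\<zeta> - z)) \<le> ennreal B * ennreal (near_kernel (\<zeta> - z)) + ennreal (k z)" .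
  qed
  also have "\<dots> = ennreal B * ennreal (4 * pi) + (\<integral>\<^sup>+z. ennreal (k z) \<partial>lborel)"
    by (simp add: nn_integral_add nn_integral_cmult nn_integral_near_kernel)
  also have "\<dots> \<le> ennreal (B * (4 * pi) + K)"
    using B K \<open>0 \<le> K\<close> by (simp add: ennreal_mult ennreal_plus add_left_mono del: ennreal_plus) (simp add: ennreal_plus ennreal_mult'' add_left_mono)
  finally show ?thesis .
qed

abbreviation two_pi_i :: complex where
  "two_pi_i \<equiv> 2 * of_real pi * \<i>"

definition C1_loop :: "(real \<Rightarrow> complex) \<Rightarrow> (real \<Rightarrow> complex) \<Rightarrow> bool" where
  "C1_loop \<alpha> \<alpha>' \<longleftrightarrow> (\<forall>t. (\<alpha> has_vector_derivative \<alpha>' t) (at t)) \<and> continuous_on UNIV \<alpha>' \<and> \<alpha> 1 = \<alpha> 0"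

text \<open>The boundary of \<open>A\<close> is recorded only through the Cauchy integrals of the
  loop, with orientation \<open>n\<close>. Since they are prescribed almost everywhere, points of
  the loop may be counted on either side.\<close>

definition encloses :: "real \<Rightarrow> (real \<Rightarrow> complex) \<Rightarrow> (real \<Rightarrow> complex) \<Rightarrow> complex set \<Rightarrow> bool" where
  "encloses n \<alpha> \<alpha>' A \<longleftrightarrow> bounded A \<and> A \<in> sets borel \<and>
    (AE z in lborel. z \<notin> \<alpha> ` {0..1} \<and>
       ((\<lambda>t. \<alpha>' t / (\<alpha> t - z)) has_integral two_pi_i * of_real n * indicator A z) {0..1})"

lemma C1_loop_continuous:
  assumes "C1_loop \<alpha> \<alpha>'"
  shows "continuous_on UNIV \<alpha>" "continuous_on UNIV \<alpha>'"
  using assms unfolding C1_loop_def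
  by (auto intro!: continuous_at_imp_continuous_on dest: has_vector_derivative_continuous)

lemma C1_loop_measurable:
  assumes "C1_loop \<alpha> \<alpha>'"
  shows "\<alpha> \<in> borel_measurable unit_interval" "\<alpha>' \<in> borel_measurable unit_interval"
  using C1_loop_continuous[OF assms] by (auto intro!: measurable_unit_interval borel_measurable_continuous_onI)

lemma C1_loop_bounded:
  assumes "C1_loop \<alpha> \<alpha>'"
  obtains M where "M > 0" "\<And>t. t \<in> {0..1} \<Longrightarrow> norm (\<alpha>' t) \<le> M"
proof -
  have "compact (\<alpha>' ` {0..1})"
    using C1_loop_continuous(2)[OF assms] by (intro compact_continuous_image) (auto intro: continuous_on_subset)
  then obtain M where "\<forall>x\<in>\<alpha>' ` {0..1}. norm x \<le> M" using compact_imp_bounded bounded_iff by metis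
  then show ?thesis by (intro that[of "max M 1"]) (auto simp: le_max_iff_disj)
qed

lemma AE_circle_integral_encloses:
  assumes \<alpha>: "C1_loop \<alpha> \<alpha>'" and z: "z \<notin> \<alpha> ` {0..1}"
    and I: "((\<lambda>t. \<alpha>' t / (\<alpha> t - z)) has_integral I) {0..1}"
  shows "integrable unit_interval (\<lambda>t. \<alpha>' t / (\<alpha> t - z))" "(\<integral>t. \<alpha>' t / (\<alpha> t - z) \<partial>unit_interval) = I"
proof -
  note [measurable] = C1_loop_measurable[OF \<alpha>]
  have "continuous_on {0..1} (\<lambda>t. \<alpha>' t / (\<alpha> t - z))"
    using C1_loop_continuous[OF \<alpha>] z by (intro continuous_intros) (auto intro: continuous_on_subset)
  then have "compact ((\<lambda>t. \<alpha>' t / (\<alpha> t - z)) ` {0..1})" by (intro compact_continuous_image) auto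
  then obtain B where "\<forall>x\<in>(\<lambda>t. \<alpha>' t / (\<alpha> t - z)) ` {0..1}. norm x \<le> B" using compact_imp_bounded bounded_iff by metis
  then show *: "integrable unit_interval (\<lambda>t. \<alpha>' t / (\<alpha> t - z))"
    by (intro unit_interval.integrable_const_bound[of _ B]) auto
  show "(\<integral>t. \<alpha>' t / (\<alpha> t - z) \<partial>unit_interval) = I"
    using has_integral_unique[OF I integral_unit_interval[OF *]] by simp
qed

lemma kernel_tail_nonneg: "0 \<le> kernel_tail \<epsilon> r"
  by (simp add: kernel_tail_def)

lemma kernel_tail_le: "\<epsilon> > 0 \<Longrightarrow> kernel_tail \<epsilon> r \<le> pi / \<epsilon>\<^sup>2"
  unfolding kernel_tail_def by (intro divide_left_mono mult_pos_pos zero_less_power) (auto simp: power_mono less_max_iff_disj)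

lemma kernel_tail_le2: "r > 0 \<Longrightarrow> kernel_tail \<epsilon> r \<le> pi / r\<^sup>2"
  unfolding kernel_tail_def by (intro divide_left_mono mult_pos_pos zero_less_power) (auto simp: power_mono less_max_iff_disj)

lemma trunc_kernel_nonneg: "\<epsilon> > 0 \<Longrightarrow> 0 \<le> trunc_kernel \<epsilon> r"
  by (simp add: trunc_kernel_def)

lemma trunc_kernel_le: "\<epsilon> > 0 \<Longrightarrow> trunc_kernel \<epsilon> r \<le> 1 / \<epsilon> ^ 4"
  by (auto simp: trunc_kernel_def intro!: divide_left_mono power_mono)

lemma nn_integral_trunc_kernel:
  fixes w :: complex
  assumes "\<epsilon> > 0"
  shows "(\<integral>\<^sup>+z. ennreal (trunc_kernel \<epsilon> (norm (z - w))) \<partial>lborel) = ennreal (pi / \<epsilon>\<^sup>2)"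
proof -
  have "(\<integral>\<^sup>+z. ennreal (trunc_kernel \<epsilon> (norm (z::complex))) \<partial>lborel) = ennreal (pi / \<epsilon>\<^sup>2)"
    by (rule nn_integral_eq_has_bochner_integral[OF has_bochner_integral_trunc_kernel[OF assms]])
       (use assms in \<open>auto intro: trunc_kernel_nonneg\<close>)
  then show ?thesis
    using nn_integral_complex_shift[of "\<lambda>z. ennreal (trunc_kernel \<epsilon> (norm z))" "-w"] by simp
qed

text \<open>The indicator of \<open>B\<close> is a winding integral, so Fubini turns the integral
  over \<open>B\<close> into an integral along the loop of the Cauchy transform of a radial density.
  By the shell theorem that transform is (pi / \<epsilon>^2 - tail) / (\<beta> - w). The constant pi
  / \<epsilon>^2 is the total mass of the kernel and, as the loop winds once around
  \<open>w\<close>, reproduces it; passing to the complement of \<open>B\<close> leaves the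
  tail.\<close>

lemma integral_trunc_kernel_outside_loop:
  assumes \<beta>: "C1_loop \<beta> \<beta>'" and enc: "encloses n \<beta> \<beta>' B" and n: "\<bar>n\<bar> = 1" and \<epsilon>: "\<epsilon> > 0"
    and w: "w \<notin> \<beta> ` {0..1}"
    and W: "((\<lambda>t. \<beta>' t / (\<beta> t - w)) has_integral two_pi_i * of_real n) {0..1}"
  shows "of_real (\<integral>z. indicator (- B) z * trunc_kernel \<epsilon> (norm (z - w)) \<partial>lborel)
     = (\<integral>s. \<beta>' s * of_real (kernel_tail \<epsilon> (norm (\<beta> s - w))) / (\<beta> s - w) \<partial>unit_interval) / (two_pi_i * of_real n)"
proof -
  note [measurable] = C1_loop_measurable[OF \<beta>]
  have [measurable]: "B \<in> sets borel" using enc by (simp add: encloses_def)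
  obtain M where M: "M > 0" "\<And>t. t \<in> {0..1} \<Longrightarrow> norm (\<beta>' t) \<le> M" using C1_loop_bounded[OF \<beta>] by blast
  define k where "k = (\<lambda>z. trunc_kernel \<epsilon> (norm (z - w)))"
  have [measurable]: "k \<in> borel_measurable borel" unfolding k_def by measurable
  have k: "0 \<le> k z" "k z \<le> 1 / \<epsilon> ^ 4" for z using trunc_kernel_nonneg trunc_kernel_le \<epsilon> by (auto simp: k_def)
  have kn: "(\<integral>\<^sup>+z. ennreal (k z) \<partial>lborel) = ennreal (pi / \<epsilon>\<^sup>2)"
    using nn_integral_trunc_kernel[OF \<epsilon>, of w] by (simp add: k_def)
  have kint: "integrable lborel k" "integral\<^sup>L lborel k = pi / \<epsilon>\<^sup>2"
  proof -
    have "has_bochner_integral lborel k (pi / \<epsilon>\<^sup>2)"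
      by (rule has_bochner_integral_nn_integral) (use k kn \<epsilon> in auto)
    then show "integrable lborel k" "integral\<^sup>L lborel k = pi / \<epsilon>\<^sup>2" by (auto simp: has_bochner_integral_iff)
  qed
  define C where "C = 1 / \<epsilon> ^ 4 * (4 * pi) + pi / \<epsilon>\<^sup>2"
  have C: "C \<ge> 0" using \<epsilon> by (simp add: C_def)
  have bd: "(\<integral>\<^sup>+z. ennreal (k z / norm (\<zeta> - z)) \<partial>lborel) \<le> ennreal C" for \<zeta>
    unfolding C_def by (rule nn_integral_Cauchy_bound) (use k kn \<epsilon> in auto)
  define H where "H = (\<lambda>s z. \<beta>' s * of_real (k z) / (\<beta> s - z))"
  have [measurable]: "case_prod H \<in> borel_measurable (unit_interval \<Otimes>\<^sub>M lborel)"
    unfolding H_def by measurable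
  have int: "integrable (unit_interval \<Otimes>\<^sub>M lborel) (case_prod H)"
  proof (rule integrable_unit_plane[where f = "\<lambda>_. ennreal (M * C)", OF _ _ AE_I2])
    fix s :: real assume "s \<in> space unit_interval"
    then have s: "s \<in> {0..1}" by simp
    have "(\<integral>\<^sup>+z. ennreal (norm (H s z)) \<partial>lborel) \<le> (\<integral>\<^sup>+z. ennreal M * ennreal (k z / norm (\<beta> s - z)) \<partial>lborel)"
    proof (rule nn_integral_mono)
      fix z
      have "norm (H s z) = norm (\<beta>' s) * (k z / norm (\<beta> s - z))" using k by (simp add: H_def norm_mult norm_divide)
      also have "\<dots> \<le> M * (k z / norm (\<beta> s - z))" using M s k by (intro mult_right_mono) auto
      finally show "ennreal (norm (H s z)) \<le> ennreal M * ennreal (k z / norm (\<beta> s - z))"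
        using M k by (simp add: ennreal_mult[symmetric] ennreal_leI)
    qed
    also have "\<dots> \<le> ennreal M * ennreal C"
      using bd[of "\<beta> s"] by (simp add: nn_integral_cmult mult_left_mono)
    finally show "(\<integral>\<^sup>+z. ennreal (norm (H s z)) \<partial>lborel) \<le> ennreal (M * C)" using M C by (simp add: ennreal_mult)
  qed (simp_all add: emeasure_restrict_space ennreal_mult_less_top)
  have cint: "integrable lborel (\<lambda>z. of_real (k z) / (\<zeta> - z))" for \<zeta>
  proof (rule integrableI_bounded)
    have "(\<integral>\<^sup>+z. ennreal (norm (of_real (k z) / (\<zeta> - z))) \<partial>lborel) = (\<integral>\<^sup>+z. ennreal (k z / norm (\<zeta> - z)) \<partial>lborel)"
      using k by (simp add: norm_divide)
    then show "(\<integral>\<^sup>+z. ennreal (norm (of_real (k z) / (\<zeta> - z))) \<partial>lborel) < \<infinity>"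
      using bd[of \<zeta>] by (simp add: le_less_trans)
  qed measurable
  have inner1: "(\<integral>z. H s z \<partial>lborel) = \<beta>' s * of_real (pi / \<epsilon>\<^sup>2) / (\<beta> s - w) - \<beta>' s * of_real (kernel_tail \<epsilon> (norm (\<beta> s - w))) / (\<beta> s - w)"
    if s: "s \<in> {0..1}" for s
  proof -
    define \<zeta> where "\<zeta> = \<beta> s - w"
    have \<zeta>: "\<zeta> \<noteq> 0" using w s by (auto simp: \<zeta>_def)
    have e: "(\<lambda>z. complex_of_real (k (z + w)) / (\<beta> s - (z + w))) = (\<lambda>z. of_real (trunc_kernel \<epsilon> (norm z)) / (\<zeta> - z))"
      by (auto simp: k_def \<zeta>_def algebra_simps)
    have shifted: "integrable lborel (\<lambda>z. complex_of_real (k (z + w)) / (\<beta> s - (z + w)))"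
    proof -
      have "integrable (distr lborel borel ((+) w)) (\<lambda>z. of_real (k z) / (\<beta> s - z))"
        using cint[of "\<beta> s"] by (simp add: lborel_distr_plus)
      then show ?thesis by (subst (asm) integrable_distr_eq) (simp_all add: add.commute)
    qed
    have "(\<integral>z. H s z \<partial>lborel) = \<beta>' s * (\<integral>z. complex_of_real (k z) / (\<beta> s - z) \<partial>lborel)"
      unfolding H_def by (simp flip: integral_mult_right_zero)
    also have "(\<integral>z. complex_of_real (k z) / (\<beta> s - z) \<partial>lborel) = (\<integral>z. complex_of_real (k (z + w)) / (\<beta> s - (z + w)) \<partial>lborel)"
      by (rule integral_complex_shift[symmetric]) measurable
    also have "\<dots> = of_real (\<integral>z. (if norm (z::complex) < norm \<zeta> then trunc_kernel \<epsilon> (norm z) else 0) \<partial>lborel) / \<zeta>"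
      using shifted unfolding e by (intro integral_radial_Cauchy_kernel \<zeta>) auto
    also have "(\<integral>z. (if norm (z::complex) < norm \<zeta> then trunc_kernel \<epsilon> (norm z) else 0) \<partial>lborel) = pi / \<epsilon>\<^sup>2 - kernel_tail \<epsilon> (norm \<zeta>)"
      by (rule has_bochner_integral_integral_eq[OF has_bochner_integral_trunc_kernel_inside[OF \<epsilon>]])
    finally show ?thesis by (simp add: \<zeta>_def diff_divide_distrib right_diff_distrib)
  qed
  have inner2: "AE z in lborel. (\<integral>s. H s z \<partial>unit_interval) = two_pi_i * of_real n * of_real (indicator B z * k z)"
  proof -
    have "AE z in lborel. z \<notin> \<beta> ` {0..1} \<and>
       ((\<lambda>t. \<beta>' t / (\<beta> t - z)) has_integral two_pi_i * of_real n * indicator B z) {0..1}"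
      using enc by (simp add: encloses_def)
    then show ?thesis
    proof eventually_elim
      case (elim z)
      then have "(\<integral>t. \<beta>' t / (\<beta> t - z) \<partial>unit_interval) = two_pi_i * of_real n * indicator B z"
        using AE_circle_integral_encloses(2)[OF \<beta>] by blast
      moreover have "(\<integral>s. H s z \<partial>unit_interval) = (\<integral>t. of_real (k z) * (\<beta>' t / (\<beta> t - z)) \<partial>unit_interval)"
        unfolding H_def by (intro Bochner_Integration.integral_cong) auto
      moreover have "\<dots> = of_real (k z) * (\<integral>t. \<beta>' t / (\<beta> t - z) \<partial>unit_interval)" by (rule integral_mult_right_zero)
      ultimately show ?case by (simp add: indicator_def)
    qed
  qed
  have Wint: "integrable unit_interval (\<lambda>t. \<beta>' t / (\<beta> t - w))"
    "(\<integral>t. \<beta>' t / (\<beta> t - w) \<partial>unit_interval) = two_pi_i * of_real n"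
    using AE_circle_integral_encloses[OF \<beta> w W] by auto
  have T1: "integrable unit_interval (\<lambda>s. \<beta>' s * of_real (pi / \<epsilon>\<^sup>2) / (\<beta> s - w))"
    "(\<integral>s. \<beta>' s * of_real (pi / \<epsilon>\<^sup>2) / (\<beta> s - w) \<partial>unit_interval) = of_real (pi / \<epsilon>\<^sup>2) * (two_pi_i * of_real n)"
  proof -
    have e: "(\<lambda>s. \<beta>' s * of_real (pi / \<epsilon>\<^sup>2) / (\<beta> s - w)) = (\<lambda>s. of_real (pi / \<epsilon>\<^sup>2) * (\<beta>' s / (\<beta> s - w)))" by auto
    show "integrable unit_interval (\<lambda>s. \<beta>' s * of_real (pi / \<epsilon>\<^sup>2) / (\<beta> s - w))" unfolding e using Wint(1) by (rule integrable_mult_right)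
    show "(\<integral>s. \<beta>' s * of_real (pi / \<epsilon>\<^sup>2) / (\<beta> s - w) \<partial>unit_interval) = of_real (pi / \<epsilon>\<^sup>2) * (two_pi_i * of_real n)"
      unfolding e integral_mult_right_zero Wint(2) ..
  qed
  have T2: "integrable unit_interval (\<lambda>s. \<beta>' s * of_real (kernel_tail \<epsilon> (norm (\<beta> s - w))) / (\<beta> s - w))"
  proof (rule Bochner_Integration.integrable_bound[OF T1(1)])
    show "AE s in unit_interval. norm (\<beta>' s * of_real (kernel_tail \<epsilon> (norm (\<beta> s - w))) / (\<beta> s - w))
       \<le> norm (\<beta>' s * of_real (pi / \<epsilon>\<^sup>2) / (\<beta> s - w))"
    proof (intro always_eventually allI)
      fix s
      have "norm (complex_of_real (kernel_tail \<epsilon> (norm (\<beta> s - w)))) \<le> norm (complex_of_real (pi / \<epsilon>\<^sup>2))"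
        using kernel_tail_le[OF \<epsilon>, of "norm (\<beta> s - w)"] kernel_tail_nonneg[of \<epsilon> "norm (\<beta> s - w)"] unfolding norm_of_real by linarith
      then show "norm (\<beta>' s * of_real (kernel_tail \<epsilon> (norm (\<beta> s - w))) / (\<beta> s - w))
         \<le> norm (\<beta>' s * of_real (pi / \<epsilon>\<^sup>2) / (\<beta> s - w))"
        unfolding norm_mult norm_divide by (intro divide_right_mono mult_left_mono) auto
    qed
  qed measurable
  have n0: "2 * complex_of_real pi * \<i> * complex_of_real n \<noteq> 0" using n by auto
  have Bint: "integrable lborel (\<lambda>z. indicator B z * k z)"
    using kint(1) by (rule Bochner_Integration.integrable_bound) (auto simp: indicator_def)
  have "two_pi_i * of_real n * of_real (\<integral>z. indicator B z * k z \<partial>lborel)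
      = (\<integral>z. two_pi_i * of_real n * complex_of_real (indicator B z * k z) \<partial>lborel)"
    by (simp only: integral_mult_right_zero integral_complex_of_real)
  also have "\<dots> = (\<integral>z. (\<integral>s. H s z \<partial>unit_interval) \<partial>lborel)"
    using inner2 by (intro integral_cong_AE) auto
  also have "\<dots> = (\<integral>s. (\<integral>z. H s z \<partial>lborel) \<partial>unit_interval)"
    using unit_plane.Fubini_integral[OF int] .
  also have "\<dots> = (\<integral>s. \<beta>' s * of_real (pi / \<epsilon>\<^sup>2) / (\<beta> s - w) - \<beta>' s * of_real (kernel_tail \<epsilon> (norm (\<beta> s - w))) / (\<beta> s - w) \<partial>unit_interval)"
    by (rule Bochner_Integration.integral_cong) (auto simp: inner1)
  also have "\<dots> = of_real (pi / \<epsilon>\<^sup>2) * (two_pi_i * of_real n) -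
     (\<integral>s. \<beta>' s * of_real (kernel_tail \<epsilon> (norm (\<beta> s - w))) / (\<beta> s - w) \<partial>unit_interval)"
    using T1 T2 by simp
  finally have eq: "two_pi_i * of_real n * of_real (\<integral>z. indicator B z * k z \<partial>lborel)
     = of_real (pi / \<epsilon>\<^sup>2) * (two_pi_i * of_real n) -
     (\<integral>s. \<beta>' s * of_real (kernel_tail \<epsilon> (norm (\<beta> s - w))) / (\<beta> s - w) \<partial>unit_interval)" .
  have alg: "(P - J) * c = X" if "c * J = P * c - X" for c J P X :: complex
    using that by (simp add: algebra_simps)
  have "(\<integral>z. indicator (- B) z * k z \<partial>lborel) = (\<integral>z. k z - indicator B z * k z \<partial>lborel)"
    by (intro Bochner_Integration.integral_cong) (auto simp: indicator_def)
  also have "\<dots> = pi / \<epsilon>\<^sup>2 - (\<integral>z. indicator B z * k z \<partial>lborel)" using kint Bint by simp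
  finally have "of_real (\<integral>z. indicator (- B) z * k z \<partial>lborel) * (two_pi_i * of_real n)
     = (\<integral>s. \<beta>' s * of_real (kernel_tail \<epsilon> (norm (\<beta> s - w))) / (\<beta> s - w) \<partial>unit_interval)"
    using alg[OF eq] by (simp only: of_real_diff)
  then show ?thesis unfolding k_def by (rule eq_divide_imp[OF n0])
qed

text \<open>Write 1 / (a b) as (1/a + 1/b) / (a + b) and split 1 / (a + b) into two square roots:
  one is absorbed by \<open>d\<close>, the other raises the exponents of \<open>a\<close> and
  \<open>b\<close> from 1 to 3/2. Thus two poles at distance \<open>d\<close> cost only
  \<open>d\<close> to the power -1/2.\<close>

lemma inverse_product_bound:
  assumes b: "b > 0" and a: "a > (0::real)" and d: "0 < d" "d \<le> a + b"
  shows "1 / (a * b) \<le> d powr (- (1/2)) * (a powr (- (3/2)) + b powr (- (3/2)))"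
proof -
  have *: "1 / c * (a + b) powr (- (1/2)) \<le> c powr (- (3/2))" if "c > 0" "c \<le> a + b" for c
  proof -
    have "(a + b) powr (- (1/2)) \<le> c powr (- (1/2))"
      by (rule powr_mono2') (use that in auto)
    then have "1 / c * (a + b) powr (- (1/2)) \<le> 1 / c * c powr (- (1/2))"
      using that by (intro mult_left_mono) auto
    also have "1 / c * c powr (- (1/2)) = c powr (-1) * c powr (- (1/2))" using that by (simp add: powr_minus_divide)
    also have "\<dots> = c powr (- (3/2))" by (subst powr_add[symmetric]) simp
    finally show ?thesis .
  qed
  have "1 / (a * b) = (1 / a + 1 / b) * (1 / (a + b))" using a b by (simp add: field_simps)
  also have "1 / (a + b) = (a + b) powr (- (1/2)) * (a + b) powr (- (1/2))"
    using a b by (subst powr_add[symmetric]) (simp add: powr_minus_divide)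
  also have "(1 / a + 1 / b) * ((a + b) powr (- (1/2)) * (a + b) powr (- (1/2)))
      = (1 / a * (a + b) powr (- (1/2)) + 1 / b * (a + b) powr (- (1/2))) * (a + b) powr (- (1/2))"
    by (simp add: algebra_simps)
  also have "\<dots> \<le> (a powr (- (3/2)) + b powr (- (3/2))) * d powr (- (1/2))"
    using *[of a] *[of b] a b d by (intro mult_mono add_mono powr_mono2') auto
  finally show ?thesis by (simp add: mult.commute)
qed

text \<open>Within distance 1 the tail is bounded and the near kernel, of mass 4 pi, takes the pole;
  beyond, the tail decays like pi / r^2 and the cube of the inverse distance has mass 2 pi.\<close>

lemma kernel_tail_over_norm_bound:
  fixes x :: complex
  assumes \<epsilon>: "\<epsilon> > 0"
  shows "(\<integral>\<^sup>+w. ennreal (kernel_tail \<epsilon> (norm (x - w)) / norm (x - w)) \<partial>lborel) \<le> ennreal (pi / \<epsilon>\<^sup>2 * (4 * pi) + pi * (2 * pi))"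
proof -
  have far: "(\<integral>\<^sup>+z. ennreal (if norm (z::complex) \<ge> 1 then norm z powr (-3) else 0) \<partial>lborel) = ennreal (2 * pi)"
    using has_bochner_integral_norm_powr_outside[of 3 1]
    by (intro nn_integral_eq_has_bochner_integral) auto
  have near: "(\<integral>\<^sup>+z. ennreal (near_kernel z) \<partial>lborel) = ennreal (4 * pi)"
    using nn_integral_near_kernel[of 0] nn_integral_complex_reflect[of "\<lambda>z. ennreal (near_kernel z)" 0] by simp
  have "(\<integral>\<^sup>+w. ennreal (kernel_tail \<epsilon> (norm (x - w)) / norm (x - w)) \<partial>lborel)
      = (\<integral>\<^sup>+w. ennreal (kernel_tail \<epsilon> (norm (w::complex)) / norm w) \<partial>lborel)"
    by (rule nn_integral_complex_reflect[of "\<lambda>w. ennreal (kernel_tail \<epsilon> (norm w) / norm w)" x]) measurable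
  also have "\<dots> \<le> (\<integral>\<^sup>+w. ennreal (pi / \<epsilon>\<^sup>2) * ennreal (near_kernel w) + ennreal pi * ennreal (if norm w \<ge> 1 then norm w powr (-3) else 0) \<partial>lborel)"
  proof (rule nn_integral_mono)
    fix w :: complex
    have "kernel_tail \<epsilon> (norm w) / norm w \<le> pi / \<epsilon>\<^sup>2 * near_kernel w + pi * (if norm w \<ge> 1 then norm w powr (-3) else 0)"
    proof (cases "norm w \<ge> 1")
      case True
      have w0: "norm w > 0" using True by linarith
      have "kernel_tail \<epsilon> (norm w) / norm w \<le> pi / (norm w)\<^sup>2 / norm w"
        using kernel_tail_le2[OF w0] by (intro divide_right_mono) auto
      also have "\<dots> = pi * norm w powr (-3)"
      proof -
        have "norm w powr (-3) = 1 / norm w ^ 3"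
          using powr_minus[of "norm w" 3] w0 by (simp only: powr_numeral inverse_eq_divide)
        then show ?thesis by (simp only:) (simp add: power2_eq_square power3_eq_cube)
      qed
      finally show ?thesis using True \<epsilon> near_kernel_nonneg[of w] by (simp add: add_increasing)
    next
      case False
      have "1 / norm w \<le> near_kernel w"
      proof (cases "w = 0")
        case False
        then have "norm w powr (-1) \<le> norm w powr (- (3/2))"
          using \<open>\<not> norm w \<ge> 1\<close> by (intro powr_mono') auto
        then show ?thesis using False \<open>\<not> norm w \<ge> 1\<close> by (simp add: powr_minus_divide near_kernel_def)
      qed (simp add: near_kernel_def)
      then have "kernel_tail \<epsilon> (norm w) * (1 / norm w) \<le> pi / \<epsilon>\<^sup>2 * near_kernel w"
        using kernel_tail_le[OF \<epsilon>] by (intro mult_mono) (use \<epsilon> in auto)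
      then show ?thesis using False by simp
    qed
    then have "ennreal (kernel_tail \<epsilon> (norm w) / norm w) \<le> ennreal (pi / \<epsilon>\<^sup>2 * near_kernel w + pi * (if norm w \<ge> 1 then norm w powr (-3) else 0))"
      by (rule ennreal_leI)
    also have "\<dots> = ennreal (pi / \<epsilon>\<^sup>2) * ennreal (near_kernel w) + ennreal pi * ennreal (if norm w \<ge> 1 then norm w powr (-3) else 0)"
    proof -
      have "ennreal (pi / \<epsilon>\<^sup>2) * ennreal (near_kernel w) = ennreal (pi / \<epsilon>\<^sup>2 * near_kernel w)"
        by (rule ennreal_mult[symmetric]) (use \<epsilon> near_kernel_nonneg in auto)
      moreover have "ennreal pi * ennreal (if norm w \<ge> 1 then norm w powr (-3) else 0) = ennreal (pi * (if norm w \<ge> 1 then norm w powr (-3) else 0))"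
        by (rule ennreal_mult[symmetric]) auto
      ultimately show ?thesis
        using \<epsilon> near_kernel_nonneg by (simp only:) (rule ennreal_plus, auto)
    qed
    finally show "ennreal (kernel_tail \<epsilon> (norm w) / norm w) \<le> ennreal (pi / \<epsilon>\<^sup>2) * ennreal (near_kernel w) + ennreal pi * ennreal (if norm w \<ge> 1 then norm w powr (-3) else 0)" .
  qed
  also have "\<dots> = ennreal (pi / \<epsilon>\<^sup>2) * ennreal (4 * pi) + ennreal pi * ennreal (2 * pi)"
    by (subst nn_integral_add, measurable, subst (1 2) nn_integral_cmult, measurable) (simp only: near far)
  also have "\<dots> = ennreal (pi / \<epsilon>\<^sup>2 * (4 * pi) + pi * (2 * pi))"
  proof -
    have "ennreal (pi / \<epsilon>\<^sup>2) * ennreal (4 * pi) = ennreal (pi / \<epsilon>\<^sup>2 * (4 * pi))"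
      by (rule ennreal_mult[symmetric]) auto
    moreover have "ennreal pi * ennreal (2 * pi) = ennreal (pi * (2 * pi))"
      by (rule ennreal_mult[symmetric]) auto
    ultimately show ?thesis by (simp only:) (rule ennreal_plus[symmetric], auto)
  qed
  finally show ?thesis .
qed

text \<open>This is the absolute bound behind Fubini for the second point. It must blow up as
  \<open>x\<close> approaches \<open>y\<close>, but only with the power -1/2, which is still
  integrable when \<open>y\<close> runs along a regular curve.\<close>

lemma kernel_tail_product_bound:
  fixes x y :: complex
  assumes \<epsilon>: "\<epsilon> > 0" and xy: "x \<noteq> y"
  shows "(\<integral>\<^sup>+w. ennreal (kernel_tail \<epsilon> (norm (x - w)) / (norm (x - w) * norm (y - w))) \<partial>lborel)
     \<le> ennreal (pi / \<epsilon>\<^sup>2 * (4 * pi) + pi * (2 * pi)) + ennreal (pi / \<epsilon>\<^sup>2 * (12 * pi)) * ennreal (norm (x - y) powr (- (1/2)))"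
proof -
  define D where "D = norm (x - y) powr (- (1/2))"
  define P where "P = pi / \<epsilon>\<^sup>2"
  have DP: "D \<ge> 0" "P \<ge> 0" using \<epsilon> by (auto simp: D_def P_def)
  have "(\<integral>\<^sup>+w. ennreal (kernel_tail \<epsilon> (norm (x - w)) / (norm (x - w) * norm (y - w))) \<partial>lborel)
    \<le> (\<integral>\<^sup>+w. ennreal (kernel_tail \<epsilon> (norm (x - w)) / norm (x - w)) + (ennreal (P * D) * ennreal (near_kernel (x - w)) + ennreal (2 * P * D) * ennreal (near_kernel (y - w))) \<partial>lborel)"
  proof (rule nn_integral_mono)
    fix w :: complex
    define a b where "a = norm (x - w)" and "b = norm (y - w)"
    have k: "0 \<le> kernel_tail \<epsilon> a" "kernel_tail \<epsilon> a \<le> P" using kernel_tail_nonneg kernel_tail_le[OF \<epsilon>] by (auto simp: P_def)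
    have n: "0 \<le> near_kernel (x - w)" "0 \<le> near_kernel (y - w)" by (auto simp: near_kernel_nonneg)
    have rest: "0 \<le> P * D * near_kernel (x - w) + 2 * P * D * near_kernel (y - w)" using DP n by auto
    have ka: "0 \<le> kernel_tail \<epsilon> a / a" using k by (simp add: a_def)
    have "kernel_tail \<epsilon> a / (a * b) \<le> kernel_tail \<epsilon> a / a + (P * D * near_kernel (x - w) + 2 * P * D * near_kernel (y - w))"
    proof (cases "a = 0 \<or> b = 0")
      case True
      then have "kernel_tail \<epsilon> a / (a * b) = 0" by auto
      then show ?thesis using rest ka by linarith
    next
      case False
      then have ab: "a > 0" "b > 0" by (auto simp: a_def b_def)
      show ?thesis
      proof (cases "b \<ge> 1")
        case True
        have "kernel_tail \<epsilon> a / (a * b) \<le> kernel_tail \<epsilon> a / a"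
          using ab k True by (intro divide_left_mono) auto
        then show ?thesis using rest by linarith
      next
        case False
        then have b1: "b < 1" by simp
        have tri: "norm (x - y) \<le> a + b"
          using norm_triangle_ineq4[of "x - w" "y - w"] by (simp add: a_def b_def)
        have "1 / (a * b) \<le> D * (a powr (- (3/2)) + b powr (- (3/2)))"
          unfolding D_def by (rule inverse_product_bound) (use ab xy tri in auto)
        also have "\<dots> \<le> D * (near_kernel (x - w) + 2 * near_kernel (y - w))"
        proof (rule mult_left_mono[OF _ DP(1)])
          have nb: "near_kernel (y - w) = b powr (- (3/2))" using b1 by (simp add: near_kernel_def b_def)
          \<comment> \<open>As \<open>b < 1\<close>, this term is at least 1 and pays for the case
            \<open>a > 1\<close>, where the near kernel at \<open>x\<close> vanishes. This explains
            the factor 2.\<close>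
          have b1': "1 \<le> b powr (- (3/2))" using powr_mono'[of "- (3/2)" 0 b] b1 ab by simp
          have "a powr (- (3/2)) \<le> near_kernel (x - w) + 1"
          proof (cases "a \<le> 1")
            case False
            then have "a powr (- (3/2)) \<le> 1" using powr_mono[of "- (3/2)" 0 a] by simp
            then show ?thesis using n by linarith
          qed (simp add: near_kernel_def a_def)
          then show "a powr (- (3/2)) + b powr (- (3/2)) \<le> near_kernel (x - w) + 2 * near_kernel (y - w)"
            using b1' unfolding nb by linarith
        qed
        finally have "kernel_tail \<epsilon> a * (1 / (a * b)) \<le> P * (D * (near_kernel (x - w) + 2 * near_kernel (y - w)))"
          using k DP n ab by (intro mult_mono) auto
        then show ?thesis using ka by (simp add: algebra_simps)
      qed
    qed
    then have "ennreal (kernel_tail \<epsilon> a / (a * b)) \<le> ennreal (kernel_tail \<epsilon> a / a + (P * D * near_kernel (x - w) + 2 * P * D * near_kernel (y - w)))"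
      by (rule ennreal_leI)
    also have "\<dots> = ennreal (kernel_tail \<epsilon> a / a) + (ennreal (P * D) * ennreal (near_kernel (x - w)) + ennreal (2 * P * D) * ennreal (near_kernel (y - w)))"
      using ka rest DP n by (simp add: ennreal_plus ennreal_mult[symmetric] del: ennreal_plus) (simp add: ennreal_plus[symmetric] ennreal_mult[symmetric] del: ennreal_plus)
    finally show "ennreal (kernel_tail \<epsilon> (norm (x - w)) / (norm (x - w) * norm (y - w))) \<le>
       ennreal (kernel_tail \<epsilon> (norm (x - w)) / norm (x - w)) + (ennreal (P * D) * ennreal (near_kernel (x - w)) + ennreal (2 * P * D) * ennreal (near_kernel (y - w)))"
      by (simp add: a_def b_def)
  qed
  also have "\<dots> = (\<integral>\<^sup>+w. ennreal (kernel_tail \<epsilon> (norm (x - w)) / norm (x - w)) \<partial>lborel) + (ennreal (P * D) * ennreal (4 * pi) + ennreal (2 * P * D) * ennreal (4 * pi))"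
    by (subst nn_integral_add, measurable, subst nn_integral_add, measurable, subst (1 2) nn_integral_cmult, measurable) (simp add: nn_integral_near_kernel)
  also have "ennreal (P * D) * ennreal (4 * pi) + ennreal (2 * P * D) * ennreal (4 * pi) = ennreal (P * (12 * pi)) * ennreal D"
    using DP by (simp add: ennreal_mult[symmetric] ennreal_plus[symmetric] algebra_simps del: ennreal_plus)
  finally show ?thesis
    using kernel_tail_over_norm_bound[OF \<epsilon>, of x] unfolding D_def P_def by (meson add_right_mono order_trans)
qed

text \<open>The indicator of \<open>A\<close> is written as the conjugate of its Cauchy integral.
  The pole in \<open>cnj w\<close>, paired with the pole of 1 / (x - w), then gives precisely the
  situation of \<open>integral_radial_Cauchy_kernel2\<close> in v = x - w, d = x - \<alpha> t, and
  the answer is a real radial function of \<open>d\<close>. Conjugating 2 pi i produces the minus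
  sign.\<close>

lemma integral_kernel_tail_inside_loop:
  assumes \<alpha>: "C1_loop \<alpha> \<alpha>'" and enc: "encloses n \<alpha> \<alpha>' A" and n: "\<bar>n\<bar> = 1" and \<epsilon>: "\<epsilon> > 0"
    and neq: "AE t in unit_interval. \<alpha> t \<noteq> x"
    and fin: "(\<integral>\<^sup>+t. ennreal (norm (x - \<alpha> t) powr (- (1/2))) \<partial>unit_interval) < \<infinity>"
  shows "(\<integral>w. indicator A w * of_real (kernel_tail \<epsilon> (norm (x - w))) / (x - w) \<partial>lborel)
     = - (\<integral>t. cnj (\<alpha>' t) * of_real (log_kernel \<epsilon> (norm (x - \<alpha> t))) \<partial>unit_interval) / (two_pi_i * of_real n)"
proof -
  note [measurable] = C1_loop_measurable[OF \<alpha>]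
  have [measurable]: "A \<in> sets borel" using enc by (simp add: encloses_def)
  obtain M where M: "M > 0" "\<And>t. t \<in> {0..1} \<Longrightarrow> norm (\<alpha>' t) \<le> M" using C1_loop_bounded[OF \<alpha>] by blast
  define \<phi> where "\<phi> = (\<lambda>w. kernel_tail \<epsilon> (norm (x - w)))"
  have [measurable]: "\<phi> \<in> borel_measurable borel" unfolding \<phi>_def by measurable
  have \<phi>0: "0 \<le> \<phi> w" for w by (simp add: \<phi>_def kernel_tail_nonneg)
  define C1 where "C1 = pi / \<epsilon>\<^sup>2 * (4 * pi) + pi * (2 * pi)"
  define C2 where "C2 = pi / \<epsilon>\<^sup>2 * (12 * pi)"
  define H where "H = (\<lambda>t w. cnj (\<alpha>' t) / (cnj (\<alpha> t) - cnj w) * (of_real (\<phi> w) / (x - w)))"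
  have [measurable]: "case_prod H \<in> borel_measurable (unit_interval \<Otimes>\<^sub>M lborel)"
    unfolding H_def by measurable
  have normH: "norm (H t w) = norm (\<alpha>' t) * (\<phi> w / (norm (x - w) * norm (\<alpha> t - w)))" for t w
  proof -
    have "norm (cnj (\<alpha> t) - cnj w) = norm (\<alpha> t - w)" by (metis complex_cnj_diff complex_mod_cnj)
    then show ?thesis using \<phi>0[of w] by (simp add: H_def norm_mult norm_divide)
  qed
  have bound: "(\<integral>\<^sup>+w. ennreal (norm (H t w)) \<partial>lborel) \<le> ennreal M * (ennreal C1 + ennreal C2 * ennreal (norm (x - \<alpha> t) powr (- (1/2))))"
    if t: "t \<in> {0..1}" "\<alpha> t \<noteq> x" for t
  proof -
    have "(\<integral>\<^sup>+w. ennreal (norm (H t w)) \<partial>lborel) \<le> (\<integral>\<^sup>+w. ennreal M * ennreal (\<phi> w / (norm (x - w) * norm (\<alpha> t - w))) \<partial>lborel)"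
      unfolding normH using M t \<phi>0 by (intro nn_integral_mono) (auto simp: ennreal_mult[symmetric] intro!: ennreal_leI divide_right_mono mult_right_mono)
    also have "\<dots> = ennreal M * (\<integral>\<^sup>+w. ennreal (\<phi> w / (norm (x - w) * norm (\<alpha> t - w))) \<partial>lborel)"
      by (rule nn_integral_cmult) measurable
    also have "\<dots> \<le> ennreal M * (ennreal C1 + ennreal C2 * ennreal (norm (x - \<alpha> t) powr (- (1/2))))"
      using kernel_tail_product_bound[OF \<epsilon>, of x "\<alpha> t"] t unfolding \<phi>_def C1_def C2_def by (intro mult_left_mono) auto
    finally show ?thesis .
  qed
  have int: "integrable (unit_interval \<Otimes>\<^sub>M lborel) (case_prod H)"
  proof (rule integrable_unit_plane)
    show "AE t in unit_interval. (\<integral>\<^sup>+w. ennreal (norm (H t w)) \<partial>lborel) \<le> ennreal M * (ennreal C1 + ennreal C2 * ennreal (norm (x - \<alpha> t) powr (- (1/2))))"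
      using neq AE_space by eventually_elim (use bound in auto)
    show "(\<integral>\<^sup>+t. ennreal M * (ennreal C1 + ennreal C2 * ennreal (norm (x - \<alpha> t) powr (- (1/2)))) \<partial>unit_interval) < \<infinity>"
      using fin by (simp add: nn_integral_cmult nn_integral_add ennreal_mult_less_top emeasure_restrict_space)
  qed measurable
  have inner1: "(\<integral>w. H t w \<partial>lborel) = cnj (\<alpha>' t) * of_real (log_kernel \<epsilon> (norm (x - \<alpha> t)))"
    if t: "t \<in> {0..1}" "\<alpha> t \<noteq> x" for t
  proof -
    define d where "d = x - \<alpha> t"
    have d: "d \<noteq> 0" using t by (auto simp: d_def)
    define F where "F = (\<lambda>v. of_real (kernel_tail \<epsilon> (norm v)) / (v * (cnj v - cnj d)))"
    have Fm[measurable]: "F \<in> borel_measurable borel" unfolding F_def by measurable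
    have HF: "H t w = cnj (\<alpha>' t) * F (x - w)" for w
    proof -
      have "cnj (x - w) - cnj d = cnj (\<alpha> t) - cnj w" by (simp add: d_def)
      then show ?thesis by (simp add: H_def F_def \<phi>_def mult.commute)
    qed
    have "(\<integral>\<^sup>+v. ennreal (norm (F v)) \<partial>lborel) = (\<integral>\<^sup>+w. ennreal (norm (F (x - w))) \<partial>lborel)"
      by (rule nn_integral_complex_reflect[symmetric]) measurable
    also have "\<dots> = (\<integral>\<^sup>+w. ennreal (\<phi> w / (norm (x - w) * norm (\<alpha> t - w))) \<partial>lborel)"
    proof (rule nn_integral_cong)
      fix w
      have "cnj (x - w) - cnj d = cnj (\<alpha> t - w)" by (simp add: d_def)
      then have "norm (cnj (x - w) - cnj d) = norm (\<alpha> t - w)" by (metis complex_mod_cnj)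
      then show "ennreal (norm (F (x - w))) = ennreal (\<phi> w / (norm (x - w) * norm (\<alpha> t - w)))"
        using \<phi>0[of w] by (simp add: F_def norm_mult norm_divide \<phi>_def kernel_tail_nonneg)
    qed
    also have "\<dots> \<le> ennreal C1 + ennreal C2 * ennreal (norm (x - \<alpha> t) powr (- (1/2)))"
      using kernel_tail_product_bound[OF \<epsilon>, of x "\<alpha> t"] t unfolding \<phi>_def C1_def C2_def by auto
    also have "\<dots> < \<infinity>" by (simp add: ennreal_mult_less_top)
    finally have Fint: "integrable lborel F" by (intro integrableI_bounded) auto
    have "(\<integral>w. H t w \<partial>lborel) = cnj (\<alpha>' t) * (\<integral>w. F (x - w) \<partial>lborel)"
      unfolding HF by (rule integral_mult_right_zero)
    also have "(\<integral>w. F (x - w) \<partial>lborel) = (\<integral>v. F v \<partial>lborel)" by (rule integral_complex_reflect) measurable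
    also have "\<dots> = of_real (\<integral>v. (if norm (v::complex) > norm d then kernel_tail \<epsilon> (norm v) / (norm v)\<^sup>2 else 0) \<partial>lborel)"
      unfolding F_def by (rule integral_radial_Cauchy_kernel2) (use d Fint in \<open>auto simp: F_def\<close>)
    also have "(\<integral>v. (if norm (v::complex) > norm d then kernel_tail \<epsilon> (norm v) / (norm v)\<^sup>2 else 0) \<partial>lborel) = log_kernel \<epsilon> (norm d)"
      by (rule has_bochner_integral_integral_eq[OF has_bochner_integral_log_kernel[OF \<epsilon>]]) (use d in auto)
    finally show ?thesis by (simp add: d_def)
  qed
  have inner2: "AE w in lborel. (\<integral>t. H t w \<partial>unit_interval) = - (two_pi_i * of_real n) * (indicator A w * of_real (\<phi> w) / (x - w))"
  proof -
    have "AE z in lborel. z \<notin> \<alpha> ` {0..1} \<and>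
       ((\<lambda>t. \<alpha>' t / (\<alpha> t - z)) has_integral two_pi_i * of_real n * indicator A z) {0..1}"
      using enc by (simp add: encloses_def)
    then show ?thesis
    proof eventually_elim
      case (elim z)
      then have I: "(\<integral>t. \<alpha>' t / (\<alpha> t - z) \<partial>unit_interval) = two_pi_i * of_real n * indicator A z"
        using AE_circle_integral_encloses(2)[OF \<alpha>] by blast
      have "(\<integral>t. H t z \<partial>unit_interval) = (\<integral>t. (of_real (\<phi> z) / (x - z)) * cnj (\<alpha>' t / (\<alpha> t - z)) \<partial>unit_interval)"
        unfolding H_def by (intro Bochner_Integration.integral_cong) (auto simp: mult.commute)
      also have "\<dots> = (of_real (\<phi> z) / (x - z)) * (\<integral>t. cnj (\<alpha>' t / (\<alpha> t - z)) \<partial>unit_interval)" by (rule integral_mult_right_zero)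
      also have "(\<integral>t. cnj (\<alpha>' t / (\<alpha> t - z)) \<partial>unit_interval) = cnj (\<integral>t. \<alpha>' t / (\<alpha> t - z) \<partial>unit_interval)"
        by (rule integral_bounded_linear[OF bounded_linear_cnj])
          (use elim AE_circle_integral_encloses(1)[OF \<alpha>] in blast)
      finally show ?case unfolding I by (simp add: indicator_def)
    qed
  qed
  have n0: "2 * complex_of_real pi * \<i> * complex_of_real n \<noteq> 0" using n by auto
  have "- (two_pi_i * of_real n) * (\<integral>w. indicator A w * of_real (\<phi> w) / (x - w) \<partial>lborel)
      = (\<integral>w. - (two_pi_i * of_real n) * (indicator A w * of_real (\<phi> w) / (x - w)) \<partial>lborel)"
    by (rule integral_mult_right_zero[symmetric])
  also have "\<dots> = (\<integral>w. (\<integral>t. H t w \<partial>unit_interval) \<partial>lborel)"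
    using inner2 by (intro integral_cong_AE) auto
  also have "\<dots> = (\<integral>t. (\<integral>w. H t w \<partial>lborel) \<partial>unit_interval)"
    using unit_plane.Fubini_integral[OF int] .
  also have "\<dots> = (\<integral>t. cnj (\<alpha>' t) * of_real (log_kernel \<epsilon> (norm (x - \<alpha> t))) \<partial>unit_interval)"
    by (rule integral_cong_AE) (measurable, use neq AE_space in eventually_elim, use inner1 in auto)
  finally have eq: "- (two_pi_i * of_real n) * (\<integral>w. indicator A w * of_real (\<phi> w) / (x - w) \<partial>lborel)
     = (\<integral>t. cnj (\<alpha>' t) * of_real (log_kernel \<epsilon> (norm (x - \<alpha> t))) \<partial>unit_interval)" .
  have alg: "J * c = - X" if "- c * J = X" for c J X :: complex
    using that by (metis minus_mult_left minus_minus mult.commute)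
  have "(\<integral>w. indicator A w * of_real (\<phi> w) / (x - w) \<partial>lborel) * (two_pi_i * of_real n)
     = - (\<integral>t. cnj (\<alpha>' t) * of_real (log_kernel \<epsilon> (norm (x - \<alpha> t))) \<partial>unit_interval)"
    by (rule alg[OF eq])
  then show ?thesis unfolding \<phi>_def by (rule eq_divide_imp[OF n0])
qed

abbreviation plane_pairs :: "(complex \<times> complex) measure" where
  "plane_pairs \<equiv> lborel \<Otimes>\<^sub>M lborel"

abbreviation cut_kernel :: "complex set \<Rightarrow> complex set \<Rightarrow> real \<Rightarrow> complex \<times> complex \<Rightarrow> real" where
  "cut_kernel A B \<epsilon> \<equiv> \<lambda>(w, z). indicator A w * (indicator B z * trunc_kernel \<epsilon> (norm (z - w)))"

text \<open>A double Green formula: both regions enter only through winding numbers.\<close>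

lemma trunc_kernel_double_loop:
  assumes \<alpha>: "C1_loop \<alpha> \<alpha>'" "encloses n \<alpha> \<alpha>' A" and \<beta>: "C1_loop \<beta> \<beta>'" "encloses n \<beta> \<beta>' B"
    and AB: "A \<subseteq> B" and n: "\<bar>n\<bar> = 1" and \<epsilon>: "\<epsilon> > 0"
    and neq: "\<And>s. s \<in> {0..1} \<Longrightarrow> AE t in unit_interval. \<alpha> t \<noteq> \<beta> s"
    and fin: "\<And>s. s \<in> {0..1} \<Longrightarrow> (\<integral>\<^sup>+t. ennreal (norm (\<beta> s - \<alpha> t) powr (- (1/2))) \<partial>unit_interval) < \<infinity>"
  shows "integrable plane_pairs (cut_kernel A (- B) \<epsilon>)" (is "integrable _ ?F")
    and "of_real (integral\<^sup>L plane_pairs (cut_kernel A (- B) \<epsilon>))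
      = (\<integral>s. \<beta>' s * (\<integral>t. cnj (\<alpha>' t) * of_real (log_kernel \<epsilon> (norm (\<beta> s - \<alpha> t))) \<partial>unit_interval) \<partial>unit_interval) / (4 * of_real pi ^ 2)"
proof -
  note [measurable] = C1_loop_measurable[OF \<alpha>(1)] C1_loop_measurable[OF \<beta>(1)]
  have [measurable]: "A \<in> sets borel" "B \<in> sets borel" using \<alpha> \<beta> by (auto simp: encloses_def)
  have Afin: "emeasure lborel A < \<infinity>"
    using \<alpha>(2) by (intro emeasure_bounded_finite) (auto simp: encloses_def)
  obtain M where M: "M > 0" "\<And>t. t \<in> {0..1} \<Longrightarrow> norm (\<beta>' t) \<le> M" using C1_loop_bounded[OF \<beta>(1)] by blast
  have [measurable]: "?F \<in> borel_measurable plane_pairs" by measurable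
  show Fint: "integrable plane_pairs ?F"
  proof (rule integrableI_bounded)
    have "(\<integral>\<^sup>+p. ennreal (norm (?F p)) \<partial>plane_pairs) = (\<integral>\<^sup>+w. (\<integral>\<^sup>+z. ennreal (norm (?F (w, z))) \<partial>lborel) \<partial>lborel)"
      by (subst lborel.nn_integral_fst[symmetric]) auto
    also have "\<dots> \<le> (\<integral>\<^sup>+w. ennreal (pi / \<epsilon>\<^sup>2) * indicator A w \<partial>lborel)"
    proof (rule nn_integral_mono)
      fix w
      have "(\<integral>\<^sup>+z. ennreal (norm (?F (w, z))) \<partial>lborel) \<le> (\<integral>\<^sup>+z. indicator A w * ennreal (trunc_kernel \<epsilon> (norm (z - w))) \<partial>lborel)"
        using trunc_kernel_nonneg[OF \<epsilon>] by (intro nn_integral_mono) (auto simp: indicator_def)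
      also have "\<dots> = ennreal (pi / \<epsilon>\<^sup>2) * indicator A w"
        by (subst nn_integral_cmult) (auto simp: nn_integral_trunc_kernel[OF \<epsilon>] mult.commute)
      finally show "(\<integral>\<^sup>+z. ennreal (norm (?F (w, z))) \<partial>lborel) \<le> ennreal (pi / \<epsilon>\<^sup>2) * indicator A w" .
    qed
    also have "\<dots> = ennreal (pi / \<epsilon>\<^sup>2) * emeasure lborel A" by (simp add: nn_integral_cmult)
    also have "\<dots> < \<infinity>" using Afin by (simp add: ennreal_mult_less_top)
    finally show "(\<integral>\<^sup>+p. ennreal (norm (?F p)) \<partial>plane_pairs) < \<infinity>" .
  qed measurable
  define c where "c = two_pi_i * complex_of_real n"
  have n2: "n * n = 1" using n by (metis abs_mult_self_eq mult.right_neutral)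
  \<comment> \<open>The normalizations of the two Cauchy integrals multiply to -4 pi^2; the minus
    sign is undone by the one from the conjugated integral.\<close>
  have c2: "c * c = - (4 * of_real pi ^ 2)"
  proof -
    have "c * c = - (4 * of_real pi ^ 2) * of_real (n * n)" by (simp add: c_def power2_eq_square)
    then show ?thesis by (simp add: n2)
  qed
  define H where "H = (\<lambda>s w. \<beta>' s * (indicator A w * of_real (kernel_tail \<epsilon> (norm (\<beta> s - w))) / (\<beta> s - w)))"
  have [measurable]: "case_prod H \<in> borel_measurable (unit_interval \<Otimes>\<^sub>M lborel)"
    unfolding H_def by measurable
  define C where "C = pi / \<epsilon>\<^sup>2 * (4 * pi) + pi * (2 * pi)"
  have int: "integrable (unit_interval \<Otimes>\<^sub>M lborel) (case_prod H)"
  proof (rule integrable_unit_plane[where f = "\<lambda>_. ennreal M * ennreal C", OF _ _ AE_I2])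
    fix s :: real assume "s \<in> space unit_interval"
    then have s: "s \<in> {0..1}" by simp
    have "(\<integral>\<^sup>+w. ennreal (norm (H s w)) \<partial>lborel) \<le> (\<integral>\<^sup>+w. ennreal M * ennreal (kernel_tail \<epsilon> (norm (\<beta> s - w)) / norm (\<beta> s - w)) \<partial>lborel)"
    proof (rule nn_integral_mono)
      fix w
      have "norm (H s w) \<le> M * (kernel_tail \<epsilon> (norm (\<beta> s - w)) / norm (\<beta> s - w))"
        unfolding H_def norm_mult using M(2)[OF s] M(1)
        by (intro mult_mono) (auto simp: indicator_def norm_divide kernel_tail_nonneg)
      then show "ennreal (norm (H s w)) \<le> ennreal M * ennreal (kernel_tail \<epsilon> (norm (\<beta> s - w)) / norm (\<beta> s - w))"
        using M(1) kernel_tail_nonneg by (simp add: ennreal_mult[symmetric] ennreal_leI)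
    qed
    also have "\<dots> = ennreal M * (\<integral>\<^sup>+w. ennreal (kernel_tail \<epsilon> (norm (\<beta> s - w)) / norm (\<beta> s - w)) \<partial>lborel)"
      by (rule nn_integral_cmult) measurable
    also have "\<dots> \<le> ennreal M * ennreal C"
      unfolding C_def by (intro mult_left_mono kernel_tail_over_norm_bound[OF \<epsilon>]) auto
    finally show "(\<integral>\<^sup>+w. ennreal (norm (H s w)) \<partial>lborel) \<le> ennreal M * ennreal C" .
  qed (simp_all add: emeasure_restrict_space ennreal_mult_less_top)
  have inner: "AE w in lborel. complex_of_real (\<integral>z. ?F (w, z) \<partial>lborel) = (\<integral>s. H s w \<partial>unit_interval) / c"
  proof -
    have "AE w in lborel. w \<notin> \<beta> ` {0..1} \<and>
       ((\<lambda>t. \<beta>' t / (\<beta> t - w)) has_integral two_pi_i * of_real n * indicator B w) {0..1}"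
      using \<beta>(2) by (simp add: encloses_def)
    then show ?thesis
    proof eventually_elim
      case (elim w)
      show ?case
      proof (cases "w \<in> A")
        case True
        then have "w \<in> B" using AB by auto
        have "complex_of_real (\<integral>z. ?F (w, z) \<partial>lborel) = of_real (\<integral>z. indicator (- B) z * trunc_kernel \<epsilon> (norm (z - w)) \<partial>lborel)"
          using True by simp
        also have "\<dots> = (\<integral>s. \<beta>' s * of_real (kernel_tail \<epsilon> (norm (\<beta> s - w))) / (\<beta> s - w) \<partial>unit_interval) / c"
          unfolding c_def by (rule integral_trunc_kernel_outside_loop[OF \<beta> n \<epsilon>]) (use elim \<open>w \<in> B\<close> in auto)
        finally show ?thesis using True by (simp add: H_def)
      qed (simp add: H_def)
    qed
  qed
  have "of_real (\<integral>p. ?F p \<partial>plane_pairs) = complex_of_real (\<integral>w. (\<integral>z. ?F (w, z) \<partial>lborel) \<partial>lborel)"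
    using lborel_pair.integral_fst'[OF Fint] by simp
  also have "\<dots> = (\<integral>w. complex_of_real (\<integral>z. ?F (w, z) \<partial>lborel) \<partial>lborel)" by (rule integral_complex_of_real[symmetric])
  also have "\<dots> = (\<integral>w. (\<integral>s. H s w \<partial>unit_interval) / c \<partial>lborel)"
    by (rule integral_cong_AE) (measurable, use inner in auto)
  also have "\<dots> = (\<integral>w. (\<integral>s. H s w \<partial>unit_interval) \<partial>lborel) / c" by (rule integral_divide_zero)
  also have "(\<integral>w. (\<integral>s. H s w \<partial>unit_interval) \<partial>lborel) = (\<integral>s. (\<integral>w. H s w \<partial>lborel) \<partial>unit_interval)"
    using unit_plane.Fubini_integral[OF int] .
  also have "\<dots> = (\<integral>s. \<beta>' s * (\<integral>t. cnj (\<alpha>' t) * of_real (log_kernel \<epsilon> (norm (\<beta> s - \<alpha> t))) \<partial>unit_interval) * (- 1 / c) \<partial>unit_interval)"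
  proof (rule Bochner_Integration.integral_cong[OF refl])
    fix s assume "s \<in> space unit_interval"
    then have s: "s \<in> {0..1}" by simp
    have "(\<integral>w. H s w \<partial>lborel) = \<beta>' s * (\<integral>w. indicator A w * of_real (kernel_tail \<epsilon> (norm (\<beta> s - w))) / (\<beta> s - w) \<partial>lborel)"
      unfolding H_def by (rule integral_mult_right_zero)
    also have "(\<integral>w. indicator A w * of_real (kernel_tail \<epsilon> (norm (\<beta> s - w))) / (\<beta> s - w) \<partial>lborel)
       = - (\<integral>t. cnj (\<alpha>' t) * of_real (log_kernel \<epsilon> (norm (\<beta> s - \<alpha> t))) \<partial>unit_interval) / c"
      unfolding c_def by (rule integral_kernel_tail_inside_loop[OF \<alpha> n \<epsilon> neq[OF s] fin[OF s]])
    finally show "(\<integral>w. H s w \<partial>lborel) = \<beta>' s * (\<integral>t. cnj (\<alpha>' t) * of_real (log_kernel \<epsilon> (norm (\<beta> s - \<alpha> t))) \<partial>unit_interval) * (- 1 / c)"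
      by simp
  qed
  also have "\<dots> / c = (\<integral>s. \<beta>' s * (\<integral>t. cnj (\<alpha>' t) * of_real (log_kernel \<epsilon> (norm (\<beta> s - \<alpha> t))) \<partial>unit_interval) \<partial>unit_interval) * (- 1 / (c * c))"
    by (simp only: integral_mult_left_zero) simp
  also have "- 1 / (c * c) = 1 / (4 * of_real pi ^ 2)" unfolding c2 by simp
  finally show "of_real (\<integral>p. ?F p \<partial>plane_pairs)
      = (\<integral>s. \<beta>' s * (\<integral>t. cnj (\<alpha>' t) * of_real (log_kernel \<epsilon> (norm (\<beta> s - \<alpha> t))) \<partial>unit_interval) \<partial>unit_interval) / (4 * of_real pi ^ 2)"
    by simp
qed

text \<open>Beyond the cutoff the log kernel is pi^2 / r^2, so only 1/4 of the inverse squared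
  distance remains. In this form the formula is applied to the curve and one of its parallel
  curves.\<close>

lemma trunc_kernel_far_loops:
  assumes \<alpha>: "C1_loop \<alpha> \<alpha>'" "encloses n \<alpha> \<alpha>' A" and \<beta>: "C1_loop \<beta> \<beta>'" "encloses n \<beta> \<beta>' B"
    and AB: "A \<subseteq> B" and n: "\<bar>n\<bar> = 1" and \<epsilon>: "\<epsilon> > 0" and far: "\<And>s t. \<epsilon> < norm (\<beta> s - \<alpha> t)"
  shows "integrable plane_pairs (cut_kernel A (- B) \<epsilon>)"
    and "of_real (integral\<^sup>L plane_pairs (cut_kernel A (- B) \<epsilon>))
      = (\<integral>s. (\<integral>t. \<beta>' s * cnj (\<alpha>' t) / of_real ((norm (\<beta> s - \<alpha> t))\<^sup>2) \<partial>unit_interval) \<partial>unit_interval) / 4"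
proof -
  note [measurable] = C1_loop_measurable[OF \<alpha>(1)]
  have neq: "AE t in unit_interval. \<alpha> t \<noteq> \<beta> s" for s
  proof (intro AE_I2)
    fix t show "\<alpha> t \<noteq> \<beta> s" using far[of s t] \<epsilon> by auto
  qed
  have fin: "(\<integral>\<^sup>+t. ennreal (norm (\<beta> s - \<alpha> t) powr (- (1/2))) \<partial>unit_interval) < \<infinity>" for s
  proof -
    have "(\<integral>\<^sup>+t. ennreal (norm (\<beta> s - \<alpha> t) powr (- (1/2))) \<partial>unit_interval) \<le> (\<integral>\<^sup>+t. ennreal (\<epsilon> powr (- (1/2))) \<partial>unit_interval)"
      using \<epsilon> less_imp_le[OF far] by (intro nn_integral_mono ennreal_leI powr_mono2') auto
    also have "\<dots> < \<infinity>" by (simp add: emeasure_restrict_space ennreal_mult_less_top)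
    finally show ?thesis .
  qed
  note DL = trunc_kernel_double_loop[OF \<alpha> \<beta> AB n \<epsilon> neq fin]
  show "integrable plane_pairs (cut_kernel A (- B) \<epsilon>)" by (rule DL(1))
  have "\<beta>' s * (\<integral>t. cnj (\<alpha>' t) * of_real (log_kernel \<epsilon> (norm (\<beta> s - \<alpha> t))) \<partial>unit_interval)
      = of_real (pi\<^sup>2) * (\<integral>t. \<beta>' s * cnj (\<alpha>' t) / of_real ((norm (\<beta> s - \<alpha> t))\<^sup>2) \<partial>unit_interval)" for s
    unfolding integral_mult_right_zero[symmetric] using far by (intro Bochner_Integration.integral_cong) (auto simp: log_kernel_def)
  then show "of_real (integral\<^sup>L plane_pairs (cut_kernel A (- B) \<epsilon>))
      = (\<integral>s. (\<integral>t. \<beta>' s * cnj (\<alpha>' t) / of_real ((norm (\<beta> s - \<alpha> t))\<^sup>2) \<partial>unit_interval) \<partial>unit_interval) / 4"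
    unfolding DL(2) by (simp only: integral_mult_right_zero) simp
qed

subsection \<open>Closed curves and their tubes\<close>

lemma shift_deriv: "((\<lambda>s. s + a) has_vector_derivative 1) (at (t::real))"
  by (auto intro!: derivative_eq_intros)

lemma lipschitz_of_bounded_derivative:
  fixes f :: "real \<Rightarrow> 'a::real_normed_vector"
  assumes f: "\<And>t. (f has_vector_derivative f' t) (at t)" and B: "\<And>t. norm (f' t) \<le> B"
  shows "norm (f (t + h) - f t) \<le> B * \<bar>h\<bar>"
proof -
  have "norm (f (t + h) - f t) \<le> B * norm (t + h - t)"
  proof (rule differentiable_bound[of UNIV f "\<lambda>x h. h *\<^sub>R f' x"])
    fix x
    show "(f has_derivative (\<lambda>h. h *\<^sub>R f' x)) (at x within UNIV)" using f by (simp add: has_vector_derivative_def)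
    show "onorm (\<lambda>h. h *\<^sub>R f' x) \<le> B"
    proof (rule onorm_le)
      fix h
      show "norm (h *\<^sub>R f' x) \<le> B * norm h" using mult_right_mono[OF B[of x], of "\<bar>h\<bar>"] by (simp add: mult.commute)
    qed
  qed auto
  then show ?thesis by simp
qed

text \<open>Two continuous derivatives carry the whole analysis. They are explicit functions rather
  than \<open>vector_derivative\<close> terms, so that images under Moebius maps and conjugation can
  be given by formulas.\<close>

locale C2_curve =
  fixes g g1 g2 :: "real \<Rightarrow> complex"
  assumes deriv_g: "\<And>t. (g has_vector_derivative g1 t) (at t)"
    and deriv_g1: "\<And>t. (g1 has_vector_derivative g2 t) (at t)"
    and cont_g2: "continuous_on UNIV g2"
    and periodic_g: "\<And>t. g (t + 1) = g t"
    and regular: "\<And>t. g1 t \<noteq> 0"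
    and inj_g: "inj_on g {0..<1}"
begin

lemma cont_g: "continuous_on S g" and cont_g1: "continuous_on S g1"
  using deriv_g deriv_g1
  by (auto intro!: continuous_at_imp_continuous_on dest: has_vector_derivative_continuous)

lemma cont_g2': "continuous_on S g2"
  using cont_g2 by (rule continuous_on_subset) simp

lemma periodic_g1: "g1 (t + 1) = g1 t"
proof -
  have "((\<lambda>s. g (s + 1)) has_vector_derivative g1 (t + 1)) (at t)"
    using vector_diff_chain_at[OF shift_deriv, of g "g1 (t + 1)" t] deriv_g[of "t + 1"]
    by (simp add: o_def)
  then show ?thesis using deriv_g[of t] by (simp add: periodic_g vector_derivative_unique_at)
qed

lemma periodic_g2: "g2 (t + 1) = g2 t"
proof -
  have "((\<lambda>s. g1 (s + 1)) has_vector_derivative g2 (t + 1)) (at t)"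
    using vector_diff_chain_at[OF shift_deriv, of g1 "g2 (t + 1)" t] deriv_g1[of "t + 1"]
    by (simp add: o_def)
  then show ?thesis using deriv_g1[of t] by (simp add: periodic_g1 vector_derivative_unique_at)
qed

end

lemma periodic_shift_int:
  fixes f :: "real \<Rightarrow> 'a"
  assumes "\<And>t. f (t + 1) = f t"
  shows "f (t + of_int k) = f t"
proof -
  have nat: "f (t + of_nat n) = f t" for t n
  proof (induction n)
    case (Suc n)
    then show ?case using assms[of "t + of_nat n"] by (simp add: add_ac)
  qed simp
  show ?thesis
  proof (cases "k \<ge> 0")
    case True
    then show ?thesis using nat[of t "nat k"] by simp
  next
    case False
    then show ?thesis using nat[of "t + of_int k" "nat (- k)"] by simp
  qed
qed

lemma periodic_frac:
  fixes f :: "real \<Rightarrow> 'a"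
  assumes "\<And>t. f (t + 1) = f t"
  shows "f (frac t) = f t"
  using periodic_shift_int[of f "frac t" "\<lfloor>t\<rfloor>"] assms by (simp add: frac_def)

lemma periodic_bounded:
  fixes f :: "real \<Rightarrow> 'a::real_normed_vector"
  assumes c: "continuous_on {0..1} f" and p: "\<And>t. f (t + 1) = f t"
  obtains M where "M > 0" "\<And>t. norm (f t) \<le> M"
proof -
  have "compact (f ` {0..1})" using c by (intro compact_continuous_image) auto
  then obtain M where M: "\<forall>x\<in>f ` {0..1}. norm x \<le> M" using compact_imp_bounded bounded_iff by metis
  have "norm (f t) \<le> max M 1" for t
  proof -
    have "frac t \<in> {0..1}" using frac_lt_1[of t] by (simp add: frac_ge_0 less_imp_le)
    then have "norm (f (frac t)) \<le> M" using M by blast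
    then show ?thesis using periodic_frac[of f t] p by simp
  qed
  then show ?thesis by (intro that[of "max M 1"]) auto
qed

lemma periodic_bounded_below:
  fixes f :: "real \<Rightarrow> 'a::real_normed_vector"
  assumes c: "continuous_on {0..1} f" and p: "\<And>t. f (t + 1) = f t" and nz: "\<And>t. f t \<noteq> 0"
  obtains m where "m > 0" "\<And>t. m \<le> norm (f t)"
proof -
  have "continuous_on {0..1} (\<lambda>t. norm (f t))" using c by (rule continuous_on_norm)
  then have "\<exists>t0\<in>{0..1}. \<forall>t\<in>{0..1}. norm (f t0) \<le> norm (f t)"
    by (intro continuous_attains_inf) auto
  then obtain t0 where t0: "t0 \<in> {0..1}" "\<forall>t\<in>{0..1}. norm (f t0) \<le> norm (f t)" by blast
  have "norm (f t0) \<le> norm (f t)" for t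
  proof -
    have "frac t \<in> {0..1}" using frac_lt_1[of t] by (simp add: frac_ge_0 less_imp_le)
    then show ?thesis using t0 periodic_frac[of f t] p by metis
  qed
  then show ?thesis using nz[of t0] by (intro that[of "norm (f t0)"]) auto
qed

context C2_curve
begin

lemma periodic_int: "g (t + of_int k) = g t" "g1 (t + of_int k) = g1 t"
  using periodic_shift_int periodic_g periodic_g1 by blast+

lemma g_eq_iff: "g s = g t \<longleftrightarrow> s - t \<in> \<int>"
proof
  assume "g s = g t"
  then have "g (frac s) = g (frac t)" using periodic_frac[of g] periodic_g by simp
  then have "frac s = frac t" by (rule inj_onD[OF inj_g]) (auto simp: frac_lt_1)
  then have "s - t = of_int (\<lfloor>s\<rfloor> - \<lfloor>t\<rfloor>)" by (simp add: frac_def algebra_simps)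
  then show "s - t \<in> \<int>" by (metis Ints_of_int)
next
  assume "s - t \<in> \<int>"
  then obtain k where "s - t = of_int k" by (auto elim: Ints_cases)
  then have "s = t + of_int k" by simp
  then show "g s = g t" using periodic_int(1) by simp
qed

lemma shift_half_period:
  obtains h where "\<bar>h\<bar> \<le> 1/2" "g s = g (t + h)"
proof
  define k where "k = round (s - t)"
  have "\<bar>of_int k - (s - t)\<bar> \<le> 1/2" unfolding k_def by (rule of_int_round_abs_le)
  then show "\<bar>s - t - of_int k\<bar> \<le> 1/2" by (simp add: abs_minus_commute)
  show "g s = g (t + (s - t - of_int k))" using periodic_int(1)[of "s - of_int k" k] by simp
qed

text \<open>One pair of constants for all later estimates. The bound on the imaginary part says that
  the curve leaves its tangent line only to second order; the last clause is the chord-arc bound,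
  which can hold only up to half a period.\<close>

definition are_bounds :: "real \<Rightarrow> real \<Rightarrow> bool" where
  "are_bounds M c \<longleftrightarrow> M > 0 \<and> c > 0 \<and> (\<forall>t h. norm (g1 t) \<le> M \<and> norm (g2 t) \<le> M \<and> c \<le> norm (g1 t) \<and>
     norm (g1 (t + h) - g1 t) \<le> M * \<bar>h\<bar> \<and> norm (g (t + h) - g t) \<le> M * \<bar>h\<bar> \<and>
     norm (g (t + h) - g t - h *\<^sub>R g1 t) \<le> M * h\<^sup>2 \<and>
     \<bar>Im (g1 t * cnj (g (t + h) - g t))\<bar> \<le> M * h\<^sup>2 \<and> (\<bar>h\<bar> \<le> 1/2 \<longrightarrow> c * \<bar>h\<bar> \<le> norm (g (t + h) - g t)))"

lemma curve_bounds_exist: "\<exists>M c. are_bounds M c"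
proof -
  obtain M1 where M1: "M1 > 0" "\<And>t. norm (g1 t) \<le> M1" by (rule periodic_bounded[OF cont_g1 periodic_g1], blast)
  obtain M2 where M2: "M2 > 0" "\<And>t. norm (g2 t) \<le> M2" by (rule periodic_bounded[OF cont_g2' periodic_g2], blast)
  obtain m where m: "m > 0" "\<And>t. m \<le> norm (g1 t)" by (rule periodic_bounded_below[OF cont_g1 periodic_g1 regular], blast)
  have lip1: "norm (g1 (t + h) - g1 t) \<le> M2 * \<bar>h\<bar>" for t h
    by (rule lipschitz_of_bounded_derivative[OF deriv_g1 M2(2)])
  have lip0: "norm (g (t + h) - g t) \<le> M1 * \<bar>h\<bar>" for t h
    by (rule lipschitz_of_bounded_derivative[OF deriv_g M1(2)])
  have taylor: "norm (g (t + h) - g t - h *\<^sub>R g1 t) \<le> M2 * h\<^sup>2" for t h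
  proof -
    have "norm (g (t + h) - g t - (t + h - t) *\<^sub>R g1 t) \<le> norm (t + h - t) * (M2 * \<bar>h\<bar>)"
    proof (rule vector_differentiable_bound_linearization[of "closed_segment t (t + h)"])
      fix x assume "x \<in> closed_segment t (t + h)"
      then have "\<bar>x - t\<bar> \<le> \<bar>h\<bar>" by (auto simp: closed_segment_eq_real_ivl split: if_splits)
      then have "M2 * \<bar>x - t\<bar> \<le> M2 * \<bar>h\<bar>" using M2 by (intro mult_left_mono) auto
      then show "norm (g1 x - g1 t) \<le> M2 * \<bar>h\<bar>" using lip1[of t "x - t"] by simp
    qed (use deriv_g in \<open>auto intro: has_vector_derivative_at_within\<close>)
    then show ?thesis by (simp add: power2_eq_square mult_ac)
  qed
  have im: "\<bar>Im (g1 t * cnj (g (t + h) - g t))\<bar> \<le> M1 * M2 * h\<^sup>2" for t h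
  proof -
    have "g1 t * cnj (h *\<^sub>R g1 t) = of_real (h * (norm (g1 t))\<^sup>2)"
      by (simp add: scaleR_conv_of_real complex_norm_square[symmetric] mult_ac)
    then have "Im (g1 t * cnj (g (t + h) - g t)) = Im (g1 t * cnj (g (t + h) - g t - h *\<^sub>R g1 t))"
      by (simp only: complex_cnj_diff right_diff_distrib minus_complex.sel) simp
    also have "\<bar>\<dots>\<bar> \<le> norm (g1 t) * norm (g (t + h) - g t - h *\<^sub>R g1 t)"
      using abs_Im_le_cmod[of "g1 t * cnj (g (t + h) - g t - h *\<^sub>R g1 t)"] by (simp only: norm_mult complex_mod_cnj)
    also have "\<dots> \<le> M1 * (M2 * h\<^sup>2)" using M1 taylor[of t h] by (intro mult_mono) auto
    finally show ?thesis by simp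
  qed
  \<comment> \<open>For |h| up to \<eta> the Taylor remainder M2 h^2 uses up at most half of the
    linear term m |h|.\<close>
  define \<eta> where "\<eta> = min (1/2) (m / (2 * M2))"
  have \<eta>: "\<eta> > 0" "\<eta> \<le> 1/2" "\<eta> * M2 \<le> m / 2" using m M2 by (auto simp: \<eta>_def min_def field_simps)
  have small: "m / 2 * \<bar>h\<bar> \<le> norm (g (t + h) - g t)" if "\<bar>h\<bar> \<le> \<eta>" for t h
  proof -
    have "M2 * h\<^sup>2 = (\<bar>h\<bar> * M2) * \<bar>h\<bar>" by (simp add: power2_eq_square mult_ac)
    also have "\<dots> \<le> (\<eta> * M2) * \<bar>h\<bar>" using that M2 by (intro mult_right_mono) auto
    also have "\<dots> \<le> m / 2 * \<bar>h\<bar>" using \<eta> by (intro mult_right_mono) auto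
    finally have "M2 * h\<^sup>2 \<le> m / 2 * \<bar>h\<bar>" .
    moreover have "m * \<bar>h\<bar> \<le> norm (h *\<^sub>R g1 t)" using mult_right_mono[OF m(2)[of t], of "\<bar>h\<bar>"] by (simp add: mult.commute)
    moreover have "norm (h *\<^sub>R g1 t) \<le> norm (g (t + h) - g t) + norm (g (t + h) - g t - h *\<^sub>R g1 t)"
      using norm_triangle_ineq4[of "g (t + h) - g t" "g (t + h) - g t - h *\<^sub>R g1 t"] by simp
    moreover have "m * \<bar>h\<bar> - m / 2 * \<bar>h\<bar> = m / 2 * \<bar>h\<bar>" by simp
    ultimately show ?thesis using taylor[of t h] by linarith
  qed
  \<comment> \<open>The remaining differences form a compact set free of integers, so injectivity
    keeps the chord above some \<mu> > 0. As |h| \<le> 1/2 there, \<mu> is at least 2 \<mu>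
    |h|.\<close>
  define S where "S = {0..1::real} \<times> ({\<eta>..1/2} \<union> {-1/2..-\<eta>})"
  have "compact S" unfolding S_def by (intro compact_Times compact_Un) auto
  moreover have "S \<noteq> {}" using \<eta> by (auto simp: S_def)
  moreover have "continuous_on S (\<lambda>p. norm (g (fst p + snd p) - g (fst p)))"
    by (intro continuous_intros continuous_on_compose2[OF cont_g[of UNIV]]) auto
  ultimately obtain p where p: "p \<in> S" "\<And>q. q \<in> S \<Longrightarrow> norm (g (fst p + snd p) - g (fst p)) \<le> norm (g (fst q + snd q) - g (fst q))"
    using continuous_attains_inf[of S "\<lambda>p. norm (g (fst p + snd p) - g (fst p))"] by blast
  define \<mu> where "\<mu> = norm (g (fst p + snd p) - g (fst p))"
  have \<mu>: "\<mu> > 0"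
  proof -
    have "snd p \<notin> \<int>"
    proof
      assume "snd p \<in> \<int>"
      then obtain k where k: "snd p = of_int k" by (auto elim: Ints_cases)
      then have "\<bar>of_int k :: real\<bar> \<le> 1/2" "of_int k \<noteq> (0::real)" using p(1) \<eta> by (auto simp: S_def)
      then have "\<bar>k\<bar> < 1" by linarith
      then show False using \<open>of_int k \<noteq> (0::real)\<close> by simp
    qed
    then have "g (fst p + snd p) \<noteq> g (fst p)" by (simp add: g_eq_iff)
    then show ?thesis by (simp add: \<mu>_def)
  qed
  have large: "2 * \<mu> * \<bar>h\<bar> \<le> norm (g (t + h) - g t)" if "\<bar>h\<bar> \<ge> \<eta>" "\<bar>h\<bar> \<le> 1/2" for t h
  proof -
    have "(frac t, h) \<in> S" using that frac_lt_1[of t] by (auto simp: S_def less_imp_le abs_real_def split: if_splits)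
    then have "\<mu> \<le> norm (g (frac t + h) - g (frac t))" unfolding \<mu>_def using p(2) by fastforce
    moreover have "g (frac t + h) = g (t + h)" "g (frac t) = g t"
      using periodic_int(1)[of "frac t + h" "\<lfloor>t\<rfloor>"] periodic_int(1)[of "frac t" "\<lfloor>t\<rfloor>"] by (simp_all add: frac_def)
    moreover have "2 * \<mu> * \<bar>h\<bar> \<le> 2 * \<mu> * (1/2)" using that \<mu> by (intro mult_left_mono) auto
    ultimately show ?thesis by simp
  qed
  define M where "M = max (max M1 M2) (M1 * M2)"
  define c where "c = min (min (m / 2) (2 * \<mu>)) m"
  have M: "M1 \<le> M" "M2 \<le> M" "M1 * M2 \<le> M" by (auto simp: M_def)
  have c: "c \<le> m / 2" "c \<le> 2 * \<mu>" "c \<le> m" by (auto simp: c_def)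
  have up: "x \<le> M * y" if "x \<le> A * y" "A \<le> M" "y \<ge> 0" for x y A
    using that mult_right_mono[of A M y] by linarith
  have dn: "c * y \<le> x" if "A * y \<le> x" "c \<le> A" "y \<ge> 0" for x y A
    using that mult_right_mono[of c A y] by linarith
  show ?thesis unfolding are_bounds_def
  proof (intro exI conjI allI impI)
    show "M > 0" using M1 M by linarith
    show "c > 0" using m \<mu> by (simp add: c_def)
    fix t h
    show "norm (g1 t) \<le> M" "norm (g2 t) \<le> M" "c \<le> norm (g1 t)"
      using M1(2)[of t] M2(2)[of t] m(2)[of t] M c by linarith+
    show "norm (g1 (t + h) - g1 t) \<le> M * \<bar>h\<bar>" using up[OF lip1 M(2)] by simp
    show "norm (g (t + h) - g t) \<le> M * \<bar>h\<bar>" using up[OF lip0 M(1)] by simp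
    show "norm (g (t + h) - g t - h *\<^sub>R g1 t) \<le> M * h\<^sup>2" using up[OF taylor M(2)] by simp
    show "\<bar>Im (g1 t * cnj (g (t + h) - g t))\<bar> \<le> M * h\<^sup>2" using up[OF im M(3)] by simp
    assume "\<bar>h\<bar> \<le> 1/2"
    then show "c * \<bar>h\<bar> \<le> norm (g (t + h) - g t)"
      using dn[OF small c(1)] dn[OF large c(2)] by (cases "\<bar>h\<bar> \<le> \<eta>") auto
  qed
qed

definition curve_bounds :: "real \<times> real" where
  "curve_bounds = (SOME p. are_bounds (fst p) (snd p))"

definition "bM = fst curve_bounds"
definition "bc = snd curve_bounds"

lemma bounds:
  shows bM_pos: "bM > 0" and bc_pos: "bc > 0"
    and g1_le: "norm (g1 t) \<le> bM" and g2_le: "norm (g2 t) \<le> bM" and g1_ge: "bc \<le> norm (g1 t)"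
    and g1_lip: "norm (g1 (t + h) - g1 t) \<le> bM * \<bar>h\<bar>"
    and g_lip: "norm (g (t + h) - g t) \<le> bM * \<bar>h\<bar>"
    and g_taylor: "norm (g (t + h) - g t - h *\<^sub>R g1 t) \<le> bM * h\<^sup>2"
    and Im_chord: "\<bar>Im (g1 t * cnj (g (t + h) - g t))\<bar> \<le> bM * h\<^sup>2"
    and chord_ge: "\<bar>h\<bar> \<le> 1/2 \<Longrightarrow> bc * \<bar>h\<bar> \<le> norm (g (t + h) - g t)"
proof -
  have "\<exists>p. are_bounds (fst p) (snd p)" using curve_bounds_exist by simp
  from someI_ex[OF this] have *: "are_bounds bM bc"
    unfolding bM_def bc_def curve_bounds_def .
  show "bM > 0" "bc > 0" using * by (simp_all add: are_bounds_def)
  have **: "norm (g1 t) \<le> bM \<and> norm (g2 t) \<le> bM \<and> bc \<le> norm (g1 t) \<and>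
     norm (g1 (t + h) - g1 t) \<le> bM * \<bar>h\<bar> \<and> norm (g (t + h) - g t) \<le> bM * \<bar>h\<bar> \<and>
     norm (g (t + h) - g t - h *\<^sub>R g1 t) \<le> bM * h\<^sup>2 \<and>
     \<bar>Im (g1 t * cnj (g (t + h) - g t))\<bar> \<le> bM * h\<^sup>2 \<and> (\<bar>h\<bar> \<le> 1/2 \<longrightarrow> bc * \<bar>h\<bar> \<le> norm (g (t + h) - g t))"
    using * unfolding are_bounds_def by blast
  then show "norm (g1 t) \<le> bM" "norm (g2 t) \<le> bM" "bc \<le> norm (g1 t)"
    "norm (g1 (t + h) - g1 t) \<le> bM * \<bar>h\<bar>" "norm (g (t + h) - g t) \<le> bM * \<bar>h\<bar>"
    "norm (g (t + h) - g t - h *\<^sub>R g1 t) \<le> bM * h\<^sup>2" "\<bar>Im (g1 t * cnj (g (t + h) - g t))\<bar> \<le> bM * h\<^sup>2"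
    by (simp_all only: simp_thms)
  show "\<bar>h\<bar> \<le> 1/2 \<Longrightarrow> bc * \<bar>h\<bar> \<le> norm (g (t + h) - g t)"
    using ** by (simp only: simp_thms)
qed

definition K :: "complex set" where "K = g ` {0..1}"

lemma K_range: "K = range g"
proof -
  have "g t \<in> g ` {0..1}" for t
  proof -
    have "g (frac t) = g t" using periodic_frac[of g] periodic_g by blast
    moreover have "frac t \<in> {0..1}" using frac_lt_1[of t] by (simp add: less_imp_le)
    ultimately show ?thesis by (metis imageI)
  qed
  then show ?thesis by (auto simp: K_def)
qed

lemma g_in_K: "g t \<in> K" by (auto simp: K_range)

lemma compact_K: "compact K" unfolding K_def using cont_g by (intro compact_continuous_image) auto

lemma K_nonempty: "K \<noteq> {}" by (auto simp: K_def)

definition tang :: "real \<Rightarrow> complex" where "tang t = g1 t / of_real (norm (g1 t))"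
definition tube :: "real \<Rightarrow> real \<Rightarrow> complex" where "tube t \<tau> = g t + of_real \<tau> * (\<i> * tang t)"
text \<open>Chosen so that \<open>radius\<close> times the constant of \<open>Im_tang_chord\<close>
  is 1/4; see \<open>tube_distance\<close>.\<close>

definition radius :: real where "radius = bc ^ 3 / (4 * bM)"

lemma norm_tang [simp]: "norm (tang t) = 1" using regular by (simp add: tang_def norm_divide)

lemma radius_pos: "radius > 0" using bM_pos bc_pos by (simp add: radius_def)

lemma Im_tang_chord: "\<bar>Im (tang t * cnj (p - g t))\<bar> \<le> bM / bc ^ 3 * (norm (p - g t))\<^sup>2" if p: "p \<in> K"
proof -
  obtain s where "p = g s" using p by (auto simp: K_range)
  then obtain h where h: "\<bar>h\<bar> \<le> 1/2" "p = g (t + h)" using shift_half_period by metis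
  have "tang t * cnj (p - g t) = (g1 t * cnj (p - g t)) / of_real (norm (g1 t))" by (simp add: tang_def)
  then have "\<bar>Im (tang t * cnj (p - g t))\<bar> = \<bar>Im (g1 t * cnj (p - g t))\<bar> / norm (g1 t)" by (simp only: Im_divide_of_real abs_divide) simp
  also have "\<dots> \<le> bM * h\<^sup>2 / bc"
    using Im_chord[of t h] g1_ge[of t] bc_pos bM_pos h by (intro frac_le) auto
  also have "h\<^sup>2 \<le> (norm (p - g t))\<^sup>2 / bc\<^sup>2"
  proof -
    have "(bc * \<bar>h\<bar>)\<^sup>2 \<le> (norm (p - g t))\<^sup>2" using chord_ge[OF h(1), of t] h bc_pos by (intro power_mono) auto
    then show ?thesis using bc_pos by (simp add: field_simps)
  qed
  then have "bM * h\<^sup>2 / bc \<le> bM * ((norm (p - g t))\<^sup>2 / bc\<^sup>2) / bc"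
    using bM_pos bc_pos by (intro divide_right_mono mult_left_mono) auto
  finally show ?thesis by (simp add: power3_eq_cube power2_eq_square mult_ac)
qed

text \<open>In the expanded square the cross term is 2 \<tau> times the normal component of the
  chord. That component is quadratic in the chord, and the choice of \<open>radius\<close> makes the
  cross term at most half the squared chord. This inequality yields the distance to the curve, the
  injectivity of the tube and the lower bounds of all kernels below.\<close>

lemma tube_distance:
  assumes p: "p \<in> K" and \<tau>: "\<bar>\<tau>\<bar> \<le> radius"
  shows "(norm (tube t \<tau> - p))\<^sup>2 \<ge> \<tau>\<^sup>2 + (norm (p - g t))\<^sup>2 / 2"
proof -
  define d where "d = p - g t"
  have "(norm (tube t \<tau> - p))\<^sup>2 = (norm (of_real \<tau> * (\<i> * tang t) - d))\<^sup>2"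
    by (simp add: tube_def d_def algebra_simps)
  also have "\<dots> = \<tau>\<^sup>2 + (norm d)\<^sup>2 - 2 * Re (of_real \<tau> * (\<i> * tang t) * cnj d)"
    using dot_norm_neg[of "of_real \<tau> * (\<i> * tang t)" d]
    by (simp add: norm_mult inner_mult_right field_simps inner_complex_def)
  also have "Re (of_real \<tau> * (\<i> * tang t) * cnj d) = - \<tau> * Im (tang t * cnj d)"
    by (simp add: algebra_simps)
  finally have eq: "(norm (tube t \<tau> - p))\<^sup>2 = \<tau>\<^sup>2 + (norm d)\<^sup>2 + 2 * (\<tau> * Im (tang t * cnj d))" by simp
  have "\<bar>\<tau> * Im (tang t * cnj d)\<bar> \<le> radius * (bM / bc ^ 3 * (norm d)\<^sup>2)"
    unfolding abs_mult d_def using Im_tang_chord[OF p, of t] \<tau> radius_pos by (intro mult_mono) auto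
  also have "\<dots> = (norm d)\<^sup>2 / 4" using bM_pos bc_pos by (simp add: radius_def)
  finally show ?thesis unfolding eq by (simp add: d_def[symmetric] abs_le_iff)
qed

lemma infdist_tube:
  assumes \<tau>: "\<bar>\<tau>\<bar> \<le> radius"
  shows "infdist (tube t \<tau>) K = \<bar>\<tau>\<bar>"
proof (rule antisym)
  have "dist (tube t \<tau>) (g t) = \<bar>\<tau>\<bar>" by (simp add: tube_def dist_norm norm_mult)
  then show "infdist (tube t \<tau>) K \<le> \<bar>\<tau>\<bar>" using infdist_le[OF g_in_K, of "tube t \<tau>" t] by simp
  show "\<bar>\<tau>\<bar> \<le> infdist (tube t \<tau>) K"
    unfolding infdist_notempty[OF K_nonempty]
  proof (rule cINF_greatest[OF K_nonempty])
    fix p assume "p \<in> K"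
    then have "\<tau>\<^sup>2 \<le> (norm (tube t \<tau> - p))\<^sup>2"
      using tube_distance[OF _ \<tau>, of p t] zero_le_power2[of "norm (p - g t)"] by linarith
    then show "\<bar>\<tau>\<bar> \<le> dist (tube t \<tau>) p" unfolding dist_norm by (metis abs_le_square_iff abs_norm_cancel)
  qed
qed

text \<open>Both offsets have the absolute value of the distance to \<open>K\<close>. Since
  \<open>g s\<close> lies at exactly that distance from the common point,
  \<open>tube_distance\<close> leaves no room for the chord between the two feet.\<close>

lemma tube_inj:
  assumes eq: "tube t \<tau> = tube s \<sigma>" and \<tau>: "\<bar>\<tau>\<bar> \<le> radius" and \<sigma>: "\<bar>\<sigma>\<bar> \<le> radius"
  shows "\<tau> = \<sigma>" "g t = g s"
proof -
  have abs: "\<bar>\<tau>\<bar> = \<bar>\<sigma>\<bar>" using infdist_tube[OF \<tau>, of t] infdist_tube[OF \<sigma>, of s] eq by simp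
  have "(norm (tube s \<sigma> - g s))\<^sup>2 = \<sigma>\<^sup>2" by (simp add: tube_def norm_mult)
  then have "\<tau>\<^sup>2 + (norm (g s - g t))\<^sup>2 / 2 \<le> \<sigma>\<^sup>2" using tube_distance[OF g_in_K[of s] \<tau>, of t] eq by simp
  moreover have "\<tau>\<^sup>2 = \<sigma>\<^sup>2" using abs by (metis power2_abs)
  ultimately have "(norm (g s - g t))\<^sup>2 \<le> 0" by simp
  then show gs: "g t = g s" by simp
  then have "t - s \<in> \<int>" by (simp add: g_eq_iff)
  then obtain k where "t - s = of_int k" by (auto elim: Ints_cases)
  then have "t = s + of_int k" by simp
  then have "tang t = tang s" using periodic_int(2) by (simp add: tang_def)
  then have "of_real \<tau> * (\<i> * tang t) = of_real \<sigma> * (\<i> * tang t)" using eq gs by (simp add: tube_def)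
  moreover have "tang t \<noteq> 0" by (metis norm_tang norm_zero zero_neq_one)
  ultimately show "\<tau> = \<sigma>" by simp
qed

text \<open>At a nearest point of the curve the squared distance is critical in the parameter, so
  the connecting segment is normal to the curve.\<close>

lemma nearest_tube:
  obtains t \<tau> where "w = tube t \<tau>" "\<bar>\<tau>\<bar> = infdist w K"
proof -
  obtain p where p: "p \<in> K" "infdist w K = dist w p"
    using infdist_attains_inf[OF compact_imp_closed[OF compact_K] K_nonempty] by metis
  then obtain t where t: "p = g t" by (auto simp: K_range)
  have der: "((\<lambda>s. (w - g s) \<bullet> (w - g s)) has_real_derivative - 2 * ((w - g t) \<bullet> g1 t)) (at t)"
  proof -
    have "((\<lambda>s. w - g s) has_vector_derivative - g1 t) (at t)"
      using deriv_g by (auto intro!: derivative_eq_intros)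
    then have "((\<lambda>s. w - g s) has_derivative (\<lambda>h. h *\<^sub>R (- g1 t))) (at t)" by (simp add: has_vector_derivative_def)
    from has_derivative_inner[OF this this]
    have "((\<lambda>s. (w - g s) \<bullet> (w - g s)) has_derivative (\<lambda>h. (w - g t) \<bullet> (h *\<^sub>R (- g1 t)) + (h *\<^sub>R (- g1 t)) \<bullet> (w - g t))) (at t)" .
    moreover have "(\<lambda>h. (w - g t) \<bullet> (h *\<^sub>R (- g1 t)) + (h *\<^sub>R (- g1 t)) \<bullet> (w - g t)) = (*) (- 2 * ((w - g t) \<bullet> g1 t))"
    proof
      fix h
      have "(h *\<^sub>R (- g1 t)) \<bullet> (w - g t) = (w - g t) \<bullet> (h *\<^sub>R (- g1 t))" by (rule inner_commute)
      then show "(w - g t) \<bullet> (h *\<^sub>R (- g1 t)) + (h *\<^sub>R (- g1 t)) \<bullet> (w - g t) = - 2 * ((w - g t) \<bullet> g1 t) * h"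
        by (simp only: inner_scaleR_right inner_minus_right) (simp only: mult_minus_left mult_minus_right mult_2 mult.commute[of h] distrib_right minus_add_distrib)
    qed
    ultimately show ?thesis unfolding has_field_derivative_def by (simp only:)
  qed
  have "(w - g t) \<bullet> (w - g t) \<le> (w - g s) \<bullet> (w - g s)" for s
  proof -
    have "dist w (g t) \<le> dist w (g s)" using p t infdist_le[OF g_in_K, of w s] by simp
    then show ?thesis by (simp add: dist_norm dot_square_norm power_mono)
  qed
  then have "- 2 * ((w - g t) \<bullet> g1 t) = 0"
    using DERIV_local_min[OF der, of 1] by simp
  then have in0: "(w - g t) \<bullet> g1 t = 0" by simp
  have orth: "Re ((w - g t) * cnj (tang t)) = 0"
  proof -
    have "(w - g t) * cnj (tang t) = (w - g t) * cnj (g1 t) / of_real (norm (g1 t))" by (simp add: tang_def)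
    moreover have "Re ((w - g t) * cnj (g1 t)) = (w - g t) \<bullet> g1 t" by (simp add: inner_complex_def)
    ultimately show ?thesis using in0 by (simp only: Re_divide_of_real)
  qed
  define \<tau> where "\<tau> = Im ((w - g t) * cnj (tang t))"
  have tt: "cnj (tang t) * tang t = 1"
    using complex_norm_square[of "tang t"] by (simp add: mult.commute)
  have "(w - g t) * cnj (tang t) = \<i> * of_real \<tau>"
    using orth by (simp add: complex_eq_iff \<tau>_def)
  then have "(w - g t) * cnj (tang t) * tang t = \<i> * of_real \<tau> * tang t" by simp
  then have "w - g t = \<i> * of_real \<tau> * tang t" using tt by (simp add: mult.assoc)
  then have w: "w = tube t \<tau>" by (simp add: tube_def algebra_simps)
  moreover have "\<bar>\<tau>\<bar> = dist w (g t)" by (simp add: w tube_def dist_norm norm_mult)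
  ultimately show ?thesis using p t that by metis
qed

lemma path_g: "path g" "pathstart g = g 0" "pathfinish g = pathstart g" "path_image g = K"
  using cont_g periodic_g[of 0] by (auto simp: path_def pathstart_def pathfinish_def path_image_def K_def)

lemma simple_path_g: "simple_path g"
  unfolding simple_path_def loop_free_def
proof (intro conjI ballI impI path_g)
  fix x y :: real assume xy: "x \<in> {0..1}" "y \<in> {0..1}" "g x = g y"
  then obtain k where k: "x - y = of_int k" by (auto simp: g_eq_iff elim: Ints_cases)
  then have "\<bar>of_int k :: real\<bar> \<le> 1" using xy by auto
  then have "\<bar>k\<bar> \<le> 1" by linarith
  then have "k = 0 \<or> k = 1 \<or> k = -1" by linarith
  then show "x = y \<or> x = 0 \<and> y = 1 \<or> x = 1 \<and> y = 0" using k xy by auto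
qed

lemma Jordan:
  shows open_inside_K: "open (inside K)" and open_outside_K: "open (outside K)" and bounded_inside_K: "bounded (inside K)"
    and inside_Un_outside_K: "inside K \<union> outside K = - K" and inside_Int_outside_K: "inside K \<inter> outside K = {}"
    and frontier_inside_K: "frontier (inside K) = K" and frontier_outside_K: "frontier (outside K) = K"
    and connected_inside_K: "connected (inside K)" and connected_outside_K: "connected (outside K)"
    and inside_K_nonempty: "inside K \<noteq> {}" and unbounded_outside_K: "\<not> bounded (outside K)"
  using Jordan_inside_outside[OF simple_path_g path_g(3)] by (simp_all add: path_g)

lemma infdist_pos: "w \<notin> K \<Longrightarrow> infdist w K > 0"
  using in_closed_iff_infdist_zero[OF compact_imp_closed[OF compact_K] K_nonempty, of w] infdist_nonneg[of w K] by force

lemma infdist_zero: "w \<in> K \<Longrightarrow> infdist w K = 0"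
  by simp

lemma tube_notin_K: "0 < \<bar>\<tau>\<bar> \<Longrightarrow> \<bar>\<tau>\<bar> \<le> radius \<Longrightarrow> tube t \<tau> \<notin> K"
  using infdist_tube[of \<tau> t] infdist_zero by fastforce

lemma cont_tang: "continuous_on S tang"
  unfolding tang_def[abs_def] using regular by (intro continuous_intros cont_g1) auto

lemma connected_side:
  assumes "\<bar>e\<bar> = (1::real)"
  shows "connected ((\<lambda>(t, \<tau>). tube t (e * \<tau>)) ` (UNIV \<times> {0<..radius}))"
proof (rule connected_continuous_image)
  show "continuous_on (UNIV \<times> {0<..radius}) (\<lambda>(t, \<tau>). tube t (e * \<tau>))"
    unfolding case_prod_beta tube_def
    by (intro continuous_intros continuous_on_compose2[OF cont_g[of UNIV]] continuous_on_compose2[OF cont_tang[of UNIV]]) auto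
  show "connected ((UNIV :: real set) \<times> {0<..radius})" by (intro connected_Times) auto
qed

text \<open>A one-sided tube is the continuous image of a connected set and avoids \<open>K\<close>,
  so it cannot meet both components.\<close>

lemma side_in:
  assumes e: "\<bar>e\<bar> = 1"
  shows "(\<forall>t \<tau>. 0 < \<tau> \<and> \<tau> \<le> radius \<longrightarrow> tube t (e * \<tau>) \<in> inside K) \<or>
         (\<forall>t \<tau>. 0 < \<tau> \<and> \<tau> \<le> radius \<longrightarrow> tube t (e * \<tau>) \<in> outside K)"
proof -
  define S where "S = (\<lambda>(t, \<tau>). tube t (e * \<tau>)) ` (UNIV \<times> {0<..radius})"
  have in_S: "tube t (e * \<tau>) \<in> S" if "0 < \<tau>" "\<tau> \<le> radius" for t \<tau>
  proof -
    have "(\<lambda>(t, \<tau>). tube t (e * \<tau>)) (t, \<tau>) \<in> S" unfolding S_def by (rule imageI) (use that in auto)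
    then show ?thesis by simp
  qed
  have "S \<inter> K = {}"
  proof -
    have "tube t (e * \<tau>) \<notin> K" if "0 < \<tau>" "\<tau> \<le> radius" for t \<tau>
      using that e by (intro tube_notin_K) (auto simp: abs_mult)
    then show ?thesis by (auto simp: S_def)
  qed
  then have "S \<subseteq> inside K \<union> outside K" using inside_Un_outside_K by auto
  then have "S \<subseteq> inside K \<or> S \<subseteq> outside K"
    using connectedD[OF connected_side[OF e, folded S_def] open_inside_K open_outside_K] inside_Int_outside_K by blast
  then show ?thesis using in_S by blast
qed

text \<open>Both components of the complement have \<open>K\<close> as frontier, hence both contain
  tube points close to \<open>K\<close>. As each of the two one-sided tubes lies in a single
  component, they must lie in different ones.\<close>

lemma side_exists:
  "\<exists>e. \<bar>e\<bar> = 1 \<and> (\<forall>t \<tau>. 0 < \<tau> \<and> \<tau> \<le> radius \<longrightarrow> tube t (e * \<tau>) \<in> inside K \<and> tube t (- e * \<tau>) \<in> outside K)"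
proof -
  have near: "\<exists>q\<in>A. \<exists>t \<tau> e. \<bar>e\<bar> = 1 \<and> 0 < \<tau> \<and> \<tau> \<le> radius \<and> q = tube t (e * \<tau>)" if A: "frontier A = K" "A \<inter> K = {}" for A
  proof -
    have "g 0 \<in> closure A" using A g_in_K[of 0] by (auto simp: frontier_def)
    then obtain q where q: "q \<in> A" "dist q (g 0) < radius" using radius_pos by (meson closure_approachable)
    obtain t \<tau> where t: "q = tube t \<tau>" "\<bar>\<tau>\<bar> = infdist q K" by (rule nearest_tube)
    have "infdist q K \<le> radius" using infdist_le[OF g_in_K, of q 0] q by linarith
    moreover have "infdist q K > 0" using A q by (intro infdist_pos) auto
    ultimately have "0 < \<bar>\<tau>\<bar>" "\<bar>\<tau>\<bar> \<le> radius" unfolding t(2)[symmetric] by auto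
    moreover have "q = tube t (sgn \<tau> * \<bar>\<tau>\<bar>)" by (simp only: sgn_mult_abs t(1))
    moreover have "\<bar>sgn \<tau>\<bar> = 1" using \<open>0 < \<bar>\<tau>\<bar>\<close> by (simp add: abs_sgn_eq)
    ultimately have "\<bar>sgn \<tau>\<bar> = 1 \<and> 0 < \<bar>\<tau>\<bar> \<and> \<bar>\<tau>\<bar> \<le> radius \<and> q = tube t (sgn \<tau> * \<bar>\<tau>\<bar>)" by blast
    then show ?thesis using q by blast
  qed
  have disj: "inside K \<inter> K = {}" "outside K \<inter> K = {}" using inside_Un_outside_K by auto
  obtain q t \<tau> e where 1: "q \<in> inside K" "\<bar>e\<bar> = 1" "0 < \<tau>" "\<tau> \<le> radius" "q = tube t (e * \<tau>)"
    using near[OF frontier_inside_K disj(1)] by blast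
  have I: "\<forall>t \<tau>. 0 < \<tau> \<and> \<tau> \<le> radius \<longrightarrow> tube t (e * \<tau>) \<in> inside K"
    using side_in[OF 1(2)] 1 inside_Int_outside_K by blast
  obtain q' t' \<tau>' e' where 2: "q' \<in> outside K" "\<bar>e'\<bar> = 1" "0 < \<tau>'" "\<tau>' \<le> radius" "q' = tube t' (e' * \<tau>')"
    using near[OF frontier_outside_K disj(2)] by blast
  have O: "\<forall>t \<tau>. 0 < \<tau> \<and> \<tau> \<le> radius \<longrightarrow> tube t (e' * \<tau>) \<in> outside K"
    using side_in[OF 2(2)] 2 inside_Int_outside_K by blast
  have "e' \<noteq> e" using I 2 inside_Int_outside_K by blast
  then have "e' = - e" using 1(2) 2(2) by linarith
  then show ?thesis using I O 1(2) by blast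
qed

text \<open>It is 1 if the inside lies to the left of the direction of travel and -1 if to the
  right, because \<open>tube\<close> uses the left normal.\<close>

definition side :: real where
  "side = (SOME e. \<bar>e\<bar> = 1 \<and> (\<forall>t \<tau>. 0 < \<tau> \<and> \<tau> \<le> radius \<longrightarrow> tube t (e * \<tau>) \<in> inside K \<and> tube t (- e * \<tau>) \<in> outside K))"

lemma side:
  "\<bar>side\<bar> = 1"
  "0 < \<tau> \<Longrightarrow> \<tau> \<le> radius \<Longrightarrow> tube t (side * \<tau>) \<in> inside K"
  "0 < \<tau> \<Longrightarrow> \<tau> \<le> radius \<Longrightarrow> tube t (- side * \<tau>) \<in> outside K"
  using someI_ex[OF side_exists] unfolding side_def[symmetric] by blast+

lemma tube_side:
  assumes "0 < \<bar>\<tau>\<bar>" "\<bar>\<tau>\<bar> \<le> radius"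
  shows "side * \<tau> > 0 \<Longrightarrow> tube t \<tau> \<in> inside K" "side * \<tau> < 0 \<Longrightarrow> tube t \<tau> \<in> outside K"
proof -
  have s: "side = 1 \<or> side = -1" using side(1) by linarith
  show "side * \<tau> > 0 \<Longrightarrow> tube t \<tau> \<in> inside K" using side(2)[of "\<bar>\<tau>\<bar>" t] s assms by (auto simp: abs_if split: if_splits)
  show "side * \<tau> < 0 \<Longrightarrow> tube t \<tau> \<in> outside K" using side(3)[of "\<bar>\<tau>\<bar>" t] s assms by (auto simp: abs_if split: if_splits)
qed

text \<open>The orientation seen by winding numbers. That it agrees with the geometric
  \<open>side\<close> is proved only in \<open>orient_side\<close>, by an energy argument.\<close>

definition orient :: real where
  "orient = (if \<forall>z\<in>inside K. winding_number g z = 1 then 1 else -1)"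

lemma winding_g:
  "z \<in> inside K \<Longrightarrow> winding_number g z = of_real orient"
  "z \<in> outside K \<Longrightarrow> winding_number g z = 0"
proof -
  show "z \<in> outside K \<Longrightarrow> winding_number g z = 0"
    using winding_number_zero_in_outside[OF path_g(1,3)] by (simp add: path_g)
  show "winding_number g z = of_real orient" if z: "z \<in> inside K"
  proof (rule simple_closed_path_winding_number_inside[OF simple_path_g, unfolded path_g])
    assume "\<And>z. z \<in> inside K \<Longrightarrow> winding_number g z = 1"
    then show ?thesis using z by (simp add: orient_def)
  next
    assume a: "\<And>z. z \<in> inside K \<Longrightarrow> winding_number g z = -1"
    then have "\<not> (\<forall>z\<in>inside K. winding_number g z = 1)" using z by force
    then show ?thesis using a[OF z] by (simp add: orient_def)
  qed
qed

lemma abs_orient: "\<bar>orient\<bar> = 1" by (simp add: orient_def)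

lemma winding_g_tube:
  assumes "0 < \<bar>\<tau>\<bar>" "\<bar>\<tau>\<bar> \<le> radius"
  shows "winding_number g (tube t \<tau>) = (if side * \<tau> > 0 then of_real orient else 0)"
proof -
  have "side * \<tau> \<noteq> 0" using assms side(1) by auto
  then consider "side * \<tau> > 0" | "side * \<tau> < 0" by linarith
  then show ?thesis using tube_side[OF assms, of t] winding_g by cases auto
qed

end

section \<open>Winding numbers of the curve and of its parallel curves\<close>

lemma winding_number_has_integral_C1:
  assumes \<alpha>: "C1_loop \<alpha> \<alpha>'" and z: "z \<notin> \<alpha> ` {0..1}"
  shows "((\<lambda>t. \<alpha>' t / (\<alpha> t - z)) has_integral two_pi_i * winding_number \<alpha> z) {0..1}"
proof -
  have vd: "vector_derivative \<alpha> (at t within {0..1}) = \<alpha>' t" if "t \<in> {0..1}" for t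
    using that \<alpha> by (intro vector_derivative_at_within_ivl) (auto simp: C1_loop_def)
  have "\<alpha> C1_differentiable_on {0..1}"
    unfolding C1_differentiable_on_def using \<alpha> by (auto simp: C1_loop_def intro: continuous_on_subset)
  then have vp: "valid_path \<alpha>" by (simp add: valid_path_def C1_differentiable_imp_piecewise)
  have "((\<lambda>w. 1 / (w - z)) has_contour_integral two_pi_i * winding_number \<alpha> z) \<alpha>"
    using has_contour_integral_winding_number[OF vp, of z] z by (simp add: path_image_def)
  then have "((\<lambda>t. 1 / (\<alpha> t - z) * vector_derivative \<alpha> (at t within {0..1})) has_integral two_pi_i * winding_number \<alpha> z) {0..1}"
    unfolding has_contour_integral_def .
  then show ?thesis
    by (rule has_integral_eq[rotated]) (simp add: vd)
qed

lemma C1_loop_image_null: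
  assumes \<alpha>: "C1_loop \<alpha> \<alpha>'"
  shows "\<alpha> ` {0..1} \<in> null_sets lborel"
proof -
  have "negligible (\<alpha> ` {0..1})"
    using \<alpha> by (intro negligible_differentiable_image_lowdim)
      (auto simp: C1_loop_def differentiable_on_def has_vector_derivative_def differentiable_def intro: has_derivative_at_withinI)
  moreover have "compact (\<alpha> ` {0..1})"
    using C1_loop_continuous(1)[OF \<alpha>] by (intro compact_continuous_image) (auto intro: continuous_on_subset)
  moreover have "\<alpha> ` {0..1} \<in> sets lborel" using calculation(2) by (simp add: borel_compact)
  ultimately show ?thesis by (simp add: null_sets_completion_iff negligible_iff_null_sets)
qed

context C2_curve
begin

lemma C1_loop_g: "C1_loop g g1"
  using deriv_g cont_g1 periodic_g[of 0] by (simp add: C1_loop_def)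

lemma null_K: "K \<in> null_sets lborel"
  using C1_loop_image_null[OF C1_loop_g] by (simp add: K_def)

lemma encloses_inside: "encloses orient g g1 (inside K)"
  unfolding encloses_def
proof (intro conjI)
  show "bounded (inside K)" "inside K \<in> sets borel" using bounded_inside_K open_inside_K by auto
  have "AE z in lborel. z \<notin> K" using null_K by (rule AE_not_in)
  then show "AE z in lborel. z \<notin> g ` {0..1} \<and>
      ((\<lambda>t. g1 t / (g t - z)) has_integral two_pi_i * of_real orient * indicator (inside K) z) {0..1}"
  proof eventually_elim
    case (elim z)
    then have "z \<in> inside K \<or> z \<in> outside K" using inside_Un_outside_K by blast
    then have "winding_number g z = of_real orient * indicator (inside K) z"
      using winding_g inside_Int_outside_K by (auto simp: indicator_def)
    then show ?case using winding_number_has_integral_C1[OF C1_loop_g, of z] elim by (simp add: K_def mult.assoc)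
  qed
qed

text \<open>The rate of change of the tangent angle, that is, signed curvature times speed. The
  function \<open>par1\<close> that follows is the velocity of the parallel curve.\<close>

definition turn :: "real \<Rightarrow> real" where "turn t = Im (g2 t / g1 t)"
definition par1 :: "real \<Rightarrow> real \<Rightarrow> complex" where "par1 \<delta> t = of_real (norm (g1 t) - \<delta> * turn t) * tang t"

lemma cont_turn: "continuous_on S turn"
  unfolding turn_def[abs_def] using regular by (intro continuous_intros cont_g1 cont_g2') auto

text \<open>The Frenet equation. With g2 = q g1, the derivative of the speed removes exactly the
  part \<open>Re q\<close>, and \<open>Im q\<close>, which is \<open>turn\<close>, rotates the
  tangent.\<close>

lemma deriv_tang: "(tang has_vector_derivative \<i> * of_real (turn t) * tang t) (at t)"
proof -
  have n: "((\<lambda>t. norm (g1 t)) has_vector_derivative (g1 t \<bullet> g2 t) / norm (g1 t)) (at t)"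
  proof -
    have "(norm has_derivative (\<lambda>h. (g1 t \<bullet> h) / norm (g1 t))) (at (g1 t))"
      using has_derivative_norm[OF regular[of t]] by (simp add: sgn_div_norm inner_commute divide_inverse mult_ac inner_scaleR_left cong: if_cong)
    then have "((norm \<circ> g1) has_derivative ((\<lambda>h. (g1 t \<bullet> h) / norm (g1 t)) \<circ> (\<lambda>h. h *\<^sub>R g2 t))) (at t)"
      using deriv_g1[of t] by (intro diff_chain_at) (auto simp: has_vector_derivative_def)
    then show ?thesis by (simp add: o_def has_vector_derivative_def)
  qed
  have 1: "((\<lambda>t. g1 t / complex_of_real (norm (g1 t))) has_vector_derivative
     (g2 t * of_real (norm (g1 t)) - g1 t * of_real ((g1 t \<bullet> g2 t) / norm (g1 t))) / (of_real (norm (g1 t)))\<^sup>2) (at t)"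
  proof -
    have inv: "((\<lambda>t. inverse (norm (g1 t))) has_real_derivative - ((g1 t \<bullet> g2 t) / norm (g1 t)) * inverse ((norm (g1 t))\<^sup>2)) (at t)"
      using n regular[of t] unfolding has_real_derivative_iff_has_vector_derivative[symmetric]
      by (auto intro!: derivative_eq_intros simp: power2_eq_square)
    have "((\<lambda>t. inverse (norm (g1 t)) *\<^sub>R g1 t) has_vector_derivative
       inverse (norm (g1 t)) *\<^sub>R g2 t + (- ((g1 t \<bullet> g2 t) / norm (g1 t)) * inverse ((norm (g1 t))\<^sup>2)) *\<^sub>R g1 t) (at t)"
      using inv deriv_g1[of t] by (rule has_vector_derivative_scaleR)
    moreover have "(\<lambda>t. inverse (norm (g1 t)) *\<^sub>R g1 t) = (\<lambda>t. g1 t / complex_of_real (norm (g1 t)))"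
      by (simp add: scaleR_conv_of_real divide_inverse mult.commute)
    moreover have "inverse (norm (g1 t)) *\<^sub>R g2 t + (- ((g1 t \<bullet> g2 t) / norm (g1 t)) * inverse ((norm (g1 t))\<^sup>2)) *\<^sub>R g1 t
      = (g2 t * of_real (norm (g1 t)) - g1 t * of_real ((g1 t \<bullet> g2 t) / norm (g1 t))) / (of_real (norm (g1 t)))\<^sup>2"
    proof -
      define N I where "N = norm (g1 t)" and "I = (g1 t \<bullet> g2 t) / norm (g1 t)"
      have "complex_of_real N \<noteq> 0" using regular[of t] by (simp add: N_def)
      then show ?thesis unfolding N_def[symmetric] I_def[symmetric]
        by (simp add: scaleR_conv_of_real power2_eq_square diff_divide_distrib) (simp add: divide_inverse mult.commute)
    qed
    ultimately show ?thesis by (simp only:)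
  qed
  have 2: "(g2 t * of_real (norm (g1 t)) - g1 t * of_real ((g1 t \<bullet> g2 t) / norm (g1 t))) / (of_real (norm (g1 t)))\<^sup>2
      = \<i> * of_real (turn t) * tang t"
  proof -
    define q where "q = g2 t / g1 t"
    define N where "N = norm (g1 t)"
    have N: "N > 0" using regular[of t] by (simp add: N_def)
    have g2: "g2 t = q * g1 t" using regular[of t] by (simp add: q_def)
    have "g1 t \<bullet> g2 t = Re (g2 t * cnj (g1 t))" by (simp add: inner_complex_def)
    also have "g2 t * cnj (g1 t) = q * (g1 t * cnj (g1 t))" unfolding g2 by (rule mult.assoc)
    also have "g1 t * cnj (g1 t) = of_real (N\<^sup>2)" by (simp only: N_def complex_norm_square)
    also have "Re (q * of_real (N\<^sup>2)) = Re q * N\<^sup>2" by simp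
    finally have "g1 t \<bullet> g2 t = Re q * N\<^sup>2" .
    then have "(g1 t \<bullet> g2 t) / N = Re q * N" using N by (simp add: power2_eq_square)
    then have "(g2 t * of_real N - g1 t * of_real ((g1 t \<bullet> g2 t) / N)) / (of_real N)\<^sup>2 = (q - of_real (Re q)) * (g1 t / of_real N)"
      using N unfolding g2 by (simp add: field_simps power2_eq_square)
    also have "q - of_real (Re q) = \<i> * of_real (Im q)" by (simp add: complex_eq_iff)
    finally show ?thesis by (simp add: N_def turn_def q_def tang_def)
  qed
  show ?thesis using 1 unfolding 2 tang_def[abs_def] .
qed

lemma periodic_tube: "tube (t + 1) \<tau> = tube t \<tau>"
  using periodic_g periodic_g1 by (simp add: tube_def tang_def)

lemma C1_loop_tube: "C1_loop (\<lambda>t. tube t \<delta>) (par1 \<delta>)"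
  unfolding C1_loop_def
proof (intro conjI allI)
  fix t
  have "((\<lambda>t. g t + of_real \<delta> * (\<i> * tang t)) has_vector_derivative g1 t + of_real \<delta> * (\<i> * (\<i> * of_real (turn t) * tang t))) (at t)"
    using deriv_g deriv_tang by (intro has_vector_derivative_add has_vector_derivative_mult_right)
  moreover have "g1 t + of_real \<delta> * (\<i> * (\<i> * of_real (turn t) * tang t)) = par1 \<delta> t"
    using regular[of t] by (simp add: par1_def tang_def algebra_simps)
  ultimately show "((\<lambda>t. tube t \<delta>) has_vector_derivative par1 \<delta> t) (at t)" by (simp add: tube_def[abs_def])
next
  show "continuous_on UNIV (par1 \<delta>)" unfolding par1_def[abs_def]
    by (intro continuous_intros cont_g1 cont_turn cont_tang)
  show "tube 1 \<delta> = tube 0 \<delta>" using periodic_tube[of 0 \<delta>] by simp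
qed

lemma tube_range: "tube t \<tau> \<in> (\<lambda>t. tube t \<tau>) ` {0..1}"
proof -
  have "tube (frac t) \<tau> = tube t \<tau>" using periodic_frac[of "\<lambda>t. tube t \<tau>"] periodic_tube by blast
  moreover have "frac t \<in> {0..1}" using frac_lt_1[of t] by (simp add: less_imp_le)
  ultimately show ?thesis by (metis imageI)
qed

lemma path_tube: "path (\<lambda>t. tube t \<delta>)" "pathfinish (\<lambda>t. tube t \<delta>) = pathstart (\<lambda>t. tube t \<delta>)"
  using C1_loop_continuous(1)[OF C1_loop_tube[of \<delta>]] C1_loop_tube[of \<delta>]
  by (auto simp: path_def pathfinish_def pathstart_def C1_loop_def intro: continuous_on_subset)

lemma closed_segment_tube: "closed_segment (tube t a) (tube t b) = tube t ` closed_segment a b"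
proof -
  have "tube t x = (\<lambda>y. g t + y) ((\<lambda>r. r *\<^sub>R (\<i> * tang t)) x)" for x by (simp add: tube_def scaleR_conv_of_real)
  then have e: "tube t = (\<lambda>y. g t + y) \<circ> (\<lambda>r. r *\<^sub>R (\<i> * tang t))" by auto
  have "linear (\<lambda>r. r *\<^sub>R (\<i> * tang t))" by (simp add: linear_iff scaleR_add_left)
  from closed_segment_linear_image[OF this, of a b]
  show ?thesis unfolding e image_comp[symmetric] by (simp only: o_apply closed_segment_translation)
qed

lemma tube_0: "tube t 0 = g t" by (simp add: tube_def)

lemma winding_tube_eq:
  assumes \<delta>: "0 < \<bar>\<delta>\<bar>" "\<bar>\<delta>\<bar> \<le> radius" and z: "z \<notin> (\<lambda>(t, \<tau>). tube t \<tau>) ` (UNIV \<times> closed_segment 0 \<delta>)"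
  shows "winding_number (\<lambda>t. tube t \<delta>) z = winding_number g z"
proof (rule winding_number_loops_linear_eq)
  fix t :: real
  have "closed_segment (g t) (tube t \<delta>) = tube t ` closed_segment 0 \<delta>" using closed_segment_tube[of t 0 \<delta>] by (simp add: tube_0)
  then show "z \<notin> closed_segment (g t) (tube t \<delta>)" using z by auto
qed (use path_g path_tube in auto)

text \<open>Farther than |\<delta>| from \<open>K\<close> the straight homotopy from the curve to
  the parallel curve avoids \<open>z\<close>. Closer in, \<open>z\<close> is first moved along its
  own normal to the parallel curve on the opposite side: that segment misses the parallel curve at
  \<delta>, and its end point is missed by the homotopy, so the winding number is that of
  \<open>g\<close> on the opposite side.\<close>

lemma winding_tube:
  assumes \<delta>: "0 < \<bar>\<delta>\<bar>" "\<bar>\<delta>\<bar> \<le> radius" and z: "infdist z K \<noteq> \<bar>\<delta>\<bar>"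
  shows "winding_number (\<lambda>t. tube t \<delta>) z = (if infdist z K > \<bar>\<delta>\<bar> then winding_number g z
     else if side * \<delta> < 0 then of_real orient else 0)"
proof (cases "infdist z K > \<bar>\<delta>\<bar>")
  case True
  have "z \<notin> (\<lambda>(t, \<tau>). tube t \<tau>) ` (UNIV \<times> closed_segment 0 \<delta>)"
  proof
    assume "z \<in> (\<lambda>(t, \<tau>). tube t \<tau>) ` (UNIV \<times> closed_segment 0 \<delta>)"
    then obtain t \<tau> where t: "z = tube t \<tau>" "\<tau> \<in> closed_segment 0 \<delta>" by auto
    then have "\<bar>\<tau>\<bar> \<le> \<bar>\<delta>\<bar>" by (auto simp: closed_segment_eq_real_ivl split: if_splits)
    then show False using infdist_tube[of \<tau> t] True t \<delta> by auto
  qed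
  then show ?thesis using True winding_tube_eq[OF \<delta>] by simp
next
  case False
  obtain t0 \<tau>0 where t0: "z = tube t0 \<tau>0" "\<bar>\<tau>0\<bar> = infdist z K" by (rule nearest_tube)
  have \<tau>0: "\<bar>\<tau>0\<bar> < \<bar>\<delta>\<bar>" using False z t0 by linarith
  define z0 where "z0 = tube t0 (- \<delta>)"
  have "winding_number (\<lambda>t. tube t \<delta>) z = winding_number (\<lambda>t. tube t \<delta>) z0"
  proof (rule winding_number_eq[OF path_tube])
    show "z \<in> closed_segment z z0" "z0 \<in> closed_segment z z0" "connected (closed_segment z z0)" by auto
    have "tube t0 x \<noteq> tube t \<delta>" if "x \<in> closed_segment \<tau>0 (- \<delta>)" for x t
    proof
      assume eq: "tube t0 x = tube t \<delta>"
      have "\<bar>x\<bar> \<le> \<bar>\<delta>\<bar>" "x \<noteq> \<delta>" using that \<tau>0 by (auto simp: closed_segment_eq_real_ivl split: if_splits)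
      then show False using tube_inj(1)[OF eq] \<delta> by auto
    qed
    then show "closed_segment z z0 \<inter> path_image (\<lambda>t. tube t \<delta>) = {}"
      unfolding t0(1) z0_def closed_segment_tube path_image_def by auto
  qed
  also have "\<dots> = winding_number g z0"
  proof (rule winding_tube_eq[OF \<delta>], rule notI)
    assume "z0 \<in> (\<lambda>(t, \<tau>). tube t \<tau>) ` (UNIV \<times> closed_segment 0 \<delta>)"
    then obtain t \<tau> where t: "tube t0 (- \<delta>) = tube t \<tau>" "\<tau> \<in> closed_segment 0 \<delta>" by (auto simp: z0_def)
    then have "\<bar>\<tau>\<bar> \<le> \<bar>\<delta>\<bar>" "\<tau> \<noteq> - \<delta>" using \<delta> by (auto simp: closed_segment_eq_real_ivl split: if_splits)
    then show False using tube_inj(1)[OF t(1)] \<delta> by auto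
  qed
  also have "\<dots> = (if side * \<delta> < 0 then of_real orient else 0)"
    using winding_g_tube[of "- \<delta>" t0] \<delta> by (simp add: z0_def)
  finally show ?thesis using False by simp
qed

text \<open>The condition \<open>side * \<delta> > 0\<close> says that the parallel curve runs
  inside \<open>K\<close>, so the region shrinks; otherwise it grows by a collar around
  \<open>K\<close>.\<close>

definition par_region :: "real \<Rightarrow> complex set" where
  "par_region \<delta> = (if side * \<delta> > 0 then {z \<in> inside K. infdist z K > \<bar>\<delta>\<bar>} else inside K \<union> {z. infdist z K < \<bar>\<delta>\<bar>})"

lemma AE_infdist_neq:
  assumes \<delta>: "0 < \<bar>\<delta>\<bar>" "\<bar>\<delta>\<bar> \<le> radius"
  shows "AE z in lborel. infdist z K \<noteq> \<bar>\<delta>\<bar>"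
proof -
  have "AE z in lborel. z \<notin> (\<lambda>t. tube t \<delta>) ` {0..1}" "AE z in lborel. z \<notin> (\<lambda>t. tube t (- \<delta>)) ` {0..1}"
    using C1_loop_image_null[OF C1_loop_tube] by (auto intro: AE_not_in)
  then show ?thesis
  proof eventually_elim
    case (elim z)
    obtain t \<tau> where t: "z = tube t \<tau>" "\<bar>\<tau>\<bar> = infdist z K" by (rule nearest_tube)
    have "\<tau> \<noteq> \<delta>" "\<tau> \<noteq> - \<delta>" using elim t(1) tube_range[of t \<tau>] by auto
    then show ?case using t(2) by linarith
  qed
qed

lemma encloses_tube:
  assumes \<delta>: "0 < \<bar>\<delta>\<bar>" "\<bar>\<delta>\<bar> \<le> radius"
  shows "encloses orient (\<lambda>t. tube t \<delta>) (par1 \<delta>) (par_region \<delta>)"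
  unfolding encloses_def
proof (intro conjI)
  have op: "open {z. infdist z K > \<bar>\<delta>\<bar>}" "open {z. infdist z K < \<bar>\<delta>\<bar>}"
    by (intro open_Collect_less continuous_intros)+
  have eq: "{z \<in> inside K. infdist z K > \<bar>\<delta>\<bar>} = inside K \<inter> {z. infdist z K > \<bar>\<delta>\<bar>}" by auto
  show "par_region \<delta> \<in> sets borel"
    using op open_inside_K unfolding par_region_def eq by auto
  have "bounded {z. infdist z K < \<bar>\<delta>\<bar>}"
  proof -
    obtain B where B: "\<And>x. x \<in> K \<Longrightarrow> norm x \<le> B" using compact_imp_bounded[OF compact_K] bounded_iff by metis
    have "norm z \<le> B + \<bar>\<delta>\<bar>" if "infdist z K < \<bar>\<delta>\<bar>" for z
    proof -
      obtain p where "p \<in> K" "infdist z K = dist z p"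
        using infdist_attains_inf[OF compact_imp_closed[OF compact_K] K_nonempty] by metis
      then show ?thesis using that B[of p] norm_triangle_sub[of z p] by (simp add: dist_norm)
    qed
    then show ?thesis by (auto simp: bounded_iff)
  qed
  then show "bounded (par_region \<delta>)"
    using bounded_inside_K by (auto simp: par_region_def intro: bounded_subset)
  have sd: "side * \<delta> \<noteq> 0" using \<delta> side(1) by auto
  show "AE z in lborel. z \<notin> (\<lambda>t. tube t \<delta>) ` {0..1} \<and>
     ((\<lambda>t. par1 \<delta> t / (tube t \<delta> - z)) has_integral two_pi_i * of_real orient * indicator (par_region \<delta>) z) {0..1}"
    using AE_infdist_neq[OF \<delta>] AE_not_in[OF null_K]
  proof eventually_elim
    case (elim z)
    have z: "z \<notin> (\<lambda>t. tube t \<delta>) ` {0..1}" using elim(1) infdist_tube[OF \<delta>(2)] by auto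
    have io: "z \<in> inside K \<or> z \<in> outside K" "\<not> (z \<in> inside K \<and> z \<in> outside K)"
      using elim(2) inside_Un_outside_K inside_Int_outside_K by blast+
    have "winding_number (\<lambda>t. tube t \<delta>) z = of_real orient * indicator (par_region \<delta>) z"
      unfolding winding_tube[OF \<delta> elim(1)] par_region_def
      using winding_g[of z] io sd elim(1) by (auto simp: indicator_def)
    then show ?case using winding_number_has_integral_C1[OF C1_loop_tube z] z by (simp add: mult.assoc)
  qed
qed

end

subsection \<open>The renormalized energy of a curve\<close>

lemma dominated_convergence_at_right:
  fixes F :: "real \<Rightarrow> 'a \<Rightarrow> 'b::{banach, second_countable_topology}"
  assumes eta: "0 < \<eta>" and F: "\<And>\<epsilon>. 0 < \<epsilon> \<Longrightarrow> \<epsilon> < \<eta> \<Longrightarrow> F \<epsilon> \<in> borel_measurable M"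
    and f: "f \<in> borel_measurable M"
    and lim: "AE x in M. ((\<lambda>\<epsilon>. F \<epsilon> x) \<longlongrightarrow> f x) (at_right 0)"
    and bd: "\<And>\<epsilon>. 0 < \<epsilon> \<Longrightarrow> \<epsilon> < \<eta> \<Longrightarrow> AE x in M. norm (F \<epsilon> x) \<le> w x"
    and w: "integrable M w"
  shows "((\<lambda>\<epsilon>. integral\<^sup>L M (F \<epsilon>)) \<longlongrightarrow> integral\<^sup>L M f) (at_right 0)"
  unfolding tendsto_at_iff_sequentially
proof (intro allI impI)
  fix X :: "nat \<Rightarrow> real"
  assume X: "\<forall>i. X i \<in> {0<..} - {0}" "X \<longlonglongrightarrow> 0"
  have X1: "filterlim X (at_right 0) sequentially"
    by (rule tendsto_imp_filterlim_at_right[OF X(2)]) (use X(1) in auto)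
  have "eventually (\<lambda>i. X i < \<eta>) sequentially" using X(2) eta by (rule order_tendstoD(2))
  then obtain n0 where n0: "\<And>i. i \<ge> n0 \<Longrightarrow> X i < \<eta>" by (auto simp: eventually_sequentially)
  have "(\<lambda>i. integral\<^sup>L M (F (X (i + n0)))) \<longlonglongrightarrow> integral\<^sup>L M f"
  proof (rule integral_dominated_convergence[OF f _ w])
    show "AE x in M. (\<lambda>i. F (X (i + n0)) x) \<longlonglongrightarrow> f x"
      using lim
    proof eventually_elim
      case (elim x)
      then have "(\<lambda>i. F (X i) x) \<longlonglongrightarrow> f x" using X1 by (rule filterlim_compose)
      then show ?case by (rule LIMSEQ_ignore_initial_segment)
    qed
    fix i
    have "X (i + n0) > 0" "X (i + n0) < \<eta>" using X n0[of "i + n0"] by auto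
    then show "F (X (i + n0)) \<in> borel_measurable M" "AE x in M. norm (F (X (i + n0)) x) \<le> w x"
      using F bd by auto
  qed
  then show "((\<lambda>\<epsilon>. integral\<^sup>L M (F \<epsilon>)) \<circ> X) \<longlonglongrightarrow> integral\<^sup>L M f"
    unfolding o_def by (rule LIMSEQ_offset)
qed

section \<open>Pairs of curve points as a torus\<close>

abbreviation half_interval :: "real measure" where
  "half_interval \<equiv> restrict_space lborel {-(1/2)..1/2}"

interpretation half_interval: finite_measure half_interval
  by (rule finite_measureI) (simp add: emeasure_restrict_space space_restrict_space)

interpretation torus: pair_sigma_finite unit_interval half_interval
  by unfold_locales

text \<open>A pair of curve points is stored as (t, h), standing for the parameters t and t + h. The
  diagonal becomes the line h = 0 in the middle, and the chord-arc bound is valid on the whole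
  domain.\<close>

abbreviation torus :: "(real \<times> real) measure" where
  "torus \<equiv> unit_interval \<Otimes>\<^sub>M half_interval"

interpretation torus_finite: finite_measure torus
  by (rule finite_measure_pair_measure) unfold_locales

lemma space_half_interval [simp]: "space half_interval = {-(1/2)..1/2}"
  by (simp add: space_restrict_space)

lemma space_torus [simp]: "space torus = {0..1} \<times> {-(1/2)..1/2}"
  by (simp add: space_pair_measure)

lemma measurable_half_interval:
  assumes "f \<in> borel_measurable borel"
  shows "f \<in> borel_measurable half_interval"
  using assms by (intro measurable_restrict_space1) simp

lemma measurable_torus_fst [measurable]: "fst \<in> borel_measurable torus"
  using measurable_compose[OF measurable_fst measurable_unit_interval[of "\<lambda>x. x"]] by simp

lemma measurable_torus_snd [measurable]: "snd \<in> borel_measurable torus"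
  using measurable_compose[OF measurable_snd measurable_half_interval[of "\<lambda>x. x"]] by simp

lemma measurable_torus_continuous:
  fixes f :: "real \<Rightarrow> 'b::{banach, second_countable_topology}"
  assumes "continuous_on UNIV f"
  shows "(\<lambda>p. f (fst p)) \<in> borel_measurable torus" "(\<lambda>p. f (fst p + snd p)) \<in> borel_measurable torus"
proof -
  have [measurable]: "f \<in> borel_measurable borel" using assms by (rule borel_measurable_continuous_onI)
  show "(\<lambda>p. f (fst p)) \<in> borel_measurable torus" "(\<lambda>p. f (fst p + snd p)) \<in> borel_measurable torus" by measurable
qed

lemma integrable_torus_bounded:
  fixes f :: "real \<times> real \<Rightarrow> 'b::{banach, second_countable_topology}"
  assumes "f \<in> borel_measurable torus" "\<And>t h. t \<in> {0..1} \<Longrightarrow> h \<in> {-(1/2)..1/2} \<Longrightarrow> norm (f (t, h)) \<le> B"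
  shows "integrable torus f"
  using assms by (intro torus_finite.integrable_const_bound[of _ B] AE_I2) auto

lemma half_interval_has_integral:
  fixes f :: "real \<Rightarrow> 'b::euclidean_space"
  assumes "integrable half_interval f"
  shows "(f has_integral integral\<^sup>L half_interval f) {-(1/2)..1/2}"
proof -
  have "set_integrable lborel {-(1/2)..1/2} f"
    using assms by (simp add: integrable_restrict_space set_integrable_def)
  then have "(f has_integral (LINT x:{-(1/2)..1/2}|lborel. f x)) {-(1/2)..1/2}"
    using set_borel_integral_eq_integral[of "{-(1/2)..1/2}" f] by (simp add: has_integral_integrable_integral)
  then show ?thesis
    by (simp add: integral_restrict_space set_lebesgue_integral_def)
qed

lemma unit_interval_integral_eq:
  fixes f :: "real \<Rightarrow> real"
  assumes "continuous_on UNIV f"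
  shows "integrable unit_interval f" "integral\<^sup>L unit_interval f = integral {0..1} f"
proof -
  have "continuous_on {0..1} f" using assms by (rule continuous_on_subset) simp
  then have s: "set_integrable lborel {0..1} f"
    by (intro borel_integrable_compact[unfolded set_integrable_def[symmetric]]) (auto simp: set_integrable_def borel_integrable_atLeastAtMost' intro!: borel_integrable_compact)
  then show "integrable unit_interval f"
    by (simp add: integrable_restrict_space set_integrable_def)
  show "integral\<^sup>L unit_interval f = integral {0..1} f"
    using set_borel_integral_eq_integral(2)[OF s] by (simp add: integral_restrict_space set_lebesgue_integral_def)
qed

lemma half_interval_neq_zero: "AE h in half_interval. h \<noteq> 0"
  by (subst AE_restrict_space_iff) (auto intro: AE_mp[OF AE_lborel_singleton[of 0]])

lemma torus_neq_zero: "AE p in torus. snd p \<noteq> 0"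
proof -
  have "AE t in unit_interval. AE h in half_interval. snd (t, h) \<noteq> 0"
    using half_interval_neq_zero by simp
  moreover have "{p \<in> space torus. snd p \<noteq> 0} \<in> sets torus" by measurable
  ultimately show ?thesis by (intro torus.AE_pair_measure) auto
qed

lemma periodic_half_interval:
  fixes f :: "real \<Rightarrow> complex"
  assumes [measurable]: "f \<in> borel_measurable borel" and per: "\<And>t. f (t + 1) = f t"
    and int: "integrable unit_interval f"
  shows "integrable half_interval (\<lambda>h. f (t + h))" and "(\<integral>h. f (t + h) \<partial>half_interval) = (\<integral>s. f s \<partial>unit_interval)"
proof -
  \<comment> \<open>The window of length 1 centred at \<open>t\<close> is [b, b + 1] moved by the
    integer \<open>k\<close>. It is cut at 1, and the second piece is shifted back by one period, so
    that \<open>A\<close> and \<open>B\<close> together fill the unit interval.\<close>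
  define k where "k = \<lfloor>t - 1/2\<rfloor>"
  define b where "b = frac (t - 1/2)"
  have "0 \<le> b" "b < 1" by (simp_all add: b_def frac_lt_1)
  moreover have "t = of_int k + b + 1/2" by (simp add: b_def k_def frac_def)
  ultimately have b: "0 \<le> b" "b < 1" "t = of_int k + b + 1/2" by auto
  have perk: "f (of_int m + x) = f x" for m x using periodic_shift_int[of f x m] per by (simp add: add.commute)
  have I01: "integrable lborel (\<lambda>x. indicator {0..1} x *\<^sub>R f x)"
    using int by (simp add: integrable_restrict_space set_integrable_def)
  have Isub: "integrable lborel (\<lambda>x. indicator S x *\<^sub>R f x)" if "S \<in> sets borel" "S \<subseteq> {0..1}" for S
    using I01
  proof (rule Bochner_Integration.integrable_bound)
    show "AE x in lborel. norm (indicator S x *\<^sub>R f x) \<le> norm (indicator {0..1} x *\<^sub>R f x)"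
      by (rule always_eventually, rule allI) (use that(2) in \<open>auto simp: indicator_def\<close>)
  qed (use that in measurable)
  have shift: "integrable lborel (\<lambda>h. F (h + a))" "(\<integral>h. F (h + a) \<partial>lborel) = (\<integral>x. F x \<partial>lborel)"
    if "integrable lborel F" for F :: "real \<Rightarrow> complex" and a
    using lborel_integrable_real_affine[OF that, of 1 a] lborel_integral_real_affine[of 1 F a] by (simp_all add: add.commute)
  define A where "A = (\<lambda>x. indicator {b..<1} x *\<^sub>R f x)"
  define B where "B = (\<lambda>x. indicator {0..<b} x *\<^sub>R f x)"
  have AB: "integrable lborel A" "integrable lborel B" unfolding A_def B_def using b by (auto intro!: Isub)
  have eq: "indicator {-(1/2)..<1/2} h *\<^sub>R f (t + h) = A (h + (b + 1/2)) + B (h + (b - 1/2))" for h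
  proof -
    have "f (t + h) = f (of_int k + (h + (b + 1/2)))" by (simp add: b(3) add_ac)
    then have 1: "f (t + h) = f (h + (b + 1/2))" by (simp only: perk)
    have "f (h + (b + 1/2)) = f (of_int 1 + (h + (b - 1/2)))" by (simp add: algebra_simps)
    then have 2: "f (h + (b + 1/2)) = f (h + (b - 1/2))" by (simp only: perk)
    show ?thesis unfolding A_def B_def 1 using 2 b by (auto simp: indicator_def)
  qed
  have int1: "integrable lborel (\<lambda>h. indicator {-(1/2)..<1/2} h *\<^sub>R f (t + h))"
    unfolding eq using shift(1)[OF AB(1)] shift(1)[OF AB(2)] by (rule Bochner_Integration.integrable_add)
  have ae1: "AE h in lborel. indicator {-(1/2)..<1/2::real} h *\<^sub>R f (t + h) = indicator {-(1/2)..1/2} h *\<^sub>R f (t + h)"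
    using AE_lborel_singleton[of "1/2::real"] by eventually_elim (auto simp: indicator_def)
  have "integrable lborel (\<lambda>h. indicator {-(1/2)..1/2} h *\<^sub>R f (t + h))"
    by (rule integrable_cong_AE_imp[OF int1 _ ]) (use ae1 in \<open>auto elim: eventually_mono\<close>)
  then show "integrable half_interval (\<lambda>h. f (t + h))"
    by (simp add: integrable_restrict_space set_integrable_def)
  have "(\<integral>h. f (t + h) \<partial>half_interval) = (\<integral>h. indicator {-(1/2)..1/2} h *\<^sub>R f (t + h) \<partial>lborel)"
    by (simp add: integral_restrict_space)
  also have "\<dots> = (\<integral>h. indicator {-(1/2)..<1/2} h *\<^sub>R f (t + h) \<partial>lborel)"
    by (rule integral_cong_AE) (use ae1 in \<open>auto elim: eventually_mono\<close>)
  also have "\<dots> = (\<integral>h. A h \<partial>lborel) + (\<integral>h. B h \<partial>lborel)"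
    unfolding eq using shift[OF AB(1)] shift[OF AB(2)] by simp
  also have "\<dots> = (\<integral>x. A x + B x \<partial>lborel)" using AB by simp
  also have "\<dots> = (\<integral>x. indicator {0..1} x *\<^sub>R f x \<partial>lborel)"
  proof (rule integral_cong_AE)
    show "AE x in lborel. A x + B x = indicator {0..1} x *\<^sub>R f x"
      using AE_lborel_singleton[of "1::real"] by eventually_elim (use b in \<open>auto simp: A_def B_def indicator_def\<close>)
  qed (simp_all add: A_def B_def)
  also have "\<dots> = (\<integral>s. f s \<partial>unit_interval)" by (simp add: integral_restrict_space)
  finally show "(\<integral>h. f (t + h) \<partial>half_interval) = (\<integral>s. f s \<partial>unit_interval)" .
qed

lemma half_interval_inverse_sqrt: "integrable half_interval (\<lambda>h. \<bar>h\<bar> powr (- (1/2)))"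
proof -
  define c :: real where "c = (1/2) powr (- (1/2) + 1) / (- (1/2) + 1)"
  have 1: "((\<lambda>h. \<bar>h\<bar> powr (- (1/2))) has_integral c) {0..1/2::real}"
    using has_integral_powr_from_0[of "- (1/2)" "1/2"] unfolding c_def
    by (rule has_integral_eq[rotated]) auto
  then have "((\<lambda>h. \<bar>- h\<bar> powr (- (1/2))) has_integral c) {- (1/2)..- (0::real)}"
    by (subst has_integral_reflect_real) simp
  then have "((\<lambda>h. \<bar>h\<bar> powr (- (1/2))) has_integral c) {- (1/2)..0::real}" by simp
  from has_integral_combine[OF _ _ this 1]
  have "((\<lambda>h. \<bar>h\<bar> powr (- (1/2))) has_integral c + c) {-(1/2)..1/2::real}" by simp
  then have "(\<lambda>h. \<bar>h\<bar> powr (- (1/2))) absolutely_integrable_on {-(1/2)..1/2::real}"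
    by (intro nonnegative_absolutely_integrable_1) (auto simp: integrable_on_def)
  then have "set_integrable lborel {-(1/2)..1/2} (\<lambda>h::real. \<bar>h\<bar> powr (- (1/2)))"
    unfolding set_integrable_def by (rule integrable_completion[THEN iffD1, rotated]) measurable
  then show ?thesis by (simp add: integrable_restrict_space set_integrable_def)
qed

lemma torus_inverse_sqrt: "integrable torus (\<lambda>p. \<bar>snd p\<bar> powr (- (1/2)))"
proof (rule torus.Fubini_integrable)
  show "(\<lambda>p. \<bar>snd p\<bar> powr (- (1/2))) \<in> borel_measurable torus" by measurable
qed (use half_interval_inverse_sqrt in simp_all)

section \<open>Integration by parts along the curve\<close>

lemma log_kernel_bound:
  assumes \<epsilon>: "\<epsilon> > 0" and r: "r > 0"
  shows "\<bar>log_kernel \<epsilon> r\<bar> \<le> pi\<^sup>2 / \<epsilon>\<^sup>2 * (1 + 4 * sqrt \<epsilon> * r powr (- (1/2)))"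
proof (cases "r > \<epsilon>")
  case True
  have "pi\<^sup>2 / r\<^sup>2 \<le> pi\<^sup>2 / \<epsilon>\<^sup>2" using True \<epsilon> by (intro divide_left_mono) (auto simp: power_mono)
  also have "\<dots> \<le> pi\<^sup>2 / \<epsilon>\<^sup>2 * (1 + 4 * sqrt \<epsilon> * r powr (- (1/2)))"
    using \<epsilon> mult_left_mono[of 1 "1 + 4 * sqrt \<epsilon> * r powr (- (1/2))" "pi\<^sup>2 / \<epsilon>\<^sup>2"] by simp
  finally show ?thesis using True by (simp add: log_kernel_def)
next
  case False
  \<comment> \<open>The logarithm is 4 ln y and ln y \<le> y; this trades it for the power -1/2 of
    \<open>r\<close>, whose integrability along the curve is already at hand.\<close>
  define y where "y = sqrt (\<epsilon> / r)"
  have y: "y > 0" "y ^ 4 = \<epsilon>\<^sup>2 / r\<^sup>2" "y \<ge> 1"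
  proof -
    show "y > 0" using \<epsilon> r by (simp add: y_def)
    have "y ^ 4 = (y\<^sup>2)\<^sup>2" by simp
    also have "y\<^sup>2 = \<epsilon> / r" using \<epsilon> r by (simp add: y_def)
    finally show "y ^ 4 = \<epsilon>\<^sup>2 / r\<^sup>2" by (simp add: power_divide)
    show "y \<ge> 1" using False r by (simp add: y_def)
  qed
  have l: "ln (\<epsilon>\<^sup>2 / r\<^sup>2) = 4 * ln y" using y(1) by (simp add: y(2)[symmetric] ln_realpow)
  have "ln y \<ge> 0" "ln y \<le> y" using y ln_le_minus_one[of y] by auto
  moreover have "y = sqrt \<epsilon> * r powr (- (1/2))"
    using \<epsilon> r by (simp add: y_def real_sqrt_divide powr_half_sqrt powr_minus_divide)
  ultimately have "0 \<le> 1 + ln (\<epsilon>\<^sup>2 / r\<^sup>2)" "1 + ln (\<epsilon>\<^sup>2 / r\<^sup>2) \<le> 1 + 4 * sqrt \<epsilon> * r powr (- (1/2))" unfolding l by auto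
  then show ?thesis using False \<epsilon> by (auto simp: log_kernel_def abs_mult intro!: divide_right_mono mult_left_mono)
qed

text \<open>The product r * \<open>primitive_kernel\<close> is the primitive of
  \<open>log_kernel\<close> / (4 pi^2) that vanishes at infinity. Below the cut its constant of
  integration is -1 / \<epsilon>, by continuity at r = \<epsilon>; the resulting term -1 /
  (\<epsilon> r) is what produces the divergence of the energy.\<close>

definition primitive_kernel :: "real \<Rightarrow> real \<Rightarrow> real" where
  "primitive_kernel \<epsilon> r = (if r \<le> \<epsilon> then 3 / (4 * \<epsilon>\<^sup>2) - 1 / (\<epsilon> * r) - ln (r / \<epsilon>) / (2 * \<epsilon>\<^sup>2) else - 1 / (4 * r\<^sup>2))"

text \<open>r^2 times the derivative of \<open>primitive_kernel\<close>. It equals 1 / (2 r) beyond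
  the cut and never exceeds 1 / r, which supplies limit and domination as \<epsilon> tends to
  0.\<close>

definition cut_inverse :: "real \<Rightarrow> real \<Rightarrow> real" where
  "cut_inverse \<epsilon> r = (if r \<le> \<epsilon> then 1 / \<epsilon> - r / (2 * \<epsilon>\<^sup>2) else 1 / (2 * r))"

lemma log_kernel_primitive:
  assumes "\<epsilon> > 0" "r > 0"
  shows "log_kernel \<epsilon> r / (4 * pi\<^sup>2) = primitive_kernel \<epsilon> r + cut_inverse \<epsilon> r / r"
proof (cases "r \<le> \<epsilon>")
  case True
  have "ln (\<epsilon>\<^sup>2 / r\<^sup>2) = - 2 * ln (r / \<epsilon>)" using assms by (simp add: ln_div ln_realpow)
  then show ?thesis using True assms
    by (simp add: log_kernel_def primitive_kernel_def cut_inverse_def field_simps power2_eq_square)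
next
  case False
  then show ?thesis using assms
    by (simp add: log_kernel_def primitive_kernel_def cut_inverse_def field_simps power2_eq_square)
qed

lemma primitive_kernel_deriv:
  assumes \<epsilon>: "\<epsilon> > 0" and r: "r > 0"
  shows "(primitive_kernel \<epsilon> has_real_derivative cut_inverse \<epsilon> r / r\<^sup>2) (at r)"
proof -
  define f1 where "f1 = (\<lambda>r. 3 / (4 * \<epsilon>\<^sup>2) - 1 / (\<epsilon> * r) - ln (r / \<epsilon>) / (2 * \<epsilon>\<^sup>2))"
  define f2 where "f2 = (\<lambda>r::real. - 1 / (4 * r\<^sup>2))"
  have d1: "(f1 has_real_derivative (1 / \<epsilon> - r / (2 * \<epsilon>\<^sup>2)) / r\<^sup>2) (at r)" if "r > 0" for r
    unfolding f1_def using that \<epsilon>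
    by (auto intro!: derivative_eq_intros simp: field_simps power2_eq_square)
  have d2: "(f2 has_real_derivative (1 / (2 * r)) / r\<^sup>2) (at r)" if "r > 0" for r
    unfolding f2_def using that
    by (auto intro!: derivative_eq_intros simp: field_simps power2_eq_square)
  have pk: "primitive_kernel \<epsilon> = (\<lambda>r. if r \<in> {..\<epsilon>} then f1 r else f2 r)"
    by (auto simp: primitive_kernel_def f1_def f2_def)
  consider "r < \<epsilon>" | "r > \<epsilon>" | "r = \<epsilon>" by linarith
  then show ?thesis
  proof cases
    case 1
    have "eventually (\<lambda>x. primitive_kernel \<epsilon> x = f1 x) (nhds r)"
      using eventually_nhds_in_open[of "{..<\<epsilon>}" r] 1 by (auto simp: pk elim!: eventually_mono)
    from DERIV_cong_ev[OF refl this refl] d1[OF r] 1 show ?thesis by (simp add: cut_inverse_def)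
  next
    case 2
    have "eventually (\<lambda>x. primitive_kernel \<epsilon> x = f2 x) (nhds r)"
      using eventually_nhds_in_open[of "{\<epsilon><..}" r] 2 by (auto simp: pk elim!: eventually_mono)
    from DERIV_cong_ev[OF refl this refl] d2[OF r] 2 show ?thesis by (simp add: cut_inverse_def)
  next
    case 3
    \<comment> \<open>At the cut both branches have the same value and the same slope, so the
      one-sided derivatives can be glued.\<close>
    have e: "cut_inverse \<epsilon> r = 1 / \<epsilon> - r / (2 * \<epsilon>\<^sup>2)" "cut_inverse \<epsilon> r = 1 / (2 * r)"
      using 3 \<epsilon> by (simp_all add: cut_inverse_def field_simps power2_eq_square)
    have same: "f1 \<epsilon> = f2 \<epsilon>" using \<epsilon> by (simp add: f1_def f2_def field_simps power2_eq_square)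
    have "((\<lambda>r. if r \<in> {..\<epsilon>} then f1 r else f2 r) has_derivative
        (if r \<in> {..\<epsilon>} then (*) (cut_inverse \<epsilon> r / r\<^sup>2) else (*) (cut_inverse \<epsilon> r / r\<^sup>2))) (at r within {..\<epsilon>} \<union> {\<epsilon>..})"
    proof (rule has_derivative_If_within_closures)
      show "(f1 has_derivative (*) (cut_inverse \<epsilon> r / r\<^sup>2)) (at r within {..\<epsilon>} \<union> closure {..\<epsilon>} \<inter> closure {\<epsilon>..})"
        using d1[OF r, folded e(1)] unfolding has_field_derivative_def by (rule has_derivative_at_withinI)
      show "(f2 has_derivative (*) (cut_inverse \<epsilon> r / r\<^sup>2)) (at r within {\<epsilon>..} \<union> closure {..\<epsilon>} \<inter> closure {\<epsilon>..})"
        using d2[OF r, folded e(2)] unfolding has_field_derivative_def by (rule has_derivative_at_withinI)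
    qed (use same 3 in auto)
    moreover have "{..\<epsilon>} \<union> {\<epsilon>..} = (UNIV :: real set)" by auto
    ultimately show ?thesis unfolding has_field_derivative_def pk by simp
  qed
qed

lemma cut_inverse_bounds:
  assumes "\<epsilon> > 0" "r > 0"
  shows "0 \<le> cut_inverse \<epsilon> r" "cut_inverse \<epsilon> r \<le> 1 / r"
proof -
  show "0 \<le> cut_inverse \<epsilon> r"
  proof (cases "r \<le> \<epsilon>")
    case True
    have "r / (2 * \<epsilon>\<^sup>2) \<le> \<epsilon> / (2 * \<epsilon>\<^sup>2)" using True assms by (intro divide_right_mono) auto
    also have "\<dots> \<le> 1 / \<epsilon>" using assms by (simp add: power2_eq_square field_simps)
    finally show ?thesis using True by (simp add: cut_inverse_def)
  qed (use assms in \<open>simp add: cut_inverse_def\<close>)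
  show "cut_inverse \<epsilon> r \<le> 1 / r"
  proof (cases "r \<le> \<epsilon>")
    case True
    have "1 / \<epsilon> \<le> 1 / r" using True assms by (intro divide_left_mono) auto
    moreover have "0 \<le> r / (2 * \<epsilon>\<^sup>2)" using assms by simp
    ultimately have "1 / \<epsilon> - r / (2 * \<epsilon>\<^sup>2) \<le> 1 / r" by linarith
    then show ?thesis using True by (simp add: cut_inverse_def)
  next
    case False
    have "1 / (2 * r) \<le> 1 / r" using assms by (simp add: field_simps)
    then show ?thesis using False by (simp add: cut_inverse_def)
  qed
qed

lemma measurable_cut_inverse [measurable]: "cut_inverse \<epsilon> \<in> borel_measurable borel"
  unfolding cut_inverse_def[abs_def] by measurable

context C2_curve
begin

definition chord :: "real \<Rightarrow> real \<Rightarrow> complex" where "chord t h = g (t + h) - g t"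

text \<open>Up to the square of the chord length, the product of the components of the two
  velocities normal to the chord. Each factor is of order h^2, so the product matches the fourth
  power of the chord and the energy density stays bounded at the diagonal.\<close>

definition normal_product :: "real \<Rightarrow> real \<Rightarrow> real" where
  "normal_product t h = Im (g1 (t + h) * cnj (chord t h)) * Im (g1 t * cnj (chord t h))"

definition energy_density :: "real \<Rightarrow> real \<Rightarrow> real" where
  "energy_density t h = normal_product t h / norm (chord t h) ^ 4"

text \<open>The factor 1/2 is the limit of r * \<open>cut_inverse\<close>, and the sign comes from
  subtracting the integral in the renormalized energy.\<close>

definition energy :: real where
  "energy = - (1/2) * (\<integral>p. energy_density (fst p) (snd p) \<partial>torus)"

definition len :: real where "len = integral {0..1} (\<lambda>t. norm (g1 t))"

lemma chord_lower: "\<bar>h\<bar> \<le> 1/2 \<Longrightarrow> bc * \<bar>h\<bar> \<le> norm (chord t h)"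
  using chord_ge by (simp add: chord_def)

lemma chord_pos: "\<bar>h\<bar> \<le> 1/2 \<Longrightarrow> h \<noteq> 0 \<Longrightarrow> norm (chord t h) > 0"
  using chord_lower[of h t] bc_pos mult_pos_pos[of bc "\<bar>h\<bar>"] by linarith

lemma Im_g1_chord: "\<bar>Im (g1 t * cnj (chord t h))\<bar> \<le> bM * h\<^sup>2"
  using Im_chord by (simp add: chord_def)

lemma Im_g1_chord': "\<bar>Im (g1 (t + h) * cnj (chord t h))\<bar> \<le> bM * h\<^sup>2"
proof -
  have "chord t h = - chord (t + h) (- h)" by (simp add: chord_def)
  then show ?thesis using Im_g1_chord[of "t + h" "- h"] by simp
qed

lemma normal_product_bound: "\<bar>normal_product t h\<bar> \<le> bM\<^sup>2 * h ^ 4"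
proof -
  have "\<bar>normal_product t h\<bar> \<le> (bM * h\<^sup>2) * (bM * h\<^sup>2)"
    unfolding normal_product_def abs_mult using bM_pos
    by (intro mult_mono Im_g1_chord Im_g1_chord') auto
  then show ?thesis by (simp add: power2_eq_square power4_eq_xxxx mult_ac)
qed

lemma energy_density_bound:
  assumes "\<bar>h\<bar> \<le> 1/2"
  shows "\<bar>energy_density t h\<bar> \<le> bM\<^sup>2 / bc ^ 4"
proof (cases "h = 0")
  case True
  then show ?thesis by (simp add: energy_density_def chord_def)
next
  case False
  have "(bc * \<bar>h\<bar>) ^ 4 \<le> norm (chord t h) ^ 4" using chord_lower[OF assms] bc_pos by (intro power_mono) auto
  then have le: "bc ^ 4 * h ^ 4 \<le> norm (chord t h) ^ 4" by (simp add: power_mult_distrib)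
  have "h ^ 4 > 0" using False by simp
  then have "\<bar>energy_density t h\<bar> \<le> (bM\<^sup>2 * h ^ 4) / (bc ^ 4 * h ^ 4)"
    unfolding energy_density_def abs_divide using normal_product_bound[of t h] le bc_pos bM_pos by (intro frac_le) auto
  then show ?thesis using False by simp
qed

lemma measurable_torus_curve [measurable]:
  "(\<lambda>p. g1 (fst p)) \<in> borel_measurable torus" "(\<lambda>p. g1 (fst p + snd p)) \<in> borel_measurable torus"
  "(\<lambda>p. chord (fst p) (snd p)) \<in> borel_measurable torus"
  unfolding chord_def
  using measurable_torus_continuous[OF cont_g] measurable_torus_continuous[OF cont_g1]
  by (auto intro!: borel_measurable_diff)

lemma measurable_Re_Im [measurable]: "Re \<in> borel_measurable borel" "Im \<in> borel_measurable borel"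
  by (intro borel_measurable_continuous_onI continuous_intros)+

lemma measurable_energy_density [measurable]:
  "(\<lambda>p. normal_product (fst p) (snd p)) \<in> borel_measurable torus"
  "(\<lambda>p. energy_density (fst p) (snd p)) \<in> borel_measurable torus"
  unfolding normal_product_def energy_density_def by measurable

text \<open>Both sides are the real part of the first velocity times the conjugate of the second,
  each multiplied by \<open>cnj (chord t h)\<close>. It exchanges tangential for normal components,
  at the price of a term that the log kernel contains.\<close>

lemma chord_product_identity:
  "Re (g1 t * cnj (chord t h)) * Re (g1 (t + h) * cnj (chord t h)) + normal_product t h
    = (norm (chord t h))\<^sup>2 * Re (g1 (t + h) * cnj (g1 t))"
  unfolding normal_product_def cmod_power2 by (simp add: algebra_simps power2_eq_square)

definition boundary_term :: "real \<Rightarrow> real \<Rightarrow> real \<Rightarrow> real" where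
  "boundary_term \<epsilon> t h = Re (g1 t * cnj (chord t h)) * primitive_kernel \<epsilon> (norm (chord t h))"

lemma deriv_chord: "(chord t has_vector_derivative g1 (t + h)) (at h)"
proof -
  have "((\<lambda>h. g (h + t) - g t) has_vector_derivative g1 (h + t) - 0) (at h)"
    using vector_diff_chain_at[OF shift_deriv, of g "g1 (h + t)" h t] deriv_g[of "h + t"]
    by (intro has_vector_derivative_diff) (auto simp: o_def)
  then show ?thesis by (simp add: chord_def[abs_def] add.commute)
qed

lemma deriv_norm_chord:
  assumes "chord t h \<noteq> 0"
  shows "((\<lambda>h. norm (chord t h)) has_real_derivative Re (g1 (t + h) * cnj (chord t h)) / norm (chord t h)) (at h)"
proof -
  have "((norm \<circ> chord t) has_derivative ((\<lambda>y. y \<bullet> sgn (chord t h)) \<circ> (\<lambda>y. y *\<^sub>R g1 (t + h)))) (at h)"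
    using deriv_chord has_derivative_norm[OF assms] by (intro diff_chain_at) (auto simp: has_vector_derivative_def)
  moreover have "((\<lambda>y. y \<bullet> sgn (chord t h)) \<circ> (\<lambda>y. y *\<^sub>R g1 (t + h))) = (*) (Re (g1 (t + h) * cnj (chord t h)) / norm (chord t h))"
  proof
    fix y :: real
    have "g1 (t + h) \<bullet> sgn (chord t h) = Re (g1 (t + h) * cnj (chord t h)) / norm (chord t h)"
    proof -
      have "g1 (t + h) \<bullet> chord t h = Re (g1 (t + h) * cnj (chord t h))" by (simp add: inner_complex_def)
      then show ?thesis by (simp only: sgn_div_norm inner_scaleR_right divide_inverse mult.commute)
    qed
    then show "((\<lambda>y. y \<bullet> sgn (chord t h)) \<circ> (\<lambda>y. y *\<^sub>R g1 (t + h))) y = Re (g1 (t + h) * cnj (chord t h)) / norm (chord t h) * y"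
      by (simp add: mult.commute)
  qed
  ultimately show ?thesis by (simp add: has_field_derivative_def o_def)
qed

lemma deriv_Re_chord: "((\<lambda>h. Re (c * cnj (chord t h))) has_real_derivative Re (c * cnj (g1 (t + h)))) (at h)"
proof -
  have "((\<lambda>h. Re (c * cnj (chord t h))) has_vector_derivative Re (c * cnj (g1 (t + h)))) (at h)"
    using deriv_chord[of t h]
    by (intro bounded_linear.has_vector_derivative[OF bounded_linear_Re] has_vector_derivative_mult_right
        bounded_linear.has_vector_derivative[OF bounded_linear_cnj])
  then show ?thesis by (simp add: has_real_derivative_iff_has_vector_derivative)
qed

text \<open>The derivative falls on the linear factor, giving \<open>primitive_kernel\<close>, and
  on the radial factor, giving a product of two tangential components. The identity above turns the
  latter into q / r times the inner product of the velocities minus the normal product, and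
  \<open>log_kernel_primitive\<close> reassembles the log kernel.\<close>

lemma deriv_boundary_term:
  fixes \<epsilon> t h :: real
  assumes \<epsilon>: "\<epsilon> > 0" and h: "\<bar>h\<bar> \<le> 1/2" "h \<noteq> 0"
  defines "r \<equiv> norm (chord t h)"
  shows "(boundary_term \<epsilon> t has_real_derivative
     log_kernel \<epsilon> r / (4 * pi\<^sup>2) * Re (g1 (t + h) * cnj (g1 t)) - cut_inverse \<epsilon> r * normal_product t h / r ^ 3) (at h)"
proof -
  have r: "r > 0" "chord t h \<noteq> 0" using chord_pos[OF h, of t] by (auto simp: r_def)
  define A where "A = Re (g1 t * cnj (chord t h))"
  define B where "B = Re (g1 (t + h) * cnj (chord t h))"
  define C where "C = Re (g1 (t + h) * cnj (g1 t))"
  define q where "q = cut_inverse \<epsilon> r"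
  define N where "N = normal_product t h"
  have id: "A * B + N = r\<^sup>2 * C" unfolding A_def B_def C_def r_def N_def by (rule chord_product_identity)
  have "((\<lambda>h. primitive_kernel \<epsilon> (norm (chord t h))) has_real_derivative q / r\<^sup>2 * (B / r)) (at h)"
    unfolding q_def r_def B_def using r
    by (intro DERIV_chain2[OF primitive_kernel_deriv[OF \<epsilon>] deriv_norm_chord]) (auto simp: r_def)
  note dp = this
  have "((\<lambda>h. Re (g1 t * cnj (chord t h))) has_real_derivative C) (at h)"
    using deriv_Re_chord[of "g1 t" t h] by (simp add: C_def mult.commute)
  from DERIV_mult[OF this dp]
  have "(boundary_term \<epsilon> t has_real_derivative (A * (q / r\<^sup>2 * (B / r)) + C * primitive_kernel \<epsilon> r)) (at h)"
    unfolding boundary_term_def[abs_def] A_def r_def by (simp only: mult.commute add.commute)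
  moreover have "A * (q / r\<^sup>2 * (B / r)) + C * primitive_kernel \<epsilon> r
      = log_kernel \<epsilon> r / (4 * pi\<^sup>2) * C - q * N / r ^ 3"
  proof -
    have "A * (q / r\<^sup>2 * (B / r)) = q * (A * B) / r ^ 3" by (simp add: power2_eq_square power3_eq_cube)
    also have "A * B = r\<^sup>2 * C - N" using id by simp
    also have "q * (r\<^sup>2 * C - N) / r ^ 3 = q / r * C - q * N / r ^ 3"
      using r by (simp add: field_simps power2_eq_square power3_eq_cube)
    finally have 1: "A * (q / r\<^sup>2 * (B / r)) = q / r * C - q * N / r ^ 3" .
    have 2: "log_kernel \<epsilon> r / (4 * pi\<^sup>2) = primitive_kernel \<epsilon> r + q / r"
      unfolding q_def by (rule log_kernel_primitive[OF \<epsilon> r(1)])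
    show ?thesis unfolding 1 2 by (simp add: algebra_simps)
  qed
  ultimately show ?thesis by (simp add: q_def N_def C_def)
qed

lemma chord_over_h: "((\<lambda>h. chord t h /\<^sub>R h) \<longlongrightarrow> g1 t) (at 0)"
proof -
  have "((\<lambda>h. chord t h /\<^sub>R h - g1 t) \<longlongrightarrow> 0) (at 0)"
  proof (rule Lim_null_comparison)
    show "eventually (\<lambda>h. norm (chord t h /\<^sub>R h - g1 t) \<le> bM * \<bar>h\<bar>) (at 0)"
      unfolding eventually_at_filter
    proof (rule always_eventually, intro allI impI)
      fix h :: real assume h: "h \<noteq> 0"
      have "h *\<^sub>R (chord t h /\<^sub>R h - g1 t) = g (t + h) - g t - h *\<^sub>R g1 t"
        using h by (simp add: chord_def scaleR_diff_right)
      then have "\<bar>h\<bar> * norm (chord t h /\<^sub>R h - g1 t) \<le> bM * h\<^sup>2"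
        using g_taylor[of t h] by (metis norm_scaleR)
      also have "bM * h\<^sup>2 = \<bar>h\<bar> * (bM * \<bar>h\<bar>)" by (simp add: power2_eq_square)
      finally show "norm (chord t h /\<^sub>R h - g1 t) \<le> bM * \<bar>h\<bar>" using h by simp
    qed
    have "((\<lambda>h. bM * \<bar>h\<bar>) \<longlongrightarrow> bM * \<bar>0\<bar>) (at 0)" by (intro tendsto_intros)
    then show "((\<lambda>h. bM * \<bar>h\<bar>) \<longlongrightarrow> 0) (at 0)" by simp
  qed
  then show ?thesis by (rule LIM_zero_cancel)
qed

text \<open>Near h = 0 the linear factor behaves like |g1|^2 h, and the radial factor like -1 /
  (\<epsilon> |g1| |h|), since the logarithm is killed by the extra power of r. The one-sided limits
  thus differ by a sign, and multiplying by \<open>sgn h\<close> treats both at once.\<close>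

lemma boundary_term_limits:
  assumes \<epsilon>: "\<epsilon> > 0"
  shows "(boundary_term \<epsilon> t \<longlongrightarrow> - norm (g1 t) / \<epsilon>) (at_right 0)"
    and "(boundary_term \<epsilon> t \<longlongrightarrow> norm (g1 t) / \<epsilon>) (at_left 0)"
proof -
  define A where "A = (\<lambda>h. Re (g1 t * cnj (chord t h)))"
  define r where "r = (\<lambda>h. norm (chord t h))"
  have gn: "norm (g1 t) > 0" using regular by simp
  have Ah: "((\<lambda>h. A h / h) \<longlongrightarrow> (norm (g1 t))\<^sup>2) (at 0)"
  proof -
    have "((\<lambda>h. Re (g1 t * cnj (chord t h /\<^sub>R h))) \<longlongrightarrow> Re (g1 t * cnj (g1 t))) (at 0)"
      by (intro tendsto_intros chord_over_h)
    moreover have "Re (g1 t * cnj (g1 t)) = (norm (g1 t))\<^sup>2" using cmod_power2[of "g1 t"] by (simp add: power2_eq_square)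
    moreover have "(\<lambda>h. Re (g1 t * cnj (chord t h /\<^sub>R h))) = (\<lambda>h. A h / h)"
      by (auto simp: A_def field_simps)
    ultimately show ?thesis by simp
  qed
  have rh: "((\<lambda>h. r h / \<bar>h\<bar>) \<longlongrightarrow> norm (g1 t)) (at 0)"
  proof -
    have "((\<lambda>h. norm (chord t h /\<^sub>R h)) \<longlongrightarrow> norm (g1 t)) (at 0)"
      by (intro tendsto_intros chord_over_h)
    then show ?thesis by (simp add: r_def divide_inverse mult.commute)
  qed
  have r0: "(r \<longlongrightarrow> 0) (at 0)"
  proof -
    have "isCont (chord t) 0" using deriv_chord[of t 0] by (rule has_vector_derivative_continuous)
    then have "(chord t \<longlongrightarrow> chord t 0) (at 0)" by (simp add: isCont_def)
    from tendsto_norm[OF this] show ?thesis by (simp add: r_def chord_def)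
  qed
  have ev: "eventually (\<lambda>h. \<bar>h\<bar> \<le> 1/2 \<and> h \<noteq> 0) (at (0::real))"
    unfolding eventually_at by (rule exI[of _ "1/2"]) (auto simp: dist_real_def)
  have evr: "eventually (\<lambda>h. r h > 0) (at 0)"
    using ev
  proof eventually_elim
    case (elim h)
    then show ?case using chord_pos[of h t] by (simp add: r_def)
  qed
  have fr: "filterlim r (at_right 0) (at 0)"
    using r0 evr by (auto simp: filterlim_at elim: eventually_mono)
  have rle: "eventually (\<lambda>h. r h \<le> \<epsilon>) (at 0)"
    using order_tendstoD(2)[OF r0 \<epsilon>] by (auto elim: eventually_mono)
  have xlnx: "((\<lambda>x::real. x * ln (x / \<epsilon>)) \<longlongrightarrow> 0) (at_right 0)" using \<epsilon> by real_asymp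
  have rlnr: "((\<lambda>h. r h * ln (r h / \<epsilon>)) \<longlongrightarrow> 0) (at 0)"
    by (rule filterlim_compose[OF xlnx fr])
  have Ar: "((\<lambda>h. sgn h * (A h / r h)) \<longlongrightarrow> norm (g1 t)) (at 0)"
  proof -
    have "((\<lambda>h. (A h / h) / (r h / \<bar>h\<bar>)) \<longlongrightarrow> (norm (g1 t))\<^sup>2 / norm (g1 t)) (at 0)"
      using gn by (intro tendsto_divide Ah rh) auto
    moreover have "(norm (g1 t))\<^sup>2 / norm (g1 t) = norm (g1 t)" using gn by (simp add: power2_eq_square)
    ultimately have "((\<lambda>h. (A h / h) / (r h / \<bar>h\<bar>)) \<longlongrightarrow> norm (g1 t)) (at 0)" by (simp only:)
    moreover have "eventually (\<lambda>h. (A h / h) / (r h / \<bar>h\<bar>) = sgn h * (A h / r h)) (at 0)"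
      using ev by eventually_elim (auto simp: sgn_if)
    ultimately show ?thesis by (rule Lim_transform_eventually)
  qed
  have main: "((\<lambda>h. sgn h * boundary_term \<epsilon> t h) \<longlongrightarrow> - norm (g1 t) / \<epsilon>) (at 0)"
  proof -
    have "((\<lambda>h. (sgn h * (A h / r h)) * (3 / (4 * \<epsilon>\<^sup>2) * r h - 1 / \<epsilon> - r h * ln (r h / \<epsilon>) / (2 * \<epsilon>\<^sup>2)))
        \<longlongrightarrow> norm (g1 t) * (3 / (4 * \<epsilon>\<^sup>2) * 0 - 1 / \<epsilon> - 0 / (2 * \<epsilon>\<^sup>2))) (at 0)"
      using \<epsilon> by (intro tendsto_intros Ar r0 rlnr) auto
    moreover have "eventually (\<lambda>h. (sgn h * (A h / r h)) * (3 / (4 * \<epsilon>\<^sup>2) * r h - 1 / \<epsilon> - r h * ln (r h / \<epsilon>) / (2 * \<epsilon>\<^sup>2))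
        = sgn h * boundary_term \<epsilon> t h) (at 0)"
      using evr rle
    proof eventually_elim
      case (elim h)
      have "(A h / r h) * (3 / (4 * \<epsilon>\<^sup>2) * r h - 1 / \<epsilon> - r h * ln (r h / \<epsilon>) / (2 * \<epsilon>\<^sup>2))
        = A h * (3 / (4 * \<epsilon>\<^sup>2) - 1 / (\<epsilon> * r h) - ln (r h / \<epsilon>) / (2 * \<epsilon>\<^sup>2))"
        using elim(1) \<epsilon> by (simp add: right_diff_distrib)
      also have "\<dots> = boundary_term \<epsilon> t h"
        using elim(2) by (simp add: boundary_term_def primitive_kernel_def A_def r_def)
      finally show ?case by (simp only: mult.assoc)
    qed
    ultimately show ?thesis by (rule Lim_transform_eventually[THEN tendsto_eq_rhs]) simp
  qed
  have "((\<lambda>h. sgn h * boundary_term \<epsilon> t h) \<longlongrightarrow> - norm (g1 t) / \<epsilon>) (at_right 0)"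
    using main by (rule filterlim_mono[OF _ order_refl at_le]) simp
  moreover have "eventually (\<lambda>h. sgn h * boundary_term \<epsilon> t h = boundary_term \<epsilon> t h) (at_right 0)"
    by (auto simp: eventually_at_filter)
  ultimately show "(boundary_term \<epsilon> t \<longlongrightarrow> - norm (g1 t) / \<epsilon>) (at_right 0)" by (rule Lim_transform_eventually)
  have "((\<lambda>h. - (sgn h * boundary_term \<epsilon> t h)) \<longlongrightarrow> - (- norm (g1 t) / \<epsilon>)) (at_left 0)"
    using main by (intro tendsto_minus) (rule filterlim_mono[OF _ order_refl at_le], auto)
  moreover have "eventually (\<lambda>h. - (sgn h * boundary_term \<epsilon> t h) = boundary_term \<epsilon> t h) (at_left 0)"
    by (auto simp: eventually_at_filter)
  ultimately show "(boundary_term \<epsilon> t \<longlongrightarrow> norm (g1 t) / \<epsilon>) (at_left 0)"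
    by (rule Lim_transform_eventually[THEN tendsto_eq_rhs]) simp
qed

text \<open>The ends h = 1/2 and h = -1/2 belong to the same chord and cancel by periodicity. Only
  the jump of the boundary term at h = 0 survives; integrated over \<open>t\<close> it is the
  divergence 2 L / \<epsilon>.\<close>

lemma boundary_integral:
  assumes \<epsilon>: "\<epsilon> > 0"
  shows "((\<lambda>h. log_kernel \<epsilon> (norm (chord t h)) / (4 * pi\<^sup>2) * Re (g1 (t + h) * cnj (g1 t))
      - cut_inverse \<epsilon> (norm (chord t h)) * normal_product t h / norm (chord t h) ^ 3) has_integral 2 * norm (g1 t) / \<epsilon>) {-(1/2)..1/2}"
proof -
  let ?f = "\<lambda>h. log_kernel \<epsilon> (norm (chord t h)) / (4 * pi\<^sup>2) * Re (g1 (t + h) * cnj (g1 t))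
      - cut_inverse \<epsilon> (norm (chord t h)) * normal_product t h / norm (chord t h) ^ 3"
  define G where "G = norm (g1 t) / \<epsilon>"
  \<comment> \<open>\<open>R\<close> and \<open>L\<close> extend the boundary term continuously from
    the right and from the left; the fundamental theorem is applied on each half separately.\<close>
  define R where "R = (\<lambda>h. if h = 0 then - G else boundary_term \<epsilon> t h)"
  define L where "L = (\<lambda>h. if h = 0 then G else boundary_term \<epsilon> t h)"
  have dB: "(F has_vector_derivative ?f h) (at h)" if "\<bar>h\<bar> \<le> 1/2" "h \<noteq> 0" "F = R \<or> F = L" for F h
  proof -
    have "eventually (\<lambda>x. F x = boundary_term \<epsilon> t x) (nhds h)"
    proof -
      have "eventually (\<lambda>x. x \<in> - {0}) (nhds h)" using that(2) by (intro eventually_nhds_in_open) auto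
      then show ?thesis by eventually_elim (use that(3) in \<open>auto simp: R_def L_def\<close>)
    qed
    from DERIV_cong_ev[OF refl this refl] deriv_boundary_term[OF \<epsilon> that(1,2)]
    show ?thesis by (simp add: has_real_derivative_iff_has_vector_derivative[symmetric])
  qed
  have cont_nz: "continuous (at h within S) F" if "\<bar>h\<bar> \<le> 1/2" "h \<noteq> 0" "F = R \<or> F = L" for F h S
    using has_vector_derivative_continuous[OF dB[OF that]] by (rule continuous_at_imp_continuous_at_within)
  have R: "(?f has_integral R (1/2) - R 0) {0..1/2}"
  proof (rule fundamental_theorem_of_calculus_interior)
    show "continuous_on {0..1/2} R"
      unfolding continuous_on_eq_continuous_within
    proof
      fix h :: real assume h: "h \<in> {0..1/2}"
      show "continuous (at h within {0..1/2}) R"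
      proof (cases "h = 0")
        case True
        have "(boundary_term \<epsilon> t \<longlongrightarrow> - G) (at_right 0)" using boundary_term_limits(1)[OF \<epsilon>, of t] by (simp add: G_def)
        then have "(R \<longlongrightarrow> - G) (at_right 0)"
          by (rule Lim_transform_eventually) (auto simp: R_def eventually_at_filter)
        then have "(R \<longlongrightarrow> - G) (at 0 within {0..1/2})" by (simp add: at_within_Icc_at_right)
        then show ?thesis using True by (simp add: continuous_within R_def)
      qed (use h cont_nz in auto)
    qed
  qed (use dB in auto)
  have L: "(?f has_integral L 0 - L (-(1/2))) {-(1/2)..0}"
  proof (rule fundamental_theorem_of_calculus_interior)
    show "continuous_on {-(1/2)..0} L"
      unfolding continuous_on_eq_continuous_within
    proof
      fix h :: real assume h: "h \<in> {-(1/2)..0}"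
      show "continuous (at h within {-(1/2)..0}) L"
      proof (cases "h = 0")
        case True
        have "(boundary_term \<epsilon> t \<longlongrightarrow> G) (at_left 0)" using boundary_term_limits(2)[OF \<epsilon>, of t] by (simp add: G_def)
        then have "(L \<longlongrightarrow> G) (at_left 0)"
          by (rule Lim_transform_eventually) (auto simp: L_def eventually_at_filter)
        then have "(L \<longlongrightarrow> G) (at 0 within {-(1/2)..0})" by (simp add: at_within_Icc_at_left)
        then show ?thesis using True by (simp add: continuous_within L_def)
      qed (use h cont_nz in auto)
    qed
  qed (use dB in auto)
  have "chord t (1/2) = chord t (-(1/2))" using periodic_g[of "t - 1/2"] by (simp add: chord_def add.commute)
  then have "R (1/2) = L (-(1/2))" by (simp add: R_def L_def boundary_term_def)
  then have "L 0 - L (-(1/2)) + (R (1/2) - R 0) = 2 * norm (g1 t) / \<epsilon>" by (simp add: R_def L_def G_def)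
  then show ?thesis using has_integral_combine[OF _ _ L R] by simp
qed

lemma log_kernel_chord_bound:
  assumes \<epsilon>: "\<epsilon> > 0" and h: "\<bar>h\<bar> \<le> 1/2" "h \<noteq> 0"
  shows "\<bar>log_kernel \<epsilon> (norm (chord t h))\<bar> \<le> pi\<^sup>2 / \<epsilon>\<^sup>2 * (1 + 4 * sqrt \<epsilon> * bc powr (- (1/2)) * \<bar>h\<bar> powr (- (1/2)))"
proof -
  have r: "norm (chord t h) > 0" by (rule chord_pos[OF h])
  have "norm (chord t h) powr (- (1/2)) \<le> (bc * \<bar>h\<bar>) powr (- (1/2))"
    using chord_lower[OF h(1)] bc_pos h by (intro powr_mono2') auto
  also have "\<dots> = bc powr (- (1/2)) * \<bar>h\<bar> powr (- (1/2))" using bc_pos by (simp add: powr_mult)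
  finally have "4 * sqrt \<epsilon> * norm (chord t h) powr (- (1/2)) \<le> 4 * sqrt \<epsilon> * (bc powr (- (1/2)) * \<bar>h\<bar> powr (- (1/2)))"
    using \<epsilon> by (intro mult_left_mono) auto
  then have "pi\<^sup>2 / \<epsilon>\<^sup>2 * (1 + 4 * sqrt \<epsilon> * norm (chord t h) powr (- (1/2))) \<le> pi\<^sup>2 / \<epsilon>\<^sup>2 * (1 + 4 * sqrt \<epsilon> * bc powr (- (1/2)) * \<bar>h\<bar> powr (- (1/2)))"
    using \<epsilon> by (intro mult_left_mono) (auto simp: mult.assoc)
  then show ?thesis using log_kernel_bound[OF \<epsilon> r] by linarith
qed

lemma inverse_sqrt_chord:
  "(\<integral>\<^sup>+t. ennreal (norm (g s - g t) powr (- (1/2))) \<partial>unit_interval) < \<infinity>"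
proof -
  define f where "f = (\<lambda>t. complex_of_real (norm (g s - g t) powr (- (1/2))))"
  have gm[measurable]: "g \<in> borel_measurable borel" by (intro borel_measurable_continuous_onI cont_g)
  have [measurable]: "f \<in> borel_measurable borel" unfolding f_def by measurable
  have per: "f (t + 1) = f t" for t by (simp add: f_def periodic_g)
  define k where "k = \<lfloor>s\<rfloor>"
  have nonneg: "norm (f t) = norm (g s - g t) powr (- (1/2))" for t by (simp add: f_def)
  define I where "I = (\<lambda>S. (\<integral>\<^sup>+t. indicator S t * ennreal (norm (f t)) \<partial>lborel))"
  have fin: "I {s - 1/2..s + 1/2} < \<infinity>"
  proof -
    have "I {s - 1/2..s + 1/2} = (\<integral>\<^sup>+h. indicator {s - 1/2..s + 1/2} (s + 1 * h) * ennreal (norm (f (s + 1 * h))) \<partial>lborel)"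
      unfolding I_def by (subst nn_integral_real_affine[where c = 1 and t = s]) auto
    also have "\<dots> \<le> (\<integral>\<^sup>+h. ennreal (bc powr (- (1/2))) * (indicator {-(1/2)..1/2} h * ennreal (\<bar>h\<bar> powr (- (1/2)))) \<partial>lborel)"
    proof (rule nn_integral_mono_AE)
      show "AE h in lborel. indicator {s - 1/2..s + 1/2} (s + 1 * h) * ennreal (norm (f (s + 1 * h)))
        \<le> ennreal (bc powr (- (1/2))) * (indicator {-(1/2)..1/2} h * ennreal (\<bar>h\<bar> powr (- (1/2))))"
        using AE_lborel_singleton[of "0::real"]
      proof eventually_elim
        case (elim h)
        show ?case
        proof (cases "\<bar>h\<bar> \<le> 1/2")
          case True
          have "norm (f (s + h)) = norm (chord s h) powr (- (1/2))" unfolding nonneg chord_def by (simp add: norm_minus_commute)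
          also have "\<dots> \<le> (bc * \<bar>h\<bar>) powr (- (1/2))"
            using chord_lower[OF True, of s] bc_pos elim by (intro powr_mono2') auto
          also have "\<dots> = bc powr (- (1/2)) * \<bar>h\<bar> powr (- (1/2))" using bc_pos by (simp add: powr_mult)
          finally have "ennreal (norm (f (s + h))) \<le> ennreal (bc powr (- (1/2))) * ennreal (\<bar>h\<bar> powr (- (1/2)))"
            by (simp add: ennreal_mult[symmetric] ennreal_leI)
          then show ?thesis using True by (auto simp: indicator_def)
        qed (auto simp: indicator_def)
      qed
    qed
    also have "\<dots> = ennreal (bc powr (- (1/2))) * (\<integral>\<^sup>+h. indicator {-(1/2)..1/2} h * ennreal (\<bar>h\<bar> powr (- (1/2))) \<partial>lborel)"
      by (rule nn_integral_cmult) measurable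
    also have "(\<integral>\<^sup>+h. indicator {-(1/2)..1/2::real} h * ennreal (\<bar>h\<bar> powr (- (1/2))) \<partial>lborel) = (\<integral>\<^sup>+h. ennreal (norm (\<bar>h\<bar> powr (- (1/2)))) \<partial>half_interval)"
      by (subst nn_integral_restrict_space) (auto simp: mult.commute)
    also have "ennreal (bc powr (- (1/2))) * \<dots> < \<infinity>"
      using half_interval_inverse_sqrt unfolding integrable_iff_bounded by (auto simp: ennreal_mult_less_top)
    finally show ?thesis .
  qed
  have shift: "I {a + of_int m..b + of_int m} = I {a..b}" for a b m
  proof -
    have "I {a + of_int m..b + of_int m} = (\<integral>\<^sup>+h. indicator {a + of_int m..b + of_int m} (of_int m + 1 * h) * ennreal (norm (f (of_int m + 1 * h))) \<partial>lborel)"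
      unfolding I_def by (subst nn_integral_real_affine[where c = 1 and t = "of_int m"]) auto
    also have "\<dots> = I {a..b}"
      unfolding I_def using periodic_shift_int[of f, OF per] by (intro nn_integral_cong) (auto simp: indicator_def add.commute)
    finally show ?thesis .
  qed
  have "I {0..1} < \<infinity>"
  proof -
    define m where "m = \<lfloor>s + 1/2\<rfloor>"
    have m: "of_int m \<le> s + 1/2" "s + 1/2 < of_int m + 1" unfolding m_def by linarith+
    \<comment> \<open>The unit interval is covered by two consecutive integer translates of the
      window of length 1 around \<open>s\<close>.\<close>
    have "I {0..1} \<le> I {s - 1/2 - of_int (m - 1)..s + 1/2 - of_int (m - 1)} + I {s - 1/2 - of_int m..s + 1/2 - of_int m}"
      unfolding I_def by (subst nn_integral_add[symmetric]) (use m in \<open>auto intro!: nn_integral_mono simp: indicator_def\<close>)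
    also have "\<dots> = I {s - 1/2..s + 1/2} + I {s - 1/2..s + 1/2}"
      using shift[of "s - 1/2" "- (m - 1)" "s + 1/2"] shift[of "s - 1/2" "- m" "s + 1/2"] by simp
    also have "\<dots> < \<infinity>" using fin by simp
    finally show ?thesis .
  qed
  moreover have "(\<integral>\<^sup>+t. ennreal (norm (g s - g t) powr (- (1/2))) \<partial>unit_interval) = I {0..1}"
    unfolding I_def nonneg by (subst nn_integral_restrict_space) (auto simp: mult.commute)
  ultimately show ?thesis by simp
qed

lemma AE_g_neq: "AE t in unit_interval. g t \<noteq> g s"
proof -
  have "{t \<in> {0..1}. g t = g s} \<subseteq> {frac s, 0, 1}"
  proof
    fix t assume t: "t \<in> {t \<in> {0..1}. g t = g s}"
    then obtain k where k: "t - s = of_int k" by (auto simp: g_eq_iff elim: Ints_cases)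
    show "t \<in> {frac s, 0, 1}"
    proof (cases "t = 1")
      case False
      have "t = of_int k + s" using k by simp
      then have "frac t = frac s" by (simp add: frac_def)
      moreover have "frac t = t" using t False by (simp add: frac_eq)
      ultimately show ?thesis by simp
    qed simp
  qed
  then have "finite {t \<in> {0..1}. g t = g s}" by (rule finite_subset) simp
  then have "AE t in lborel. t \<notin> {t \<in> {0..1}. g t = g s}"
    by (intro AE_not_in countable_imp_null_set_lborel countable_finite)
  then show ?thesis by (subst AE_restrict_space_iff) (auto elim: eventually_mono)
qed

definition cut_energy :: "real \<Rightarrow> real" where
  "cut_energy \<epsilon> = integral\<^sup>L plane_pairs (cut_kernel (inside K) (- inside K) \<epsilon>)"

text \<open>The double Green formula with \<open>A\<close> and \<open>B\<close> both equal to the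
  inside, recentred so that the second point is s + h. Its real part differs from the bounded normal
  product term by the integrand of \<open>boundary_integral\<close>, which integrates to the length
  term.\<close>

lemma cut_energy_formula:
  assumes \<epsilon>: "\<epsilon> > 0"
  shows "cut_energy \<epsilon> = 2 * len / \<epsilon> + (\<integral>p. cut_inverse \<epsilon> (norm (chord (fst p) (snd p))) * normal_product (fst p) (snd p) / norm (chord (fst p) (snd p)) ^ 3 \<partial>torus)"
proof -
  have gm[measurable]: "g \<in> borel_measurable borel" "g1 \<in> borel_measurable borel"
    by (intro borel_measurable_continuous_onI cont_g cont_g1)+
  define Q where "Q = (\<lambda>t h. log_kernel \<epsilon> (norm (chord t h)) / (4 * pi\<^sup>2))"
  define F where "F = (\<lambda>p. g1 (fst p) * cnj (g1 (fst p + snd p)) * of_real (Q (fst p) (snd p)))"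
  define D where "D = (\<lambda>t h. cut_inverse \<epsilon> (norm (chord t h)) * normal_product t h / norm (chord t h) ^ 3)"
  have [measurable]: "F \<in> borel_measurable torus" "(\<lambda>p. D (fst p) (snd p)) \<in> borel_measurable torus"
    unfolding F_def Q_def D_def by measurable
  define C where "C = bM\<^sup>2 * (pi\<^sup>2 / \<epsilon>\<^sup>2 / (4 * pi\<^sup>2))"
  define C' where "C' = 4 * sqrt \<epsilon> * bc powr (- (1/2))"
  have Fbd: "norm (F (t, h)) \<le> C * (1 + C' * \<bar>h\<bar> powr (- (1/2)))" if "\<bar>h\<bar> \<le> 1/2" "h \<noteq> 0" for t h
  proof -
    have a4: "\<bar>4 * pi\<^sup>2\<bar> = 4 * pi\<^sup>2" by simp
    have "\<bar>Q t h\<bar> \<le> pi\<^sup>2 / \<epsilon>\<^sup>2 * (1 + C' * \<bar>h\<bar> powr (- (1/2))) / (4 * pi\<^sup>2)"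
      unfolding Q_def C'_def abs_divide a4 by (rule divide_right_mono[OF log_kernel_chord_bound[OF \<epsilon> that, of t]]) simp
    moreover have "norm (g1 t * cnj (g1 (t + h))) \<le> bM\<^sup>2"
      using g1_le[of t] g1_le[of "t + h"] bM_pos by (simp add: norm_mult power2_eq_square mult_mono)
    ultimately have "norm (g1 t * cnj (g1 (t + h))) * \<bar>Q t h\<bar> \<le> bM\<^sup>2 * (pi\<^sup>2 / \<epsilon>\<^sup>2 * (1 + C' * \<bar>h\<bar> powr (- (1/2))) / (4 * pi\<^sup>2))"
      by (intro mult_mono) auto
    then show ?thesis by (simp add: F_def norm_mult C_def)
  qed
  have Fint: "integrable torus F"
  proof (rule Bochner_Integration.integrable_bound)
    show "integrable torus (\<lambda>p. C * (1 + C' * \<bar>snd p\<bar> powr (- (1/2))))"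
      using torus_inverse_sqrt by (intro integrable_mult_right Bochner_Integration.integrable_add) auto
    show "AE p in torus. norm (F p) \<le> norm (C * (1 + C' * \<bar>snd p\<bar> powr (- (1/2))))"
      using torus_neq_zero AE_space
    proof eventually_elim
      case (elim p)
      then have "\<bar>snd p\<bar> \<le> 1/2" by (auto simp: abs_le_iff)
      then have "norm (F (fst p, snd p)) \<le> C * (1 + C' * \<bar>snd p\<bar> powr (- (1/2)))" using elim by (intro Fbd)
      then show ?case by simp
    qed
  qed simp
  have Dbd: "\<bar>D t h\<bar> \<le> bM\<^sup>2 / bc ^ 4" if "\<bar>h\<bar> \<le> 1/2" for t h
  proof (cases "h = 0")
    case True
    then show ?thesis using bc_pos by (simp add: D_def chord_def)
  next
    case False
    define r where "r = norm (chord t h)"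
    have r: "r > 0" unfolding r_def by (rule chord_pos[OF that False])
    have "\<bar>D t h\<bar> = cut_inverse \<epsilon> r * (\<bar>normal_product t h\<bar> / r ^ 3)"
      using cut_inverse_bounds[OF \<epsilon> r] r by (simp add: D_def r_def[symmetric] abs_mult)
    also have "\<dots> \<le> 1 / r * (\<bar>normal_product t h\<bar> / r ^ 3)"
      using cut_inverse_bounds[OF \<epsilon> r] r by (intro mult_right_mono) auto
    also have "\<dots> = \<bar>energy_density t h\<bar>"
      using r by (simp add: energy_density_def r_def[symmetric] power3_eq_cube power4_eq_xxxx)
    also have "\<dots> \<le> bM\<^sup>2 / bc ^ 4" by (rule energy_density_bound[OF that])
    finally show ?thesis .
  qed
  have Dint: "integrable torus (\<lambda>p. D (fst p) (snd p))"
  proof (rule integrable_torus_bounded[where B = "bM\<^sup>2 / bc ^ 4"])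
    fix t h :: real assume "h \<in> {-(1/2)..1/2}"
    then show "norm (D (fst (t, h)) (snd (t, h))) \<le> bM\<^sup>2 / bc ^ 4"
      unfolding real_norm_def fst_conv snd_conv by (intro Dbd) (auto simp: abs_le_iff)
  qed simp
  have "complex_of_real (cut_energy \<epsilon>) = (\<integral>s. g1 s * (\<integral>t. cnj (g1 t) * of_real (log_kernel \<epsilon> (norm (g s - g t))) \<partial>unit_interval) \<partial>unit_interval) / (4 * of_real pi ^ 2)"
    unfolding cut_energy_def
    by (rule trunc_kernel_double_loop(2)[OF C1_loop_g encloses_inside C1_loop_g encloses_inside order_refl abs_orient \<epsilon> AE_g_neq inverse_sqrt_chord])
  also have "\<dots> = (\<integral>s. (\<integral>h. F (s, h) \<partial>half_interval) \<partial>unit_interval)"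
  proof -
    have inner: "(\<integral>h. F (s, h) \<partial>half_interval) = g1 s * (\<integral>t. cnj (g1 t) * of_real (log_kernel \<epsilon> (norm (g s - g t))) \<partial>unit_interval) / (4 * of_real pi ^ 2)" for s
    proof -
      define f where "f = (\<lambda>t. cnj (g1 t) * complex_of_real (log_kernel \<epsilon> (norm (g s - g t))))"
      have [measurable]: "f \<in> borel_measurable borel" unfolding f_def by measurable
      have per: "f (t + 1) = f t" for t by (simp add: f_def periodic_g periodic_g1)
      have fint: "integrable unit_interval f"
      proof (rule integrableI_bounded)
        show "f \<in> borel_measurable unit_interval" by (rule measurable_unit_interval) measurable
        define c1 where "c1 = bM * (pi\<^sup>2 / \<epsilon>\<^sup>2)"
        define c2 where "c2 = c1 * (4 * sqrt \<epsilon>)"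
        have c: "0 \<le> c1" "0 \<le> c2" using bM_pos \<epsilon> by (auto simp: c1_def c2_def)
        have "(\<integral>\<^sup>+t. ennreal (norm (f t)) \<partial>unit_interval) \<le> (\<integral>\<^sup>+t. ennreal c1 + ennreal c2 * ennreal (norm (g s - g t) powr (- (1/2))) \<partial>unit_interval)"
        proof (rule nn_integral_mono_AE)
          show "AE t in unit_interval. ennreal (norm (f t)) \<le> ennreal c1 + ennreal c2 * ennreal (norm (g s - g t) powr (- (1/2)))"
            using AE_g_neq[of s]
          proof eventually_elim
            case (elim t)
            then have "norm (g s - g t) > 0" by simp
            from log_kernel_bound[OF \<epsilon> this]
            have "norm (f t) \<le> bM * (pi\<^sup>2 / \<epsilon>\<^sup>2 * (1 + 4 * sqrt \<epsilon> * norm (g s - g t) powr (- (1/2))))"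
              unfolding f_def norm_mult using g1_le[of t] bM_pos by (intro mult_mono) auto
            also have "\<dots> = c1 + c2 * norm (g s - g t) powr (- (1/2))" by (simp add: c1_def c2_def algebra_simps)
            finally have "ennreal (norm (f t)) \<le> ennreal (c1 + c2 * norm (g s - g t) powr (- (1/2)))" by (rule ennreal_leI)
            also have "\<dots> = ennreal c1 + ennreal c2 * ennreal (norm (g s - g t) powr (- (1/2)))"
              using c by (subst ennreal_plus) (auto simp: ennreal_mult)
            finally show ?case .
          qed
        qed
        also have "\<dots> = ennreal c1 * emeasure unit_interval (space unit_interval) + ennreal c2 * (\<integral>\<^sup>+t. ennreal (norm (g s - g t) powr (- (1/2))) \<partial>unit_interval)"
        proof -
          define u where "u = (\<lambda>t. ennreal (norm (g s - g t) powr (- (1/2))))"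
          have um: "u \<in> borel_measurable unit_interval"
            unfolding u_def by (rule measurable_unit_interval) measurable
          have "(\<integral>\<^sup>+t. ennreal c1 + ennreal c2 * u t \<partial>unit_interval) = (\<integral>\<^sup>+t. ennreal c1 \<partial>unit_interval) + (\<integral>\<^sup>+t. ennreal c2 * u t \<partial>unit_interval)"
            using um by (intro nn_integral_add) auto
          also have "(\<integral>\<^sup>+t. ennreal c2 * u t \<partial>unit_interval) = ennreal c2 * (\<integral>\<^sup>+t. u t \<partial>unit_interval)"
            by (rule nn_integral_cmult[OF um])
          finally show ?thesis unfolding u_def by simp
        qed
        also have "\<dots> < \<infinity>"
          using inverse_sqrt_chord[of s] by (simp add: ennreal_mult_less_top emeasure_restrict_space)
        finally show "(\<integral>\<^sup>+t. ennreal (norm (f t)) \<partial>unit_interval) < \<infinity>" .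
      qed
      have "(\<integral>h. F (s, h) \<partial>half_interval) = (\<integral>h. (g1 s / (4 * of_real pi ^ 2)) * f (s + h) \<partial>half_interval)"
      proof (rule Bochner_Integration.integral_cong[OF refl])
        fix h
        have "norm (g s - g (s + h)) = norm (chord s h)" by (simp add: chord_def norm_minus_commute)
        then show "F (s, h) = (g1 s / (4 * of_real pi ^ 2)) * f (s + h)" by (simp add: F_def Q_def f_def)
      qed
      also have "\<dots> = (g1 s / (4 * of_real pi ^ 2)) * (\<integral>h. f (s + h) \<partial>half_interval)" by (rule integral_mult_right_zero)
      also have "(\<integral>h. f (s + h) \<partial>half_interval) = (\<integral>t. f t \<partial>unit_interval)"
        by (rule periodic_half_interval(2)[OF _ per fint]) measurable
      finally show ?thesis by (simp add: f_def)
    qed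
    show ?thesis unfolding inner by (rule integral_divide_zero[symmetric])
  qed
  also have "\<dots> = (\<integral>p. F p \<partial>torus)" by (rule torus.integral_fst'[OF Fint])
  finally have "cut_energy \<epsilon> = Re (\<integral>p. F p \<partial>torus)" by (metis Re_complex_of_real)
  also have "\<dots> = (\<integral>p. Re (F p) \<partial>torus)" by (rule integral_bounded_linear[OF bounded_linear_Re Fint, symmetric])
  finally have 1: "cut_energy \<epsilon> = (\<integral>p. Re (F p) \<partial>torus)" .
  have ReF: "integrable torus (\<lambda>p. Re (F p))" by (rule integrable_bounded_linear[OF bounded_linear_Re Fint])
  \<comment> \<open>Only the difference is known in closed form along each fiber. Both terms are
    integrable on the torus, so they can be separated afterwards.\<close>
  have "(\<integral>p. Re (F p) \<partial>torus) - (\<integral>p. D (fst p) (snd p) \<partial>torus) = (\<integral>p. Re (F p) - D (fst p) (snd p) \<partial>torus)"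
    by (rule Bochner_Integration.integral_diff[OF ReF Dint, symmetric])
  also have "\<dots> = (\<integral>t. (\<integral>h. Re (F (t, h)) - D t h \<partial>half_interval) \<partial>unit_interval)"
    using torus.integral_fst'[OF Bochner_Integration.integrable_diff[OF ReF Dint]] by simp
  also have "\<dots> = (\<integral>t. 2 * norm (g1 t) / \<epsilon> \<partial>unit_interval)"
  proof (rule integral_cong_AE)
    show "(\<lambda>t. \<integral>h. Re (F (t, h)) - D t h \<partial>half_interval) \<in> borel_measurable unit_interval"
      using borel_measurable_integrable[OF torus.integrable_fst'[OF Bochner_Integration.integrable_diff[OF ReF Dint]]] by simp
    show "(\<lambda>t. 2 * norm (g1 t) / \<epsilon>) \<in> borel_measurable unit_interval"
      by (rule measurable_unit_interval) measurable
    show "AE t in unit_interval. (\<integral>h. Re (F (t, h)) - D t h \<partial>half_interval) = 2 * norm (g1 t) / \<epsilon>"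
      using torus.AE_integrable_fst'[OF Bochner_Integration.integrable_diff[OF ReF Dint]]
    proof eventually_elim
      case (elim t)
      then have i: "integrable half_interval (\<lambda>h. Re (F (t, h)) - D t h)" by simp
      have "(\<lambda>h. Re (F (t, h)) - D t h) = (\<lambda>h. log_kernel \<epsilon> (norm (chord t h)) / (4 * pi\<^sup>2) * Re (g1 (t + h) * cnj (g1 t))
        - cut_inverse \<epsilon> (norm (chord t h)) * normal_product t h / norm (chord t h) ^ 3)"
        by (rule ext) (simp add: F_def Q_def D_def algebra_simps add_divide_distrib)
      then have "((\<lambda>h. Re (F (t, h)) - D t h) has_integral 2 * norm (g1 t) / \<epsilon>) {-(1/2)..1/2}"
        using boundary_integral[OF \<epsilon>, of t] by simp
      then show ?case using half_interval_has_integral[OF i] has_integral_unique by blast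
    qed
  qed
  also have "\<dots> = 2 * len / \<epsilon>"
  proof -
    have "(\<integral>t. norm (g1 t) \<partial>unit_interval) = len"
      unfolding len_def by (rule unit_interval_integral_eq(2)) (intro continuous_intros cont_g1)
    moreover have "(\<integral>t. 2 * norm (g1 t) / \<epsilon> \<partial>unit_interval) = 2 / \<epsilon> * (\<integral>t. norm (g1 t) \<partial>unit_interval)"
      by (subst integral_mult_right_zero[symmetric]) simp
    ultimately show ?thesis by simp
  qed
  finally show ?thesis using 1 by (simp add: D_def)
qed

lemma cut_energy_limit: "((\<lambda>\<epsilon>. 2 * len / \<epsilon> - cut_energy \<epsilon>) \<longlongrightarrow> energy) (at_right 0)"
proof -
  define D where "D = (\<lambda>\<epsilon> p. cut_inverse \<epsilon> (norm (chord (fst p) (snd p))) * normal_product (fst p) (snd p) / norm (chord (fst p) (snd p)) ^ 3)"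
  have lim: "((\<lambda>\<epsilon>. \<integral>p. D \<epsilon> p \<partial>torus) \<longlongrightarrow> (\<integral>p. energy_density (fst p) (snd p) / 2 \<partial>torus)) (at_right 0)"
  proof (rule dominated_convergence_at_right[where \<eta> = 1 and w = "\<lambda>_. bM\<^sup>2 / bc ^ 4"])
    show "D \<epsilon> \<in> borel_measurable torus" for \<epsilon> unfolding D_def by measurable
    show "AE p in torus. ((\<lambda>\<epsilon>. D \<epsilon> p) \<longlongrightarrow> energy_density (fst p) (snd p) / 2) (at_right 0)"
      using torus_neq_zero AE_space
    proof eventually_elim
      case (elim p)
      define r where "r = norm (chord (fst p) (snd p))"
      have "\<bar>snd p\<bar> \<le> 1/2" using elim by (auto simp: abs_le_iff)
      then have r: "r > 0" unfolding r_def using elim by (intro chord_pos)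
      have "eventually (\<lambda>\<epsilon>. D \<epsilon> p = energy_density (fst p) (snd p) / 2) (at_right 0)"
        using eventually_at_right_less[of 0] eventually_at_rightI[of 0 r, OF _ r]
      proof -
        have "eventually (\<lambda>\<epsilon>. \<epsilon> \<in> {0<..<r}) (at_right 0)" using r by (rule eventually_at_right_real)
        then show ?thesis
        proof eventually_elim
          case (elim \<epsilon>)
          then show ?case using r
            by (simp add: D_def r_def[symmetric] cut_inverse_def energy_density_def power3_eq_cube power4_eq_xxxx)
        qed
      qed
      then show ?case by (rule tendsto_eventually)
    qed
    show "AE p in torus. norm (D \<epsilon> p) \<le> bM\<^sup>2 / bc ^ 4" if \<epsilon>: "0 < \<epsilon>" for \<epsilon>
      using torus_neq_zero AE_space
    proof eventually_elim
      case (elim p)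
      define r where "r = norm (chord (fst p) (snd p))"
      have h: "\<bar>snd p\<bar> \<le> 1/2" using elim by (auto simp: abs_le_iff)
      then have r: "r > 0" unfolding r_def using elim by (intro chord_pos)
      have "\<bar>D \<epsilon> p\<bar> = cut_inverse \<epsilon> r * (\<bar>normal_product (fst p) (snd p)\<bar> / r ^ 3)"
        using cut_inverse_bounds[OF \<epsilon> r] r by (simp add: D_def r_def[symmetric] abs_mult)
      also have "\<dots> \<le> 1 / r * (\<bar>normal_product (fst p) (snd p)\<bar> / r ^ 3)"
        using cut_inverse_bounds[OF \<epsilon> r] r by (intro mult_right_mono) auto
      also have "\<dots> = \<bar>energy_density (fst p) (snd p)\<bar>"
        using r by (simp add: energy_density_def r_def[symmetric] power3_eq_cube power4_eq_xxxx)
      also have "\<dots> \<le> bM\<^sup>2 / bc ^ 4" by (rule energy_density_bound[OF h])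
      finally show ?case by simp
    qed
  qed (auto simp: torus_finite.integrable_const)
  have 1: "((\<lambda>\<epsilon>. - (\<integral>p. D \<epsilon> p \<partial>torus)) \<longlongrightarrow> - (\<integral>p. energy_density (fst p) (snd p) / 2 \<partial>torus)) (at_right 0)"
    using lim by (rule tendsto_minus)
  have 2: "- (\<integral>p. energy_density (fst p) (snd p) / 2 \<partial>torus) = energy" by (simp add: energy_def)
  have 3: "eventually (\<lambda>\<epsilon>. - (\<integral>p. D \<epsilon> p \<partial>torus) = 2 * len / \<epsilon> - cut_energy \<epsilon>) (at_right 0)"
    using eventually_at_right_less[of 0] by eventually_elim (simp add: cut_energy_formula D_def)
  show ?thesis by (rule Lim_transform_eventually[OF 1[unfolded 2] 3])
qed

end

subsection \<open>Invariance of the curve energy\<close>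

lemma half_interval_reflect:
  fixes f :: "real \<Rightarrow> complex"
  shows "(\<integral>h. f (- h) \<partial>half_interval) = (\<integral>h. f h \<partial>half_interval)"
proof -
  have "(\<integral>h. f h \<partial>half_interval) = (\<integral>h. indicator {-(1/2)..1/2} h *\<^sub>R f h \<partial>lborel)"
    by (simp add: integral_restrict_space)
  also have "\<dots> = (\<integral>h. indicator {-(1/2)..1/2} (- h) *\<^sub>R f (- h) \<partial>lborel)"
    by (subst lborel_integral_real_affine[where c = "-1" and t = 0]) simp_all
  also have "\<dots> = (\<integral>h. indicator {-(1/2)..1/2} h *\<^sub>R f (- h) \<partial>lborel)"
    by (intro Bochner_Integration.integral_cong) (auto simp: indicator_def)
  finally show ?thesis by (simp add: integral_restrict_space)
qed

lemma unit_interval_integrable_continuous: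
  fixes f :: "real \<Rightarrow> complex"
  assumes "continuous_on UNIV f"
  shows "integrable unit_interval f"
proof -
  have "continuous_on {0..1} f" using assms by (rule continuous_on_subset) simp
  then have "set_integrable lborel {0..1} f"
    unfolding set_integrable_def by (intro borel_integrable_compact) auto
  then show ?thesis by (simp add: integrable_restrict_space set_integrable_def)
qed

lemma unit_interval_shift:
  fixes f :: "real \<Rightarrow> complex"
  assumes c: "continuous_on UNIV f" and per: "\<And>t. f (t + 1) = f t"
  shows "(\<integral>t. f (t + h) \<partial>unit_interval) = (\<integral>t. f t \<partial>unit_interval)"
proof -
  have m: "f \<in> borel_measurable borel" using c by (rule borel_measurable_continuous_onI)
  have c': "continuous_on UNIV (\<lambda>t. f (t + h))"
    by (intro continuous_on_compose2[OF c] continuous_intros) auto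
  have m': "(\<lambda>t. f (t + h)) \<in> borel_measurable borel" using c' by (rule borel_measurable_continuous_onI)
  have per': "f (t + 1 + h) = f (t + h)" for t using per[of "t + h"] by (simp add: add_ac)
  have "(\<integral>t. f (t + h) \<partial>unit_interval) = (\<integral>s. f (0 + s + h) \<partial>half_interval)"
    using periodic_half_interval(2)[OF m' per' unit_interval_integrable_continuous[OF c'], of 0] by simp
  also have "\<dots> = (\<integral>s. f (h + s) \<partial>half_interval)" by (simp add: add.commute)
  also have "\<dots> = (\<integral>t. f t \<partial>unit_interval)"
    by (rule periodic_half_interval(2)[OF m per unit_interval_integrable_continuous[OF c]])
  finally show ?thesis .
qed

lemma torus_integrable_continuous:
  fixes F :: "real \<Rightarrow> real \<Rightarrow> complex"
  assumes c: "continuous_on UNIV (\<lambda>p. F (fst p) (snd p))"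
  shows "integrable torus (\<lambda>p. F (fst p) (snd p))"
proof -
  have "compact ((\<lambda>p. F (fst p) (snd p)) ` ({0..1} \<times> {-(1/2)..1/2}))"
    by (intro compact_continuous_image compact_Times continuous_on_subset[OF c]) auto
  then have "bounded ((\<lambda>p. F (fst p) (snd p)) ` ({0..1} \<times> {-(1/2)..1/2}))" by (rule compact_imp_bounded)
  then obtain B where B: "\<forall>x\<in>(\<lambda>p. F (fst p) (snd p)) ` ({0..1} \<times> {-(1/2)..1/2}). norm x \<le> B"
    unfolding bounded_iff by blast
  have bm: "(\<lambda>p. F (fst p) (snd p)) \<in> borel_measurable borel"
    using c by (rule borel_measurable_continuous_onI)
  have pm: "(\<lambda>p. (fst p, snd p)) \<in> borel_measurable torus"
    by (rule borel_measurable_Pair) measurable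
  have "(\<lambda>p. F (fst p) (snd p)) \<in> borel_measurable torus"
    using measurable_compose[OF pm bm] by simp
  then show ?thesis
  proof (rule integrable_torus_bounded)
    fix t h :: real assume "t \<in> {0..1}" "h \<in> {-(1/2)..1/2}"
    then have "(\<lambda>p. F (fst p) (snd p)) (t, h) \<in> (\<lambda>p. F (fst p) (snd p)) ` ({0..1} \<times> {-(1/2)..1/2})" by (intro imageI) auto
    then show "norm (F (fst (t, h)) (snd (t, h))) \<le> B" using B by blast
  qed
qed

text \<open>Exchanging the two curve points sends (t, h) to (t + h, -h): a periodic shift in
  \<open>t\<close> for fixed \<open>h\<close>, then a reflection in \<open>h\<close>.\<close>

lemma torus_swap:
  fixes F :: "real \<Rightarrow> real \<Rightarrow> complex"
  assumes c: "continuous_on UNIV (\<lambda>p. F (fst p) (snd p))" and per: "\<And>t h. F (t + 1) h = F t h"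
  shows "(\<integral>p. F (fst p + snd p) (- snd p) \<partial>torus) = (\<integral>p. F (fst p) (snd p) \<partial>torus)"
proof -
  have c': "continuous_on UNIV (\<lambda>p. F (fst p + snd p) (- snd p))"
  proof -
    have "continuous_on UNIV (\<lambda>p::real \<times> real. (fst p + snd p, - snd p))" by (intro continuous_intros)
    from continuous_on_compose2[OF c this subset_UNIV] show ?thesis by simp
  qed
  have ch: "continuous_on UNIV (\<lambda>t. F t h)" for h
  proof -
    have "continuous_on UNIV (\<lambda>t::real. (t, h))" by (intro continuous_intros)
    from continuous_on_compose2[OF c this subset_UNIV] show ?thesis by simp
  qed
  have int: "integrable torus (\<lambda>p. F (fst p) (snd p))" using c by (rule torus_integrable_continuous)
  have int': "integrable torus (\<lambda>p. F (fst p + snd p) (- snd p))"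
    using torus_integrable_continuous[of "\<lambda>t h. F (t + h) (- h)"] c' by simp
  have "(\<integral>p. F (fst p + snd p) (- snd p) \<partial>torus) = (\<integral>h. (\<integral>t. F (t + h) (- h) \<partial>unit_interval) \<partial>half_interval)"
    using torus.integral_snd[of "\<lambda>t h. F (t + h) (- h)"] int' by (simp add: case_prod_beta')
  also have "\<dots> = (\<integral>h. (\<integral>t. F t (- h) \<partial>unit_interval) \<partial>half_interval)"
    using unit_interval_shift[OF ch per] by simp
  also have "\<dots> = (\<integral>h. (\<integral>t. F t h \<partial>unit_interval) \<partial>half_interval)"
    by (rule half_interval_reflect[of "\<lambda>h. \<integral>t. F t h \<partial>unit_interval"])
  also have "\<dots> = (\<integral>p. F (fst p) (snd p) \<partial>torus)"
    using torus.integral_snd[of F] int by (simp add: case_prod_beta')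
  finally show ?thesis .
qed

context C2_curve
begin

lemma chord_in_K: "g t + chord t h \<in> K"
  by (simp add: chord_def g_in_K)

lemma tube_chord_lower:
  assumes "\<bar>\<tau>\<bar> \<le> radius"
  shows "\<tau>\<^sup>2 + (norm (chord t h))\<^sup>2 / 2 \<le> (norm (chord t h - \<i> * of_real \<tau> * tang t))\<^sup>2"
proof -
  have "norm (tube t \<tau> - (g t + chord t h)) = norm (chord t h - \<i> * of_real \<tau> * tang t)"
    by (subst norm_minus_commute) (simp add: tube_def algebra_simps)
  then show ?thesis using tube_distance[OF chord_in_K[of t h] assms, of t] by simp
qed

text \<open>The sum of squares factors into the differences between a curve point and the two tube
  points at offsets \<tau> and -\<tau>. Each squared factor is at least the left-hand side by
  \<open>tube_chord_lower\<close>.\<close>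

lemma square_chord_lower:
  assumes "\<bar>\<tau>\<bar> \<le> radius"
  shows "\<tau>\<^sup>2 + (norm (chord t h))\<^sup>2 / 2 \<le> norm ((chord t h)\<^sup>2 + (of_real \<tau> * tang t)\<^sup>2)"
proof -
  define a b where "a = chord t h - \<i> * of_real \<tau> * tang t" and "b = chord t h + \<i> * of_real \<tau> * tang t"
  define X where "X = \<tau>\<^sup>2 + (norm (chord t h))\<^sup>2 / 2"
  have X: "X \<ge> 0" by (simp add: X_def)
  have ab: "X \<le> (norm a)\<^sup>2" "X \<le> (norm b)\<^sup>2"
    using tube_chord_lower[OF assms, of t h] tube_chord_lower[of "- \<tau>" t h] assms by (simp_all add: X_def a_def b_def)
  have "X\<^sup>2 \<le> (norm a)\<^sup>2 * (norm b)\<^sup>2" unfolding power2_eq_square[of X] using ab X by (intro mult_mono) auto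
  also have "\<dots> = (norm (a * b))\<^sup>2" by (simp add: norm_mult power_mult_distrib)
  finally have "X \<le> norm (a * b)" by (rule power2_le_imp_le) simp
  moreover have "a * b = (chord t h)\<^sup>2 + (of_real \<tau> * tang t)\<^sup>2"
    by (simp add: a_def b_def algebra_simps power2_eq_square)
  ultimately show ?thesis by (simp add: X_def)
qed

lemma tang_scale: "of_real (\<delta> * norm (g1 t)) * tang t = of_real \<delta> * g1 t"
  using regular[of t] by (simp add: tang_def)

text \<open>The offset \<delta> |g1 t| replaces the unit tangent by the velocity. The regularization
  then contains \<open>g1\<close> itself, and exchanging the two points only exchanges their
  velocities.\<close>

lemma square_chord_lower':
  assumes "0 < \<delta>" "\<delta> * bM \<le> radius"
  shows "min (bc\<^sup>2) (1/2) * (\<delta>\<^sup>2 + (norm (chord t h))\<^sup>2) \<le> norm ((chord t h)\<^sup>2 + of_real (\<delta>\<^sup>2) * (g1 t)\<^sup>2)"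
proof -
  have le: "\<bar>\<delta> * norm (g1 t)\<bar> \<le> radius"
    using assms(1) order_trans[OF mult_left_mono[OF g1_le[of t], of \<delta>] assms(2)] by (simp add: abs_mult)
  have "(of_real (\<delta> * norm (g1 t)) * tang t)\<^sup>2 = of_real (\<delta>\<^sup>2) * (g1 t)\<^sup>2"
    unfolding tang_scale by (simp add: power_mult_distrib)
  then have *: "(\<delta> * norm (g1 t))\<^sup>2 + (norm (chord t h))\<^sup>2 / 2 \<le> norm ((chord t h)\<^sup>2 + of_real (\<delta>\<^sup>2) * (g1 t)\<^sup>2)"
    using square_chord_lower[OF le, of t h] by simp
  have "min (bc\<^sup>2) (1/2) * \<delta>\<^sup>2 \<le> bc\<^sup>2 * \<delta>\<^sup>2" by (intro mult_right_mono) auto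
  also have "\<dots> \<le> (\<delta> * norm (g1 t))\<^sup>2"
    using g1_ge[of t] bc_pos by (simp add: power_mult_distrib mult.commute mult_left_mono power_mono)
  finally have 1: "min (bc\<^sup>2) (1/2) * \<delta>\<^sup>2 \<le> (\<delta> * norm (g1 t))\<^sup>2" .
  have 2: "min (bc\<^sup>2) (1/2) * (norm (chord t h))\<^sup>2 \<le> 1/2 * (norm (chord t h))\<^sup>2" by (intro mult_right_mono) auto
  show ?thesis using * 1 2 by (simp add: distrib_left)
qed

lemma cont_chord: "continuous_on UNIV (\<lambda>p. chord (fst p) (snd p))"
  unfolding chord_def by (intro continuous_intros continuous_on_compose2[OF cont_g[of UNIV]]) auto

lemma Cauchy_integral_chord:
  assumes z: "z \<notin> K"
  shows "integrable half_interval (\<lambda>h. g1 (t + h) / (g (t + h) - z))"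
    and "(\<integral>h. g1 (t + h) / (g (t + h) - z) \<partial>half_interval) = two_pi_i * winding_number g z"
proof -
  define f where "f = (\<lambda>s. g1 s / (g s - z))"
  have c: "continuous_on UNIV f" unfolding f_def
    using z g_in_K by (intro continuous_intros cont_g cont_g1) force
  have m: "f \<in> borel_measurable borel" using c by (rule borel_measurable_continuous_onI)
  have per: "f (s + 1) = f s" for s by (simp add: f_def periodic_g periodic_g1)
  have int: "integrable unit_interval f" using c by (rule unit_interval_integrable_continuous)
  show "integrable half_interval (\<lambda>h. g1 (t + h) / (g (t + h) - z))"
    using periodic_half_interval(1)[OF m per int, of t] by (simp add: f_def)
  have "(\<integral>h. f (t + h) \<partial>half_interval) = (\<integral>s. f s \<partial>unit_interval)"
    by (rule periodic_half_interval(2)[OF m per int])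
  also have "\<dots> = two_pi_i * winding_number g z"
    unfolding f_def
    by (rule AE_circle_integral_encloses(2)[OF C1_loop_g]) (use z in \<open>auto simp: K_def intro!: winding_number_has_integral_C1[OF C1_loop_g]\<close>)
  finally show "(\<integral>h. g1 (t + h) / (g (t + h) - z) \<partial>half_interval) = two_pi_i * winding_number g z"
    by (simp add: f_def)
qed

text \<open>Partial fractions give the sum of two Cauchy integrals at points on either side of the
  curve. Exactly one of these points lies inside, so the winding numbers add up to the orientation;
  the value depends neither on \<open>t\<close> nor on \<delta>.\<close>

lemma both_sides_Cauchy:
  assumes \<delta>: "0 < \<delta>" "\<delta> * bM \<le> radius"
  shows "(\<integral>h. 2 * g1 (t + h) * chord t h / ((chord t h)\<^sup>2 + of_real (\<delta>\<^sup>2) * (g1 t)\<^sup>2) \<partial>half_interval) = two_pi_i * of_real orient"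
proof -
  define \<tau> where "\<tau> = \<delta> * norm (g1 t)"
  have \<tau>: "0 < \<tau>" "\<tau> \<le> radius"
    using \<delta>(1) regular[of t] order_trans[OF mult_left_mono[OF g1_le[of t], of \<delta>] \<delta>(2)] by (auto simp: \<tau>_def)
  have tz: "tube t \<tau> = g t + \<i> * of_real \<delta> * g1 t" "tube t (- \<tau>) = g t - \<i> * of_real \<delta> * g1 t"
    using tang_scale[of \<delta> t] by (simp_all add: tube_def \<tau>_def mult_ac)
  have nK: "tube t \<tau> \<notin> K" "tube t (- \<tau>) \<notin> K"
    using \<tau> tube_notin_K[of \<tau> t] tube_notin_K[of "- \<tau>" t] by auto
  have sn: "side \<noteq> 0" using side(1) by auto
  have w: "winding_number g (tube t \<tau>) + winding_number g (tube t (- \<tau>)) = of_real orient"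
    using winding_g_tube[of \<tau> t] winding_g_tube[of "- \<tau>" t] \<tau> sn
    by (cases "side > 0") (auto simp: zero_less_mult_iff mult_less_0_iff)
  have "(\<integral>h. 2 * g1 (t + h) * chord t h / ((chord t h)\<^sup>2 + of_real (\<delta>\<^sup>2) * (g1 t)\<^sup>2) \<partial>half_interval)
    = (\<integral>h. g1 (t + h) / (g (t + h) - tube t \<tau>) + g1 (t + h) / (g (t + h) - tube t (- \<tau>)) \<partial>half_interval)"
  proof (rule Bochner_Integration.integral_cong[OF refl])
    fix h
    have gd: "g (t + h) - tube t \<tau> = chord t h - \<i> * of_real \<delta> * g1 t" "g (t + h) - tube t (- \<tau>) = chord t h + \<i> * of_real \<delta> * g1 t"
      by (simp_all add: tz chord_def)
    have n: "chord t h - \<i> * of_real \<delta> * g1 t \<noteq> 0" "chord t h + \<i> * of_real \<delta> * g1 t \<noteq> 0"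
      using nK g_in_K[of "t + h"] unfolding gd[symmetric] by auto
    have "(chord t h)\<^sup>2 + of_real (\<delta>\<^sup>2) * (g1 t)\<^sup>2 = (chord t h - \<i> * of_real \<delta> * g1 t) * (chord t h + \<i> * of_real \<delta> * g1 t)"
      by (simp add: algebra_simps power2_eq_square)
    moreover have "2 * g1 (t + h) * d / (u * v) = g1 (t + h) / u + g1 (t + h) / v" if "u \<noteq> 0" "v \<noteq> 0" "u + v = 2 * d" for u v d
    proof -
      have "g1 (t + h) / u + g1 (t + h) / v = g1 (t + h) * (u + v) / (u * v)" using that(1,2) by (simp add: field_simps)
      then show ?thesis using that(3) by simp
    qed
    ultimately show "2 * g1 (t + h) * chord t h / ((chord t h)\<^sup>2 + of_real (\<delta>\<^sup>2) * (g1 t)\<^sup>2)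
      = g1 (t + h) / (g (t + h) - tube t \<tau>) + g1 (t + h) / (g (t + h) - tube t (- \<tau>))"
      using n unfolding gd by simp
  qed
  also have "\<dots> = two_pi_i * winding_number g (tube t \<tau>) + two_pi_i * winding_number g (tube t (- \<tau>))"
    using Cauchy_integral_chord[OF nK(1), of t] Cauchy_integral_chord[OF nK(2), of t] by simp
  also have "\<dots> = two_pi_i * of_real orient" unfolding w[symmetric] by (simp add: distrib_left)
  finally show ?thesis .
qed

text \<open>A symmetrized Plemelj formula: averaging the Cauchy integral over both sides of the curve and
  antisymmetrizing in the two curve points removes the singularity of the kernel.\<close>

lemma symmetric_Plemelj:
  assumes q: "continuous_on UNIV q" and per: "\<And>t. q (t + 1) = q t"
    and lip: "\<And>t h. norm (q (t + h) - q t) \<le> Lq * \<bar>h\<bar>" and bd: "\<And>t. norm (q t) \<le> Bq"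
  shows "integrable torus (\<lambda>p. (q (fst p) * g1 (fst p + snd p) - q (fst p + snd p) * g1 (fst p)) / chord (fst p) (snd p))"
    and "(\<integral>p. (q (fst p) * g1 (fst p + snd p) - q (fst p + snd p) * g1 (fst p)) / chord (fst p) (snd p) \<partial>torus)
      = two_pi_i * of_real orient * (\<integral>t. q t \<partial>unit_interval)"
proof -
  define P where "P = (\<lambda>p. (q (fst p) * g1 (fst p + snd p) - q (fst p + snd p) * g1 (fst p)) / chord (fst p) (snd p))"
  define E where "E = (\<lambda>\<delta> t s. (g s - g t)\<^sup>2 + of_real (\<delta>\<^sup>2) * (g1 t)\<^sup>2)"
  define A where "A = (\<lambda>\<delta> t h. q t * (2 * g1 (t + h) * chord t h / E \<delta> t (t + h)))"
  \<comment> \<open>This is half the sum of \<open>A\<close> and of \<open>A\<close> with its two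
    points exchanged, so it has the integral of \<open>A\<close> for every \<delta>. Unlike
    \<open>A\<close> it stays bounded as \<delta> tends to 0.\<close>
  define S where "S = (\<lambda>\<delta> t h. chord t h * (q t * g1 (t + h) / E \<delta> t (t + h) - q (t + h) * g1 t / E \<delta> (t + h) t))"
  define m where "m = min (bc\<^sup>2) (1/2)"
  have m: "m > 0" using bc_pos by (simp add: m_def)
  define \<eta> where "\<eta> = radius / bM"
  have \<eta>: "\<eta> > 0" using radius_pos bM_pos by (simp add: \<eta>_def)
  have small: "\<delta> * bM \<le> radius" if "\<delta> < \<eta>" for \<delta> using that bM_pos by (simp add: \<eta>_def field_simps)
  have Elow: "m * (\<delta>\<^sup>2 + (norm (g s - g t))\<^sup>2) \<le> norm (E \<delta> t s)" if "0 < \<delta>" "\<delta> < \<eta>" for \<delta> t s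
    using square_chord_lower'[OF that(1) small[OF that(2)], of t "s - t"] by (simp add: E_def m_def chord_def)
  have E0: "E \<delta> t s \<noteq> 0" if "0 < \<delta>" "\<delta> < \<eta>" for \<delta> t s
  proof -
    have "m * (\<delta>\<^sup>2 + (norm (g s - g t))\<^sup>2) > 0" using m that by (intro mult_pos_pos add_pos_nonneg) auto
    then show ?thesis using Elow[OF that, of s t] by auto
  qed
  note [continuous_intros] = continuous_on_compose2[OF cont_g[of UNIV]] continuous_on_compose2[OF cont_g1[of UNIV]] continuous_on_compose2[OF q]
  have contA: "continuous_on UNIV (\<lambda>p. A \<delta> (fst p) (snd p))" if "0 < \<delta>" "\<delta> < \<eta>" for \<delta>
  proof -
    have "continuous_on UNIV (\<lambda>p. E \<delta> (fst p) (fst p + snd p))" unfolding E_def by (intro continuous_intros) auto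
    then show ?thesis unfolding A_def using E0[OF that] by (intro continuous_intros cont_chord) auto
  qed
  have perA: "A \<delta> (t + 1) h = A \<delta> t h" for \<delta> t h
    using periodic_g[of "t + h"] periodic_g1[of "t + h"] per[of t] periodic_g[of t] periodic_g1[of t]
    by (simp add: A_def E_def chord_def add.commute add.left_commute)
  have intA: "integrable torus (\<lambda>p. A \<delta> (fst p) (snd p))" if "0 < \<delta>" "\<delta> < \<eta>" for \<delta>
    by (rule torus_integrable_continuous[OF contA[OF that]])
  have valA: "(\<integral>p. A \<delta> (fst p) (snd p) \<partial>torus) = two_pi_i * of_real orient * (\<integral>t. q t \<partial>unit_interval)" if "0 < \<delta>" "\<delta> < \<eta>" for \<delta>
  proof -
    have "(\<integral>p. A \<delta> (fst p) (snd p) \<partial>torus) = (\<integral>t. (\<integral>h. A \<delta> t h \<partial>half_interval) \<partial>unit_interval)"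
      using torus.integral_fst'[OF intA[OF that]] by simp
    also have "\<dots> = (\<integral>t. two_pi_i * of_real orient * q t \<partial>unit_interval)"
    proof (rule Bochner_Integration.integral_cong[OF refl])
      fix t
      have "(\<integral>h. A \<delta> t h \<partial>half_interval) = q t * (\<integral>h. 2 * g1 (t + h) * chord t h / ((chord t h)\<^sup>2 + of_real (\<delta>\<^sup>2) * (g1 t)\<^sup>2) \<partial>half_interval)"
        unfolding A_def E_def chord_def by (rule integral_mult_right_zero)
      then show "(\<integral>h. A \<delta> t h \<partial>half_interval) = two_pi_i * of_real orient * q t"
        using both_sides_Cauchy[OF that(1) small[OF that(2)], of t] by (simp add: mult.commute)
    qed
    also have "\<dots> = two_pi_i * of_real orient * (\<integral>t. q t \<partial>unit_interval)" by (rule integral_mult_right_zero)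
    finally show ?thesis .
  qed
  have valS: "(\<integral>p. S \<delta> (fst p) (snd p) \<partial>torus) = two_pi_i * of_real orient * (\<integral>t. q t \<partial>unit_interval)"
    if d: "0 < \<delta>" "\<delta> < \<eta>" for \<delta>
  proof -
    have c2: "continuous_on UNIV (\<lambda>p::real \<times> real. (fst p + snd p, - snd p))" by (intro continuous_intros)
    have int': "integrable torus (\<lambda>p. A \<delta> (fst p + snd p) (- snd p))"
      using torus_integrable_continuous[of "\<lambda>t h. A \<delta> (t + h) (- h)"]
        continuous_on_compose2[OF contA[OF d] c2 subset_UNIV] by simp
    have S_eq: "S \<delta> t h = (1/2) * (A \<delta> t h + A \<delta> (t + h) (- h))" for t h
    proof -
      have "chord (t + h) (- h) = - chord t h" by (simp add: chord_def)
      then show ?thesis by (simp add: S_def A_def algebra_simps)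
    qed
    have "(\<integral>p. S \<delta> (fst p) (snd p) \<partial>torus) = (1/2) * (\<integral>p. A \<delta> (fst p) (snd p) + A \<delta> (fst p + snd p) (- snd p) \<partial>torus)"
      unfolding S_eq by (rule integral_mult_right_zero)
    also have "\<dots> = (1/2) * ((\<integral>p. A \<delta> (fst p) (snd p) \<partial>torus) + (\<integral>p. A \<delta> (fst p + snd p) (- snd p) \<partial>torus))"
      using intA[OF d] int' by simp
    also have "(\<integral>p. A \<delta> (fst p + snd p) (- snd p) \<partial>torus) = (\<integral>p. A \<delta> (fst p) (snd p) \<partial>torus)"
      by (rule torus_swap[OF contA[OF d] perA])
    finally show ?thesis using valA[OF d] by simp
  qed
  have [measurable]: "(\<lambda>p. q (fst p)) \<in> borel_measurable torus" "(\<lambda>p. q (fst p + snd p)) \<in> borel_measurable torus"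
    "(\<lambda>p. g (fst p)) \<in> borel_measurable torus" "(\<lambda>p. g (fst p + snd p)) \<in> borel_measurable torus"
    using measurable_torus_continuous[OF q] measurable_torus_continuous[OF cont_g] by auto
  have mS: "(\<lambda>p. S \<delta> (fst p) (snd p)) \<in> borel_measurable torus" for \<delta>
    unfolding S_def E_def by measurable
  have mP: "P \<in> borel_measurable torus" unfolding P_def by measurable
  have q0: "0 \<le> Bq" "0 \<le> Lq" using order_trans[OF norm_ge_zero bd[of 0]] order_trans[OF norm_ge_zero lip[of 0 1]] by simp_all
  define C1 where "C1 = Bq * bM + Lq * bM"
  have lip1: "norm (q t * g1 (t + h) - q (t + h) * g1 t) \<le> C1 * \<bar>h\<bar>" for t h
  proof -
    have "q t * g1 (t + h) - q (t + h) * g1 t = q t * (g1 (t + h) - g1 t) - (q (t + h) - q t) * g1 t" by (simp add: algebra_simps)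
    also have "norm \<dots> \<le> norm (q t) * norm (g1 (t + h) - g1 t) + norm (q (t + h) - q t) * norm (g1 t)"
      using norm_triangle_ineq4 by (metis norm_mult)
    also have "\<dots> \<le> Bq * (bM * \<bar>h\<bar>) + (Lq * \<bar>h\<bar>) * bM"
      using bd[of t] g1_lip[of t h] lip[of t h] g1_le[of t] q0 by (intro add_mono mult_mono) auto
    finally show ?thesis by (simp add: C1_def algebra_simps)
  qed
  define C2 where "C2 = Bq * (3 * bM ^ 3) + Lq * bM ^ 3"
  have lip3: "norm (q t * g1 (t + h) ^ 3 - q (t + h) * g1 t ^ 3) \<le> C2 * \<bar>h\<bar>" for t h
  proof -
    have cube: "norm (g1 (t + h) ^ 3 - g1 t ^ 3) \<le> 3 * bM ^ 3 * \<bar>h\<bar>"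
    proof -
      define u v where "u = g1 (t + h)" and "v = g1 t"
      have uv: "norm u \<le> bM" "norm v \<le> bM" using g1_le by (auto simp: u_def v_def)
      have "u ^ 3 - v ^ 3 = (u - v) * (u * u + u * v + v * v)" by (simp add: power3_eq_cube algebra_simps)
      then have "norm (u ^ 3 - v ^ 3) = norm (u - v) * norm (u * u + u * v + v * v)" by (simp only: norm_mult)
      also have "norm (u * u + u * v + v * v) \<le> norm u * norm u + norm u * norm v + norm v * norm v"
        by (rule order_trans[OF norm_triangle_ineq] add_mono order_refl | simp add: norm_mult norm_triangle_le)+
      also have "\<dots> \<le> bM * bM + bM * bM + bM * bM" using uv bM_pos by (intro add_mono mult_mono) auto
      finally have "norm (u ^ 3 - v ^ 3) \<le> norm (u - v) * (3 * bM\<^sup>2)" by (simp add: power2_eq_square mult_left_mono)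
      also have "\<dots> \<le> bM * \<bar>h\<bar> * (3 * bM\<^sup>2)" using g1_lip[of t h] by (intro mult_right_mono) (auto simp: u_def v_def)
      finally show ?thesis by (simp add: u_def v_def power2_eq_square power3_eq_cube mult_ac)
    qed
    have "q t * g1 (t + h) ^ 3 - q (t + h) * g1 t ^ 3 = q t * (g1 (t + h) ^ 3 - g1 t ^ 3) - (q (t + h) - q t) * g1 t ^ 3" by (simp add: algebra_simps)
    also have "norm \<dots> \<le> norm (q t) * norm (g1 (t + h) ^ 3 - g1 t ^ 3) + norm (q (t + h) - q t) * norm (g1 t ^ 3)"
      using norm_triangle_ineq4 by (metis norm_mult)
    also have "\<dots> \<le> Bq * (3 * bM ^ 3 * \<bar>h\<bar>) + (Lq * \<bar>h\<bar>) * bM ^ 3"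
      using bd[of t] cube lip[of t h] g1_le[of t] q0 by (intro add_mono mult_mono) (auto simp: norm_power power_mono)
    finally show ?thesis by (simp add: C2_def algebra_simps)
  qed
  define C where "C = max C1 C2 / (m\<^sup>2 * bc)"
  have mx: "C1 \<le> max C1 C2" "C2 \<le> max C1 C2" "0 \<le> max C1 C2"
    using q0 bM_pos by (auto simp: C1_def le_max_iff_disj)
  have bound: "norm (S \<delta> t h) \<le> C" if d: "0 < \<delta>" "\<delta> < \<eta>" and h: "\<bar>h\<bar> \<le> 1/2" "h \<noteq> 0" for \<delta> t h
  proof -
    define r where "r = norm (chord t h)"
    have r: "r > 0" "bc * \<bar>h\<bar> \<le> r" using chord_pos[OF h, of t] chord_lower[OF h(1), of t] by (auto simp: r_def)
    define Y where "Y = \<delta>\<^sup>2 + r\<^sup>2"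
    have Y: "Y > 0" "r\<^sup>2 \<le> Y" using r by (auto simp: Y_def intro: add_nonneg_pos)
    define E1 E2 where "E1 = E \<delta> t (t + h)" and "E2 = E \<delta> (t + h) t"
    have Ed: "E1 = (chord t h)\<^sup>2 + of_real (\<delta>\<^sup>2) * (g1 t)\<^sup>2" "E2 = (chord t h)\<^sup>2 + of_real (\<delta>\<^sup>2) * (g1 (t + h))\<^sup>2"
      by (simp_all add: E1_def E2_def E_def chord_def power2_commute)
    have El: "m * Y \<le> norm E1" "m * Y \<le> norm E2"
      using Elow[OF d, of "t + h" t] Elow[OF d, of t "t + h"] by (simp_all add: E1_def E2_def Y_def r_def chord_def norm_minus_commute)
    have En: "E1 \<noteq> 0" "E2 \<noteq> 0" using E0[OF d] by (auto simp: E1_def E2_def)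
    \<comment> \<open>Over the common denominator both brackets vanish on the diagonal and are of
      order h. The numerator is therefore bounded by |h| (\<delta>^2 + r^2), against a denominator
      of order (\<delta>^2 + r^2)^2, and the factor \<open>chord t h\<close> supplies the missing
      power. The cubes of \<open>g1\<close> come from the regularizing terms of the
      denominators.\<close>
    have num: "q t * g1 (t + h) * E2 - q (t + h) * g1 t * E1 = (q t * g1 (t + h) - q (t + h) * g1 t) * (chord t h)\<^sup>2
       + of_real (\<delta>\<^sup>2) * (q t * g1 (t + h) ^ 3 - q (t + h) * g1 t ^ 3)"
      unfolding Ed by (simp add: algebra_simps power2_eq_square power3_eq_cube)
    have "norm (q t * g1 (t + h) * E2 - q (t + h) * g1 t * E1) \<le> norm ((q t * g1 (t + h) - q (t + h) * g1 t) * (chord t h)\<^sup>2)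
       + norm (of_real (\<delta>\<^sup>2) * (q t * g1 (t + h) ^ 3 - q (t + h) * g1 t ^ 3))"
      unfolding num by (rule norm_triangle_ineq)
    also have "\<dots> = norm (q t * g1 (t + h) - q (t + h) * g1 t) * r\<^sup>2 + \<delta>\<^sup>2 * norm (q t * g1 (t + h) ^ 3 - q (t + h) * g1 t ^ 3)"
      by (simp add: norm_mult norm_power r_def)
    also have "\<dots> \<le> (max C1 C2 * \<bar>h\<bar>) * r\<^sup>2 + \<delta>\<^sup>2 * (max C1 C2 * \<bar>h\<bar>)"
      using order_trans[OF lip1 mult_right_mono[OF mx(1) abs_ge_zero]] order_trans[OF lip3 mult_right_mono[OF mx(2) abs_ge_zero]]
      by (intro add_mono mult_right_mono mult_left_mono) auto
    also have "\<dots> = max C1 C2 * \<bar>h\<bar> * Y" by (simp add: Y_def algebra_simps)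
    finally have n: "norm (q t * g1 (t + h) * E2 - q (t + h) * g1 t * E1) \<le> max C1 C2 * \<bar>h\<bar> * Y" .
    have "S \<delta> t h = chord t h * (q t * g1 (t + h) * E2 - q (t + h) * g1 t * E1) / (E1 * E2)"
      using En unfolding S_def E1_def[symmetric] E2_def[symmetric] by (simp add: diff_frac_eq)
    then have "norm (S \<delta> t h) = r * norm (q t * g1 (t + h) * E2 - q (t + h) * g1 t * E1) / (norm E1 * norm E2)"
      by (simp add: norm_mult norm_divide r_def)
    also have "\<dots> \<le> r * (max C1 C2 * \<bar>h\<bar> * Y) / ((m * Y) * (m * Y))"
      using n El r Y m mx by (intro frac_le mult_left_mono mult_mono mult_nonneg_nonneg mult_pos_pos) (auto intro: order_trans[OF norm_ge_zero])
    also have "\<dots> = max C1 C2 * (r * \<bar>h\<bar>) / (m\<^sup>2 * Y)" using Y m by (simp add: power2_eq_square mult_ac)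
    also have "\<dots> \<le> max C1 C2 * (r * (r / bc)) / (m\<^sup>2 * r\<^sup>2)"
      using r Y m mx bc_pos by (intro frac_le mult_left_mono) (auto simp: field_simps)
    also have "\<dots> = C" using r m bc_pos by (simp add: C_def power2_eq_square)
    finally show ?thesis .
  qed
  have lim: "((\<lambda>\<delta>. S \<delta> t h) \<longlongrightarrow> P (t, h)) (at_right 0)" if h: "\<bar>h\<bar> \<le> 1/2" "h \<noteq> 0" for t h
  proof -
    have c0: "chord t h \<noteq> 0" using chord_pos[OF h, of t] by auto
    have e: "((\<lambda>\<delta>. E \<delta> a b) \<longlongrightarrow> (g b - g a)\<^sup>2 + of_real (0\<^sup>2) * (g1 a)\<^sup>2) (at_right 0)" for a b
      unfolding E_def by (intro tendsto_intros)
    have "((\<lambda>\<delta>. S \<delta> t h) \<longlongrightarrow> chord t h * (q t * g1 (t + h) / ((g (t + h) - g t)\<^sup>2 + of_real (0\<^sup>2) * (g1 t)\<^sup>2)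
        - q (t + h) * g1 t / ((g t - g (t + h))\<^sup>2 + of_real (0\<^sup>2) * (g1 (t + h))\<^sup>2))) (at_right 0)"
      unfolding S_def using c0 by (intro tendsto_intros e) (auto simp: chord_def)
    moreover have "(g (t + h) - g t)\<^sup>2 + of_real (0\<^sup>2) * (g1 t)\<^sup>2 = (chord t h)\<^sup>2" "(g t - g (t + h))\<^sup>2 + of_real (0\<^sup>2) * (g1 (t + h))\<^sup>2 = (chord t h)\<^sup>2"
      by (simp_all add: chord_def power2_commute)
    moreover have "chord t h * (q t * g1 (t + h) / (chord t h)\<^sup>2 - q (t + h) * g1 t / (chord t h)\<^sup>2) = P (t, h)"
      using c0 by (simp add: P_def diff_divide_distrib[symmetric] power2_eq_square)
    ultimately show ?thesis by simp
  qed
  have nz: "AE p in torus. \<bar>snd p\<bar> \<le> 1/2 \<and> snd p \<noteq> 0"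
    using torus_neq_zero AE_space by eventually_elim (auto simp: abs_le_iff)
  have "((\<lambda>\<delta>. \<integral>p. S \<delta> (fst p) (snd p) \<partial>torus) \<longlongrightarrow> (\<integral>p. P p \<partial>torus)) (at_right 0)"
  proof (rule dominated_convergence_at_right[OF \<eta> mS mP, where w = "\<lambda>_. C"])
    show "AE p in torus. ((\<lambda>\<delta>. S \<delta> (fst p) (snd p)) \<longlongrightarrow> P p) (at_right 0)"
      using nz by eventually_elim (use lim in force)
    show "AE p in torus. norm (S \<delta> (fst p) (snd p)) \<le> C" if "0 < \<delta>" "\<delta> < \<eta>" for \<delta>
      using nz by eventually_elim (use bound[OF that] in auto)
  qed auto
  moreover have "eventually (\<lambda>\<delta>. (\<integral>p. S \<delta> (fst p) (snd p) \<partial>torus) = two_pi_i * of_real orient * (\<integral>t. q t \<partial>unit_interval)) (at_right 0)"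
    using eventually_at_right_real[OF \<eta>] by eventually_elim (use valS in auto)
  then have "((\<lambda>\<delta>. \<integral>p. S \<delta> (fst p) (snd p) \<partial>torus) \<longlongrightarrow> two_pi_i * of_real orient * (\<integral>t. q t \<partial>unit_interval)) (at_right 0)"
    by (rule tendsto_eventually)
  ultimately have "(\<integral>p. P p \<partial>torus) = two_pi_i * of_real orient * (\<integral>t. q t \<partial>unit_interval)"
    using tendsto_unique[OF trivial_limit_at_right_real] by blast
  then show "(\<integral>p. (q (fst p) * g1 (fst p + snd p) - q (fst p + snd p) * g1 (fst p)) / chord (fst p) (snd p) \<partial>torus)
      = two_pi_i * of_real orient * (\<integral>t. q t \<partial>unit_interval)" by (simp add: P_def)
  have "norm (P (t, h)) \<le> C1 / bc" if "\<bar>h\<bar> \<le> 1/2" for t h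
  proof (cases "h = 0")
    case True
    then show ?thesis using q0 bM_pos bc_pos by (simp add: P_def C1_def)
  next
    case False
    have "norm (P (t, h)) \<le> (C1 * \<bar>h\<bar>) / (bc * \<bar>h\<bar>)"
      unfolding P_def norm_divide fst_conv snd_conv
      using lip1[of t h] chord_lower[OF that, of t] bc_pos False by (intro frac_le) (auto intro: order_trans[OF norm_ge_zero])
    then show ?thesis using False by simp
  qed
  then have "integrable torus P"
    by (intro integrable_torus_bounded[OF mP, of "C1 / bc"]) (auto simp: abs_le_iff)
  then show "integrable torus (\<lambda>p. (q (fst p) * g1 (fst p + snd p) - q (fst p + snd p) * g1 (fst p)) / chord (fst p) (snd p))"
    by (simp add: P_def)
qed

lemma energy_density_quotients:
  assumes "chord t h \<noteq> 0"
  shows "energy_density t h = Im (g1 (t + h) / chord t h) * Im (g1 t / chord t h)"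
proof -
  define r where "r = norm (chord t h)"
  have r: "r > 0" using assms by (simp add: r_def)
  have q: "Im (u / chord t h) = Im (u * cnj (chord t h)) / r\<^sup>2" for u
    by (simp add: Im_divide r_def cmod_power2 algebra_simps)
  show ?thesis unfolding q energy_density_def normal_product_def r_def[symmetric]
    using r by (simp add: power2_eq_square power4_eq_xxxx)
qed

lemma energy_density_integrable: "integrable torus (\<lambda>p. energy_density (fst p) (snd p))"
  by (rule integrable_torus_bounded[where B = "bM\<^sup>2 / bc ^ 4"]) (use energy_density_bound in \<open>auto simp: abs_le_iff\<close>)

end

lemma Im_times_Im: "Im a * Im b = (Re (a * cnj b) - Re (a * b)) / 2"
  by simp

text \<open>A Moebius map with denominator \<open>c x + e\<close> shifts the logarithmic derivatives \<open>\<alpha> = x'/(x - y)\<close> and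
  \<open>\<beta> = y'/(x - y)\<close> by \<open>- p\<close> and \<open>r\<close>, but keeps their product, the infinitesimal cross ratio.\<close>

lemma Im_product_shift:
  assumes "(\<alpha> - p) * (\<beta> + r) = \<alpha> * \<beta>"
  shows "Im (\<alpha> - p) * Im (\<beta> + r) = Im \<alpha> * Im \<beta> + (Re (\<alpha> * cnj r - \<beta> * cnj p) - Re (p * cnj r)) / 2"
proof -
  have "(\<alpha> - p) * cnj (\<beta> + r) = \<alpha> * cnj \<beta> + \<alpha> * cnj r - p * cnj \<beta> - p * cnj r" by (simp add: algebra_simps)
  moreover have "Re (p * cnj \<beta>) = Re (\<beta> * cnj p)" by (simp add: mult.commute)
  ultimately have "Re ((\<alpha> - p) * cnj (\<beta> + r)) = Re (\<alpha> * cnj \<beta>) + Re (\<alpha> * cnj r) - Re (\<beta> * cnj p) - Re (p * cnj r)"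
    by (simp only: minus_complex.sel plus_complex.sel)
  then show ?thesis unfolding Im_times_Im assms by (simp add: field_simps)
qed

context C2_curve
begin

lemma cnj_C2_curve: "C2_curve (\<lambda>t. cnj (g t)) (\<lambda>t. cnj (g1 t)) (\<lambda>t. cnj (g2 t))"
proof
  show "((\<lambda>t. cnj (g t)) has_vector_derivative cnj (g1 t)) (at t)" for t
    by (rule bounded_linear.has_vector_derivative[OF bounded_linear_cnj deriv_g])
  show "((\<lambda>t. cnj (g1 t)) has_vector_derivative cnj (g2 t)) (at t)" for t
    by (rule bounded_linear.has_vector_derivative[OF bounded_linear_cnj deriv_g1])
  show "continuous_on UNIV (\<lambda>t. cnj (g2 t))" by (intro continuous_intros cont_g2)
  show "inj_on (\<lambda>t. cnj (g t)) {0..<1}" using inj_g by (auto simp: inj_on_def)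
qed (use periodic_g regular in auto)

lemma cnj_energy: "C2_curve.energy (\<lambda>t. cnj (g t)) (\<lambda>t. cnj (g1 t)) = energy"
proof -
  interpret c: C2_curve "\<lambda>t. cnj (g t)" "\<lambda>t. cnj (g1 t)" "\<lambda>t. cnj (g2 t)" by (rule cnj_C2_curve)
  have ch: "c.chord t h = cnj (chord t h)" for t h by (simp add: c.chord_def chord_def)
  have "c.energy_density t h = energy_density t h" for t h
  proof -
    have i: "Im (cnj a * cnj (cnj b)) = - Im (a * cnj b)" for a b by simp
    have "c.normal_product t h = normal_product t h"
      unfolding c.normal_product_def normal_product_def ch i by (rule minus_mult_minus)
    then show ?thesis by (simp add: c.energy_density_def energy_density_def ch)
  qed
  then show ?thesis by (simp add: c.energy_def energy_def)
qed

end

section \<open>Moebius images of a curve\<close>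

locale moebius_curve = C2_curve +
  fixes a b c e :: complex
  assumes det: "a * e - b * c \<noteq> 0" and denom: "\<And>t. c * g t + e \<noteq> 0"
begin

definition m0 :: "real \<Rightarrow> complex" where "m0 t = (a * g t + b) / (c * g t + e)"
definition m1 :: "real \<Rightarrow> complex" where "m1 t = (a * e - b * c) * g1 t / (c * g t + e)\<^sup>2"
definition m2 :: "real \<Rightarrow> complex" where
  "m2 t = (a * e - b * c) * g2 t / (c * g t + e)\<^sup>2 - 2 * c * (a * e - b * c) * (g1 t)\<^sup>2 / (c * g t + e) ^ 3"

definition logd :: "real \<Rightarrow> complex" where "logd t = c * g1 t / (c * g t + e)"
definition logd1 :: "real \<Rightarrow> complex" where "logd1 t = c * g2 t / (c * g t + e) - (logd t)\<^sup>2"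

lemma deriv_denom_inverse:
  "((\<lambda>t. inverse (c * g t + e)) has_vector_derivative - (c * g1 t) / (c * g t + e)\<^sup>2) (at t)"
proof -
  have "((\<lambda>z. inverse (c * z + e)) has_field_derivative - c / (c * g t + e)\<^sup>2) (at (g t))"
    using denom[of t] by (auto intro!: derivative_eq_intros simp: power2_eq_square field_simps)
  from field_vector_diff_chain_at[OF deriv_g this] show ?thesis by (simp add: o_def mult.commute)
qed

lemma deriv_logd: "(logd has_vector_derivative logd1 t) (at t)"
proof -
  have "((\<lambda>t. c * g1 t * inverse (c * g t + e)) has_vector_derivative
     c * g1 t * (- (c * g1 t) / (c * g t + e)\<^sup>2) + c * g2 t * inverse (c * g t + e)) (at t)"
    by (intro has_vector_derivative_mult has_vector_derivative_mult_right deriv_g1 deriv_denom_inverse)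
  moreover have "c * g1 t * (- (c * g1 t) / (c * g t + e)\<^sup>2) + c * g2 t * inverse (c * g t + e) = logd1 t"
    by (simp add: logd1_def logd_def power_divide power_mult_distrib divide_inverse power2_eq_square)
  ultimately show ?thesis by (simp add: logd_def[abs_def] divide_inverse)
qed

lemma cont_logd: "continuous_on S logd" "continuous_on S logd1"
  unfolding logd1_def[abs_def] logd_def[abs_def] using denom by (intro continuous_intros cont_g cont_g1 cont_g2'; simp)+

lemma periodic_logd: "logd (t + 1) = logd t" "logd1 (t + 1) = logd1 t"
  by (simp_all add: logd1_def logd_def periodic_g periodic_g1 periodic_g2)

lemma moebius_C2: "C2_curve m0 m1 m2"
proof
  fix t
  have d0: "((\<lambda>z. (a * z + b) / (c * z + e)) has_field_derivative (a * e - b * c) / (c * g t + e)\<^sup>2) (at (g t))"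
    using denom[of t] by (auto intro!: derivative_eq_intros simp: power2_eq_square field_simps)
  from field_vector_diff_chain_at[OF deriv_g d0]
  show "(m0 has_vector_derivative m1 t) (at t)" by (simp add: o_def m0_def[abs_def] m1_def mult.commute)
  have d1: "((\<lambda>z. (a * e - b * c) / (c * z + e)\<^sup>2) has_field_derivative - 2 * c * (a * e - b * c) / (c * g t + e) ^ 3) (at (g t))"
  proof -
    define w where "w = c * g t + e"
    have w: "w \<noteq> 0" using denom by (simp add: w_def)
    have "((\<lambda>z. (a * e - b * c) / (c * z + e)\<^sup>2) has_field_derivative (0 * (c * g t + e)\<^sup>2 - (a * e - b * c) * (2 * (c * g t + e) * c)) / ((c * g t + e)\<^sup>2 * (c * g t + e)\<^sup>2)) (at (g t))"
      using denom[of t] by (intro DERIV_divide) (auto intro!: derivative_eq_intros)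
    moreover have "(0 * w\<^sup>2 - (a * e - b * c) * (2 * w * c)) / (w\<^sup>2 * w\<^sup>2) = - 2 * c * (a * e - b * c) / w ^ 3"
      using w by (simp add: power2_eq_square power3_eq_cube mult_ac)
    ultimately show ?thesis by (simp only: w_def)
  qed
  have "((\<lambda>t. g1 t * ((a * e - b * c) / (c * g t + e)\<^sup>2)) has_vector_derivative
     g1 t * (g1 t * (- 2 * c * (a * e - b * c) / (c * g t + e) ^ 3)) + g2 t * ((a * e - b * c) / (c * g t + e)\<^sup>2)) (at t)"
    using field_vector_diff_chain_at[OF deriv_g d1] by (intro has_vector_derivative_mult deriv_g1) (simp add: o_def)
  moreover have "(\<lambda>t. g1 t * ((a * e - b * c) / (c * g t + e)\<^sup>2)) = m1" by (simp add: m1_def[abs_def] mult.commute)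
  moreover have "g1 t * (g1 t * (- 2 * c * (a * e - b * c) / (c * g t + e) ^ 3)) + g2 t * ((a * e - b * c) / (c * g t + e)\<^sup>2) = m2 t"
    by (simp add: m2_def power2_eq_square mult_ac)
  ultimately show "(m1 has_vector_derivative m2 t) (at t)" by (simp only:)
  show "m0 (t + 1) = m0 t" by (simp add: m0_def periodic_g)
  show "m1 t \<noteq> 0" using det denom regular by (simp add: m1_def)
next
  show "continuous_on UNIV m2" unfolding m2_def[abs_def] using denom by (intro continuous_intros cont_g cont_g1 cont_g2') auto
  show "inj_on m0 {0..<1}"
  proof (rule inj_onI)
    fix s t assume st: "s \<in> {0..<1::real}" "t \<in> {0..<1}" "m0 s = m0 t"
    then have "(a * g s + b) * (c * g t + e) = (a * g t + b) * (c * g s + e)"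
      using denom[of s] denom[of t] by (simp add: m0_def frac_eq_eq)
    then have "(a * e - b * c) * (g s - g t) = 0" by (simp add: algebra_simps)
    then have "g s = g t" using det by simp
    then show "s = t" using inj_onD[OF inj_g] st by blast
  qed
qed

sublocale m: C2_curve m0 m1 m2 by (rule moebius_C2)

lemma m_chord: "m.chord t h = (a * e - b * c) * chord t h / ((c * g (t + h) + e) * (c * g t + e))"
proof -
  define X Y where "X = c * g (t + h) + e" and "Y = c * g t + e"
  have XY: "X \<noteq> 0" "Y \<noteq> 0" using denom by (auto simp: X_def Y_def)
  have "m.chord t h = ((a * g (t + h) + b) * Y - (a * g t + b) * X) / (X * Y)"
    using XY by (simp add: m.chord_def m0_def X_def[symmetric] Y_def[symmetric] diff_frac_eq)
  also have "(a * g (t + h) + b) * Y - (a * g t + b) * X = (a * e - b * c) * chord t h"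
    by (simp add: X_def Y_def chord_def algebra_simps)
  finally show ?thesis by (simp add: X_def Y_def)
qed

text \<open>With denominators X and Y at the two points and chord d, the image quotients are the old
  ones times Y / X and X / Y. As X - Y = c d, this is the additive shift by logarithmic derivatives,
  while the product is unchanged, which is what \<open>Im_product_shift\<close> asks for.\<close>

lemma m_energy_density:
  assumes ch: "chord t h \<noteq> 0"
  shows "m.energy_density t h = energy_density t h +
    (Re ((cnj (logd t) * g1 (t + h) - cnj (logd (t + h)) * g1 t) / chord t h) - Re (logd (t + h) * cnj (logd t))) / 2"
proof -
  define X Y d D where "X = c * g (t + h) + e" and "Y = c * g t + e" and "d = chord t h" and "D = a * e - b * c"
  have nz: "X \<noteq> 0" "Y \<noteq> 0" "d \<noteq> 0" "D \<noteq> 0" using denom ch det by (auto simp: X_def Y_def d_def D_def)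
  have XY: "X - Y = c * d" by (simp add: X_def Y_def d_def chord_def algebra_simps)
  have md: "m.chord t h = D * d / (X * Y)" by (simp add: m_chord X_def Y_def d_def D_def)
  have mn: "m.chord t h \<noteq> 0" using nz by (simp add: md)
  define \<alpha> \<beta> where "\<alpha> = g1 (t + h) / d" and "\<beta> = g1 t / d"
  have p: "logd (t + h) = c * g1 (t + h) / X" "logd t = c * g1 t / Y" by (simp_all add: logd_def X_def Y_def)
  have A: "m1 (t + h) / m.chord t h = \<alpha> - logd (t + h)"
  proof -
    have "m1 (t + h) / m.chord t h = g1 (t + h) * Y / (X * d)"
      using nz by (simp add: m1_def md X_def[symmetric] D_def[symmetric] power2_eq_square)
    also have "Y = X - c * d" using XY by (simp add: algebra_simps)
    also have "g1 (t + h) * (X - c * d) / (X * d) = \<alpha> - logd (t + h)"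
      using nz unfolding p \<alpha>_def by (simp add: field_simps)
    finally show ?thesis .
  qed
  have B: "m1 t / m.chord t h = \<beta> + logd t"
  proof -
    have "m1 t / m.chord t h = g1 t * X / (Y * d)"
      using nz by (simp add: m1_def md Y_def[symmetric] D_def[symmetric] power2_eq_square)
    also have "X = Y + c * d" using XY by (simp add: algebra_simps)
    also have "g1 t * (Y + c * d) / (Y * d) = \<beta> + logd t"
      using nz unfolding p \<beta>_def by (simp add: field_simps)
    finally show ?thesis .
  qed
  have prod: "(\<alpha> - logd (t + h)) * (\<beta> + logd t) = \<alpha> * \<beta>"
  proof -
    have "(\<alpha> - logd (t + h)) * (\<beta> + logd t) = (m1 (t + h) / m.chord t h) * (m1 t / m.chord t h)" by (simp only: A B)
    also have "\<dots> = \<alpha> * \<beta>"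
      using nz by (simp add: m1_def md X_def[symmetric] Y_def[symmetric] D_def[symmetric] \<alpha>_def \<beta>_def power2_eq_square)
    finally show ?thesis .
  qed
  have "m.energy_density t h = Im (\<alpha> - logd (t + h)) * Im (\<beta> + logd t)"
    unfolding m.energy_density_quotients[OF mn] A B ..
  also have "\<dots> = Im \<alpha> * Im \<beta> + (Re (\<alpha> * cnj (logd t) - \<beta> * cnj (logd (t + h))) - Re (logd (t + h) * cnj (logd t))) / 2"
    by (rule Im_product_shift[OF prod])
  also have "Im \<alpha> * Im \<beta> = energy_density t h" unfolding energy_density_quotients[OF ch] \<alpha>_def \<beta>_def d_def ..
  also have "\<alpha> * cnj (logd t) - \<beta> * cnj (logd (t + h)) = (cnj (logd t) * g1 (t + h) - cnj (logd (t + h)) * g1 t) / chord t h"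
    by (simp add: \<alpha>_def \<beta>_def d_def diff_divide_distrib mult.commute)
  finally show ?thesis .
qed

definition pole_winding :: real where
  "pole_winding = (if c \<noteq> 0 \<and> - e / c \<in> inside K then orient else 0)"

lemma pole_notin_K: "c \<noteq> 0 \<Longrightarrow> - e / c \<notin> K"
proof
  assume c: "c \<noteq> 0" and "- e / c \<in> K"
  then obtain t where "- e / c = g t" by (auto simp: K_range)
  from this[symmetric] have "c * g t + e = 0" using c by simp
  then show False using denom by simp
qed

lemma integral_logd: "(\<integral>t. logd t \<partial>unit_interval) = two_pi_i * of_real pole_winding"
proof (cases "c = 0")
  case True
  have "logd t = 0" for t using logd_def[of t] True by simp
  moreover have "pole_winding = 0" using pole_winding_def True by simp
  ultimately show ?thesis by simp
next
  case False
  define z where "z = - e / c"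
  have z: "z \<notin> K" unfolding z_def by (rule pole_notin_K[OF False])
  have l: "logd = (\<lambda>t. g1 t / (g t - z))"
  proof
    fix t
    have "c * g t + e = c * (g t - z)" using False by (simp add: z_def algebra_simps)
    then show "logd t = g1 t / (g t - z)" using False by (simp add: logd_def)
  qed
  have "z \<in> inside K \<or> z \<in> outside K" using inside_Un_outside_K z by blast
  then have "winding_number g z = of_real pole_winding"
    using winding_g[of z] inside_Int_outside_K False unfolding pole_winding_def z_def[symmetric] by auto
  then show ?thesis
    using AE_circle_integral_encloses(2)[OF C1_loop_g _ winding_number_has_integral_C1[OF C1_loop_g]] z
    unfolding l K_def by simp
qed

text \<open>The change of the density is (Re P - Re R) / 2. The symmetrized Plemelj formula with
  \<open>q = cnj logd\<close> evaluates P to 4 pi^2 o n, and R is a product integral with value 4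
  pi^2 n^2, where o is the orientation and n the winding number about the pole. These agree because
  n is 0 or o.\<close>

lemma energy_invariant: "m.energy = energy"
proof -
  define q where "q = (\<lambda>t. cnj (logd t))"
  obtain L where L: "L > 0" "\<And>t. norm (logd1 t) \<le> L" by (rule periodic_bounded[OF cont_logd(2) periodic_logd(2)], blast)
  obtain B where B: "B > 0" "\<And>t. norm (logd t) \<le> B" by (rule periodic_bounded[OF cont_logd(1) periodic_logd(1)], blast)
  have qc: "continuous_on UNIV q" unfolding q_def by (intro continuous_intros cont_logd)
  have qp: "q (t + 1) = q t" for t by (simp add: q_def periodic_logd)
  have ql: "norm (q (t + h) - q t) \<le> L * \<bar>h\<bar>" for t h
    using lipschitz_of_bounded_derivative[OF deriv_logd L(2), of t h] unfolding q_def
    by (metis complex_cnj_diff complex_mod_cnj)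
  have qb: "norm (q t) \<le> B" for t using B by (simp add: q_def)
  define P where "P = (\<lambda>p. (q (fst p) * g1 (fst p + snd p) - q (fst p + snd p) * g1 (fst p)) / chord (fst p) (snd p))"
  note SP = symmetric_Plemelj[OF qc qp ql qb, folded P_def]
  define R where "R = (\<lambda>p. logd (fst p + snd p) * q (fst p))"
  have Rint: "integrable torus R"
    unfolding R_def
    by (rule torus_integrable_continuous[of "\<lambda>t h. logd (t + h) * q t"])
       (intro continuous_intros continuous_on_compose2[OF cont_logd(1)[of UNIV]] continuous_on_compose2[OF qc]; simp)
  have iq: "(\<integral>t. q t \<partial>unit_interval) = - (two_pi_i * of_real pole_winding)"
  proof -
    have "(\<integral>t. q t \<partial>unit_interval) = cnj (\<integral>t. logd t \<partial>unit_interval)"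
      unfolding q_def by (rule integral_bounded_linear[OF bounded_linear_cnj]) (rule unit_interval_integrable_continuous[OF cont_logd(1)])
    then show ?thesis by (simp add: integral_logd)
  qed
  have iP: "(\<integral>p. P p \<partial>torus) = of_real (4 * pi\<^sup>2 * orient * pole_winding)"
    unfolding SP(2) iq by (simp add: power2_eq_square algebra_simps)
  have iR: "(\<integral>p. R p \<partial>torus) = of_real (4 * pi\<^sup>2 * pole_winding * pole_winding)"
  proof -
    have lm: "logd \<in> borel_measurable borel" using cont_logd(1) by (rule borel_measurable_continuous_onI)
    have "(\<integral>p. R p \<partial>torus) = (\<integral>t. (\<integral>h. logd (t + h) * q t \<partial>half_interval) \<partial>unit_interval)"
      using torus.integral_fst'[OF Rint] by (simp add: R_def)
    also have "\<dots> = (\<integral>t. (\<integral>t. logd t \<partial>unit_interval) * q t \<partial>unit_interval)"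
      using periodic_half_interval(2)[OF lm periodic_logd(1) unit_interval_integrable_continuous[OF cont_logd(1)]]
      by (simp only: integral_mult_left_zero)
    also have "\<dots> = (\<integral>t. logd t \<partial>unit_interval) * (\<integral>t. q t \<partial>unit_interval)" by (rule integral_mult_right_zero)
    finally show ?thesis unfolding iq integral_logd by (simp add: power2_eq_square algebra_simps)
  qed
  have pw: "pole_winding * pole_winding = orient * pole_winding" by (cases "c \<noteq> 0 \<and> - e / c \<in> inside K") (simp_all add: pole_winding_def)
  have RePR: "integrable torus (\<lambda>p. Re (P p))" "integrable torus (\<lambda>p. Re (R p))"
    using SP(1) Rint by (auto intro: integrable_bounded_linear[OF bounded_linear_Re])
  have "(\<integral>p. m.energy_density (fst p) (snd p) \<partial>torus) = (\<integral>p. energy_density (fst p) (snd p) + (Re (P p) - Re (R p)) / 2 \<partial>torus)"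
  proof (rule integral_cong_AE)
    show "AE p in torus. m.energy_density (fst p) (snd p) = energy_density (fst p) (snd p) + (Re (P p) - Re (R p)) / 2"
      using torus_neq_zero AE_space
    proof eventually_elim
      case (elim p)
      then have "\<bar>snd p\<bar> \<le> 1/2" by (auto simp: abs_le_iff)
      then have "chord (fst p) (snd p) \<noteq> 0" using chord_pos[of "snd p" "fst p"] elim by auto
      then show ?case by (simp add: m_energy_density P_def R_def q_def)
    qed
    show "(\<lambda>p. m.energy_density (fst p) (snd p)) \<in> borel_measurable torus" by measurable
    show "(\<lambda>p. energy_density (fst p) (snd p) + (Re (P p) - Re (R p)) / 2) \<in> borel_measurable torus"
      using RePR by measurable
  qed
  also have "\<dots> = (\<integral>p. energy_density (fst p) (snd p) \<partial>torus) + ((\<integral>p. Re (P p) \<partial>torus) - (\<integral>p. Re (R p) \<partial>torus)) / 2"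
    using RePR energy_density_integrable by simp
  also have "(\<integral>p. Re (P p) \<partial>torus) = Re (\<integral>p. P p \<partial>torus)" by (rule integral_bounded_linear[OF bounded_linear_Re SP(1)])
  also have "(\<integral>p. Re (R p) \<partial>torus) = Re (\<integral>p. R p \<partial>torus)" by (rule integral_bounded_linear[OF bounded_linear_Re Rint])
  also have "Re (\<integral>p. P p \<partial>torus) - Re (\<integral>p. R p \<partial>torus) = 0"
    unfolding iP iR Re_complex_of_real mult.assoc pw by simp
  finally show ?thesis by (simp add: m.energy_def energy_def)
qed

end

subsection \<open>Parallel curves\<close>

lemma integrable_inverse_one_plus_square:
  assumes "a > (0::real)"
  shows "integrable lborel (\<lambda>x::real. 1 / (1 + a * x\<^sup>2))"
proof -
  have pos: "1 + x\<^sup>2 > 0" for x :: real by (simp add: add_pos_nonneg)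
  have half: "(\<integral>\<^sup>+x. ennreal (1 / (1 + x\<^sup>2)) * indicator {0..} x \<partial>lborel) = ennreal (pi / 2 - arctan 0)"
  proof (rule nn_integral_FTC_atLeast)
    show "DERIV arctan x :> 1 / (1 + x\<^sup>2)" for x :: real
      using DERIV_arctan[of x] by (simp only: inverse_eq_divide)
    show "0 \<le> 1 / (1 + x\<^sup>2)" for x :: real using pos[of x] by simp
  qed (auto intro: tendsto_arctan_at_top)
  have "(\<integral>\<^sup>+x. ennreal (1 / (1 + x\<^sup>2)) * indicator {..0::real} x \<partial>lborel)
      = (\<integral>\<^sup>+x. ennreal (1 / (1 + (0 + (-1) * x)\<^sup>2)) * indicator {..0::real} (0 + (-1) * x) \<partial>lborel)"
    by (subst nn_integral_real_affine[where c = "-1" and t = 0]) auto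
  also have "\<dots> = (\<integral>\<^sup>+x. ennreal (1 / (1 + x\<^sup>2)) * indicator {0..} x \<partial>lborel)"
    by (intro nn_integral_cong) (auto simp: indicator_def)
  finally have half': "(\<integral>\<^sup>+x. ennreal (1 / (1 + x\<^sup>2)) * indicator {..0::real} x \<partial>lborel) = ennreal (pi / 2)"
    using half by simp
  have "integrable lborel (\<lambda>x::real. 1 / (1 + x\<^sup>2))"
  proof (rule integrableI_bounded)
    have "(\<integral>\<^sup>+x. ennreal (norm (1 / (1 + (x::real)\<^sup>2))) \<partial>lborel)
      \<le> (\<integral>\<^sup>+x. ennreal (1 / (1 + x\<^sup>2)) * indicator {0..} x + ennreal (1 / (1 + x\<^sup>2)) * indicator {..0::real} x \<partial>lborel)"
    proof (rule nn_integral_mono)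
      fix x :: real
      show "ennreal (norm (1 / (1 + x\<^sup>2))) \<le> ennreal (1 / (1 + x\<^sup>2)) * indicator {0..} x + ennreal (1 / (1 + x\<^sup>2)) * indicator {..0} x"
        using pos[of x] by (cases "x \<ge> 0") (auto simp: indicator_def)
    qed
    also have "\<dots> = ennreal (pi / 2) + ennreal (pi / 2)"
      using half half' by (subst nn_integral_add) auto
    also have "\<dots> < \<infinity>" by simp
    finally show "(\<integral>\<^sup>+x. ennreal (norm (1 / (1 + (x::real)\<^sup>2))) \<partial>lborel) < \<infinity>" .
  qed measurable
  from lborel_integrable_real_affine[OF this, of "sqrt a" 0]
  show ?thesis using assms by (simp add: power_mult_distrib)
qed

interpretation unit_line: pair_sigma_finite unit_interval "lborel :: real measure"
  by unfold_locales

interpretation unit_square: pair_sigma_finite unit_interval unit_interval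
  by unfold_locales

abbreviation strip :: "(real \<times> real) measure" where
  "strip \<equiv> unit_interval \<Otimes>\<^sub>M lborel"

lemma measurable_strip [measurable]:
  "fst \<in> borel_measurable strip" "snd \<in> borel_measurable strip"
proof -
  show "fst \<in> borel_measurable strip"
    using measurable_compose[OF measurable_fst measurable_unit_interval[of "\<lambda>x. x"]] by simp
  have "snd \<in> measurable strip lborel" by (rule measurable_snd)
  then show "snd \<in> borel_measurable strip" by simp
qed

lemma strip_integrable_snd:
  fixes w :: "real \<Rightarrow> real"
  assumes w: "integrable lborel w"
  shows "integrable strip (\<lambda>p. w (snd p))"
proof (rule unit_line.Fubini_integrable)
  have [measurable]: "w \<in> borel_measurable borel" using borel_measurable_integrable[OF w] by simp
  show "(\<lambda>p. w (snd p)) \<in> borel_measurable strip" by measurable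
qed (use w in simp_all)

text \<open>The inverse squared distance is not holomorphic. Replacing the conjugate of p = \<zeta>
  - i \<delta> by q = \<zeta> + i \<delta> makes it holomorphic, and the error carries the factor q
  - cnj p = 2 i Im \<zeta>, the distance from the tangent line, which is of second order along a
  curve.\<close>

lemma Re_kernel_split:
  assumes "\<zeta> - \<i> * of_real \<delta> \<noteq> 0" "\<zeta> + \<i> * of_real \<delta> \<noteq> 0"
  shows "Re z / (norm (\<zeta> - \<i> * of_real \<delta>))\<^sup>2 = Re (z / (\<zeta>\<^sup>2 + (of_real \<delta>)\<^sup>2))
    + (- 2 * Im \<zeta> * Im (z * cnj \<zeta>) + 2 * \<delta> * Im \<zeta> * Re z) / (norm (\<zeta>\<^sup>2 + (of_real \<delta>)\<^sup>2))\<^sup>2"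
proof -
  define p q where "p = \<zeta> - \<i> * of_real \<delta>" and "q = \<zeta> + \<i> * of_real \<delta>"
  have nz: "p \<noteq> 0" "q \<noteq> 0" using assms by (auto simp: p_def q_def)
  have pq: "p * q = \<zeta>\<^sup>2 + (of_real \<delta>)\<^sup>2" by (simp add: p_def q_def algebra_simps power2_eq_square)
  have qp: "q - cnj p = 2 * \<i> * of_real (Im \<zeta>)" by (simp add: p_def q_def complex_eq_iff)
  have "z / (p * cnj p) - z / (p * q) = z * (q - cnj p) / (p * cnj p * q)"
    using nz by (simp add: field_simps)
  also have "\<dots> = z * (q - cnj p) * cnj q / ((p * cnj p) * (q * cnj q))" using nz by simp
  also have "z * (q - cnj p) * cnj q = of_real (Im \<zeta>) * (2 * \<i> * (z * cnj \<zeta>) + 2 * of_real \<delta> * z)"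
    unfolding qp by (simp add: q_def algebra_simps)
  also have "(p * cnj p) * (q * cnj q) = of_real ((norm (p * q))\<^sup>2)"
    by (simp add: complex_norm_square[symmetric] norm_mult power_mult_distrib)
  finally have "Re (z / (p * cnj p) - z / (p * q)) = Im \<zeta> * (- 2 * Im (z * cnj \<zeta>) + 2 * \<delta> * Re z) / (norm (p * q))\<^sup>2"
    by (simp only: Re_divide_of_real) simp
  moreover have "Re (z / (p * cnj p)) = Re z / (norm p)\<^sup>2"
    by (simp only: complex_norm_square[symmetric] Re_divide_of_real)
  ultimately have "Re z / (norm p)\<^sup>2 = Re (z / (p * q)) + Im \<zeta> * (- 2 * Im (z * cnj \<zeta>) + 2 * \<delta> * Re z) / (norm (p * q))\<^sup>2"
    by simp
  then show ?thesis unfolding pq unfolding p_def by (simp add: algebra_simps)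
qed

text \<open>The mass of the boundary layer profile. It is kept symbolic: what matters is that it is
  the same constant for every curve.\<close>

definition bump_integral :: real where
  "bump_integral = (\<integral>x. x\<^sup>2 / (1 + x\<^sup>2)\<^sup>2 \<partial>lborel)"

lemma bump_integral_scaled:
  assumes "a > 0"
  shows "(\<integral>x. a ^ 3 * x\<^sup>2 / (1 + a\<^sup>2 * x\<^sup>2)\<^sup>2 \<partial>lborel) = bump_integral"
proof -
  have "bump_integral = \<bar>a\<bar> *\<^sub>R (\<integral>x. (0 + a * x)\<^sup>2 / (1 + (0 + a * x)\<^sup>2)\<^sup>2 \<partial>lborel)"
    unfolding bump_integral_def using assms by (intro lborel_integral_real_affine) auto
  also have "\<dots> = (\<integral>x. a * ((0 + a * x)\<^sup>2 / (1 + (0 + a * x)\<^sup>2)\<^sup>2) \<partial>lborel)"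
    by (simp only: integral_mult_right_zero real_scaleR_def abs_of_pos[OF assms])
  also have "\<dots> = (\<integral>x. a ^ 3 * x\<^sup>2 / (1 + a\<^sup>2 * x\<^sup>2)\<^sup>2 \<partial>lborel)"
    by (intro Bochner_Integration.integral_cong) (auto simp: power_mult_distrib power2_eq_square power3_eq_cube mult_ac)
  finally show ?thesis by simp
qed

context C2_curve
begin

text \<open>Multiplication by \<open>cnj (tang t)\<close> makes the tangent at \<open>t\<close> the
  real direction: \<open>offset\<close> is the normal component of the chord, and
  \<open>forward\<close> the tangential component of the second velocity.\<close>

definition offset :: "real \<Rightarrow> real \<Rightarrow> real" where "offset t h = Im (chord t h * cnj (tang t))"
definition forward :: "real \<Rightarrow> real \<Rightarrow> real" where "forward t h = Re (g1 (t + h) * cnj (tang t))"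
definition weight :: "real \<Rightarrow> real \<Rightarrow> real \<Rightarrow> real" where
  "weight \<delta> t h = norm ((chord t h)\<^sup>2 + (of_real \<delta> * tang t)\<^sup>2)"
definition par_kernel :: "real \<Rightarrow> real \<Rightarrow> real \<Rightarrow> real" where
  "par_kernel \<delta> t h = forward t h / (norm (chord t h - \<i> * of_real \<delta> * tang t))\<^sup>2"
text \<open>The holomorphic substitute for \<open>par_kernel\<close>: as a form in the second curve
  point it has simple poles at the two tube points with offsets \<delta> and -\<delta>.\<close>

definition residue_kernel :: "real \<Rightarrow> real \<Rightarrow> real \<Rightarrow> complex" where
  "residue_kernel \<delta> t h = g1 (t + h) * tang t / ((chord t h)\<^sup>2 + (of_real \<delta> * tang t)\<^sup>2)"

lemma periodic_turn: "turn (t + 1) = turn t"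
  by (simp add: turn_def periodic_g1 periodic_g2)

lemma tang_cnj: "tang t * cnj (tang t) = 1"
  using complex_norm_square[of "tang t"] by simp

lemma g1_tang: "g1 t = of_real (norm (g1 t)) * tang t"
  using regular[of t] by (simp add: tang_def)

lemma weight_lower: "\<bar>\<delta>\<bar> \<le> radius \<Longrightarrow> \<delta>\<^sup>2 + (norm (chord t h))\<^sup>2 / 2 \<le> weight \<delta> t h"
  unfolding weight_def by (rule square_chord_lower)

text \<open>\<open>Re_kernel_split\<close> in the coordinates rotated by the tangent. The three
  terms behave differently as \<delta> tends to 0: the first has an exact integral of size 1 /
  |\<delta>|, the second converges boundedly to the energy density, and the third concentrates on
  |h| of order |\<delta>|.\<close>

lemma par_kernel_split:
  assumes \<delta>: "0 < \<bar>\<delta>\<bar>" "\<bar>\<delta>\<bar> \<le> radius"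
  shows "par_kernel \<delta> t h = Re (residue_kernel \<delta> t h) + 2 * normal_product t h / (norm (g1 t) * (weight \<delta> t h)\<^sup>2)
     + 2 * \<delta> * offset t h * forward t h / (weight \<delta> t h)\<^sup>2"
proof -
  define T where "T = tang t"
  define \<zeta> z where "\<zeta> = chord t h * cnj T" and "z = g1 (t + h) * cnj T"
  have T: "T * cnj T = 1" "T \<noteq> 0" "norm T = 1" using tang_cnj[of t] norm_tang[of t] by (auto simp: T_def)
  have d: "chord t h = T * \<zeta>" "g1 (t + h) = T * z"
    using T(1) by (simp_all add: \<zeta>_def z_def mult.commute mult.left_commute)
  have nm: "norm (chord t h - \<i> * of_real \<tau> * T) = norm (\<zeta> - \<i> * of_real \<tau>)" for \<tau>
  proof -
    have "chord t h - \<i> * of_real \<tau> * T = T * (\<zeta> - \<i> * of_real \<tau>)" by (simp add: d algebra_simps)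
    then show ?thesis using T by (simp add: norm_mult)
  qed
  have pos: "norm (\<zeta> - \<i> * of_real \<tau>) > 0" if "\<bar>\<tau>\<bar> = \<bar>\<delta>\<bar>" for \<tau>
  proof -
    have "\<tau>\<^sup>2 > 0" using that \<delta> by auto
    moreover have "\<tau>\<^sup>2 + (norm (chord t h))\<^sup>2 / 2 \<le> (norm (\<zeta> - \<i> * of_real \<tau>))\<^sup>2"
      unfolding nm[symmetric] T_def by (rule tube_chord_lower) (use that \<delta> in simp)
    ultimately have "(norm (\<zeta> - \<i> * of_real \<tau>))\<^sup>2 > 0"
      using zero_le_power2[of "norm (chord t h)"] by linarith
    then have "norm (\<zeta> - \<i> * of_real \<tau>) \<noteq> 0" by (rule zero_less_power2[THEN iffD1])
    then show ?thesis by simp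
  qed
  have n: "\<zeta> - \<i> * of_real \<delta> \<noteq> 0" "\<zeta> + \<i> * of_real \<delta> \<noteq> 0" using pos[of \<delta>] pos[of "- \<delta>"] by auto
  have sq: "(chord t h)\<^sup>2 + (of_real \<delta> * T)\<^sup>2 = T\<^sup>2 * (\<zeta>\<^sup>2 + (of_real \<delta>)\<^sup>2)"
    by (simp add: d power_mult_distrib algebra_simps)
  have w: "weight \<delta> t h = norm (\<zeta>\<^sup>2 + (of_real \<delta>)\<^sup>2)"
    unfolding weight_def T_def[symmetric] sq using T by (simp add: norm_mult norm_power)
  have r: "residue_kernel \<delta> t h = z / (\<zeta>\<^sup>2 + (of_real \<delta>)\<^sup>2)"
    unfolding residue_kernel_def T_def[symmetric] sq using T by (simp add: d(2) power2_eq_square)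
  have N: "normal_product t h = - norm (g1 t) * (Im \<zeta> * Im (z * cnj \<zeta>))"
  proof -
    have "g1 (t + h) * cnj (chord t h) = (T * cnj T) * (z * cnj \<zeta>)" by (simp add: d mult_ac)
    then have 1: "g1 (t + h) * cnj (chord t h) = z * cnj \<zeta>" by (simp add: T)
    have "g1 t * cnj (chord t h) = of_real (norm (g1 t)) * ((T * cnj T) * cnj \<zeta>)"
      using g1_tang[of t] by (simp add: d(1) T_def mult_ac)
    then have 2: "g1 t * cnj (chord t h) = of_real (norm (g1 t)) * cnj \<zeta>" by (simp add: T)
    show ?thesis unfolding normal_product_def 1 2 by simp
  qed
  have gp: "norm (g1 t) > 0" using regular by simp
  have 3: "2 * normal_product t h / (norm (g1 t) * (weight \<delta> t h)\<^sup>2) = (- 2 * Im \<zeta> * Im (z * cnj \<zeta>)) / (weight \<delta> t h)\<^sup>2"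
    using gp by (simp add: N)
  have 4: "par_kernel \<delta> t h = Re z / (norm (\<zeta> - \<i> * of_real \<delta>))\<^sup>2"
    unfolding par_kernel_def forward_def T_def[symmetric] nm by (simp add: z_def)
  have 5: "offset t h = Im \<zeta>" "forward t h = Re z" by (simp_all add: offset_def forward_def \<zeta>_def z_def T_def)
  show ?thesis unfolding 3 4 5 r using Re_kernel_split[OF n, of z] unfolding w by (simp only: add_divide_distrib add.assoc)
qed

text \<open>By partial fractions this is a difference of Cauchy integrals at opposite tube points,
  divided by 2 i \<delta>; exactly one of the points lies inside. The value is exact for every
  \<delta> in range, so the divergent part carries no error term.\<close>

lemma residue_kernel_integral:
  assumes \<delta>: "0 < \<bar>\<delta>\<bar>" "\<bar>\<delta>\<bar> \<le> radius"
  shows "(\<integral>h. residue_kernel \<delta> t h \<partial>half_interval) = of_real (pi * orient * side / \<bar>\<delta>\<bar>)"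
proof -
  have nK: "tube t \<delta> \<notin> K" "tube t (- \<delta>) \<notin> K" using tube_notin_K \<delta> by auto
  have sd: "side * \<delta> \<noteq> 0" using side(1) \<delta> by auto
  have gd: "g (t + h) - tube t \<delta> = chord t h - \<i> * of_real \<delta> * tang t" "g (t + h) - tube t (- \<delta>) = chord t h + \<i> * of_real \<delta> * tang t" for h
    by (simp_all add: tube_def chord_def)
  have "residue_kernel \<delta> t h = (g1 (t + h) / (g (t + h) - tube t \<delta>) - g1 (t + h) / (g (t + h) - tube t (- \<delta>))) * (1 / (2 * \<i> * of_real \<delta>))" for h
  proof -
    define p q where "p = chord t h - \<i> * of_real \<delta> * tang t" and "q = chord t h + \<i> * of_real \<delta> * tang t"
    have nz: "p \<noteq> 0" "q \<noteq> 0" using nK g_in_K[of "t + h"] unfolding p_def q_def gd[symmetric] by auto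
    have pq: "(chord t h)\<^sup>2 + (of_real \<delta> * tang t)\<^sup>2 = p * q" by (simp add: p_def q_def algebra_simps power2_eq_square)
    have "g1 (t + h) / p - g1 (t + h) / q = g1 (t + h) * (q - p) / (p * q)" using nz by (simp add: field_simps)
    also have "q - p = 2 * \<i> * of_real \<delta> * tang t" by (simp add: p_def q_def)
    finally show ?thesis unfolding gd p_def[symmetric] q_def[symmetric] residue_kernel_def pq using \<delta> by simp
  qed
  then have "(\<integral>h. residue_kernel \<delta> t h \<partial>half_interval) = ((\<integral>h. g1 (t + h) / (g (t + h) - tube t \<delta>) \<partial>half_interval)
     - (\<integral>h. g1 (t + h) / (g (t + h) - tube t (- \<delta>)) \<partial>half_interval)) * (1 / (2 * \<i> * of_real \<delta>))"
    using Cauchy_integral_chord(1)[OF nK(1), of t] Cauchy_integral_chord(1)[OF nK(2), of t] by simp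
  also have "\<dots> = (winding_number g (tube t \<delta>) - winding_number g (tube t (- \<delta>))) * (of_real pi / of_real \<delta>)"
    unfolding Cauchy_integral_chord(2)[OF nK(1)] Cauchy_integral_chord(2)[OF nK(2)]
    using \<delta> by (simp add: field_simps)
  also have "winding_number g (tube t \<delta>) - winding_number g (tube t (- \<delta>)) = of_real (orient * sgn (side * \<delta>))"
    using winding_g_tube[OF \<delta>, of t] winding_g_tube[of "- \<delta>" t] \<delta> sd by (auto simp: sgn_if)
  also have "of_real (orient * sgn (side * \<delta>)) * (complex_of_real pi / of_real \<delta>) = of_real (orient * sgn (side * \<delta>) * (pi / \<delta>))" by simp
  also have "orient * sgn (side * \<delta>) * (pi / \<delta>) = pi * orient * side / \<bar>\<delta>\<bar>"
  proof -
    have "sgn side = side" using side(1) by (simp add: sgn_if abs_if split: if_splits)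
    moreover have "sgn \<delta> / \<delta> = 1 / \<bar>\<delta>\<bar>" using \<delta> by (simp add: sgn_if)
    moreover have "orient * sgn (side * \<delta>) * (pi / \<delta>) = pi * orient * (sgn side * (sgn \<delta> / \<delta>))" by (simp add: sgn_mult)
    ultimately show ?thesis by simp
  qed
  finally show ?thesis .
qed

lemma offset_bound: "\<bar>offset t h\<bar> \<le> bM / bc * h\<^sup>2"
proof -
  have "offset t h = - Im (g1 t * cnj (chord t h)) / norm (g1 t)"
  proof -
    have "chord t h * cnj (tang t) = cnj (g1 t * cnj (chord t h)) / of_real (norm (g1 t))" by (simp add: tang_def mult.commute)
    then show ?thesis unfolding offset_def by (simp only: Im_divide_of_real cnj.sel)
  qed
  then have "\<bar>offset t h\<bar> = \<bar>Im (g1 t * cnj (chord t h))\<bar> / norm (g1 t)" by (simp only: abs_divide abs_minus_cancel abs_norm_cancel)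
  also have "\<dots> \<le> (bM * h\<^sup>2) / bc" using Im_g1_chord[of t h] g1_ge[of t] bc_pos bM_pos by (intro frac_le) auto
  finally show ?thesis by simp
qed

lemma forward_bound: "\<bar>forward t h\<bar> \<le> bM"
proof -
  have "\<bar>forward t h\<bar> \<le> norm (g1 (t + h) * cnj (tang t))" unfolding forward_def by (rule abs_Re_le_cmod)
  also have "\<dots> \<le> bM" using g1_le[of "t + h"] by (simp add: norm_mult)
  finally show ?thesis .
qed

lemma deriv_offset: "(offset t has_real_derivative Im (g1 (t + h) * cnj (tang t))) (at h)"
proof -
  have "((\<lambda>h. Im (chord t h * cnj (tang t))) has_vector_derivative Im (g1 (t + h) * cnj (tang t))) (at h)"
    using deriv_chord[of t h] by (intro bounded_linear.has_vector_derivative[OF bounded_linear_Im] has_vector_derivative_mult_left)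
  then show ?thesis by (simp add: has_real_derivative_iff_has_vector_derivative offset_def[abs_def])
qed

lemma deriv2_offset: "((\<lambda>h. Im (g1 (t + h) * cnj (tang t))) has_real_derivative Im (g2 (t + h) * cnj (tang t))) (at h)"
proof -
  have "((\<lambda>h. g1 (h + t)) has_vector_derivative g2 (h + t)) (at h)"
    using vector_diff_chain_at[OF shift_deriv, of g1 "g2 (h + t)" h t] deriv_g1[of "h + t"] by (simp add: o_def)
  then have "((\<lambda>h. Im (g1 (h + t) * cnj (tang t))) has_vector_derivative Im (g2 (h + t) * cnj (tang t))) (at h)"
    by (intro bounded_linear.has_vector_derivative[OF bounded_linear_Im] has_vector_derivative_mult_left)
  then show ?thesis by (simp add: has_real_derivative_iff_has_vector_derivative add.commute)
qed

text \<open>In rotated coordinates the offset and its first derivative vanish at h = 0, and the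
  second derivative there is speed times \<open>turn\<close>. Taylor's formula with Lagrange
  remainder and continuity of \<open>g2\<close> give the limit.\<close>

lemma offset_second_order: "((\<lambda>h. offset t h / h\<^sup>2) \<longlongrightarrow> norm (g1 t) * turn t / 2) (at 0)"
proof -
  define w2 where "w2 = (\<lambda>h. Im (g2 (t + h) * cnj (tang t)))"
  have w20: "w2 0 = norm (g1 t) * turn t"
  proof -
    have "g2 t * cnj (tang t) = (g2 t / g1 t) * (g1 t * cnj (tang t))" using regular[of t] by simp
    also have "g1 t * cnj (tang t) = of_real (norm (g1 t)) * (tang t * cnj (tang t))" using g1_tang[of t] by (simp add: mult.assoc)
    finally have eq: "g2 t * cnj (tang t) = of_real (norm (g1 t)) * (g2 t / g1 t)" by (simp add: tang_cnj)
    have im: "Im (of_real x * z) = x * Im z" for x z by simp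
    show ?thesis unfolding w2_def add_0_right eq im turn_def ..
  qed
  have c: "isCont w2 0"
  proof -
    have "continuous_on UNIV w2" unfolding w2_def
      by (intro continuous_intros continuous_on_compose2[OF cont_g2'[of UNIV]]) auto
    then show ?thesis by (simp add: continuous_on_eq_continuous_at)
  qed
  have mvt: "\<exists>\<theta>. \<bar>\<theta>\<bar> \<le> \<bar>h\<bar> \<and> offset t h / h\<^sup>2 = w2 \<theta> / 2" if h: "h \<noteq> 0" for h
  proof -
    define diff where "diff = (\<lambda>m::nat. if m = 0 then offset t else if m = 1 then (\<lambda>h. Im (g1 (t + h) * cnj (tang t))) else w2)"
    have D: "\<forall>m x. m < 2 \<and> - \<bar>h\<bar> \<le> x \<and> x \<le> \<bar>h\<bar> \<longrightarrow> DERIV (diff m) x :> diff (Suc m) x"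
    proof (intro allI impI)
      fix m :: nat and x assume "m < 2 \<and> - \<bar>h\<bar> \<le> x \<and> x \<le> \<bar>h\<bar>"
      then have "m = 0 \<or> m = 1" by linarith
      then show "DERIV (diff m) x :> diff (Suc m) x"
        using deriv_offset[of t x] deriv2_offset[of t x] by (auto simp: diff_def w2_def)
    qed
    have i: "diff 0 = offset t" by (simp add: diff_def)
    have z: "diff 0 0 = 0" "diff 1 0 = 0"
    proof -
      show "diff 0 0 = 0" by (simp add: diff_def offset_def chord_def)
      have "g1 t * cnj (tang t) = of_real (norm (g1 t)) * (tang t * cnj (tang t))" using g1_tang[of t] by (simp add: mult.assoc)
      then have eq: "g1 t * cnj (tang t) = of_real (norm (g1 t))" by (simp only: tang_cnj mult_1_right)
      have d1: "diff 1 0 = Im (g1 t * cnj (tang t))" by (simp add: diff_def)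
      show "diff 1 0 = 0" unfolding d1 eq by simp
    qed
    have "\<exists>x. (if h < 0 then h < x \<and> x < 0 else 0 < x \<and> x < h) \<and>
        offset t h = (\<Sum>m<2. (diff m 0 / fact m) * (h - 0) ^ m) + (diff 2 x / fact 2) * (h - 0)\<^sup>2"
      by (rule Taylor[OF _ i D]) (use h in auto)
    then obtain x where x: "if h < 0 then h < x \<and> x < 0 else 0 < x \<and> x < h"
      "offset t h = (\<Sum>m<2. (diff m 0 / fact m) * (h - 0) ^ m) + (diff 2 x / fact 2) * (h - 0)\<^sup>2" by blast
    have "offset t h = w2 x / 2 * h\<^sup>2" using x(2) z by (simp add: numeral_2_eq_2 diff_def)
    moreover have "\<bar>x\<bar> \<le> \<bar>h\<bar>" using x(1) by (auto split: if_splits)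
    ultimately show ?thesis using h by (intro exI[of _ x]) simp
  qed
  show ?thesis unfolding tendsto_iff
  proof (intro allI impI)
    fix e :: real assume e: "e > 0"
    then obtain d where d: "d > 0" "\<And>x. \<bar>x\<bar> < d \<Longrightarrow> \<bar>w2 x - w2 0\<bar> < e"
      using c unfolding continuous_at_eps_delta dist_real_def by (metis diff_zero)
    show "eventually (\<lambda>h. dist (offset t h / h\<^sup>2) (norm (g1 t) * turn t / 2) < e) (at 0)"
      unfolding eventually_at
    proof (intro exI[of _ d] conjI d(1) ballI impI)
      fix h :: real assume h: "h \<noteq> 0 \<and> dist h 0 < d"
      then obtain \<theta> where th: "\<bar>\<theta>\<bar> \<le> \<bar>h\<bar>" "offset t h / h\<^sup>2 = w2 \<theta> / 2" using mvt by blast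
      then have "\<bar>w2 \<theta> - w2 0\<bar> < e" using h by (intro d(2)) (simp add: dist_real_def)
      moreover have "offset t h / h\<^sup>2 - norm (g1 t) * turn t / 2 = (w2 \<theta> - w2 0) / 2"
        unfolding th(2) w20[symmetric] by (simp add: diff_divide_distrib)
      then have "dist (offset t h / h\<^sup>2) (norm (g1 t) * turn t / 2) = \<bar>w2 \<theta> - w2 0\<bar> / 2"
        by (simp only: dist_real_def abs_divide abs_numeral)
      moreover have "\<bar>w2 \<theta> - w2 0\<bar> / 2 < e" if "\<bar>w2 \<theta> - w2 0\<bar> < e" using that by simp
      ultimately show "dist (offset t h / h\<^sup>2) (norm (g1 t) * turn t / 2) < e" by simp
    qed
  qed
qed

lemma measurable_torus_tang [measurable]:
  "(\<lambda>p. tang (fst p)) \<in> borel_measurable torus" "(\<lambda>p. turn (fst p)) \<in> borel_measurable torus"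
  using measurable_torus_continuous[OF cont_tang] measurable_torus_continuous[OF cont_turn] by auto

lemma measurable_par_kernels [measurable]:
  "(\<lambda>p. offset (fst p) (snd p)) \<in> borel_measurable torus"
  "(\<lambda>p. forward (fst p) (snd p)) \<in> borel_measurable torus"
  "(\<lambda>p. weight \<delta> (fst p) (snd p)) \<in> borel_measurable torus"
  "(\<lambda>p. residue_kernel \<delta> (fst p) (snd p)) \<in> borel_measurable torus"
  "(\<lambda>p. par_kernel \<delta> (fst p) (snd p)) \<in> borel_measurable torus"
  unfolding offset_def forward_def weight_def residue_kernel_def par_kernel_def by measurable

lemma weight_lower_h:
  assumes "\<bar>\<delta>\<bar> \<le> radius" "\<bar>h\<bar> \<le> 1/2"
  shows "\<delta>\<^sup>2 + bc\<^sup>2 / 2 * h\<^sup>2 \<le> weight \<delta> t h"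
proof -
  have "(bc * \<bar>h\<bar>)\<^sup>2 \<le> (norm (chord t h))\<^sup>2" using chord_lower[OF assms(2)] bc_pos by (intro power_mono) auto
  then show ?thesis using weight_lower[OF assms(1), of t h] by (simp add: power_mult_distrib)
qed

definition regular_part :: "real \<Rightarrow> real \<Rightarrow> real \<Rightarrow> real" where
  "regular_part \<delta> t h = 2 * normal_product t h / (norm (g1 t) * (weight \<delta> t h)\<^sup>2)"
definition layer_part :: "real \<Rightarrow> real \<Rightarrow> real \<Rightarrow> real" where
  "layer_part \<delta> t h = 2 * \<delta> * offset t h * forward t h / (weight \<delta> t h)\<^sup>2"

text \<open>The normal product is of order h^4 and the squared weight at least of that order,
  uniformly in \<delta>.\<close>

lemma regular_part_bound:
  assumes "\<bar>\<delta>\<bar> \<le> radius" "\<bar>h\<bar> \<le> 1/2"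
  shows "\<bar>regular_part \<delta> t h\<bar> \<le> 8 * bM\<^sup>2 / bc ^ 5"
proof (cases "h = 0")
  case True
  then show ?thesis using bc_pos by (simp add: regular_part_def normal_product_def chord_def)
next
  case False
  have "bc\<^sup>2 / 2 * h\<^sup>2 \<le> weight \<delta> t h" using weight_lower_h[OF assms, of t] zero_le_power2[of \<delta>] by linarith
  then have "(bc\<^sup>2 / 2 * h\<^sup>2)\<^sup>2 \<le> (weight \<delta> t h)\<^sup>2" by (intro power_mono) auto
  then have w: "bc ^ 4 / 4 * h ^ 4 \<le> (weight \<delta> t h)\<^sup>2" by (simp add: power_mult_distrib power_divide)
  have "\<bar>regular_part \<delta> t h\<bar> = 2 * \<bar>normal_product t h\<bar> / (norm (g1 t) * (weight \<delta> t h)\<^sup>2)"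
    by (simp add: regular_part_def abs_mult)
  also have "\<dots> \<le> 2 * (bM\<^sup>2 * h ^ 4) / (bc * (bc ^ 4 / 4 * h ^ 4))"
    using normal_product_bound[of t h] g1_ge[of t] w bc_pos bM_pos False
    by (intro frac_le mult_mono mult_left_mono mult_pos_pos) (auto simp: zero_less_power_eq)
  also have "\<dots> = 8 * bM\<^sup>2 / bc ^ 5" using False bc_pos by (simp add: field_simps eval_nat_numeral)
  finally show ?thesis .
qed

lemma regular_part_limit:
  assumes f: "f \<in> borel_measurable unit_interval" "\<And>t. \<bar>f t\<bar> \<le> B" and e: "\<bar>e\<bar> = 1"
  shows "((\<lambda>\<eta>. \<integral>p. f (fst p) * regular_part (e * \<eta>) (fst p) (snd p) \<partial>torus) \<longlongrightarrow>
     (\<integral>p. f (fst p) * (2 * energy_density (fst p) (snd p) / norm (g1 (fst p))) \<partial>torus)) (at_right 0)"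
proof (rule dominated_convergence_at_right[OF radius_pos, where w = "\<lambda>_. B * (8 * bM\<^sup>2 / bc ^ 5)"])
  have [measurable]: "(\<lambda>p. f (fst p)) \<in> borel_measurable torus"
    by (rule measurable_compose[OF measurable_fst f(1)])
  show "(\<lambda>p. f (fst p) * regular_part (e * \<eta>) (fst p) (snd p)) \<in> borel_measurable torus" for \<eta>
    unfolding regular_part_def by measurable
  show "(\<lambda>p. f (fst p) * (2 * energy_density (fst p) (snd p) / norm (g1 (fst p)))) \<in> borel_measurable torus" by measurable
  have B: "B \<ge> 0" using f(2)[of 0] by linarith
  show "AE p in torus. norm (f (fst p) * regular_part (e * \<eta>) (fst p) (snd p)) \<le> B * (8 * bM\<^sup>2 / bc ^ 5)" if \<eta>: "0 < \<eta>" "\<eta> < radius" for \<eta>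
    using AE_space
  proof eventually_elim
    case (elim p)
    have "\<bar>e * \<eta>\<bar> \<le> radius" using \<eta> e by (simp add: abs_mult)
    then have "\<bar>regular_part (e * \<eta>) (fst p) (snd p)\<bar> \<le> 8 * bM\<^sup>2 / bc ^ 5" using elim by (intro regular_part_bound) (auto simp: abs_le_iff)
    then show ?case unfolding real_norm_def abs_mult using f(2) B by (intro mult_mono) auto
  qed
  show "AE p in torus. ((\<lambda>\<eta>. f (fst p) * regular_part (e * \<eta>) (fst p) (snd p)) \<longlongrightarrow>
     f (fst p) * (2 * energy_density (fst p) (snd p) / norm (g1 (fst p)))) (at_right 0)"
    using torus_neq_zero AE_space
  proof eventually_elim
    case (elim p)
    obtain t h where p: "p = (t, h)" by (cases p)
    have h: "\<bar>h\<bar> \<le> 1/2" "h \<noteq> 0" using elim p by (auto simp: abs_le_iff)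
    have d: "norm (chord t h) > 0" by (rule chord_pos[OF h])
    have "((\<lambda>\<eta>. weight (e * \<eta>) t h) \<longlongrightarrow> norm ((chord t h)\<^sup>2 + (of_real (e * 0) * tang t)\<^sup>2)) (at_right 0)"
      unfolding weight_def by (intro tendsto_intros)
    then have "((\<lambda>\<eta>. weight (e * \<eta>) t h) \<longlongrightarrow> (norm (chord t h))\<^sup>2) (at_right 0)" by (simp add: norm_power)
    then have "((\<lambda>\<eta>. f t * regular_part (e * \<eta>) t h) \<longlongrightarrow> f t * (2 * normal_product t h / (norm (g1 t) * ((norm (chord t h))\<^sup>2)\<^sup>2))) (at_right 0)"
      unfolding regular_part_def using d regular[of t] by (intro tendsto_intros) auto
    moreover have "2 * normal_product t h / (norm (g1 t) * ((norm (chord t h))\<^sup>2)\<^sup>2) = 2 * energy_density t h / norm (g1 t)"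
      by (simp add: energy_density_def)
    ultimately show ?case unfolding p fst_conv snd_conv by (simp only:)
  qed
qed auto

text \<open>In the stretched variable h = \<eta> x the offset is of order \<eta>^2 x^2 and the
  weight at least \<eta>^2 (1 + a x^2). All powers of \<eta> cancel and an integrable majorant in
  \<open>x\<close> remains.\<close>

lemma layer_part_bound:
  assumes \<eta>: "0 < \<eta>" "\<eta> < radius" and e: "\<bar>e\<bar> = 1" and x: "\<bar>\<eta> * x\<bar> \<le> 1/2"
  shows "\<bar>\<eta> * layer_part (e * \<eta>) t (\<eta> * x)\<bar> \<le> 4 * bM\<^sup>2 / bc ^ 3 * (1 / (1 + bc\<^sup>2 / 2 * x\<^sup>2))"
proof -
  define a where "a = bc\<^sup>2 / 2"
  have a: "a > 0" using bc_pos by (simp add: a_def)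
  define Z where "Z = 1 + a * x\<^sup>2"
  have Z: "Z > 0" "a * x\<^sup>2 \<le> Z" using a by (auto simp: Z_def add_pos_nonneg)
  have e2: "e\<^sup>2 = 1" using e by (metis power2_abs power_one)
  have "\<bar>e * \<eta>\<bar> \<le> radius" using \<eta> e by (simp add: abs_mult)
  from weight_lower_h[OF this x, of t]
  have wl: "\<eta>\<^sup>2 * Z \<le> weight (e * \<eta>) t (\<eta> * x)"
    by (simp add: Z_def a_def power_mult_distrib e2 distrib_left mult.commute mult.left_commute)
  have "\<eta>\<^sup>2 * Z > 0" using \<eta> Z by simp
  have "(\<eta>\<^sup>2 * Z)\<^sup>2 \<le> (weight (e * \<eta>) t (\<eta> * x))\<^sup>2" using wl \<open>\<eta>\<^sup>2 * Z > 0\<close> by (intro power_mono) auto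
  then have w2: "\<eta> ^ 4 * Z\<^sup>2 \<le> (weight (e * \<eta>) t (\<eta> * x))\<^sup>2" by (simp add: power_mult_distrib)
  have "\<bar>\<eta> * layer_part (e * \<eta>) t (\<eta> * x)\<bar> = 2 * \<eta>\<^sup>2 * (\<bar>offset t (\<eta> * x)\<bar> * \<bar>forward t (\<eta> * x)\<bar>) / (weight (e * \<eta>) t (\<eta> * x))\<^sup>2"
    using \<eta> e by (simp add: layer_part_def abs_mult power2_eq_square)
  also have "\<dots> \<le> 2 * \<eta>\<^sup>2 * ((bM / bc * (\<eta> * x)\<^sup>2) * bM) / (\<eta> ^ 4 * Z\<^sup>2)"
    using \<eta> Z w2 offset_bound[of t "\<eta> * x"] forward_bound[of t "\<eta> * x"] bM_pos bc_pos
    by (intro frac_le mult_left_mono mult_mono) auto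
  also have "\<dots> = 2 * bM\<^sup>2 / bc * x\<^sup>2 / Z\<^sup>2"
    using \<eta> by (simp add: power_mult_distrib power2_eq_square power4_eq_xxxx)
  also have "x\<^sup>2 / Z\<^sup>2 \<le> (Z / a) / Z\<^sup>2"
    using Z a by (intro divide_right_mono) (auto simp: field_simps)
  then have "2 * bM\<^sup>2 / bc * x\<^sup>2 / Z\<^sup>2 \<le> 2 * bM\<^sup>2 / bc * ((Z / a) / Z\<^sup>2)"
    using bc_pos mult_left_mono[of "x\<^sup>2 / Z\<^sup>2" "(Z / a) / Z\<^sup>2" "2 * bM\<^sup>2 / bc"] by simp
  also have "\<dots> = 4 * bM\<^sup>2 / bc ^ 3 * (1 / Z)"
    using Z bc_pos by (simp add: a_def power2_eq_square power3_eq_cube)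
  finally show ?thesis by (simp add: Z_def a_def)
qed

lemma layer_part_limit_pointwise:
  assumes e: "\<bar>e\<bar> = 1"
  shows "((\<lambda>\<eta>. \<eta> * layer_part (e * \<eta>) t (\<eta> * x)) \<longlongrightarrow> e * turn t * (norm (g1 t))\<^sup>2 * x\<^sup>2 / (1 + (norm (g1 t))\<^sup>2 * x\<^sup>2)\<^sup>2) (at_right 0)"
proof -
  have e2: "e\<^sup>2 = 1" using e by (metis power2_abs power_one)
  define G where "G = norm (g1 t)"
  have lin: "((\<lambda>\<eta>. \<eta> * x) \<longlongrightarrow> 0) (at_right 0)"
    using tendsto_mult_right[of "\<lambda>\<eta>::real. \<eta>" 0 "at_right 0" x] by (simp add: tendsto_ident_at)
  have off: "((\<lambda>\<eta>. offset t (\<eta> * x) / \<eta>\<^sup>2) \<longlongrightarrow> x\<^sup>2 * (G * turn t / 2)) (at_right 0)"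
  proof (cases "x = 0")
    case True
    then show ?thesis by (simp add: offset_def chord_def)
  next
    case False
    have "filterlim (\<lambda>\<eta>. \<eta> * x) (at 0) (at_right 0)"
      using lin False by (auto simp: filterlim_at eventually_at_filter)
    from filterlim_compose[OF offset_second_order this]
    have "((\<lambda>\<eta>. offset t (\<eta> * x) / (\<eta> * x)\<^sup>2) \<longlongrightarrow> G * turn t / 2) (at_right 0)" by (simp add: G_def)
    from tendsto_mult_left[OF this, of "x\<^sup>2"] show ?thesis
      using False by (simp add: power_mult_distrib)
  qed
  have fw: "((\<lambda>\<eta>. forward t (\<eta> * x)) \<longlongrightarrow> G) (at_right 0)"
  proof -
    have c: "continuous_on UNIV (forward t)" unfolding forward_def[abs_def]
      by (intro continuous_intros continuous_on_compose2[OF cont_g1[of UNIV]]) auto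
    have "forward t 0 = G"
    proof -
      have "g1 t * cnj (tang t) = of_real (norm (g1 t)) * (tang t * cnj (tang t))" using g1_tang[of t] by (simp add: mult.assoc)
      then have "g1 t * cnj (tang t) = of_real (norm (g1 t))" by (simp only: tang_cnj mult_1_right)
      then show ?thesis by (simp add: forward_def G_def)
    qed
    moreover have "isCont (forward t) 0" using c by (simp add: continuous_on_eq_continuous_at)
    ultimately show ?thesis using isCont_tendsto_compose[OF _ lin] by metis
  qed
  have ch: "((\<lambda>\<eta>. chord t (\<eta> * x) /\<^sub>R \<eta>) \<longlongrightarrow> x *\<^sub>R g1 t) (at_right 0)"
  proof (cases "x = 0")
    case True
    then show ?thesis by (simp add: chord_def)
  next
    case False
    have "filterlim (\<lambda>\<eta>. \<eta> * x) (at 0) (at_right 0)"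
      using lin False by (auto simp: filterlim_at eventually_at_filter)
    from filterlim_compose[OF chord_over_h this]
    have "((\<lambda>\<eta>. chord t (\<eta> * x) /\<^sub>R (\<eta> * x)) \<longlongrightarrow> g1 t) (at_right 0)" .
    from tendsto_scaleR[OF tendsto_const this, of x]
    have "((\<lambda>\<eta>. x *\<^sub>R (chord t (\<eta> * x) /\<^sub>R (\<eta> * x))) \<longlongrightarrow> x *\<^sub>R g1 t) (at_right 0)" .
    moreover have "x *\<^sub>R (chord t (\<eta> * x) /\<^sub>R (\<eta> * x)) = chord t (\<eta> * x) /\<^sub>R \<eta>" for \<eta>
    proof -
      have "x * inverse (\<eta> * x) = (x * inverse x) * inverse \<eta>" by simp
      then have "x * inverse (\<eta> * x) = inverse \<eta>" using False by simp
      then show ?thesis by (simp only: scaleR_scaleR)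
    qed
    ultimately show ?thesis by (simp only:)
  qed
  have wt: "((\<lambda>\<eta>. weight (e * \<eta>) t (\<eta> * x) / \<eta>\<^sup>2) \<longlongrightarrow> 1 + G\<^sup>2 * x\<^sup>2) (at_right 0)"
  proof -
    have "((\<lambda>\<eta>. norm ((chord t (\<eta> * x) /\<^sub>R \<eta>)\<^sup>2 + (of_real e * tang t)\<^sup>2)) \<longlongrightarrow> norm ((x *\<^sub>R g1 t)\<^sup>2 + (of_real e * tang t)\<^sup>2)) (at_right 0)"
      by (intro tendsto_intros ch)
    moreover have "norm ((x *\<^sub>R g1 t)\<^sup>2 + (of_real e * tang t)\<^sup>2) = 1 + G\<^sup>2 * x\<^sup>2"
    proof -
      have "(x *\<^sub>R g1 t)\<^sup>2 + (of_real e * tang t)\<^sup>2 = of_real (G\<^sup>2 * x\<^sup>2 + e\<^sup>2) * (tang t)\<^sup>2"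
        using g1_tang[of t] unfolding G_def[symmetric]
        by (simp add: scaleR_conv_of_real power_mult_distrib algebra_simps)
      then have "norm ((x *\<^sub>R g1 t)\<^sup>2 + (of_real e * tang t)\<^sup>2) = \<bar>G\<^sup>2 * x\<^sup>2 + e\<^sup>2\<bar> * (norm (tang t))\<^sup>2"
        by (simp only: norm_mult norm_of_real norm_power)
      then show ?thesis using e2 by (simp add: add.commute)
    qed
    moreover have "eventually (\<lambda>\<eta>. norm ((chord t (\<eta> * x) /\<^sub>R \<eta>)\<^sup>2 + (of_real e * tang t)\<^sup>2) = weight (e * \<eta>) t (\<eta> * x) / \<eta>\<^sup>2) (at_right 0)"
      using eventually_at_right_less[of 0]
    proof eventually_elim
      case (elim \<eta>)
      have "(chord t (\<eta> * x))\<^sup>2 + (of_real (e * \<eta>) * tang t)\<^sup>2 = of_real (\<eta>\<^sup>2) * ((chord t (\<eta> * x) /\<^sub>R \<eta>)\<^sup>2 + (of_real e * tang t)\<^sup>2)"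
        using elim by (simp add: scaleR_conv_of_real power_mult_distrib distrib_left power_inverse field_simps)
      then have "weight (e * \<eta>) t (\<eta> * x) = \<eta>\<^sup>2 * norm ((chord t (\<eta> * x) /\<^sub>R \<eta>)\<^sup>2 + (of_real e * tang t)\<^sup>2)"
        unfolding weight_def by (simp only: norm_mult norm_of_real) simp
      then show ?case using elim by simp
    qed
    ultimately show ?thesis using Lim_transform_eventually by force
  qed
  have Zp: "1 + G\<^sup>2 * x\<^sup>2 > 0" by (simp add: add_pos_nonneg)
  have lim: "((\<lambda>\<eta>. 2 * e * (offset t (\<eta> * x) / \<eta>\<^sup>2) * forward t (\<eta> * x) / (weight (e * \<eta>) t (\<eta> * x) / \<eta>\<^sup>2)\<^sup>2)
     \<longlongrightarrow> 2 * e * (x\<^sup>2 * (G * turn t / 2)) * G / (1 + G\<^sup>2 * x\<^sup>2)\<^sup>2) (at_right 0)"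
    using Zp by (intro tendsto_intros off fw wt) auto
  have ev: "eventually (\<lambda>\<eta>. 2 * e * (offset t (\<eta> * x) / \<eta>\<^sup>2) * forward t (\<eta> * x) / (weight (e * \<eta>) t (\<eta> * x) / \<eta>\<^sup>2)\<^sup>2
     = \<eta> * layer_part (e * \<eta>) t (\<eta> * x)) (at_right 0)"
    using eventually_at_right_less[of 0]
    by eventually_elim (simp add: layer_part_def power_divide power2_eq_square)
  have val: "2 * e * (x\<^sup>2 * (G * turn t / 2)) * G / (1 + G\<^sup>2 * x\<^sup>2)\<^sup>2 = e * turn t * G\<^sup>2 * x\<^sup>2 / (1 + G\<^sup>2 * x\<^sup>2)\<^sup>2"
    by (simp add: power2_eq_square mult_ac)
  show ?thesis using Lim_transform_eventually[OF lim ev] unfolding val unfolding G_def .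
qed

lemma layer_part_integrable:
  assumes f: "f \<in> borel_measurable unit_interval" "\<And>t. \<bar>f t\<bar> \<le> B" and \<delta>: "0 < \<bar>\<delta>\<bar>" "\<bar>\<delta>\<bar> \<le> radius"
  shows "integrable torus (\<lambda>p. f (fst p) * layer_part \<delta> (fst p) (snd p))" "integrable torus (\<lambda>p. f (fst p) * regular_part \<delta> (fst p) (snd p))"
proof -
  have [measurable]: "(\<lambda>p. f (fst p)) \<in> borel_measurable torus"
    by (rule measurable_compose[OF measurable_fst f(1)])
  have B: "B \<ge> 0" using f(2)[of 0] by linarith
  show "integrable torus (\<lambda>p. f (fst p) * layer_part \<delta> (fst p) (snd p))"
  proof (rule integrable_torus_bounded)
    show "(\<lambda>p. f (fst p) * layer_part \<delta> (fst p) (snd p)) \<in> borel_measurable torus" unfolding layer_part_def by measurable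
    fix t h :: real assume h: "h \<in> {-(1/2)..1/2}"
    have "\<bar>h\<bar> \<le> 1/2" using h by (auto simp: abs_le_iff)
    then have "h\<^sup>2 \<le> (1/2)\<^sup>2" by (simp add: abs_le_square_iff[symmetric])
    then have o: "\<bar>offset t h\<bar> \<le> bM / bc" using offset_bound[of t h] bM_pos bc_pos
      mult_left_mono[of "h\<^sup>2" 1 "bM / bc"] by (simp add: power2_eq_square)
    have "\<delta>\<^sup>2 \<le> weight \<delta> t h" using weight_lower[OF \<delta>(2), of t h] zero_le_power2[of "norm (chord t h)"] by linarith
    then have "(\<delta>\<^sup>2)\<^sup>2 \<le> (weight \<delta> t h)\<^sup>2" by (intro power_mono) auto
    moreover have "\<bar>layer_part \<delta> t h\<bar> = (2 * \<bar>\<delta>\<bar>) * (\<bar>offset t h\<bar> * \<bar>forward t h\<bar>) / (weight \<delta> t h)\<^sup>2"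
      by (simp add: layer_part_def abs_mult)
    ultimately have "\<bar>layer_part \<delta> t h\<bar> \<le> (2 * \<bar>\<delta>\<bar>) * (bM / bc * bM) / (\<delta>\<^sup>2)\<^sup>2"
      using o forward_bound[of t h] \<delta> bM_pos bc_pos by (simp only:) (intro frac_le mult_left_mono mult_mono; simp)
    then show "norm (f (fst (t, h)) * layer_part \<delta> (fst (t, h)) (snd (t, h))) \<le> B * ((2 * \<bar>\<delta>\<bar>) * (bM / bc * bM) / (\<delta>\<^sup>2)\<^sup>2)"
      unfolding real_norm_def abs_mult fst_conv snd_conv using f(2)[of t] B by (intro mult_mono) auto
  qed
  show "integrable torus (\<lambda>p. f (fst p) * regular_part \<delta> (fst p) (snd p))"
  proof (rule integrable_torus_bounded)
    show "(\<lambda>p. f (fst p) * regular_part \<delta> (fst p) (snd p)) \<in> borel_measurable torus" unfolding regular_part_def by measurable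
    fix t h :: real assume h: "h \<in> {-(1/2)..1/2}"
    then have "\<bar>regular_part \<delta> t h\<bar> \<le> 8 * bM\<^sup>2 / bc ^ 5" by (intro regular_part_bound[OF \<delta>(2)]) (auto simp: abs_le_iff)
    then show "norm (f (fst (t, h)) * regular_part \<delta> (fst (t, h)) (snd (t, h))) \<le> B * (8 * bM\<^sup>2 / bc ^ 5)"
      unfolding real_norm_def abs_mult fst_conv snd_conv using f(2)[of t] B by (intro mult_mono) auto
  qed
qed

text \<open>Stretching by \<eta> blows the layer up to the whole line, where domination holds. The
  limit profile at \<open>t\<close> involves x only through |g1 t| x, so rescaling yields the
  universal mass and leaves \<open>turn\<close> divided by the speed.\<close>

lemma layer_part_limit:
  assumes f: "f \<in> borel_measurable unit_interval" "\<And>t. \<bar>f t\<bar> \<le> B" and e: "\<bar>e\<bar> = 1"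
  shows "((\<lambda>\<eta>. \<integral>p. f (fst p) * layer_part (e * \<eta>) (fst p) (snd p) \<partial>torus) \<longlongrightarrow>
     e * bump_integral * (\<integral>t. f t * turn t / norm (g1 t) \<partial>unit_interval)) (at_right 0)"
proof -
  define F where "F = (\<lambda>\<eta> p. f (fst p) * (indicator {-(1/2)..1/2} (\<eta> * snd p) * (\<eta> * layer_part (e * \<eta>) (fst p) (\<eta> * snd p))))"
  define L where "L = (\<lambda>p. f (fst p) * (e * turn (fst p) * (norm (g1 (fst p)))\<^sup>2 * (snd p)\<^sup>2 / (1 + (norm (g1 (fst p)))\<^sup>2 * (snd p)\<^sup>2)\<^sup>2))"
  define w where "w = (\<lambda>x. B * (4 * bM\<^sup>2 / bc ^ 3 * (1 / (1 + bc\<^sup>2 / 2 * x\<^sup>2))))"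
  have B: "B \<ge> 0" using f(2)[of 0] by linarith
  have bm [measurable]: "g \<in> borel_measurable borel" "g1 \<in> borel_measurable borel" "tang \<in> borel_measurable borel" "turn \<in> borel_measurable borel"
    by (intro borel_measurable_continuous_onI cont_g cont_g1 cont_tang cont_turn)+
  have fm [measurable]: "(\<lambda>p. f (fst p)) \<in> borel_measurable strip"
    by (rule measurable_compose[OF measurable_fst f(1)])
  have Fm: "F \<eta> \<in> borel_measurable strip" for \<eta>
    unfolding F_def layer_part_def offset_def forward_def weight_def chord_def by measurable
  have Lm: "L \<in> borel_measurable strip" unfolding L_def by measurable
  have wint: "integrable lborel w"
    unfolding w_def using bc_pos by (intro integrable_mult_right integrable_inverse_one_plus_square) auto
  have Fb: "norm (F \<eta> p) \<le> w (snd p)" if \<eta>: "0 < \<eta>" "\<eta> < radius" for \<eta> p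
  proof (cases "\<eta> * snd p \<in> {-(1/2)..1/2}")
    case True
    then have "\<bar>\<eta> * snd p\<bar> \<le> 1/2" by (auto simp: abs_le_iff)
    from layer_part_bound[OF \<eta> e this, of "fst p"] show ?thesis
      unfolding F_def w_def real_norm_def abs_mult[of "f (fst p)"] using f(2)[of "fst p"] B True by (intro mult_mono) auto
  next
    case False
    have "w (snd p) \<ge> 0" unfolding w_def using B bc_pos by (intro mult_nonneg_nonneg divide_nonneg_nonneg add_nonneg_nonneg) auto
    then show ?thesis using False by (simp add: F_def)
  qed
  have lim: "((\<lambda>\<eta>. \<integral>p. F \<eta> p \<partial>strip) \<longlongrightarrow> (\<integral>p. L p \<partial>strip)) (at_right 0)"
  proof (rule dominated_convergence_at_right[OF radius_pos Fm Lm, where w = "\<lambda>p. w (snd p)"])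
    show "AE p in strip. ((\<lambda>\<eta>. F \<eta> p) \<longlongrightarrow> L p) (at_right 0)"
    proof (intro AE_I2)
      fix p :: "real \<times> real"
      obtain t x where p: "p = (t, x)" by (cases p)
      have "((\<lambda>\<eta>. f t * (\<eta> * layer_part (e * \<eta>) t (\<eta> * x))) \<longlongrightarrow> L p) (at_right 0)"
        unfolding L_def p fst_conv snd_conv by (intro tendsto_mult_left layer_part_limit_pointwise[OF e])
      moreover have "eventually (\<lambda>\<eta>. f t * (\<eta> * layer_part (e * \<eta>) t (\<eta> * x)) = F \<eta> p) (at_right 0)"
      proof -
        have "((\<lambda>\<eta>. \<bar>\<eta> * x\<bar>) \<longlongrightarrow> \<bar>0 * x\<bar>) (at_right 0)" by (intro tendsto_intros)
        then have "eventually (\<lambda>\<eta>. \<bar>\<eta> * x\<bar> < 1/2) (at_right 0)" by (intro order_tendstoD(2)) auto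
        then show ?thesis by eventually_elim (auto simp: F_def p abs_less_iff indicator_def)
      qed
      ultimately show "((\<lambda>\<eta>. F \<eta> p) \<longlongrightarrow> L p) (at_right 0)" by (rule Lim_transform_eventually)
    qed
    show "AE p in strip. norm (F \<eta> p) \<le> w (snd p)" if "0 < \<eta>" "\<eta> < radius" for \<eta> using Fb[OF that] by simp
    show "integrable strip (\<lambda>p. w (snd p))" by (rule strip_integrable_snd[OF wint])
  qed
  have Fint: "integrable strip (F \<eta>)" if "0 < \<eta>" "\<eta> < radius" for \<eta>
    by (rule Bochner_Integration.integrable_bound[OF strip_integrable_snd[OF wint] Fm])
       (use Fb[OF that] in \<open>auto intro!: always_eventually order_trans[OF _ abs_ge_self]\<close>)
  have eqF: "(\<integral>p. F \<eta> p \<partial>strip) = (\<integral>p. f (fst p) * layer_part (e * \<eta>) (fst p) (snd p) \<partial>torus)" if \<eta>: "0 < \<eta>" "\<eta> < radius" for \<eta>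
  proof -
    have d: "0 < \<bar>e * \<eta>\<bar>" "\<bar>e * \<eta>\<bar> \<le> radius" using \<eta> e by (auto simp: abs_mult)
    have "(\<integral>p. F \<eta> p \<partial>strip) = (\<integral>t. (\<integral>x. F \<eta> (t, x) \<partial>lborel) \<partial>unit_interval)"
      using unit_line.integral_fst'[OF Fint[OF \<eta>]] by simp
    also have "\<dots> = (\<integral>t. (\<integral>h. f t * layer_part (e * \<eta>) t h \<partial>half_interval) \<partial>unit_interval)"
    proof (rule Bochner_Integration.integral_cong[OF refl])
      fix t
      have "(\<integral>h. f t * layer_part (e * \<eta>) t h \<partial>half_interval) = (\<integral>h. indicator {-(1/2)..1/2} h *\<^sub>R (f t * layer_part (e * \<eta>) t h) \<partial>lborel)"
        by (subst integral_restrict_space) simp_all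
      also have "\<dots> = \<bar>\<eta>\<bar> *\<^sub>R (\<integral>x. indicator {-(1/2)..1/2} (0 + \<eta> * x) *\<^sub>R (f t * layer_part (e * \<eta>) t (0 + \<eta> * x)) \<partial>lborel)"
        using \<eta> by (intro lborel_integral_real_affine) auto
      also have "\<dots> = (\<integral>x. \<eta> * (indicator {-(1/2)..1/2} (0 + \<eta> * x) *\<^sub>R (f t * layer_part (e * \<eta>) t (0 + \<eta> * x))) \<partial>lborel)"
        using \<eta> by simp
      also have "\<dots> = (\<integral>x. F \<eta> (t, x) \<partial>lborel)"
        by (intro Bochner_Integration.integral_cong) (auto simp: F_def)
      finally show "(\<integral>x. F \<eta> (t, x) \<partial>lborel) = (\<integral>h. f t * layer_part (e * \<eta>) t h \<partial>half_interval)" by simp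
    qed
    also have "\<dots> = (\<integral>p. f (fst p) * layer_part (e * \<eta>) (fst p) (snd p) \<partial>torus)"
      using torus.integral_fst'[OF layer_part_integrable(1)[OF f d]] by simp
    finally show ?thesis .
  qed
  have Lint: "integrable strip L"
  proof -
    define a where "a = bc\<^sup>2"
    have a: "a > 0" using bc_pos by (simp add: a_def)
    obtain T where T: "T > 0" "\<And>t. norm (turn t) \<le> T"
      by (rule periodic_bounded[OF cont_turn periodic_turn], blast)
    show ?thesis
    proof (rule Bochner_Integration.integrable_bound)
    show "integrable strip (\<lambda>p. B * (T * (1 / (1 + a * (snd p)\<^sup>2))))"
      by (rule strip_integrable_snd[of "\<lambda>x. B * (T * (1 / (1 + a * x\<^sup>2)))"])
         (intro integrable_mult_right integrable_inverse_one_plus_square a)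
    show "AE p in strip. norm (L p) \<le> norm (B * (T * (1 / (1 + a * (snd p)\<^sup>2))))"
    proof (intro AE_I2)
      fix p :: "real \<times> real"
      define X where "X = (norm (g1 (fst p)))\<^sup>2 * (snd p)\<^sup>2"
      have aX: "a * (snd p)\<^sup>2 \<le> X" unfolding X_def a_def using g1_ge[of "fst p"] bc_pos by (intro mult_right_mono power_mono) auto
      have X: "X \<ge> 0" by (simp add: X_def)
      have "X / (1 + X)\<^sup>2 \<le> (1 + X) / (1 + X)\<^sup>2" by (intro divide_right_mono) auto
      also have "\<dots> = 1 / (1 + X)" using X by (simp add: power2_eq_square)
      also have "\<dots> \<le> 1 / (1 + a * (snd p)\<^sup>2)"
        using aX X a by (intro divide_left_mono mult_pos_pos add_pos_nonneg mult_nonneg_nonneg) auto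
      finally have 1: "X / (1 + X)\<^sup>2 \<le> 1 / (1 + a * (snd p)\<^sup>2)" .
      have "norm (L p) = \<bar>f (fst p)\<bar> * (\<bar>turn (fst p)\<bar> * (X / (1 + X)\<^sup>2))"
        using e X by (simp add: L_def X_def abs_mult)
      also have "\<dots> \<le> B * (T * (1 / (1 + a * (snd p)\<^sup>2)))"
        using f(2)[of "fst p"] T(2)[of "fst p"] 1 X B T(1) by (intro mult_mono) auto
      finally show "norm (L p) \<le> norm (B * (T * (1 / (1 + a * (snd p)\<^sup>2))))"
        using abs_ge_self[of "B * (T * (1 / (1 + a * (snd p)\<^sup>2)))"] unfolding real_norm_def by linarith
    qed
    qed (rule Lm)
  qed
  have Lval: "(\<integral>p. L p \<partial>strip) = e * bump_integral * (\<integral>t. f t * turn t / norm (g1 t) \<partial>unit_interval)"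
  proof -
    have "(\<integral>p. L p \<partial>strip) = (\<integral>t. (\<integral>x. L (t, x) \<partial>lborel) \<partial>unit_interval)"
      using unit_line.integral_fst'[OF Lint] by simp
    also have "\<dots> = (\<integral>t. e * bump_integral * (f t * turn t / norm (g1 t)) \<partial>unit_interval)"
    proof (rule Bochner_Integration.integral_cong[OF refl])
      fix t
      define G where "G = norm (g1 t)"
      have G: "G > 0" using regular by (simp add: G_def)
      have "(\<integral>x. L (t, x) \<partial>lborel) = (\<integral>x. (f t * e * turn t / G) * (G ^ 3 * x\<^sup>2 / (1 + G\<^sup>2 * x\<^sup>2)\<^sup>2) \<partial>lborel)"
        using G by (intro Bochner_Integration.integral_cong) (auto simp: L_def G_def[symmetric] power2_eq_square power3_eq_cube)
      also have "\<dots> = (f t * e * turn t / G) * bump_integral"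
        unfolding integral_mult_right_zero bump_integral_scaled[OF G] ..
      finally show "(\<integral>x. L (t, x) \<partial>lborel) = e * bump_integral * (f t * turn t / norm (g1 t))"
        by (simp add: G_def mult_ac)
    qed
    also have "\<dots> = e * bump_integral * (\<integral>t. f t * turn t / norm (g1 t) \<partial>unit_interval)" by (rule integral_mult_right_zero)
    finally show ?thesis .
  qed
  have "eventually (\<lambda>\<eta>. (\<integral>p. F \<eta> p \<partial>strip) = (\<integral>p. f (fst p) * layer_part (e * \<eta>) (fst p) (snd p) \<partial>torus)) (at_right 0)"
    using eventually_at_right_real[OF radius_pos] by eventually_elim (use eqF in auto)
  from Lim_transform_eventually[OF lim this] show ?thesis unfolding Lval .
qed

definition total_turn :: real where "total_turn = (\<integral>t. turn t \<partial>unit_interval)"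

text \<open>The double integral of \<open>trunc_kernel_far_loops\<close> for the curve and its
  parallel curve, in torus coordinates; the factor 1/4 is the one found there, and the bracket is
  the signed speed of the parallel curve.\<close>

definition par_energy :: "real \<Rightarrow> real" where
  "par_energy \<delta> = (\<integral>p. (norm (g1 (fst p)) - \<delta> * turn (fst p)) * par_kernel \<delta> (fst p) (snd p) \<partial>torus) / 4"

lemma residue_kernel_integrable:
  assumes \<delta>: "0 < \<bar>\<delta>\<bar>" "\<bar>\<delta>\<bar> \<le> radius"
  shows "integrable torus (\<lambda>p. residue_kernel \<delta> (fst p) (snd p))"
proof (rule integrable_torus_bounded)
  fix t h :: real
  have "\<delta>\<^sup>2 \<le> weight \<delta> t h" using weight_lower[OF \<delta>(2), of t h] zero_le_power2[of "norm (chord t h)"] by linarith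
  moreover have "norm (residue_kernel \<delta> t h) = norm (g1 (t + h)) / weight \<delta> t h"
    by (simp add: residue_kernel_def weight_def norm_mult norm_divide)
  ultimately show "norm (residue_kernel \<delta> (fst (t, h)) (snd (t, h))) \<le> bM / \<delta>\<^sup>2"
    unfolding fst_conv snd_conv using g1_le[of "t + h"] \<delta> bM_pos by (simp only:) (intro frac_le; simp)
qed measurable

lemma periodic_real_bound:
  fixes f :: "real \<Rightarrow> real"
  assumes "continuous_on UNIV f" "\<And>t. f (t + 1) = f t"
  obtains B where "\<And>t. \<bar>f t\<bar> \<le> B"
proof -
  have "continuous_on {0..1} f" using assms(1) by (rule continuous_on_subset) simp
  from periodic_bounded[OF this assms(2)] show ?thesis using that by (metis real_norm_def)
qed

lemma cont_norm_g1: "continuous_on UNIV (\<lambda>t. norm (g1 t))"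
  by (intro continuous_intros cont_g1)

lemma par_energy_expand:
  assumes \<delta>: "0 < \<bar>\<delta>\<bar>" "\<bar>\<delta>\<bar> \<le> radius"
  shows "par_energy \<delta> = pi * orient * side / (4 * \<bar>\<delta>\<bar>) * (len - \<delta> * total_turn)
    + ((\<integral>p. norm (g1 (fst p)) * regular_part \<delta> (fst p) (snd p) \<partial>torus) + (\<integral>p. norm (g1 (fst p)) * layer_part \<delta> (fst p) (snd p) \<partial>torus)
    - \<delta> * ((\<integral>p. turn (fst p) * regular_part \<delta> (fst p) (snd p) \<partial>torus) + (\<integral>p. turn (fst p) * layer_part \<delta> (fst p) (snd p) \<partial>torus))) / 4"
proof -
  define W where "W = (\<lambda>t. norm (g1 t) - \<delta> * turn t)"
  have Wc: "continuous_on UNIV W" unfolding W_def by (intro continuous_intros cont_g1 cont_turn)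
  have Wp: "W (t + 1) = W t" for t by (simp add: W_def periodic_g1 periodic_turn)
  obtain B where B: "\<And>t. \<bar>W t\<bar> \<le> B" by (rule periodic_real_bound[OF Wc Wp], blast)
  obtain B1 where B1: "\<And>t. \<bar>norm (g1 t)\<bar> \<le> B1" using g1_le by (metis abs_norm_cancel)
  obtain B2 where B2: "\<And>t. \<bar>turn t\<bar> \<le> B2" by (rule periodic_real_bound[OF cont_turn periodic_turn], blast)
  have m: "(\<lambda>t. norm (g1 t)) \<in> borel_measurable unit_interval" "turn \<in> borel_measurable unit_interval" "W \<in> borel_measurable unit_interval"
    using cont_norm_g1 cont_turn[of UNIV] Wc by (auto intro!: measurable_unit_interval borel_measurable_continuous_onI)
  have [measurable]: "(\<lambda>p. W (fst p)) \<in> borel_measurable torus" by (rule measurable_compose[OF measurable_fst m(3)])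
  note i1 = layer_part_integrable[OF m(1) B1 \<delta>]
  note i2 = layer_part_integrable[OF m(2) B2 \<delta>]
  have ir: "integrable torus (\<lambda>p. W (fst p) * Re (residue_kernel \<delta> (fst p) (snd p)))"
  proof (rule Bochner_Integration.integrable_bound)
    show "integrable torus (\<lambda>p. B * norm (residue_kernel \<delta> (fst p) (snd p)))"
      using residue_kernel_integrable[OF \<delta>] by (intro integrable_mult_right integrable_norm)
    show "AE p in torus. norm (W (fst p) * Re (residue_kernel \<delta> (fst p) (snd p))) \<le> norm (B * norm (residue_kernel \<delta> (fst p) (snd p)))"
    proof (intro AE_I2)
      fix p
      have "\<bar>W (fst p)\<bar> * \<bar>Re (residue_kernel \<delta> (fst p) (snd p))\<bar> \<le> B * norm (residue_kernel \<delta> (fst p) (snd p))"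
        using B[of "fst p"] abs_Re_le_cmod by (intro mult_mono) (auto intro: order_trans[OF abs_ge_zero])
      then show "norm (W (fst p) * Re (residue_kernel \<delta> (fst p) (snd p))) \<le> norm (B * norm (residue_kernel \<delta> (fst p) (snd p)))"
        unfolding real_norm_def abs_mult[of "W (fst p)"] by (rule order_trans[OF _ abs_ge_self])
    qed
  qed measurable
  have "(\<integral>p. W (fst p) * par_kernel \<delta> (fst p) (snd p) \<partial>torus)
     = (\<integral>p. W (fst p) * Re (residue_kernel \<delta> (fst p) (snd p))
        + ((norm (g1 (fst p)) * regular_part \<delta> (fst p) (snd p) + norm (g1 (fst p)) * layer_part \<delta> (fst p) (snd p))
        - \<delta> * (turn (fst p) * regular_part \<delta> (fst p) (snd p) + turn (fst p) * layer_part \<delta> (fst p) (snd p))) \<partial>torus)"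
    by (intro Bochner_Integration.integral_cong refl)
       (simp only: par_kernel_split[OF \<delta>] regular_part_def[symmetric] layer_part_def[symmetric], simp add: W_def algebra_simps)
  also have "\<dots> = (\<integral>p. W (fst p) * Re (residue_kernel \<delta> (fst p) (snd p)) \<partial>torus)
     + ((\<integral>p. norm (g1 (fst p)) * regular_part \<delta> (fst p) (snd p) \<partial>torus) + (\<integral>p. norm (g1 (fst p)) * layer_part \<delta> (fst p) (snd p) \<partial>torus)
    - \<delta> * ((\<integral>p. turn (fst p) * regular_part \<delta> (fst p) (snd p) \<partial>torus) + (\<integral>p. turn (fst p) * layer_part \<delta> (fst p) (snd p) \<partial>torus)))"
    using ir i1 i2 by (simp add: Bochner_Integration.integral_add Bochner_Integration.integral_diff)
  also have "(\<integral>p. W (fst p) * Re (residue_kernel \<delta> (fst p) (snd p)) \<partial>torus) = pi * orient * side / \<bar>\<delta>\<bar> * (len - \<delta> * total_turn)"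
  proof -
    have "(\<integral>p. W (fst p) * Re (residue_kernel \<delta> (fst p) (snd p)) \<partial>torus) = (\<integral>t. (\<integral>h. W t * Re (residue_kernel \<delta> t h) \<partial>half_interval) \<partial>unit_interval)"
      using torus.integral_fst'[OF ir] by simp
    also have "\<dots> = (\<integral>t. (pi * orient * side / \<bar>\<delta>\<bar>) * W t \<partial>unit_interval)"
    proof (rule integral_cong_AE)
      show "(\<lambda>t. \<integral>h. W t * Re (residue_kernel \<delta> t h) \<partial>half_interval) \<in> borel_measurable unit_interval"
        using borel_measurable_integrable[OF torus.integrable_fst'[OF ir]] by simp
      show "(\<lambda>t. (pi * orient * side / \<bar>\<delta>\<bar>) * W t) \<in> borel_measurable unit_interval" using m(3) by simp
      show "AE t in unit_interval. (\<integral>h. W t * Re (residue_kernel \<delta> t h) \<partial>half_interval) = (pi * orient * side / \<bar>\<delta>\<bar>) * W t"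
        using torus.AE_integrable_fst'[OF residue_kernel_integrable[OF \<delta>]]
      proof eventually_elim
        case (elim t)
        then have i: "integrable half_interval (\<lambda>h. residue_kernel \<delta> t h)" by simp
        have "(\<integral>h. W t * Re (residue_kernel \<delta> t h) \<partial>half_interval) = W t * (\<integral>h. Re (residue_kernel \<delta> t h) \<partial>half_interval)" by (rule integral_mult_right_zero)
        also have "(\<integral>h. Re (residue_kernel \<delta> t h) \<partial>half_interval) = Re (\<integral>h. residue_kernel \<delta> t h \<partial>half_interval)"
          by (rule integral_bounded_linear[OF bounded_linear_Re i])
        finally show ?case unfolding residue_kernel_integral[OF \<delta>] Re_complex_of_real by simp
      qed
    qed
    also have "\<dots> = (pi * orient * side / \<bar>\<delta>\<bar>) * (\<integral>t. W t \<partial>unit_interval)" by (rule integral_mult_right_zero)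
    also have "(\<integral>t. W t \<partial>unit_interval) = len - \<delta> * total_turn"
      using unit_interval_integral_eq[OF cont_norm_g1] unit_interval_integral_eq[OF cont_turn[of UNIV]]
      by (simp add: W_def len_def total_turn_def)
    finally show ?thesis .
  qed
  finally show ?thesis unfolding par_energy_def W_def by (simp add: add_divide_distrib)
qed

text \<open>The residue part carries the length of the parallel curve, L - \<delta> T with T the
  total turning. Divided by |\<delta>|, its second term survives as the constant with coefficient
  pi. The regular part weighted by the speed tends to -4 times the energy, the layer part
  contributes the bump mass times T, and the parts weighted by \<delta> times \<open>turn\<close>
  vanish.\<close>

lemma par_energy_limit:
  assumes e: "\<bar>e\<bar> = 1"
  shows "((\<lambda>\<eta>. pi * orient * side / (4 * \<eta>) * len - par_energy (e * \<eta>)) \<longlongrightarrow>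
     energy + e * ((pi * orient * side - bump_integral) / 4) * total_turn) (at_right 0)"
proof -
  obtain B1 where B1: "\<And>t. \<bar>norm (g1 t)\<bar> \<le> B1" using g1_le by (metis abs_norm_cancel)
  obtain B2 where B2: "\<And>t. \<bar>turn t\<bar> \<le> B2" by (rule periodic_real_bound[OF cont_turn periodic_turn], blast)
  have m: "(\<lambda>t. norm (g1 t)) \<in> borel_measurable unit_interval" "turn \<in> borel_measurable unit_interval"
    using cont_norm_g1 cont_turn[of UNIV] by (auto intro!: measurable_unit_interval borel_measurable_continuous_onI)
  define R1 where "R1 = (\<lambda>\<eta>. \<integral>p. norm (g1 (fst p)) * regular_part (e * \<eta>) (fst p) (snd p) \<partial>torus)"
  define L1 where "L1 = (\<lambda>\<eta>. \<integral>p. norm (g1 (fst p)) * layer_part (e * \<eta>) (fst p) (snd p) \<partial>torus)"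
  define R2 where "R2 = (\<lambda>\<eta>. \<integral>p. turn (fst p) * regular_part (e * \<eta>) (fst p) (snd p) \<partial>torus)"
  define L2 where "L2 = (\<lambda>\<eta>. \<integral>p. turn (fst p) * layer_part (e * \<eta>) (fst p) (snd p) \<partial>torus)"
  have nz: "norm (g1 t) \<noteq> 0" for t using regular by simp
  have R1: "(R1 \<longlongrightarrow> - 4 * energy) (at_right 0)"
  proof -
    have "(\<integral>p. norm (g1 (fst p)) * (2 * energy_density (fst p) (snd p) / norm (g1 (fst p))) \<partial>torus) = (\<integral>p. 2 * energy_density (fst p) (snd p) \<partial>torus)"
      using nz by (intro Bochner_Integration.integral_cong) auto
    also have "\<dots> = - 4 * energy" by (simp add: energy_def)
    finally show ?thesis using regular_part_limit[OF m(1) B1 e] unfolding R1_def by simp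
  qed
  have L1: "(L1 \<longlongrightarrow> e * bump_integral * total_turn) (at_right 0)"
  proof -
    have "(\<lambda>t. norm (g1 t) * turn t / norm (g1 t)) = turn" using nz by auto
    then show ?thesis using layer_part_limit[OF m(1) B1 e] unfolding L1_def total_turn_def by simp
  qed
  note R2 = regular_part_limit[OF m(2) B2 e, folded R2_def]
  note L2 = layer_part_limit[OF m(2) B2 e, folded L2_def]
  have id: "((\<lambda>\<eta>::real. \<eta>) \<longlongrightarrow> 0) (at_right 0)" by (rule tendsto_ident_at)
  have "((\<lambda>\<eta>. pi * orient * side * e * total_turn / 4 - (R1 \<eta> + L1 \<eta> - e * \<eta> * (R2 \<eta> + L2 \<eta>)) / 4) \<longlongrightarrow>
     pi * orient * side * e * total_turn / 4 - (- 4 * energy + e * bump_integral * total_turn - e * 0 *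
       ((\<integral>p. turn (fst p) * (2 * energy_density (fst p) (snd p) / norm (g1 (fst p))) \<partial>torus) + e * bump_integral * (\<integral>t. turn t * turn t / norm (g1 t) \<partial>unit_interval))) / 4) (at_right 0)"
    by (intro tendsto_intros R1 L1 R2 L2 id) auto
  moreover have "pi * orient * side * e * total_turn / 4 - (- 4 * energy + e * bump_integral * total_turn - e * 0 *
       ((\<integral>p. turn (fst p) * (2 * energy_density (fst p) (snd p) / norm (g1 (fst p))) \<partial>torus) + e * bump_integral * (\<integral>t. turn t * turn t / norm (g1 t) \<partial>unit_interval))) / 4
     = energy + e * ((pi * orient * side - bump_integral) / 4) * total_turn"
    by (simp add: field_simps)
  ultimately have lim: "((\<lambda>\<eta>. pi * orient * side * e * total_turn / 4 - (R1 \<eta> + L1 \<eta> - e * \<eta> * (R2 \<eta> + L2 \<eta>)) / 4) \<longlongrightarrow>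
     energy + e * ((pi * orient * side - bump_integral) / 4) * total_turn) (at_right 0)" by simp
  have ev: "eventually (\<lambda>\<eta>. pi * orient * side * e * total_turn / 4 - (R1 \<eta> + L1 \<eta> - e * \<eta> * (R2 \<eta> + L2 \<eta>)) / 4
     = pi * orient * side / (4 * \<eta>) * len - par_energy (e * \<eta>)) (at_right 0)"
    using eventually_at_right_real[OF radius_pos]
  proof eventually_elim
    case (elim \<eta>)
    then have \<eta>: "0 < \<eta>" "\<eta> < radius" by auto
    have ab: "\<bar>e * \<eta>\<bar> = \<eta>" using \<eta> e by (simp add: abs_mult)
    have d: "0 < \<bar>e * \<eta>\<bar>" "\<bar>e * \<eta>\<bar> \<le> radius" unfolding ab using \<eta> by auto
    have alg: "c * e * T / 4 - X / 4 = c / (4 * \<eta>) * l - (c / (4 * \<eta>) * (l - e * \<eta> * T) + X / 4)" for c T X l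
      using \<eta> by (simp add: field_simps)
    have ex: "par_energy (e * \<eta>) = pi * orient * side / (4 * \<eta>) * (len - e * \<eta> * total_turn)
        + (R1 \<eta> + L1 \<eta> - e * \<eta> * (R2 \<eta> + L2 \<eta>)) / 4"
      unfolding R1_def L1_def R2_def L2_def by (rule par_energy_expand[OF d, unfolded ab])
    show ?case unfolding ex by (rule alg)
  qed
  show ?thesis by (rule Lim_transform_eventually[OF lim ev])
qed

lemma dist_tube_curve: "\<bar>\<delta>\<bar> \<le> radius \<Longrightarrow> \<bar>\<delta>\<bar> \<le> norm (g s - tube t \<delta>)"
  using infdist_tube[of \<delta> t] infdist_le[OF g_in_K, of "tube t \<delta>" s] by (simp add: dist_norm norm_minus_commute)

definition par_form :: "real \<Rightarrow> real \<Rightarrow> real \<Rightarrow> complex" where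
  "par_form \<delta> t s = g1 s * cnj (par1 \<delta> t) / of_real ((norm (g s - tube t \<delta>))\<^sup>2)"

lemma par_form_torus:
  assumes \<delta>: "0 < \<bar>\<delta>\<bar>" "\<bar>\<delta>\<bar> \<le> radius"
  shows "continuous_on UNIV (\<lambda>p. par_form \<delta> (fst p) (snd p))" "continuous_on UNIV (\<lambda>p. par_form \<delta> (fst p) (fst p + snd p))"
    and "Re (\<integral>p. par_form \<delta> (fst p) (fst p + snd p) \<partial>torus) = 4 * par_energy \<delta>"
proof -
  have nz: "norm (g s - tube t \<delta>) \<noteq> 0" for s t using dist_tube_curve[OF \<delta>(2), of s t] \<delta> by linarith
  have ct: "continuous_on UNIV (\<lambda>t. tube t \<delta>)" "continuous_on UNIV (par1 \<delta>)"
    using C1_loop_continuous[OF C1_loop_tube[of \<delta>]] by auto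
  show c1: "continuous_on UNIV (\<lambda>p. par_form \<delta> (fst p) (snd p))" unfolding par_form_def
    by (intro continuous_intros continuous_on_compose2[OF cont_g1[of UNIV]] continuous_on_compose2[OF cont_g[of UNIV]]
        continuous_on_compose2[OF ct(1)] continuous_on_compose2[OF ct(2)]) (use nz in auto)
  show c2: "continuous_on UNIV (\<lambda>p. par_form \<delta> (fst p) (fst p + snd p))" unfolding par_form_def
    by (intro continuous_intros continuous_on_compose2[OF cont_g1[of UNIV]] continuous_on_compose2[OF cont_g[of UNIV]]
        continuous_on_compose2[OF ct(1)] continuous_on_compose2[OF ct(2)]) (use nz in auto)
  have "Re (\<integral>p. par_form \<delta> (fst p) (fst p + snd p) \<partial>torus) = (\<integral>p. Re (par_form \<delta> (fst p) (fst p + snd p)) \<partial>torus)"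
    by (rule integral_bounded_linear[OF bounded_linear_Re, symmetric])
       (rule torus_integrable_continuous[of "\<lambda>t h. par_form \<delta> t (t + h)", OF c2])
  also have "\<dots> = (\<integral>p. (norm (g1 (fst p)) - \<delta> * turn (fst p)) * par_kernel \<delta> (fst p) (snd p) \<partial>torus)"
  proof (rule Bochner_Integration.integral_cong[OF refl])
    fix p :: "real \<times> real"
    obtain t h where p: "p = (t, h)" by (cases p)
    define a where "a = norm (g1 t) - \<delta> * turn t"
    define n where "n = norm (chord t h - \<i> * of_real \<delta> * tang t)"
    have d: "norm (g (t + h) - tube t \<delta>) = n" by (simp add: n_def chord_def tube_def algebra_simps)
    have "par_form \<delta> t (t + h) = of_real (a / n\<^sup>2) * (g1 (t + h) * cnj (tang t))"
      unfolding par_form_def d par1_def a_def by (simp add: mult_ac)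
    then have "Re (par_form \<delta> t (t + h)) = a / n\<^sup>2 * forward t h"
      unfolding forward_def by simp
    then show "Re (par_form \<delta> (fst p) (fst p + snd p)) = (norm (g1 (fst p)) - \<delta> * turn (fst p)) * par_kernel \<delta> (fst p) (snd p)"
      by (simp add: p par_kernel_def a_def n_def)
  qed
  finally show "Re (\<integral>p. par_form \<delta> (fst p) (fst p + snd p) \<partial>torus) = 4 * par_energy \<delta>" by (simp add: par_energy_def)
qed

lemma par_form_inner:
  assumes \<delta>: "0 < \<bar>\<delta>\<bar>" "\<bar>\<delta>\<bar> \<le> radius"
  shows "(\<integral>s. par_form \<delta> t s \<partial>unit_interval) = (\<integral>h. par_form \<delta> t (t + h) \<partial>half_interval)"
proof -
  have "continuous_on UNIV (\<lambda>s::real. (t, s))" by (intro continuous_intros)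
  from continuous_on_compose2[OF par_form_torus(1)[OF \<delta>] this subset_UNIV]
  have c: "continuous_on UNIV (par_form \<delta> t)" by simp
  have per: "par_form \<delta> t (s + 1) = par_form \<delta> t s" for s by (simp add: par_form_def periodic_g periodic_g1)
  show ?thesis
    by (rule periodic_half_interval(2)[OF borel_measurable_continuous_onI[OF c] per unit_interval_integrable_continuous[OF c], symmetric])
qed

text \<open>The cutoff |\<delta>| / 2 lies strictly below the distance of the two loops, as
  \<open>trunc_kernel_far_loops\<close> asks. Since the two regions are separated by |\<delta>| as
  well, it cuts nothing off between them.\<close>

lemma par_inside_energy:
  assumes \<delta>: "0 < \<bar>\<delta>\<bar>" "\<bar>\<delta>\<bar> \<le> radius" and s: "side * \<delta> > 0"
  shows "integrable plane_pairs (cut_kernel (par_region \<delta>) (- inside K) (\<bar>\<delta>\<bar> / 2))"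
    and "integral\<^sup>L plane_pairs (cut_kernel (par_region \<delta>) (- inside K) (\<bar>\<delta>\<bar> / 2)) = par_energy \<delta>"
proof -
  have sub: "par_region \<delta> \<subseteq> inside K" using s by (auto simp: par_region_def)
  have far: "\<bar>\<delta>\<bar> / 2 < norm (g s - tube t \<delta>)" for s t using dist_tube_curve[OF \<delta>(2), of s t] \<delta> by linarith
  have \<epsilon>: "\<bar>\<delta>\<bar> / 2 > 0" using \<delta> by simp
  note DL = trunc_kernel_far_loops[OF C1_loop_tube encloses_tube[OF \<delta>] C1_loop_g encloses_inside sub abs_orient \<epsilon> far]
  show "integrable plane_pairs (cut_kernel (par_region \<delta>) (- inside K) (\<bar>\<delta>\<bar> / 2))"
    by (rule DL(1))
  define J where "J = integral\<^sup>L plane_pairs (cut_kernel (par_region \<delta>) (- inside K) (\<bar>\<delta>\<bar> / 2))"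
  have c2: "continuous_on UNIV (\<lambda>p. par_form \<delta> (fst p) (snd p))" by (rule par_form_torus(1)[OF \<delta>])
  have sq: "integrable (unit_interval \<Otimes>\<^sub>M unit_interval) (\<lambda>p. par_form \<delta> (fst p) (snd p))"
  proof -
    have "compact ((\<lambda>p. par_form \<delta> (fst p) (snd p)) ` ({0..1} \<times> {0..1}))"
      by (intro compact_continuous_image compact_Times continuous_on_subset[OF c2]) auto
    then have "bounded ((\<lambda>p. par_form \<delta> (fst p) (snd p)) ` ({0..1} \<times> {0..1}))" by (rule compact_imp_bounded)
    then obtain B where B: "\<forall>x\<in>(\<lambda>p. par_form \<delta> (fst p) (snd p)) ` ({0..1} \<times> {0..1}). norm x \<le> B" unfolding bounded_iff by blast
    interpret sqf: finite_measure "unit_interval \<Otimes>\<^sub>M unit_interval"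
      by (rule finite_measure_pair_measure) unfold_locales
    have f: "fst \<in> borel_measurable (unit_interval \<Otimes>\<^sub>M unit_interval)" "snd \<in> borel_measurable (unit_interval \<Otimes>\<^sub>M unit_interval)"
      using measurable_compose[OF measurable_fst measurable_unit_interval[of "\<lambda>x. x"]]
        measurable_compose[OF measurable_snd measurable_unit_interval[of "\<lambda>x. x"]] by simp_all
    have pm: "(\<lambda>p. (fst p, snd p)) \<in> borel_measurable (unit_interval \<Otimes>\<^sub>M unit_interval)"
      by (rule borel_measurable_Pair[OF f])
    have "(\<lambda>p. par_form \<delta> (fst p) (snd p)) \<in> borel_measurable (unit_interval \<Otimes>\<^sub>M unit_interval)"
      using measurable_compose[OF pm borel_measurable_continuous_onI[OF c2]] by simp
    then show ?thesis
      by (rule sqf.integrable_const_bound[of _ B, rotated]) (use B in \<open>auto simp: space_pair_measure intro!: AE_I2\<close>)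
  qed
  have "complex_of_real J = (\<integral>s. (\<integral>t. par_form \<delta> t s \<partial>unit_interval) \<partial>unit_interval) / 4"
    unfolding J_def par_form_def by (rule DL(2))
  also have "(\<integral>s. (\<integral>t. par_form \<delta> t s \<partial>unit_interval) \<partial>unit_interval) = (\<integral>t. (\<integral>s. par_form \<delta> t s \<partial>unit_interval) \<partial>unit_interval)"
    using unit_square.Fubini_integral[of "par_form \<delta>"] sq by (simp add: case_prod_beta')
  also have "\<dots> = (\<integral>p. par_form \<delta> (fst p) (fst p + snd p) \<partial>torus)"
    unfolding par_form_inner[OF \<delta>]
    using torus.integral_fst'[OF torus_integrable_continuous[of "\<lambda>t h. par_form \<delta> t (t + h)", OF par_form_torus(2)[OF \<delta>]]] by simp
  finally have "J = Re ((\<integral>p. par_form \<delta> (fst p) (fst p + snd p) \<partial>torus) / 4)" by (metis Re_complex_of_real)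
  then show "integral\<^sup>L plane_pairs (cut_kernel (par_region \<delta>) (- inside K) (\<bar>\<delta>\<bar> / 2)) = par_energy \<delta>"
    using par_form_torus(3)[OF \<delta>] unfolding J_def by simp
qed

lemma par_outside_energy:
  assumes \<delta>: "0 < \<bar>\<delta>\<bar>" "\<bar>\<delta>\<bar> \<le> radius" and s: "side * \<delta> < 0"
  shows "integrable plane_pairs (cut_kernel (inside K) (- par_region \<delta>) (\<bar>\<delta>\<bar> / 2))"
    and "integral\<^sup>L plane_pairs (cut_kernel (inside K) (- par_region \<delta>) (\<bar>\<delta>\<bar> / 2)) = par_energy \<delta>"
proof -
  have sub: "inside K \<subseteq> par_region \<delta>" using s by (auto simp: par_region_def)
  have far: "\<bar>\<delta>\<bar> / 2 < norm (tube s \<delta> - g t)" for s t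
    using dist_tube_curve[OF \<delta>(2), of t s] \<delta> by (simp add: norm_minus_commute)
  have \<epsilon>: "\<bar>\<delta>\<bar> / 2 > 0" using \<delta> by simp
  note DL = trunc_kernel_far_loops[OF C1_loop_g encloses_inside C1_loop_tube encloses_tube[OF \<delta>] sub abs_orient \<epsilon> far]
  show "integrable plane_pairs (cut_kernel (inside K) (- par_region \<delta>) (\<bar>\<delta>\<bar> / 2))"
    by (rule DL(1))
  define J where "J = integral\<^sup>L plane_pairs (cut_kernel (inside K) (- par_region \<delta>) (\<bar>\<delta>\<bar> / 2))"
  have cs: "continuous_on UNIV (par_form \<delta> s)" for s
  proof -
    have "continuous_on UNIV (\<lambda>t::real. (s, t))" by (intro continuous_intros)
    from continuous_on_compose2[OF par_form_torus(1)[OF \<delta>] this subset_UNIV] show ?thesis by simp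
  qed
  have "(\<integral>t. cnj (par_form \<delta> s t) \<partial>unit_interval) = cnj (\<integral>t. par_form \<delta> s t \<partial>unit_interval)" for s
    by (rule integral_bounded_linear[OF bounded_linear_cnj unit_interval_integrable_continuous[OF cs]])
  \<comment> \<open>Here the parallel curve is the outer loop, so the loop formula yields the
    conjugate of \<open>par_form\<close>; the real part is the same.\<close>
  moreover have "cnj (par_form \<delta> s t) = par1 \<delta> s * cnj (g1 t) / of_real ((norm (tube s \<delta> - g t))\<^sup>2)" for s t
    by (simp add: par_form_def norm_minus_commute)
  ultimately have "complex_of_real J = (\<integral>s. cnj (\<integral>t. par_form \<delta> s t \<partial>unit_interval) \<partial>unit_interval) / 4"
    unfolding J_def using DL(2) by simp
  also have "(\<integral>s. cnj (\<integral>t. par_form \<delta> s t \<partial>unit_interval) \<partial>unit_interval) = cnj (\<integral>s. (\<integral>t. par_form \<delta> s t \<partial>unit_interval) \<partial>unit_interval)"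
    unfolding par_form_inner[OF \<delta>]
    by (rule integral_bounded_linear[OF bounded_linear_cnj])
       (use torus.integrable_fst'[OF torus_integrable_continuous[of "\<lambda>t h. par_form \<delta> t (t + h)", OF par_form_torus(2)[OF \<delta>]]] in simp)
  also have "(\<integral>s. (\<integral>t. par_form \<delta> s t \<partial>unit_interval) \<partial>unit_interval) = (\<integral>p. par_form \<delta> (fst p) (fst p + snd p) \<partial>torus)"
    unfolding par_form_inner[OF \<delta>]
    using torus.integral_fst'[OF torus_integrable_continuous[of "\<lambda>t h. par_form \<delta> t (t + h)", OF par_form_torus(2)[OF \<delta>]]] by simp
  finally have "J = Re (cnj (\<integral>p. par_form \<delta> (fst p) (fst p + snd p) \<partial>torus) / 4)" by (metis Re_complex_of_real)
  then show "integral\<^sup>L plane_pairs (cut_kernel (inside K) (- par_region \<delta>) (\<bar>\<delta>\<bar> / 2)) = par_energy \<delta>"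
    using par_form_torus(3)[OF \<delta>] unfolding J_def by simp
qed

lemma len_pos: "len > 0"
proof -
  have "bc * (1 - 0) \<le> integral {0..1} (\<lambda>t. norm (g1 t))"
    using integral_le[of "\<lambda>_. bc" "{0..1::real}" "\<lambda>t. norm (g1 t)"] g1_ge
      integrable_continuous_interval[OF continuous_on_subset[OF cont_norm_g1], of 0 1] by auto
  then show ?thesis using bc_pos by (simp add: len_def)
qed

text \<open>A proof by positivity. On the inner side \<open>par_energy\<close> is the integral of a
  nonnegative kernel, while its leading term is pi * orient * side * len / (4 \<eta>). If the signs
  disagreed, \<eta> times the renormalized expression would stay below -pi * len / 4, although it
  tends to 0.\<close>

lemma orient_side: "orient * side = 1"
proof (rule ccontr)
  assume "orient * side \<noteq> 1"
  then have os: "orient * side = -1" using abs_orient side(1) by (auto simp: abs_if split: if_splits)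
  have pe: "par_energy (side * \<eta>) \<ge> 0" if "0 < \<eta>" "\<eta> < radius" for \<eta>
  proof -
    have d: "0 < \<bar>side * \<eta>\<bar>" "\<bar>side * \<eta>\<bar> \<le> radius" using that side(1) by (auto simp: abs_mult)
    have "side * (side * \<eta>) > 0" using that side(1) by (auto simp: zero_less_mult_iff mult_less_0_iff abs_if split: if_splits)
    from par_inside_energy(2)[OF d this, symmetric] show ?thesis
      by (simp only:) (rule Bochner_Integration.integral_nonneg, use d in \<open>auto simp: trunc_kernel_def\<close>)
  qed
  have lim: "((\<lambda>\<eta>. \<eta> * (pi * orient * side / (4 * \<eta>) * len - par_energy (side * \<eta>))) \<longlongrightarrow>
     0 * (energy + side * ((pi * orient * side - bump_integral) / 4) * total_turn)) (at_right 0)"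
    by (intro tendsto_mult par_energy_limit side(1) tendsto_ident_at)
  have "eventually (\<lambda>\<eta>. \<eta> * (pi * orient * side / (4 * \<eta>) * len - par_energy (side * \<eta>)) \<le> - pi * len / 4) (at_right 0)"
    using eventually_at_right_real[OF radius_pos]
  proof eventually_elim
    case (elim \<eta>)
    then have \<eta>: "0 < \<eta>" "\<eta> < radius" by auto
    have "\<eta> * (pi * orient * side / (4 * \<eta>) * len - par_energy (side * \<eta>)) = pi * (orient * side) * len / 4 - \<eta> * par_energy (side * \<eta>)"
      using \<eta> by (simp add: field_simps)
    also have "\<dots> \<le> - pi * len / 4" unfolding os using \<eta> pe[OF \<eta>] by simp
    finally show ?case .
  qed
  from tendsto_upperbound[OF lim this] have "0 \<le> - pi * len / 4" by simp
  moreover have "0 < pi * len" using len_pos pi_gt_zero by simp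
  ultimately show False by linarith
qed

end

subsection \<open>The renormalized energy of a domain\<close>

text \<open>The subtracted pi / x^2 is the integral of the kernel over the whole plane outside the
  disc of radius x. For x < \<rho> what remains is minus the integral over the complement of
  \<Omega>, independent of x, so the limit is that of a constant. Truncating at
  \<open>e < \<rho>\<close> does not affect the complement.\<close>

lemma potential_eq:
  assumes b: "ball w \<rho> \<subseteq> \<Omega>" and \<Omega>[measurable]: "\<Omega> \<in> sets borel" and e: "0 < e" "e < \<rho>"
  shows "potential w \<Omega> = - (\<integral>z. indicator (- \<Omega>) z * trunc_kernel e (norm (z - w)) \<partial>lborel)"
proof -
  define H where "H z = indicator (- \<Omega>) z * trunc_kernel e (norm (z - w))" for z
  define G where "G x z = (if norm (z - w) \<ge> x then 1 / norm (z - w) ^ 4 else 0)" for x :: real and z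
  have [measurable]: "H \<in> borel_measurable borel" unfolding H_def by measurable
  have [measurable]: "G x \<in> borel_measurable borel" for x unfolding G_def by measurable
  have T: "integrable lborel (\<lambda>z. trunc_kernel e (norm (z - w)))"
  proof (rule integrableI_nonneg)
    show "(\<lambda>z. trunc_kernel e (norm (z - w))) \<in> borel_measurable lborel" by measurable
    show "AE z in lborel. 0 \<le> trunc_kernel e (norm (z - w))" using trunc_kernel_nonneg[OF e(1)] by simp
    show "(\<integral>\<^sup>+z. ennreal (trunc_kernel e (norm (z - w))) \<partial>lborel) < \<infinity>"
      by (simp add: nn_integral_trunc_kernel[OF e(1)])
  qed
  have H: "integrable lborel H"
    by (rule Bochner_Integration.integrable_bound[OF T])
       (use trunc_kernel_nonneg[OF e(1)] in \<open>auto simp: H_def indicator_def abs_mult\<close>)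
  have G: "has_bochner_integral lborel (G x) (pi / x\<^sup>2)" if x: "x > 0" for x
  proof (rule has_bochner_integral_nn_integral)
    have m: "(\<lambda>z::complex. ennreal (if norm z \<ge> x then 1 / norm z ^ 4 else 0)) \<in> borel_measurable borel" by measurable
    have "(\<integral>\<^sup>+z. ennreal (G x z) \<partial>lborel) = (\<integral>\<^sup>+z. ennreal (if norm (z::complex) \<ge> x then 1 / norm z ^ 4 else 0) \<partial>lborel)"
      using nn_integral_complex_shift[OF m, of "- w"] by (simp only: G_def diff_conv_add_uminus)
    also have "\<dots> = ennreal (pi / x\<^sup>2)"
      by (rule nn_integral_eq_has_bochner_integral[OF has_bochner_integral_inverse_fourth[OF x]]) auto
    finally show "(\<integral>\<^sup>+z. ennreal (G x z) \<partial>lborel) = ennreal (pi / x\<^sup>2)" .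
  qed (auto simp: G_def)
  have "eventually (\<lambda>x. (LINT z : \<Omega> - ball w x | lborel. 1 / norm (z - w) ^ 4) - pi / x\<^sup>2 = - integral\<^sup>L lborel H) (at_right 0)"
    using eventually_at_right_real[OF less_trans[OF e]]
  proof eventually_elim
    case (elim x)
    then have x: "0 < x" "x < \<rho>" by auto
    have eq: "indicator (\<Omega> - ball w x) z *\<^sub>R (1 / norm (z - w) ^ 4) = G x z - H z" for z
    proof (cases "z \<in> \<Omega>")
      case True
      then show ?thesis by (auto simp: G_def H_def dist_norm norm_minus_commute)
    next
      case False
      then have "norm (z - w) \<ge> \<rho>" using b by (force simp: dist_norm norm_minus_commute)
      then show ?thesis using False e x by (auto simp: G_def H_def trunc_kernel_def)
    qed
    have "(LINT z : \<Omega> - ball w x | lborel. 1 / norm (z - w) ^ 4) = pi / x\<^sup>2 - integral\<^sup>L lborel H"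
      unfolding set_lebesgue_integral_def eq
      using Bochner_Integration.integral_diff[OF has_bochner_integral_iff[THEN iffD1, THEN conjunct1, OF G[OF x(1)]] H]
        has_bochner_integral_iff[THEN iffD1, THEN conjunct2, OF G[OF x(1)]] by simp
    then show ?case by simp
  qed
  then show ?thesis unfolding potential_def H_def[symmetric]
    by (intro tendsto_Lim tendsto_eventually) auto
qed

context C2_curve
begin

lemma inside_iff_winding: "z \<notin> K \<Longrightarrow> z \<in> inside K \<longleftrightarrow> winding_number g z \<noteq> 0"
  using inside_Un_outside_K inside_Int_outside_K winding_g[of z] abs_orient by fastforce

lemma compl_outside: "- outside K = K \<union> inside K" and compl_inside: "- inside K = K \<union> outside K"
  using inside_Un_outside_K inside_Int_outside_K by blast+

lemma frontier_regions: "frontier (- outside K) = K" "frontier (- inside K) = K"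
  using frontier_inside_K frontier_outside_K by (simp_all only: frontier_complement)

lemma sets_regions [measurable]: "inside K \<in> sets borel" "outside K \<in> sets borel" "K \<in> sets borel"
  using open_inside_K open_outside_K compact_imp_closed[OF compact_K] by simp_all

lemma ball_subset_region:
  assumes "frontier U = K" "w \<in> U" "0 < \<eta>" "\<eta> \<le> infdist w K"
  shows "ball w \<eta> \<subseteq> U"
proof (rule ccontr)
  assume "\<not> ball w \<eta> \<subseteq> U"
  then have "ball w \<eta> - U \<noteq> {}" by blast
  moreover have "w \<in> ball w \<eta>" using assms by simp
  ultimately have "ball w \<eta> \<inter> frontier U \<noteq> {}" using connected_Int_frontier[OF connected_ball, of w \<eta> U] assms(2) by blast
  then obtain y where "y \<in> K" "dist w y < \<eta>" using assms(1) by auto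
  then show False using infdist_le[of y K w] assms(4) by simp
qed

lemma sets_far [measurable]:
  assumes [measurable]: "U \<in> sets borel"
  shows "{w \<in> U. \<eta> \<le> infdist w K} \<in> sets borel"
proof -
  have "closed {w. \<eta> \<le> infdist w K}" by (intro closed_Collect_le continuous_intros)
  then have [measurable]: "{w. \<eta> \<le> infdist w K} \<in> sets borel" by (rule borel_closed)
  have "{w \<in> U. \<eta> \<le> infdist w K} = U \<inter> {w. \<eta> \<le> infdist w K}" by auto
  also have "\<dots> \<in> sets borel" by (intro sets.Int) measurable
  finally show ?thesis .
qed

text \<open>A point of \<open>U\<close> at distance at least \<eta> from the boundary has its
  \<eta>-ball in \<open>U\<close>, so the truncation \<eta> / 2 serves all points at once.\<close>

lemma integral_potential:
  assumes fr: "frontier U = K" and U[measurable]: "U \<in> sets borel" and \<eta>: "0 < \<eta>"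
  shows "(LINT w : {w \<in> U. \<eta> \<le> infdist w K} | lborel. potential w U)
     = - (\<integral>w. indicator {w \<in> U. \<eta> \<le> infdist w K} w * (\<integral>z. indicator (- U) z * trunc_kernel (\<eta> / 2) (norm (z - w)) \<partial>lborel) \<partial>lborel)"
  unfolding set_lebesgue_integral_def Bochner_Integration.integral_minus[symmetric]
proof (rule Bochner_Integration.integral_cong[OF refl])
  fix w
  show "indicator {w \<in> U. \<eta> \<le> infdist w K} w *\<^sub>R potential w U
      = - (indicator {w \<in> U. \<eta> \<le> infdist w K} w * (\<integral>z. indicator (- U) z * trunc_kernel (\<eta> / 2) (norm (z - w)) \<partial>lborel))"
  proof (cases "w \<in> {w \<in> U. \<eta> \<le> infdist w K}")
    case True
    then have "ball w \<eta> \<subseteq> U" using ball_subset_region[OF fr _ \<eta>] by auto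
    from potential_eq[OF this U, of "\<eta> / 2"] \<eta> True show ?thesis by simp
  qed simp
qed

text \<open>Up to null sets, the points at distance at least \<eta> from the boundary form the
  shrunken region of the parallel curve, and the complement of the inside is the outside.\<close>

lemma integral_potential_inner:
  assumes \<eta>: "0 < \<eta>" "\<eta> \<le> radius"
  shows "(LINT w : {w \<in> - outside K. \<eta> \<le> infdist w K} | lborel. potential w (- outside K)) = - par_energy (side * \<eta>)"
proof -
  define \<delta> where "\<delta> = side * \<eta>"
  have ss: "side * side = 1" using side(1) by (auto simp: abs_if split: if_splits)
  have ab: "\<bar>\<delta>\<bar> = \<eta>" using \<eta> side(1) by (simp add: \<delta>_def abs_mult)
  have d: "0 < \<bar>\<delta>\<bar>" "\<bar>\<delta>\<bar> \<le> radius" using \<eta> ab by auto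
  have sd: "side * \<delta> > 0" using \<eta> ss by (simp add: \<delta>_def mult.assoc[symmetric])
  have [measurable]: "par_region \<delta> \<in> sets borel" using encloses_tube[OF d] by (simp add: encloses_def)
  note P = par_inside_energy[OF d sd]
  have "par_energy \<delta> = (\<integral>w. (\<integral>z. indicator (par_region \<delta>) w * (indicator (- inside K) z * trunc_kernel (\<eta> / 2) (norm (z - w))) \<partial>lborel) \<partial>lborel)"
    using lborel_pair.integral_fst'[OF P(1)] P(2) by (simp add: ab)
  also have "\<dots> = (\<integral>w. indicator {w \<in> - outside K. \<eta> \<le> infdist w K} w * (\<integral>z. indicator (- (- outside K)) z * trunc_kernel (\<eta> / 2) (norm (z - w)) \<partial>lborel) \<partial>lborel)"
  proof (rule integral_cong_AE)
    show "AE w in lborel. (\<integral>z. indicator (par_region \<delta>) w * (indicator (- inside K) z * trunc_kernel (\<eta> / 2) (norm (z - w))) \<partial>lborel)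
      = indicator {w \<in> - outside K. \<eta> \<le> infdist w K} w * (\<integral>z. indicator (- (- outside K)) z * trunc_kernel (\<eta> / 2) (norm (z - w)) \<partial>lborel)"
      using AE_infdist_neq[OF d]
    proof eventually_elim
      case (elim w)
      have "(\<integral>z. indicator (- inside K) z * trunc_kernel (\<eta> / 2) (norm (z - w)) \<partial>lborel)
          = (\<integral>z. indicator (- (- outside K)) z * trunc_kernel (\<eta> / 2) (norm (z - w)) \<partial>lborel)"
      proof (rule integral_cong_AE)
        show "AE z in lborel. indicator (- inside K) z * trunc_kernel (\<eta> / 2) (norm (z - w))
            = indicator (- (- outside K)) z * trunc_kernel (\<eta> / 2) (norm (z - w))"
          using AE_not_in[OF null_K]
        proof eventually_elim
          case (elim z)
          then have "z \<in> - inside K \<longleftrightarrow> z \<in> - (- outside K)" using compl_inside by auto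
          then show ?case by (simp only: indicator_def)
        qed
      qed measurable
      moreover have "w \<in> par_region \<delta> \<longleftrightarrow> w \<in> {w \<in> - outside K. \<eta> \<le> infdist w K}"
        using sd elim \<eta>(1) infdist_zero[of w] inside_Un_outside_K inside_Int_outside_K unfolding par_region_def compl_outside by (auto simp: ab)
      ultimately show ?case by (simp add: indicator_def)
    qed
  qed measurable
  also have "\<dots> = - (LINT w : {w \<in> - outside K. \<eta> \<le> infdist w K} | lborel. potential w (- outside K))"
    by (subst integral_potential) (use frontier_regions \<eta> in auto)
  finally show ?thesis by (simp add: \<delta>_def)
qed

text \<open>The points exchange roles: the one carrying the potential ranges over the complement of
  the grown region, the other over the inside. The kernel is symmetric, so Fubini is used in the
  opposite order.\<close>

lemma integral_potential_outer:
  assumes \<eta>: "0 < \<eta>" "\<eta> \<le> radius"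
  shows "(LINT w : {w \<in> - inside K. \<eta> \<le> infdist w K} | lborel. potential w (- inside K)) = - par_energy (- side * \<eta>)"
proof -
  define \<delta> where "\<delta> = - side * \<eta>"
  have ss: "side * side = 1" using side(1) by (auto simp: abs_if split: if_splits)
  have ab: "\<bar>\<delta>\<bar> = \<eta>" using \<eta> side(1) by (simp add: \<delta>_def abs_mult)
  have d: "0 < \<bar>\<delta>\<bar>" "\<bar>\<delta>\<bar> \<le> radius" using \<eta> ab by auto
  have sd: "side * \<delta> < 0" using \<eta> ss by (simp add: \<delta>_def mult.assoc[symmetric])
  note P = par_outside_energy[OF d sd]
  have R: "- par_region \<delta> = {w \<in> - inside K. \<eta> \<le> infdist w K}" using sd by (auto simp: par_region_def ab)
  have "par_energy \<delta> = (\<integral>z. (\<integral>w. indicator (inside K) w * (indicator (- par_region \<delta>) z * trunc_kernel (\<eta> / 2) (norm (z - w))) \<partial>lborel) \<partial>lborel)"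
    using lborel_pair.integral_snd[OF P(1)] P(2) by (simp add: ab)
  also have "\<dots> = (\<integral>w. indicator {w \<in> - inside K. \<eta> \<le> infdist w K} w * (\<integral>z. indicator (- (- inside K)) z * trunc_kernel (\<eta> / 2) (norm (z - w)) \<partial>lborel) \<partial>lborel)"
  proof (rule Bochner_Integration.integral_cong[OF refl])
    fix z
    have "(\<integral>w. indicator (inside K) w * (indicator (- par_region \<delta>) z * trunc_kernel (\<eta> / 2) (norm (z - w))) \<partial>lborel)
        = (\<integral>w. indicator (- par_region \<delta>) z * (indicator (inside K) w * trunc_kernel (\<eta> / 2) (norm (w - z))) \<partial>lborel)"
      by (intro Bochner_Integration.integral_cong refl) (simp add: norm_minus_commute)
    also have "\<dots> = indicator (- par_region \<delta>) z * (\<integral>w. indicator (inside K) w * trunc_kernel (\<eta> / 2) (norm (w - z)) \<partial>lborel)"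
      by (rule integral_mult_right_zero)
    finally show "(\<integral>w. indicator (inside K) w * (indicator (- par_region \<delta>) z * trunc_kernel (\<eta> / 2) (norm (z - w))) \<partial>lborel)
        = indicator {w \<in> - inside K. \<eta> \<le> infdist w K} z * (\<integral>w. indicator (- (- inside K)) w * trunc_kernel (\<eta> / 2) (norm (w - z)) \<partial>lborel)"
      unfolding R by (simp only: double_compl)
  qed
  also have "\<dots> = - (LINT w : {w \<in> - inside K. \<eta> \<le> infdist w K} | lborel. potential w (- inside K))"
    by (subst integral_potential) (use frontier_regions \<eta> in auto)
  finally show ?thesis by (simp add: \<delta>_def)
qed

lemma side_eq_orient: "side = orient"
  using orient_side side(1) abs_orient by (auto simp: abs_if split: if_splits)

text \<open>The energies of the compact region \<open>- outside K\<close> and, below, of the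
  unbounded region \<open>- inside K\<close>. The correction changes sign because the parallel
  curves lie on opposite sides of \<open>K\<close>.\<close>

definition inner_energy :: real where
  "inner_energy = energy + (pi - bump_integral) / 4 * (orient * total_turn)"

definition outer_energy :: real where
  "outer_energy = energy - (pi - bump_integral) / 4 * (orient * total_turn)"

lemma domain_energy_limits:
  assumes L: "curve_length K = len"
  shows "(domain_energy_approx (- outside K) \<longlongrightarrow> inner_energy) (at_right 0)"
    and "(domain_energy_approx (- inside K) \<longlongrightarrow> outer_energy) (at_right 0)"
proof -
  have os: "pi * orient * side = pi" using orient_side by (simp add: mult.assoc)
  have e1: "eventually (\<lambda>\<eta>. pi * orient * side / (4 * \<eta>) * len - par_energy (side * \<eta>) = domain_energy_approx (- outside K) \<eta>) (at_right 0)"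
    using eventually_at_right_real[OF radius_pos]
  proof eventually_elim
    case (elim \<eta>)
    then have "0 < \<eta>" "\<eta> \<le> radius" by auto
    from integral_potential_inner[OF this] show ?case
      unfolding domain_energy_approx_def frontier_regions L os by simp
  qed
  have e2: "eventually (\<lambda>\<eta>. pi * orient * side / (4 * \<eta>) * len - par_energy (- side * \<eta>) = domain_energy_approx (- inside K) \<eta>) (at_right 0)"
    using eventually_at_right_real[OF radius_pos]
  proof eventually_elim
    case (elim \<eta>)
    then have "0 < \<eta>" "\<eta> \<le> radius" by auto
    from integral_potential_outer[OF this] show ?case
      unfolding domain_energy_approx_def frontier_regions L os by simp
  qed
  have s2: "\<bar>- side\<bar> = 1" using side(1) by simp
  have "inner_energy = energy + side * ((pi * orient * side - bump_integral) / 4) * total_turn"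
    "outer_energy = energy + - side * ((pi * orient * side - bump_integral) / 4) * total_turn"
    unfolding os by (simp_all add: inner_energy_def outer_energy_def side_eq_orient algebra_simps diff_divide_distrib)
  then show "(domain_energy_approx (- outside K) \<longlongrightarrow> inner_energy) (at_right 0)"
      "(domain_energy_approx (- inside K) \<longlongrightarrow> outer_energy) (at_right 0)"
    using Lim_transform_eventually[OF par_energy_limit[OF side(1)] e1] Lim_transform_eventually[OF par_energy_limit[OF s2] e2] by simp_all
qed

lemma curve_energy_approx_eq:
  assumes L: "curve_length K = len" and \<epsilon>: "\<epsilon> > 0"
  shows "curve_energy_approx K \<epsilon> = 2 * len / \<epsilon> - cut_energy \<epsilon>"
proof -
  \<comment> \<open>Pairs with a point on the curve form a null set, so the closed region may be
    replaced by the open inside.\<close>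
  let ?N = "K \<times> UNIV \<union> UNIV \<times> K"
  let ?A = "((K \<union> inside K) \<times> - (K \<union> inside K)) - {(w, z). norm (z - w) \<le> \<epsilon>}"
  have "closed {(w, z). norm (z - w :: complex) \<le> \<epsilon>}"
    unfolding case_prod_beta by (intro closed_Collect_le continuous_intros)
  then have [measurable]: "{(w, z). norm (z - w :: complex) \<le> \<epsilon>} \<in> sets plane_pairs"
    unfolding lborel_prod by simp
  have K0: "emeasure lborel K = 0" using null_K by auto
  have "K \<times> UNIV \<in> null_sets plane_pairs" "UNIV \<times> K \<in> null_sets plane_pairs"
    by (auto simp: null_sets_def lborel.emeasure_pair_measure_Times K0)
  then have N: "?N \<in> null_sets plane_pairs" by (rule null_sets.Un)
  have "(\<integral>p. indicator ?A p *\<^sub>R (case p of (w, z) \<Rightarrow> 1 / norm (z - w) ^ 4) \<partial>plane_pairs) = cut_energy \<epsilon>"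
    unfolding cut_energy_def
  proof (rule integral_cong_AE)
    show "AE p in plane_pairs. indicator ?A p *\<^sub>R (case p of (w, z) \<Rightarrow> 1 / norm (z - w) ^ 4)
       = cut_kernel (inside K) (- inside K) \<epsilon> p"
      using AE_not_in[OF N]
    proof eventually_elim
      case (elim p)
      obtain w z where p: "p = (w, z)" by force
      then have "w \<notin> K" "z \<notin> K" using elim by auto
      then show ?case unfolding p by (auto simp: indicator_def trunc_kernel_def)
    qed
    have [measurable]: "?A \<in> sets plane_pairs" by measurable
    show "(\<lambda>p. indicator ?A p *\<^sub>R (case p of (w, z) \<Rightarrow> 1 / norm (z - w) ^ 4)) \<in> borel_measurable plane_pairs" by measurable
  qed measurable
  then show ?thesis
    unfolding curve_energy_approx_def bounded_region_def L set_lebesgue_integral_def lborel_prod[symmetric] by simp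
qed

lemma curve_energy_limit:
  assumes L: "curve_length K = len"
  shows "(curve_energy_approx K \<longlongrightarrow> energy) (at_right 0)"
proof (rule Lim_transform_eventually[OF cut_energy_limit])
  show "eventually (\<lambda>\<epsilon>. 2 * len / \<epsilon> - cut_energy \<epsilon> = curve_energy_approx K \<epsilon>) (at_right 0)"
    using eventually_at_right_less[of 0] by eventually_elim (simp add: curve_energy_approx_eq[OF L])
qed

end

text \<open>The divergent part of the cut energy, which only depends on the image, determines the length.\<close>

lemma len_unique:
  assumes "C2_curve g g1 g2" "C2_curve h h1 h2" and K: "C2_curve.K g = C2_curve.K h"
  shows "C2_curve.len g1 = C2_curve.len h1"
proof -
  interpret g: C2_curve g g1 g2 by fact
  interpret h: C2_curve h h1 h2 by fact
  have c: "g.cut_energy = h.cut_energy" unfolding g.cut_energy_def h.cut_energy_def K ..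
  have "((\<lambda>\<epsilon>. \<epsilon> * ((2 * g.len / \<epsilon> - g.cut_energy \<epsilon>) - (2 * h.len / \<epsilon> - h.cut_energy \<epsilon>))) \<longlongrightarrow> 0 * (g.energy - h.energy)) (at_right 0)"
    by (intro tendsto_mult tendsto_diff g.cut_energy_limit h.cut_energy_limit tendsto_ident_at)
  moreover have "eventually (\<lambda>\<epsilon>. \<epsilon> * ((2 * g.len / \<epsilon> - g.cut_energy \<epsilon>) - (2 * h.len / \<epsilon> - h.cut_energy \<epsilon>)) = 2 * (g.len - h.len)) (at_right 0)"
    using eventually_at_right_less[of 0] by eventually_elim (simp add: c field_simps)
  ultimately have "((\<lambda>\<epsilon>::real. 2 * (g.len - h.len)) \<longlongrightarrow> 0) (at_right 0)"
    using Lim_transform_eventually by fastforce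
  then show ?thesis by (simp add: tendsto_const_iff)
qed

section \<open>Smooth parametrizations and length\<close>

lemma smooth_closed_family:
  assumes F: "\<And>h. h \<in> F \<Longrightarrow> \<exists>h'\<in>F. \<forall>t. (h has_vector_derivative h' t) (at t)" and f: "f \<in> F"
  shows "smooth f"
proof -
  let ?D = "\<lambda>(g :: real \<Rightarrow> complex) s. vector_derivative g (at s)"
  have m: "(?D ^^ n) f \<in> F" for n
  proof (induction n)
    case (Suc n)
    obtain h' where h': "h' \<in> F" "\<And>t. ((?D ^^ n) f has_vector_derivative h' t) (at t)" using F[OF Suc] by blast
    have "(?D ^^ Suc n) f = h'" by (rule ext) (simp add: vector_derivative_at[OF h'(2)])
    then show ?case using h'(1) by simp
  qed (use f in simp)
  show ?thesis unfolding smooth_def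
  proof (intro allI)
    fix n t
    obtain h' where "\<And>t. ((?D ^^ n) f has_vector_derivative h' t) (at t)" using F[OF m] by blast
    then show "(?D ^^ n) f differentiable at t" by (rule differentiableI_vector)
  qed
qed

lemma smooth_has_derivative:
  assumes "smooth f"
  shows "(f has_vector_derivative vector_derivative f (at t)) (at t)"
proof -
  have "f differentiable at t" using assms unfolding smooth_def by (metis funpow_0)
  then show ?thesis by (simp add: vector_derivative_works)
qed

lemma smooth_vector_derivative:
  assumes "smooth f"
  shows "smooth (\<lambda>t. vector_derivative f (at t))"
  unfolding smooth_def
proof (intro allI)
  fix n t
  let ?D = "\<lambda>(g :: real \<Rightarrow> complex) s. vector_derivative g (at s)"
  have "(?D ^^ Suc n) f differentiable at t" using assms unfolding smooth_def by blast
  then show "(?D ^^ n) (\<lambda>t. vector_derivative f (at t)) differentiable at t"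
    unfolding funpow_Suc_right by simp
qed

lemma smooth_const: "smooth (\<lambda>_. k)"
proof (rule smooth_closed_family[of "range (\<lambda>k _. k)"])
  fix h :: "real \<Rightarrow> complex" assume "h \<in> range (\<lambda>k _. k)"
  then obtain k where "h = (\<lambda>_. k)" by auto
  then show "\<exists>h'\<in>range (\<lambda>k _. k). \<forall>t. (h has_vector_derivative h' t) (at t)"
    by (intro bexI[of _ "\<lambda>_. 0"]) auto
qed auto

lemma smooth_cnj:
  assumes "smooth f"
  shows "smooth (\<lambda>t. cnj (f t))"
proof (rule smooth_closed_family[of "{\<lambda>t. cnj (h t) | h. smooth h}"])
  fix k assume "k \<in> {\<lambda>t. cnj (h t) | h. smooth h}"
  then obtain h where h: "k = (\<lambda>t. cnj (h t))" "smooth h" by auto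
  show "\<exists>h'\<in>{\<lambda>t. cnj (h t) | h. smooth h}. \<forall>t. (k has_vector_derivative h' t) (at t)"
  proof (intro bexI[of _ "\<lambda>t. cnj (vector_derivative h (at t))"] allI)
    show "(k has_vector_derivative cnj (vector_derivative h (at t))) (at t)" for t
      unfolding h(1) by (rule has_vector_derivative_cnj[OF smooth_has_derivative[OF h(2)]])
  qed (use smooth_vector_derivative[OF h(2)] in auto)
qed (use assms in auto)

text \<open>The algebra generated by the smooth functions and one further function \<open>v\<close>.
  If the derivative of \<open>v\<close> lies in it, the algebra is closed under differentiation, and
  no formula for higher derivatives is required. The use is for inverses, whose derivative is a
  polynomial in the inverse.\<close>

inductive_set smooth_algebra :: "(real \<Rightarrow> complex) \<Rightarrow> (real \<Rightarrow> complex) set" for v where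
  base: "smooth f \<Longrightarrow> f \<in> smooth_algebra v"
| gen: "v \<in> smooth_algebra v"
| add: "f \<in> smooth_algebra v \<Longrightarrow> h \<in> smooth_algebra v \<Longrightarrow> (\<lambda>t. f t + h t) \<in> smooth_algebra v"
| mult: "f \<in> smooth_algebra v \<Longrightarrow> h \<in> smooth_algebra v \<Longrightarrow> (\<lambda>t. f t * h t) \<in> smooth_algebra v"

lemma smooth_algebra_smooth:
  assumes v: "\<And>t. (v has_vector_derivative v' t) (at t)" "v' \<in> smooth_algebra v" and f: "f \<in> smooth_algebra v"
  shows "smooth f"
proof (rule smooth_closed_family[OF _ f])
  fix h assume "h \<in> smooth_algebra v"
  then show "\<exists>h'\<in>smooth_algebra v. \<forall>t. (h has_vector_derivative h' t) (at t)"
  proof induction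
    case (base f)
    then show ?case
      by (intro bexI[of _ "\<lambda>t. vector_derivative f (at t)"] allI smooth_has_derivative smooth_algebra.base smooth_vector_derivative)
  next
    case gen
    then show ?case using v by blast
  next
    case (add f h)
    then obtain f' h' where d: "f' \<in> smooth_algebra v" "h' \<in> smooth_algebra v"
      "\<And>t. (f has_vector_derivative f' t) (at t)" "\<And>t. (h has_vector_derivative h' t) (at t)" by blast
    show ?case
      by (rule bexI[of _ "\<lambda>t. f' t + h' t"]) (use d in \<open>auto intro: smooth_algebra.add has_vector_derivative_add\<close>)
  next
    case (mult f h)
    then obtain f' h' where d: "f' \<in> smooth_algebra v" "h' \<in> smooth_algebra v"
      "\<And>t. (f has_vector_derivative f' t) (at t)" "\<And>t. (h has_vector_derivative h' t) (at t)" by blast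
    show ?case
      by (rule bexI[of _ "\<lambda>t. f t * h' t + f' t * h t"])
         (use d mult.hyps in \<open>auto intro!: smooth_algebra.add smooth_algebra.mult has_vector_derivative_mult\<close>)
  qed
qed

lemma parametrizes_C2:
  assumes p: "parametrizes \<gamma> K"
  defines "\<gamma>1 \<equiv> \<lambda>t. vector_derivative \<gamma> (at t)"
  defines "\<gamma>2 \<equiv> \<lambda>t. vector_derivative \<gamma>1 (at t)"
  shows "C2_curve \<gamma> \<gamma>1 \<gamma>2" "C2_curve.K \<gamma> = K"
proof -
  have s: "smooth \<gamma>" using p by (simp add: parametrizes_def)
  have s1: "smooth \<gamma>1" unfolding \<gamma>1_def by (rule smooth_vector_derivative[OF s])
  have s2: "smooth \<gamma>2" unfolding \<gamma>2_def by (rule smooth_vector_derivative[OF s1])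
  have "continuous_on UNIV \<gamma>2"
    using smooth_has_derivative[OF s2] by (intro continuous_at_imp_continuous_on ballI) (blast intro: has_vector_derivative_continuous)
  then show C: "C2_curve \<gamma> \<gamma>1 \<gamma>2"
    using p smooth_has_derivative[OF s] smooth_has_derivative[OF s1]
    unfolding C2_curve_def by (simp add: parametrizes_def \<gamma>1_def \<gamma>2_def)
  interpret C2_curve \<gamma> \<gamma>1 \<gamma>2 by (rule C)
  have "{0..1::real} = insert 1 {0..<1}" by auto
  moreover have "\<gamma> 1 = \<gamma> 0" using periodic_g[of 0] by simp
  ultimately have "\<gamma> ` {0..1} = \<gamma> ` {0..<1}" by auto
  then show "C2_curve.K \<gamma> = K" using p unfolding K_def parametrizes_def by simp
qed

text \<open>The length is taken from an arbitrarily chosen parametrization;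
  \<open>len_unique\<close> identifies it with the length of any other regular parametrization of
  the same set.\<close>

lemma curve_length_eq:
  assumes p: "parametrizes \<gamma> K" and "C2_curve g g1 g2" "C2_curve.K g = K"
  shows "curve_length K = C2_curve.len g1"
proof -
  define \<sigma> where "\<sigma> = (SOME \<gamma>. parametrizes \<gamma> K)"
  have \<sigma>: "parametrizes \<sigma> K" unfolding \<sigma>_def by (rule someI[where P = "\<lambda>\<gamma>. parametrizes \<gamma> K", OF p])
  note C = parametrizes_C2[OF \<sigma>]
  have "curve_length K = C2_curve.len (\<lambda>t. vector_derivative \<sigma> (at t))"
    unfolding curve_length_def Let_def \<sigma>_def[symmetric] C2_curve.len_def[OF C(1)] ..
  also have "\<dots> = C2_curve.len g1" by (rule len_unique[OF C(1) assms(2)]) (simp add: C(2) assms(3))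
  finally show ?thesis .
qed

subsection \<open>Images of curves and regions\<close>

text \<open>The inverse map made explicit; the value a / c is attained at infinity. As an
  equivalence it provides existence and uniqueness of preimages of finite points together.\<close>

lemma ext_moebius_eq_Some_iff:
  assumes det: "a * e - b * c \<noteq> 0"
  shows "ext_moebius a b c e x = Some z \<longleftrightarrow> x = (if a = c * z then None else Some ((e * z - b) / (a - c * z)))"
proof (cases x)
  case None
  then show ?thesis using det by (auto simp: ext_moebius_def field_simps)
next
  case (Some y)
  have "a * y + b - z * (c * y + e) = y * (a - c * z) - (e * z - b)" by (simp add: algebra_simps)
  then have key: "a * y + b = z * (c * y + e) \<longleftrightarrow> y * (a - c * z) = e * z - b" by (metis eq_iff_diff_eq_0)
  have nz: "\<not> (a * y + b = z * (c * y + e) \<and> c * y + e = 0)"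
  proof
    assume A: "a * y + b = z * (c * y + e) \<and> c * y + e = 0"
    then have "b = - (a * y)" "e = - (c * y)" by (simp_all add: eq_neg_iff_add_eq_0 add.commute)
    then show False using det by (simp add: algebra_simps)
  qed
  have nz': "\<not> (y * (a - c * z) = e * z - b \<and> a = c * z)" using det by (auto simp: algebra_simps)
  have "ext_moebius a b c e x = Some z \<longleftrightarrow> c * y + e \<noteq> 0 \<and> a * y + b = z * (c * y + e)"
    by (auto simp: Some ext_moebius_def moebius_def nonzero_divide_eq_eq)
  also have "\<dots> \<longleftrightarrow> a \<noteq> c * z \<and> y * (a - c * z) = e * z - b" using key nz nz' by metis
  also have "\<dots> \<longleftrightarrow> x = (if a = c * z then None else Some ((e * z - b) / (a - c * z)))"
    by (auto simp: Some nonzero_eq_divide_eq)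
  finally show ?thesis .
qed

lemma moebius_image_bounded:
  assumes "bounded A"
  shows "moebius_image f A = {z. \<exists>x\<in>A. f (Some x) = Some z}"
  using assms by (auto simp: moebius_image_def extended_def image_iff) metis

text \<open>The difference between a / c and an image point is det / (c (c x + e)), which is large
  near the pole. The constant \<delta> in the proof is the distance below which this contradicts the
  bound \<open>R\<close>.\<close>

lemma moebius_unbounded_at_pole:
  assumes det: "a * e - b * c \<noteq> (0::complex)" and c: "c \<noteq> 0" and l: "(- e / c) islimpt A"
  shows "\<not> bounded {z. \<exists>x\<in>A. ext_moebius a b c e (Some x) = Some z}"
proof
  assume "bounded {z. \<exists>x\<in>A. ext_moebius a b c e (Some x) = Some z}"
  then obtain B where B: "B > 0" "\<And>z. z \<in> {z. \<exists>x\<in>A. ext_moebius a b c e (Some x) = Some z} \<Longrightarrow> norm z \<le> B"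
    unfolding bounded_pos by blast
  define R where "R = B + norm (a / c)"
  have R: "R > 0" using B(1) by (simp add: R_def add_pos_nonneg)
  define \<delta> where "\<delta> = norm (a * e - b * c) / (R * (norm c)\<^sup>2)"
  have "\<delta> > 0" using det c R by (simp add: \<delta>_def)
  then obtain x where x: "x \<in> A" "x \<noteq> - e / c" "dist x (- e / c) < \<delta>"
    using l unfolding islimpt_approachable by blast
  have cx: "c * x + e = c * (x - (- e / c))" using c by (simp add: field_simps)
  have nz: "c * x + e \<noteq> 0" unfolding cx mult_eq_0_iff right_minus_eq using c x(2) by blast
  define z where "z = (a * x + b) / (c * x + e)"
  have "norm z \<le> B" using x(1) nz by (intro B(2)) (auto simp: ext_moebius_def moebius_def z_def)
  moreover have "a / c - z = (a * e - b * c) / (c * (c * x + e))"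
    using c nz by (simp add: z_def diff_frac_eq) (simp add: algebra_simps)
  moreover have "norm (a / c - z) \<le> norm (a / c) + norm z" by (rule norm_triangle_ineq4)
  ultimately have "norm (a * e - b * c) / (norm c * norm (c * x + e)) \<le> R" by (simp add: R_def norm_divide norm_mult)
  moreover have "norm (c * x + e) = norm c * dist x (- e / c)" unfolding cx by (simp add: norm_mult dist_norm)
  ultimately have "norm (a * e - b * c) / ((norm c)\<^sup>2 * dist x (- e / c)) \<le> R" by (simp add: power2_eq_square mult.assoc)
  then have "norm (a * e - b * c) \<le> R * ((norm c)\<^sup>2 * dist x (- e / c))" using c x(2) by (simp add: pos_divide_le_eq)
  also have "\<dots> < R * ((norm c)\<^sup>2 * \<delta>)" using R c x(3) by (intro mult_strict_left_mono) auto
  also have "\<dots> = norm (a * e - b * c)" using R c by (simp add: \<delta>_def)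
  finally show False by simp
qed

text \<open>\<open>D\<close> and \<open>Q\<close> stand for the denominators at a curve point and at
  a fixed point, \<open>y\<close> for the difference of the two points, \<Delta> for the determinant
  and \<open>x\<close> for the velocity.\<close>

lemma Cauchy_quotient_shift:
  fixes x y D Q c \<Delta> :: complex
  assumes "D \<noteq> 0" "y \<noteq> 0" "\<Delta> \<noteq> 0" "Q \<noteq> 0" and Q: "Q = D - c * y"
  shows "(\<Delta> * x / D\<^sup>2) / (\<Delta> * y / (D * Q)) = x / y - c * x / D"
proof -
  have "(\<Delta> * x / D\<^sup>2) / (\<Delta> * y / (D * Q)) = x * Q / (y * D)"
    using assms(1-4) by (simp add: field_simps power2_eq_square)
  also have "\<dots> = x / y - c * x / D" unfolding Q using assms(1,2) by (simp add: field_simps)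
  finally show ?thesis .
qed

context moebius_curve
begin

abbreviation moeb :: "complex \<Rightarrow> complex" where "moeb q \<equiv> (a * q + b) / (c * q + e)"

lemma diff_moeb:
  assumes "c * p + e \<noteq> 0" "c * q + e \<noteq> 0"
  shows "moeb p - moeb q = (a * e - b * c) * (p - q) / ((c * p + e) * (c * q + e))"
  using assms by (simp add: diff_frac_eq) (simp add: algebra_simps)

lemma ext_moebius_moeb: "c * q + e \<noteq> 0 \<Longrightarrow> ext_moebius a b c e (Some q) = Some (moeb q)"
  by (simp add: ext_moebius_def moebius_def)

lemma m_K: "m.K = moeb ` K"
  unfolding m.K_range K_range m0_def by auto

lemma moeb_notin: "q \<notin> K \<Longrightarrow> c * q + e \<noteq> 0 \<Longrightarrow> moeb q \<notin> m.K"
proof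
  assume q: "q \<notin> K" "c * q + e \<noteq> 0" and "moeb q \<in> m.K"
  then obtain t where "moeb (g t) - moeb q = 0" unfolding m_K K_range by auto
  then show False using diff_moeb[OF denom q(2)] denom q g_in_K det by auto
qed

lemma logd_has_integral: "(logd has_integral two_pi_i * of_real pole_winding) {0..1}"
  using integral_unit_interval[OF unit_interval_integrable_continuous[OF cont_logd(1)]] unfolding integral_logd .

text \<open>The logarithmic derivative of the image curve minus the image point is the old one minus
  that of the denominator; integrating subtracts the winding number about the pole.\<close>

lemma winding_moeb:
  assumes q: "q \<notin> K" "c * q + e \<noteq> 0"
  shows "winding_number m0 (moeb q) = winding_number g q - of_real pole_winding"
proof -
  have A: "((\<lambda>t. m1 t / (m0 t - moeb q)) has_integral two_pi_i * winding_number m0 (moeb q)) {0..1}"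
    using moeb_notin[OF q] by (intro winding_number_has_integral_C1[OF m.C1_loop_g]) (simp add: m.K_def)
  have B: "((\<lambda>t. g1 t / (g t - q)) has_integral two_pi_i * winding_number g q) {0..1}"
    using q(1) by (intro winding_number_has_integral_C1[OF C1_loop_g]) (simp add: K_def)
  have eq: "m1 t / (m0 t - moeb q) = g1 t / (g t - q) - logd t" for t
  proof -
    have "g t - q \<noteq> 0" using q(1) g_in_K[of t] by auto
    then show ?thesis unfolding m0_def m1_def logd_def diff_moeb[OF denom q(2)]
      by (intro Cauchy_quotient_shift denom det q(2)) (simp_all add: algebra_simps)
  qed
  have "two_pi_i * winding_number m0 (moeb q) = two_pi_i * winding_number g q - two_pi_i * of_real pole_winding"
    by (rule has_integral_unique[OF A]) (unfold eq, rule has_integral_diff[OF B logd_has_integral])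
  also have "\<dots> = two_pi_i * (winding_number g q - of_real pole_winding)" by (simp add: right_diff_distrib)
  finally show ?thesis by simp
qed

text \<open>The point a / c is the image of infinity, about which the curve does not wind, so only
  the contribution of the pole remains.\<close>

lemma winding_infinity:
  assumes c: "c \<noteq> 0"
  shows "a / c \<notin> m.K" "winding_number m0 (a / c) = - of_real pole_winding"
proof -
  have d: "m0 t - a / c = - (a * e - b * c) / (c * (c * g t + e))" for t
    using c denom[of t] by (simp add: m0_def diff_frac_eq) (simp add: algebra_simps)
  then have ne: "m0 t \<noteq> a / c" for t using c denom[of t] det by (metis diff_self divide_eq_0_iff mult_eq_0_iff neg_equal_0_iff_equal)
  then show K: "a / c \<notin> m.K" unfolding m.K_range by (metis rangeE)
  have A: "((\<lambda>t. m1 t / (m0 t - a / c)) has_integral two_pi_i * winding_number m0 (a / c)) {0..1}"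
    using K by (intro winding_number_has_integral_C1[OF m.C1_loop_g]) (simp add: m.K_def)
  have eq: "m1 t / (m0 t - a / c) = - logd t" for t
  proof -
    have "(\<Delta> * x / D\<^sup>2) / (- \<Delta> / (c * D)) = - (c * x / D)" if "\<Delta> \<noteq> 0" "D \<noteq> 0" for \<Delta> x D :: complex
      using c that by (simp add: field_simps power2_eq_square)
    then show ?thesis unfolding d m1_def logd_def using det denom[of t] by blast
  qed
  have "two_pi_i * winding_number m0 (a / c) = - (two_pi_i * of_real pole_winding)"
    by (rule has_integral_unique[OF A]) (unfold eq, rule has_integral_neg[OF logd_has_integral])
  also have "\<dots> = two_pi_i * (- of_real pole_winding)" by simp
  finally show "winding_number m0 (a / c) = - of_real pole_winding" by (rule mult_left_cancel[THEN iffD1, rotated]) simp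
qed

lemma pole_winding_zero:
  assumes "pole_winding = 0" "q \<in> K \<union> inside K"
  shows "c * q + e \<noteq> 0"
proof
  assume 0: "c * q + e = 0"
  have "c \<noteq> 0" using 0 det by auto
  then have "q = - e / c" using 0 by (simp add: field_simps eq_neg_iff_add_eq_0)
  then show False using assms pole_notin_K[OF \<open>c \<noteq> 0\<close>] \<open>c \<noteq> 0\<close> abs_orient by (auto simp: pole_winding_def)
qed

text \<open>Off the curve, being inside means having nonzero winding number, and this is preserved
  if the pole has winding number 0. For the converse, a / c has winding number 0 and so is not
  inside the image; every inside point therefore has a finite preimage.\<close>

lemma inside_moeb:
  assumes p: "pole_winding = 0"
  shows "inside m.K = moeb ` inside K"
proof
  have io: "inside K \<inter> K = {}" using compl_outside compl_inside by blast
  show "moeb ` inside K \<subseteq> inside m.K"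
  proof
    fix z assume "z \<in> moeb ` inside K"
    then obtain q where q: "z = moeb q" "q \<in> inside K" by auto
    have n: "q \<notin> K" "c * q + e \<noteq> 0" using q(2) io by (blast, intro pole_winding_zero[OF p]) blast
    show "z \<in> inside m.K"
      using m.inside_iff_winding[OF moeb_notin[OF n]] winding_moeb[OF n] inside_iff_winding[OF n(1)] q p by simp
  qed
  show "inside m.K \<subseteq> moeb ` inside K"
  proof
    fix z assume z: "z \<in> inside m.K"
    then have zK: "z \<notin> m.K" using m.compl_inside by blast
    have w: "winding_number m0 z \<noteq> 0" using z m.inside_iff_winding[OF zK] by simp
    have ac: "a \<noteq> c * z"
    proof
      assume A: "a = c * z"
      then have c: "c \<noteq> 0" using det by auto
      then have "z = a / c" using A by simp
      then show False using w winding_infinity(2)[OF c] p by simp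
    qed
    define q where "q = (e * z - b) / (a - c * z)"
    have ext: "ext_moebius a b c e (Some q) = Some z" using ac by (simp add: ext_moebius_eq_Some_iff[OF det] q_def)
    then have q: "c * q + e \<noteq> 0" "z = moeb q" by (auto simp: ext_moebius_def moebius_def split: if_splits)
    have qK: "q \<notin> K" using zK q(2) unfolding m_K by auto
    have "winding_number g q \<noteq> 0" using w winding_moeb[OF qK q(1)] p q(2) by simp
    then show "z \<in> moeb ` inside K" using inside_iff_winding[OF qK] q(2) by auto
  qed
qed

lemma orient_moeb:
  assumes p: "pole_winding = 0"
  shows "m.orient = orient"
proof -
  obtain q where q: "q \<in> inside K" using inside_K_nonempty by auto
  have n: "q \<notin> K" "c * q + e \<noteq> 0" using q compl_inside by (blast, intro pole_winding_zero[OF p]) blast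
  have "moeb q \<in> inside m.K" using q inside_moeb[OF p] by auto
  then have "complex_of_real m.orient = of_real orient"
    using m.winding_g(1) winding_moeb[OF n] winding_g(1)[OF q] p by simp
  then show ?thesis by simp
qed

text \<open>The ratio of second to first derivative changes by -2 times the logarithmic derivative
  of the denominator, whose integral is 2 pi i times the winding number about the pole.\<close>

lemma total_turn_moeb:
  assumes p: "pole_winding = 0"
  shows "m.total_turn = total_turn"
proof -
  have t: "m.turn t = turn t - 2 * Im (logd t)" for t
  proof -
    have "m2 t / m1 t = g2 t / g1 t - 2 * logd t"
    proof -
      have "(\<Delta> * y / D\<^sup>2 - 2 * c * \<Delta> * x\<^sup>2 / D ^ 3) / (\<Delta> * x / D\<^sup>2) = y / x - 2 * (c * x / D)"
        if "\<Delta> \<noteq> 0" "D \<noteq> 0" "x \<noteq> 0" for \<Delta> x y D :: complex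
        using that by (simp add: field_simps power2_eq_square power3_eq_cube)
      then show ?thesis unfolding m1_def m2_def logd_def using det regular[of t] denom[of t] by blast
    qed
    then show ?thesis by (simp add: m.turn_def turn_def)
  qed
  have L: "integrable unit_interval logd" by (rule unit_interval_integrable_continuous[OF cont_logd(1)])
  have "(\<integral>t. Im (logd t) \<partial>unit_interval) = 0"
    using integral_bounded_linear[OF bounded_linear_Im L] integral_logd p by simp
  moreover have "integrable unit_interval (\<lambda>t. Im (logd t))"
    by (rule integrable_bounded_linear[OF bounded_linear_Im L])
  ultimately show ?thesis
    unfolding m.total_turn_def total_turn_def t using unit_interval_integral_eq(1)[OF cont_turn] by simp
qed

lemma domain_energies_moeb:
  assumes "pole_winding = 0"
  shows "m.inner_energy = inner_energy" "m.outer_energy = outer_energy"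
  unfolding m.inner_energy_def inner_energy_def m.outer_energy_def outer_energy_def
    orient_moeb[OF assms] total_turn_moeb[OF assms] energy_invariant by simp_all

lemma image_K: "moebius_image (ext_moebius a b c e) K = m.K"
  unfolding moebius_image_bounded[OF compact_imp_bounded[OF compact_K]] m_K
  using pole_notin_K denom by (auto simp: K_range ext_moebius_moeb)

lemma image_inner:
  assumes p: "pole_winding = 0"
  shows "moebius_image (ext_moebius a b c e) (- outside K) = - outside m.K"
proof -
  have b: "bounded (- outside K)" unfolding compl_outside using bounded_inside_K compact_imp_bounded[OF compact_K] by simp
  have "moebius_image (ext_moebius a b c e) (- outside K) = moeb ` (K \<union> inside K)"
    unfolding moebius_image_bounded[OF b] using pole_winding_zero[OF p] unfolding compl_outside
    by (auto simp: ext_moebius_moeb)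
  also have "\<dots> = - outside m.K" unfolding m.compl_outside image_Un m_K[symmetric] inside_moeb[OF p] ..
  finally show ?thesis .
qed

text \<open>With infinity included, the unbounded region is the exact complement of the inside in
  the extended plane. A bijection preserves complements, so the claim reduces to the image of the
  inside.\<close>

lemma image_outer:
  assumes p: "pole_winding = 0"
  shows "moebius_image (ext_moebius a b c e) (- inside K) = - inside m.K"
proof -
  have "\<not> bounded (- inside K)" unfolding compl_inside using unbounded_outside_K by simp
  then have E: "extended (- inside K) = - Some ` inside K"
    unfolding extended_def by (auto simp: image_iff)
  have "z \<in> moebius_image (ext_moebius a b c e) (- inside K) \<longleftrightarrow> z \<notin> moeb ` inside K" for z
  proof -
    define x where "x = (if a = c * z then None else Some ((e * z - b) / (a - c * z)))"
    have x: "ext_moebius a b c e y = Some z \<longleftrightarrow> y = x" for y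
      unfolding x_def by (rule ext_moebius_eq_Some_iff[OF det])
    have "z \<in> moebius_image (ext_moebius a b c e) (- inside K) \<longleftrightarrow> x \<notin> Some ` inside K"
    proof -
      have "z \<in> moebius_image (ext_moebius a b c e) (- inside K) \<longleftrightarrow> (\<exists>y\<in>- Some ` inside K. ext_moebius a b c e y = Some z)"
        unfolding moebius_image_def E by (metis (no_types, lifting) image_iff mem_Collect_eq)
      then show ?thesis unfolding x by auto
    qed
    moreover have "z \<in> moeb ` inside K \<longleftrightarrow> (\<exists>q\<in>inside K. ext_moebius a b c e (Some q) = Some z)"
      using pole_winding_zero[OF p] by (auto simp: ext_moebius_moeb)
    ultimately show ?thesis unfolding x by auto
  qed
  then show ?thesis unfolding inside_moeb[OF p] by auto
qed

end

context C2_curve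
begin

lemma winding_cnj:
  assumes z: "z \<notin> K"
  shows "winding_number (\<lambda>t. cnj (g t)) (cnj z) = - winding_number g z"
proof -
  have "winding_number (cnj \<circ> g) (cnj z) = - cnj (winding_number g z)"
    using z path_g by (intro winding_number_cnj) auto
  moreover have "cnj (winding_number g z) = winding_number g z"
    using z inside_Un_outside_K winding_g[of z] by fastforce
  ultimately show ?thesis by (simp add: o_def)
qed

lemma cnj_K: "C2_curve.K (\<lambda>t. cnj (g t)) = cnj ` K"
  unfolding C2_curve.K_def[OF cnj_C2_curve] K_def by (simp add: image_image)

lemma inside_cnj: "inside (cnj ` K) = cnj ` inside K" and outside_cnj: "outside (cnj ` K) = cnj ` outside K"
  and cnj_orient: "C2_curve.orient (\<lambda>t. cnj (g t)) = - orient"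
proof -
  interpret j: C2_curve "\<lambda>t. cnj (g t)" "\<lambda>t. cnj (g1 t)" "\<lambda>t. cnj (g2 t)" by (rule cnj_C2_curve)
  have c: "z \<in> cnj ` A \<longleftrightarrow> cnj z \<in> A" for z A by (metis complex_cnj_cnj image_iff)
  have "z \<in> inside j.K \<longleftrightarrow> cnj z \<in> inside K" for z
  proof (cases "cnj z \<in> K")
    case True
    then have "z \<in> j.K" unfolding cnj_K c .
    then show ?thesis using True compl_inside j.compl_inside by blast
  next
    case False
    then have "z \<notin> j.K" unfolding cnj_K c .
    then show ?thesis using j.inside_iff_winding inside_iff_winding[OF False] winding_cnj[OF False] by simp
  qed
  then show I: "inside (cnj ` K) = cnj ` inside K" unfolding cnj_K by (intro set_eqI) (simp only: c)
  have "outside K = - (K \<union> inside K)" "outside j.K = - (j.K \<union> inside j.K)" using compl_outside j.compl_outside by blast+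
  then show "outside (cnj ` K) = cnj ` outside K" unfolding cnj_K I by (auto simp: c)
  obtain q where q: "q \<in> inside K" using inside_K_nonempty by auto
  then have qK: "q \<notin> K" using compl_inside by blast
  have "cnj q \<in> inside j.K" unfolding cnj_K I using q by auto
  then have "complex_of_real j.orient = - of_real orient"
    using j.winding_g(1) winding_cnj[OF qK] winding_g(1)[OF q] by metis
  then show "j.orient = - orient" by (metis of_real_eq_iff of_real_minus)
qed

text \<open>Conjugation reverses both the orientation and the total turning; the energies depend
  only on their product.\<close>

lemma cnj_domain_energies:
  "C2_curve.inner_energy (\<lambda>t. cnj (g t)) (\<lambda>t. cnj (g1 t)) (\<lambda>t. cnj (g2 t)) = inner_energy"
  "C2_curve.outer_energy (\<lambda>t. cnj (g t)) (\<lambda>t. cnj (g1 t)) (\<lambda>t. cnj (g2 t)) = outer_energy"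
proof -
  interpret j: C2_curve "\<lambda>t. cnj (g t)" "\<lambda>t. cnj (g1 t)" "\<lambda>t. cnj (g2 t)" by (rule cnj_C2_curve)
  have "j.turn t = - turn t" for t
    by (simp only: j.turn_def turn_def complex_cnj_divide[symmetric] cnj.sel)
  then have "j.turn = (\<lambda>t. - turn t)" by auto
  then have "j.total_turn = - total_turn" unfolding j.total_turn_def total_turn_def by simp
  then show "j.inner_energy = inner_energy" "j.outer_energy = outer_energy"
    unfolding j.inner_energy_def inner_energy_def j.outer_energy_def outer_energy_def cnj_orient cnj_energy by simp_all
qed

lemma perfect:
  assumes "connected S" "K \<subseteq> S" "p \<in> S"
  shows "p islimpt S"
proof (rule connected_imp_perfect[OF assms(1,3)])
  fix x
  have "g 0 \<noteq> g (1/2)" using inj_onD[OF inj_g, of 0 "1/2"] by auto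
  then show "S \<noteq> {x}" using assms(2) g_in_K[of 0] g_in_K[of "1/2"] by auto
qed

text \<open>Neither component of the complement of \<open>K\<close> meets the frontier of
  \<open>U\<close>, so each lies in \<open>U\<close> or misses it. Of the four combinations, the
  whole plane has empty frontier, and \<open>K\<close> alone has empty interior, which regularity
  excludes.\<close>

lemma region_cases:
  assumes "region_bounded_by U K"
  shows "U = - outside K \<or> U = - inside K"
proof -
  have fr: "frontier U = K" and cl: "closed U" and ci: "closure (interior U) = U"
    using assms unfolding region_bounded_by_def by (auto intro: closed_closure) (metis closed_closure)
  have KU: "K \<subseteq> U" using fr cl frontier_subset_closed by auto
  have i: "inside K \<inter> U = {} \<or> inside K \<subseteq> U" and o: "outside K \<inter> U = {} \<or> outside K \<subseteq> U"
    using connected_Int_frontier[OF connected_inside_K, of U] connected_Int_frontier[OF connected_outside_K, of U]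
      compl_inside compl_outside unfolding fr by blast+
  have "U \<noteq> UNIV" using fr K_nonempty by auto
  moreover have "U \<noteq> K"
  proof
    assume U: "U = K"
    have "interior K \<inter> closure (inside K) = {}"
      using compl_inside interior_subset by (subst open_Int_closure_eq_empty) blast+
    moreover have "interior K \<subseteq> closure (inside K)"
      using interior_subset frontier_inside_K unfolding frontier_def by blast
    ultimately have "interior K = {}" by blast
    then show False using ci U K_nonempty by simp
  qed
  ultimately show ?thesis using i o KU inside_Un_outside_K inside_Int_outside_K compl_inside compl_outside by blast
qed

end

section \<open>Energies of the point sets and the invariance statements\<close>

lemma curve_energy_C2:
  assumes "parametrizes \<gamma> K" "C2_curve g g1 g2" "C2_curve.K g = K"
  shows "has_curve_energy K \<and> curve_energy K = C2_curve.energy g g1"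
proof -
  interpret C2_curve g g1 g2 by fact
  have "(curve_energy_approx K \<longlongrightarrow> energy) (at_right 0)"
    using curve_energy_limit curve_length_eq[OF assms] unfolding assms(3) by simp
  moreover from this have "curve_energy K = energy" unfolding curve_energy_def by (intro tendsto_Lim) auto
  ultimately show ?thesis unfolding has_curve_energy_def by simp
qed

lemma domain_energy_C2:
  assumes "parametrizes \<gamma> K" "C2_curve g g1 g2" "C2_curve.K g = K"
  shows "has_domain_energy (- outside K) \<and> domain_energy (- outside K) = C2_curve.inner_energy g g1 g2"
    and "has_domain_energy (- inside K) \<and> domain_energy (- inside K) = C2_curve.outer_energy g g1 g2"
proof -
  interpret C2_curve g g1 g2 by fact
  have L: "(domain_energy_approx (- outside K) \<longlongrightarrow> inner_energy) (at_right 0)"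
     "(domain_energy_approx (- inside K) \<longlongrightarrow> outer_energy) (at_right 0)"
    using domain_energy_limits curve_length_eq[OF assms] unfolding assms(3) by simp_all
  then have "domain_energy (- outside K) = inner_energy" "domain_energy (- inside K) = outer_energy"
    unfolding domain_energy_def by (auto intro!: tendsto_Lim)
  then show "has_domain_energy (- outside K) \<and> domain_energy (- outside K) = inner_energy"
     "has_domain_energy (- inside K) \<and> domain_energy (- inside K) = outer_energy"
    using L unfolding has_domain_energy_def by simp_all
qed

lemma parametrizes_C2_image:
  assumes "smooth g" "C2_curve g g1 g2"
  shows "parametrizes g (C2_curve.K g)"
proof -
  interpret C2_curve g g1 g2 by fact
  have "g ` {0..1} = g ` {0..<1}"
  proof -
    have "{0..1::real} = insert 1 {0..<1}" by auto
    moreover have "g 1 = g 0" using periodic_g[of 0] by simp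
    ultimately show ?thesis by auto
  qed
  then show ?thesis
    using assms(1) periodic_g regular inj_g vector_derivative_at[OF deriv_g] unfolding parametrizes_def K_def by simp
qed

lemma parametrizes_cnj:
  assumes "parametrizes \<gamma> K"
  shows "parametrizes (\<lambda>t. cnj (\<gamma> t)) (cnj ` K)"
  using parametrizes_C2_image[OF smooth_cnj C2_curve.cnj_C2_curve[OF parametrizes_C2(1)[OF assms]]]
    C2_curve.cnj_K[OF parametrizes_C2(1)[OF assms]] parametrizes_C2(2)[OF assms] assms
  by (simp add: parametrizes_def)

lemma (in moebius_curve) parametrizes_moeb:
  assumes s: "smooth g"
  shows "parametrizes m0 m.K"
proof (rule parametrizes_C2_image[OF _ moebius_C2])
  \<comment> \<open>The derivative of \<open>v\<close> is -c g1 v^2, a member of the smooth algebra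
    generated by \<open>v\<close>; and m0 = (a g + b) v.\<close>
  define v where "v t = inverse (c * g t + e)" for t
  have g1: "g1 = (\<lambda>t. vector_derivative g (at t))" using vector_derivative_at[OF deriv_g] by auto
  have s1: "smooth g1" unfolding g1 by (rule smooth_vector_derivative[OF s])
  note alg = smooth_algebra.intros smooth_algebra.base[OF smooth_const] smooth_algebra.base[OF s] smooth_algebra.base[OF s1]
  have "(\<lambda>t. (- c) * g1 t * (v t * v t)) \<in> smooth_algebra v" by (intro alg)
  moreover have "(v has_vector_derivative (- c) * g1 t * (v t * v t)) (at t)" for t
    using deriv_denom_inverse[of t] unfolding v_def by (simp add: power2_eq_square field_simps)
  moreover have "(\<lambda>t. (a * g t + b) * v t) \<in> smooth_algebra v" by (intro alg)
  ultimately have "smooth (\<lambda>t. (a * g t + b) * v t)" by (intro smooth_algebra_smooth) auto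
  then show "smooth m0" unfolding m0_def v_def by (simp add: divide_inverse[abs_def])
qed

lemma curve_energy_ext_moebius:
  assumes p: "parametrizes \<gamma> K" and det: "a * e - b * c \<noteq> 0"
    and im: "smooth_closed_curve (moebius_image (ext_moebius a b c e) K)"
  shows "has_curve_energy K \<and> has_curve_energy (moebius_image (ext_moebius a b c e) K) \<and>
     curve_energy K = curve_energy (moebius_image (ext_moebius a b c e) K)"
proof -
  define \<gamma>1 where "\<gamma>1 = (\<lambda>t. vector_derivative \<gamma> (at t))"
  define \<gamma>2 where "\<gamma>2 = (\<lambda>t. vector_derivative \<gamma>1 (at t))"
  note C = parametrizes_C2[OF p, folded \<gamma>1_def, folded \<gamma>2_def]
  interpret C2_curve \<gamma> \<gamma>1 \<gamma>2 by (rule C(1))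
  have bK: "bounded K" using compact_imp_bounded[OF compact_K] C(2) by simp
  obtain \<sigma> where \<sigma>: "parametrizes \<sigma> (moebius_image (ext_moebius a b c e) K)" using im unfolding smooth_closed_curve_def by blast
  have bI: "bounded (moebius_image (ext_moebius a b c e) K)"
    using compact_imp_bounded[OF C2_curve.compact_K[OF parametrizes_C2(1)[OF \<sigma>]]] parametrizes_C2(2)[OF \<sigma>] by simp
  \<comment> \<open>A curve has no isolated points, so with the pole on it the image would be
    unbounded; but the image is a closed curve in the plane.\<close>
  have denom: "c * \<gamma> t + e \<noteq> 0" for t
  proof
    assume 0: "c * \<gamma> t + e = 0"
    have c: "c \<noteq> 0" using 0 det by auto
    then have "\<gamma> t = - e / c" using 0 by (simp add: field_simps eq_neg_iff_add_eq_0)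
    moreover have "\<gamma> t islimpt K"
      using perfect[OF connected_path_image[OF path_g(1)], of "\<gamma> t"] path_g(4) g_in_K C(2) by simp
    ultimately show False using moebius_unbounded_at_pole[OF det c, of K] bI unfolding moebius_image_bounded[OF bK] by simp
  qed
  interpret moebius_curve \<gamma> \<gamma>1 \<gamma>2 a b c e by unfold_locales (use det denom in auto)
  have "m.K = moebius_image (ext_moebius a b c e) K" using image_K unfolding C(2) by simp
  from curve_energy_C2[OF \<sigma> moebius_C2 this] curve_energy_C2[OF p C]
  show ?thesis using energy_invariant by simp
qed

text \<open>The topological hypotheses serve to locate the pole: in both cases it lies neither on
  \<open>K\<close> nor inside, so that the pole winding is 0. After that the image region is the
  region of the same kind bounded by the image curve.\<close>

lemma domain_energy_ext_moebius:
  assumes p: "parametrizes \<gamma> K" and U: "U = - outside K \<or> U = - inside K" and det: "a * e - b * c \<noteq> 0"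
    and fr: "compact (frontier (moebius_image (ext_moebius a b c e) U))"
    and cases: "compact U \<and> compact (moebius_image (ext_moebius a b c e) U) \<or>
      \<not> bounded U \<and> \<not> bounded (moebius_image (ext_moebius a b c e) U)"
  shows "has_domain_energy U \<and> has_domain_energy (moebius_image (ext_moebius a b c e) U) \<and>
     domain_energy U = domain_energy (moebius_image (ext_moebius a b c e) U)"
proof -
  let ?f = "ext_moebius a b c e"
  define \<gamma>1 where "\<gamma>1 = (\<lambda>t. vector_derivative \<gamma> (at t))"
  define \<gamma>2 where "\<gamma>2 = (\<lambda>t. vector_derivative \<gamma>1 (at t))"
  note C = parametrizes_C2[OF p, folded \<gamma>1_def, folded \<gamma>2_def]
  interpret C2_curve \<gamma> \<gamma>1 \<gamma>2 by (rule C(1))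
  note KK = C(2)
  have bK: "bounded K" using compact_imp_bounded[OF compact_K] KK by simp
  have pole: "c \<noteq> 0 \<and> q = - e / c" if "c * q + e = 0" for q
  proof -
    have "c \<noteq> 0" using that det by auto
    then show ?thesis using that by (simp add: field_simps eq_neg_iff_add_eq_0)
  qed
  show ?thesis
  proof (cases "compact U")
    case True
    then have bI: "bounded (moebius_image ?f U)" using cases compact_imp_bounded by blast
    have "\<not> bounded (- inside K)" using compl_inside unbounded_outside_K unfolding KK by simp
    then have UO: "U = - outside K" using U True compact_imp_bounded by blast
    have "U = closure (inside K)"
      unfolding UO closure_Un_frontier using compl_outside frontier_inside_K unfolding KK by auto
    then have "connected U" using connected_imp_connected_closure[OF connected_inside_K] unfolding KK by simp
    moreover have "K \<subseteq> U" unfolding UO using compl_outside unfolding KK by auto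
    \<comment> \<open>\<open>U\<close> is connected and contains a curve, so each of its points is a
      limit point; a pole in \<open>U\<close> would make the image unbounded.\<close>
    ultimately have nz: "c * q + e \<noteq> 0" if "q \<in> U" for q
      using perfect[of U q] pole[of q] moebius_unbounded_at_pole[OF det, of U] that bI
      unfolding moebius_image_bounded[OF compact_imp_bounded[OF True]] KK by blast
    then have denom: "c * \<gamma> t + e \<noteq> 0" for t using \<open>K \<subseteq> U\<close> g_in_K[of t] unfolding KK by auto
    interpret moebius_curve \<gamma> \<gamma>1 \<gamma>2 a b c e by unfold_locales (use det denom in auto)
    have "inside K \<subseteq> U" unfolding UO using compl_outside unfolding KK by auto
    have pw: "pole_winding = 0"
    proof (rule ccontr)
      assume "pole_winding \<noteq> 0"
      then have "c \<noteq> 0" "- e / c \<in> inside K" unfolding pole_winding_def KK by (auto split: if_splits)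
      then show False using nz[of "- e / c"] \<open>inside K \<subseteq> U\<close> by auto
    qed
    have im: "moebius_image ?f U = - outside m.K" using image_inner[OF pw] unfolding UO KK .
    have s: "smooth \<gamma>" using p by (simp add: parametrizes_def)
    show ?thesis
      using domain_energy_C2(1)[OF p C] domain_energy_C2(1)[OF parametrizes_moeb[OF s] moebius_C2 refl] domain_energies_moeb[OF pw]
      unfolding im unfolding UO by simp
  next
    case False
    then have bU: "\<not> bounded U" and bI: "\<not> bounded (moebius_image ?f U)" using cases by auto
    have "bounded (- outside K)" using compl_outside bounded_inside_K bK unfolding KK by simp
    then have UI: "U = - inside K" using U bU by blast
    have E: "extended U = insert None (Some ` U)" using bU by (auto simp: extended_def)
    \<comment> \<open>With the pole in the bounded hole, \<open>U\<close> keeps a positive distance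
      from it. The explicit formula for z - a / c then bounds the image, and infinity goes to a /
      c.\<close>
    have pI: "- e / c \<notin> inside K" if c: "c \<noteq> 0"
    proof
      assume "- e / c \<in> inside K"
      then obtain r where r: "r > 0" "ball (- e / c) r \<subseteq> inside K" using open_inside_K unfolding KK open_contains_ball by blast
      have "norm z \<le> norm (a / c) + norm (a * e - b * c) / ((norm c)\<^sup>2 * r)" if "z \<in> moebius_image ?f U" for z
      proof -
        from that consider "z = a / c" | x where "x \<in> U" "?f (Some x) = Some z"
          unfolding moebius_image_def E using c by (auto simp: ext_moebius_def)
        then show ?thesis
        proof cases
          case 1
          then show ?thesis using r(1) by simp
        next
          case 2
          have x: "r \<le> norm (x - (- e / c))" using 2(1) r(2) unfolding UI by (force simp: dist_norm norm_minus_commute)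
          have nz: "c * x + e \<noteq> 0" and z: "z = (a * x + b) / (c * x + e)" using 2(2) by (auto simp: ext_moebius_def moebius_def split: if_splits)
          have cx: "norm (c * x + e) = norm c * norm (x - (- e / c))"
          proof -
            have "c * x + e = c * (x - (- e / c))" using c by (simp add: field_simps)
            then show ?thesis by (simp only: norm_mult)
          qed
          have "z = a / c - (a * e - b * c) / (c * (c * x + e))"
            unfolding z using c nz by (simp add: diff_frac_eq frac_eq_eq) (simp add: algebra_simps)
          then have "norm z \<le> norm (a / c) + norm ((a * e - b * c) / (c * (c * x + e)))" using norm_triangle_ineq4 by metis
          also have "norm ((a * e - b * c) / (c * (c * x + e))) = norm (a * e - b * c) / ((norm c)\<^sup>2 * norm (x - (- e / c)))"
            unfolding norm_divide norm_mult[of c "c * x + e"] cx by (simp add: power2_eq_square mult.assoc)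
          also have "\<dots> \<le> norm (a * e - b * c) / ((norm c)\<^sup>2 * r)"
            using x r(1) c by (intro divide_left_mono mult_left_mono mult_pos_pos) auto
          finally show ?thesis by simp
        qed
      qed
      then show False using bI unfolding bounded_iff by blast
    qed
    \<comment> \<open>With the pole on \<open>K\<close>, the image of the rest of \<open>K\<close>
      would be unbounded. It lies in the frontier of the image region, since every such point is
      also approached by images of inside points, which are outside the image region; this
      contradicts compactness of that frontier.\<close>
    have pK: "- e / c \<notin> K" if c: "c \<noteq> 0"
    proof
      assume pK: "- e / c \<in> K"
      have sub: "{z. \<exists>x\<in>K. ?f (Some x) = Some z} \<subseteq> frontier (moebius_image ?f U)"
      proof safe
        fix z q assume q: "q \<in> K" "?f (Some q) = Some z"
        have "q \<in> U" unfolding UI using q(1) compl_inside unfolding KK by auto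
        then have "Some z \<in> ?f ` extended U" unfolding E using q(2)[symmetric] by (intro image_eqI[of _ _ "Some q"]) auto
        then have "z \<in> moebius_image ?f U" unfolding moebius_image_def by simp
        moreover have "z \<in> closure (- moebius_image ?f U)"
        proof -
          have nz: "c * q + e \<noteq> 0" and z: "z = (a * q + b) / (c * q + e)" using q(2) by (auto simp: ext_moebius_def moebius_def split: if_splits)
          have "q \<in> closure (inside K)" using q(1) frontier_inside_K unfolding KK frontier_def by auto
          then obtain x where x: "\<And>n. x n \<in> inside K" "x \<longlonglongrightarrow> q" unfolding closure_sequential by blast
          define y where "y n = (a * x n + b) / (c * x n + e)" for n
          have "y n \<notin> moebius_image ?f U" for n
          proof
            have "x n \<notin> K" using x(1)[of n] compl_inside unfolding KK by blast
            then have "c * x n + e \<noteq> 0" using pole[of "x n"] pK by metis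
            then have fx: "?f (Some (x n)) = Some (y n)" by (simp add: ext_moebius_def moebius_def y_def)
            assume "y n \<in> moebius_image ?f U"
            then obtain w where w: "w \<in> extended U" "?f w = Some (y n)" unfolding moebius_image_def by (auto simp: image_iff)
            have "w = Some (x n)" using fx w(2) unfolding ext_moebius_eq_Some_iff[OF det] by simp
            then have "Some (x n) \<in> extended U" using w(1) by simp
            then have "x n \<in> U" unfolding E by auto
            then show False using x(1)[of n] UI by auto
          qed
          moreover have "y \<longlonglongrightarrow> z" unfolding y_def z by (intro tendsto_intros x(2) nz)
          ultimately show ?thesis unfolding closure_sequential by auto
        qed
        ultimately show "z \<in> frontier (moebius_image ?f U)" unfolding frontier_closures using closure_subset by blast
      qed
      have "(- e / c) islimpt K"
        using perfect[OF connected_path_image[OF path_g(1)], of "- e / c"] path_g(4) pK KK by simp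
      then show False
        using moebius_unbounded_at_pole[OF det c, of K] bounded_subset[OF compact_imp_bounded[OF fr] sub] by blast
    qed
    have denom: "c * \<gamma> t + e \<noteq> 0" for t using pole[of "\<gamma> t"] pK g_in_K[of t] unfolding KK by auto
    interpret moebius_curve \<gamma> \<gamma>1 \<gamma>2 a b c e by unfold_locales (use det denom in auto)
    have pw: "pole_winding = 0" using pI unfolding pole_winding_def KK by auto
    have im: "moebius_image ?f U = - inside m.K" using image_outer[OF pw] unfolding UI KK .
    have s: "smooth \<gamma>" using p by (simp add: parametrizes_def)
    show ?thesis
      using domain_energy_C2(2)[OF p C] domain_energy_C2(2)[OF parametrizes_moeb[OF s] moebius_C2 refl] domain_energies_moeb[OF pw]
      unfolding im unfolding UI by simp
  qed
qed

lemma bounded_cnj_image: "bounded (cnj ` A) \<longleftrightarrow> bounded A"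
  by (simp add: bounded_iff)

lemma moebius_image_cnj: "moebius_image (f \<circ> map_option cnj) A = moebius_image f (cnj ` A)"
proof -
  have "extended (cnj ` A) = map_option cnj ` extended A"
    unfolding extended_def bounded_cnj_image image_Un image_image by simp
  then show ?thesis unfolding moebius_image_def by (simp add: image_comp)
qed

lemma compact_cnj_image: "compact A \<Longrightarrow> compact (cnj ` A)"
  by (rule compact_continuous_image) (intro continuous_intros)

theorem corollary4p18:
  shows "(\<forall>K f. smooth_closed_curve K \<and> moebius_transformation f \<and>
             smooth_closed_curve (moebius_image f K) \<longrightarrow>
           has_curve_energy K \<and> has_curve_energy (moebius_image f K) \<and>
           curve_energy K = curve_energy (moebius_image f K)) \<and>
         (\<forall>K \<Omega> f. smooth_closed_curve K \<and> region_bounded_by \<Omega> K \<and> moebius_transformation f \<and>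
             compact (frontier (moebius_image f \<Omega>)) \<and>
             (compact \<Omega> \<and> compact (moebius_image f \<Omega>) \<or>
              \<not> bounded \<Omega> \<and> \<not> bounded (moebius_image f \<Omega>)) \<longrightarrow>
           has_domain_energy \<Omega> \<and> has_domain_energy (moebius_image f \<Omega>) \<and>
           domain_energy \<Omega> = domain_energy (moebius_image f \<Omega>))"
proof (intro conjI allI impI; elim conjE)
  fix K f
  assume K: "smooth_closed_curve K" and f: "moebius_transformation f" and im: "smooth_closed_curve (moebius_image f K)"
  obtain \<gamma> where p: "parametrizes \<gamma> K" using K unfolding smooth_closed_curve_def by blast
  note C = parametrizes_C2[OF p]
  obtain a b c e where det: "a * e - b * c \<noteq> 0" and "f = ext_moebius a b c e \<or> f = ext_moebius a b c e \<circ> map_option cnj"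
    using f unfolding moebius_transformation_def by blast
  then have "has_curve_energy K \<and> has_curve_energy (moebius_image f K) \<and> curve_energy K = curve_energy (moebius_image f K)"
  proof (elim disjE)
    assume f: "f = ext_moebius a b c e"
    show ?thesis using curve_energy_ext_moebius[OF p det] im unfolding f by blast
  next
    assume f: "f = ext_moebius a b c e \<circ> map_option cnj"
    have "curve_energy (cnj ` K) = curve_energy K \<and> has_curve_energy K"
      using curve_energy_C2[OF p C] curve_energy_C2[OF parametrizes_cnj[OF p] C2_curve.cnj_C2_curve[OF C(1)]]
        C2_curve.cnj_K[OF C(1)] C(2) C2_curve.cnj_energy[OF C(1)] by simp
    then show ?thesis using curve_energy_ext_moebius[OF parametrizes_cnj[OF p] det] im unfolding f moebius_image_cnj by simp
  qed
  then show "has_curve_energy K" "has_curve_energy (moebius_image f K)" "curve_energy K = curve_energy (moebius_image f K)" by auto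
next
  fix K \<Omega> f
  assume K: "smooth_closed_curve K" and \<Omega>: "region_bounded_by \<Omega> K" and f: "moebius_transformation f"
    and fr: "compact (frontier (moebius_image f \<Omega>))"
    and cases: "compact \<Omega> \<and> compact (moebius_image f \<Omega>) \<or> \<not> bounded \<Omega> \<and> \<not> bounded (moebius_image f \<Omega>)"
  obtain \<gamma> where p: "parametrizes \<gamma> K" using K unfolding smooth_closed_curve_def by blast
  note C = parametrizes_C2[OF p]
  have U: "\<Omega> = - outside K \<or> \<Omega> = - inside K" using C2_curve.region_cases[OF C(1)] \<Omega> unfolding C(2) by blast
  obtain a b c e where det: "a * e - b * c \<noteq> 0" and "f = ext_moebius a b c e \<or> f = ext_moebius a b c e \<circ> map_option cnj"
    using f unfolding moebius_transformation_def by blast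
  then have "has_domain_energy \<Omega> \<and> has_domain_energy (moebius_image f \<Omega>) \<and> domain_energy \<Omega> = domain_energy (moebius_image f \<Omega>)"
  proof (elim disjE)
    assume f: "f = ext_moebius a b c e"
    show ?thesis using domain_energy_ext_moebius[OF p U det] fr cases unfolding f by blast
  next
    assume f: "f = ext_moebius a b c e \<circ> map_option cnj"
    note q = parametrizes_cnj[OF p] C2_curve.cnj_C2_curve[OF C(1)] C2_curve.cnj_K[OF C(1), unfolded C(2)]
    have inj: "cnj ` (- A) = - cnj ` A" for A
      using bij_image_Compl_eq[of cnj A] by (metis bij_betw_def complex_cnj_cnj inj_on_def surj_def)
    have io: "- outside (cnj ` K) = cnj ` (- outside K)" "- inside (cnj ` K) = cnj ` (- inside K)"
      using C2_curve.outside_cnj[OF C(1)] C2_curve.inside_cnj[OF C(1)] unfolding C(2) inj by simp_all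
    have cU: "cnj ` \<Omega> = - outside (cnj ` K) \<or> cnj ` \<Omega> = - inside (cnj ` K)" using U io by metis
    have "has_domain_energy \<Omega> \<and> domain_energy (cnj ` \<Omega>) = domain_energy \<Omega>"
      using U domain_energy_C2[OF p C] domain_energy_C2[OF q] C2_curve.cnj_domain_energies[OF C(1)] unfolding io by auto
    moreover have "compact (cnj ` \<Omega>) \<and> compact (moebius_image (ext_moebius a b c e) (cnj ` \<Omega>)) \<or>
        \<not> bounded (cnj ` \<Omega>) \<and> \<not> bounded (moebius_image (ext_moebius a b c e) (cnj ` \<Omega>))"
      using cases compact_cnj_image unfolding f moebius_image_cnj bounded_cnj_image by blast
    ultimately show ?thesis
      using domain_energy_ext_moebius[OF parametrizes_cnj[OF p] cU det] fr unfolding f moebius_image_cnj by simp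
  qed
  then show "has_domain_energy \<Omega>" "has_domain_energy (moebius_image f \<Omega>)" "domain_energy \<Omega> = domain_energy (moebius_image f \<Omega>)" by auto
qed

end
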